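(* Let $k>0$ be an integer or a half-integer, let $f,g\in M_k(\Gamma_0(N),\chi)$ be such that either $fg$ vanishes at all cusps or $k=1/2$. Let $\Gamma=\mathrm{SL}_2(\mathbb{Z})$, let $C$ be a system of representatives of the cusps of $\Gamma_0(N)$, and for each $c\in C$ let $\gamma_c\in\Gamma$ with $\gamma_c(i\infty)=c$, let $w(c)$ be the width of the cusp $c$, and write $$f|_k\gamma_c(\tau)=q^{\alpha(c)}\sum_{n\ge0}a_{\gamma_c}(n)q^{n/w(c)},\qquad g|_k\gamma_c(\tau)=q^{\alpha(c)}\sum_{n\ge0}b_{\gamma_c}(n)q^{n/w(c)}$$ with the same rational number $\alpha(c)\in[0,1[$ for $f$ and $g$. Then $$\langle f,g\rangle_{\Gamma_0(N)}=\frac{4(8\pi)^{-(k-1)}}{[\Gamma:\Gamma_0(N)]}\sum_{c\in C}w(c)\sum_{n\ge0}\frac{a_{\gamma_c}(n)\overline{b_{\gamma_c}(n)}}{(\alpha(c)+n/w(c))^{k-1}}\,W_k\!\left(4\pi(\alpha(c)+n/w(c))^{1/2}\right)\;,$$ where, for $x>0$, $$W_k(x)=\sum_{m\ge1}(mx)^{k-1}\left(mxK_{k-2}(mx)-K_{k-1}(mx)\right).$$ Here, if $k\neq1/2$, $\alpha(c)=0$ and $n=0$, one has $a_{\gamma_c}(0)\overline{b_{\gamma_c}(0)}=0$ and the corresponding term is omitted. In the special case $k=1/2$, $\alpha(c)=0$, and $n=0$, the quantity $(n/w(c))^{1/2}W_{1/2}(4\pi(n/w(c))^{1/2})$ is to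 be interpreted as its limit as $n\to0$, in other words as $1/(4(2\pi)^{1/2})$.
   Context: $\mathfrak{H}$ is the upper half-plane, $q^x=e^{2\pi i\tau x}$ for $x\in\mathbb{Q}$, and $K_\nu$ is the $K$-Bessel function (modified Bessel function of the second kind). For $\gamma=\begin{pmatrix}a&b\\c&d\end{pmatrix}\in\mathrm{SL}_2(\mathbb{Z})$, $(f|_k\gamma)(\tau)=(c\tau+d)^{-k}f(\gamma\tau)$, with the principal branch of the square root when $k$ is half-integral. $M_k(\Gamma_0(N),\chi)$ is the usual space of modular forms of weight $k$, level $N$ and character $\chi$; for $k$ half-integral one has $4\mid N$ and the transformation law $f(\gamma\tau)=\chi(d)\left(\theta(\gamma\tau)/\theta(\tau)\right)^{2k}f(\tau)$ for $\gamma\in\Gamma_0(N)$, where $\theta(\tau)=1+2\sum_{n\ge1}q^{n^2}$. A cusp $c=A/C$ (in lowest terms) has width $w(c)=N/\gcd(N,C^2)$, and $\alpha(c)$ is nonzero if and only if the cusp is irregular. "$fg$ vanishes at all cusps" means that for every $\gamma\in\Gamma$ at least one of $f|_k\gamma$, $g|_k\gamma$ vanishes at $i\infty$. The Petersson product is normalized as $$\langle f,g\rangle_{\Gamma_0(N)}=\frac{1}{[\Gamma:\Gamma_0(N)]}\int_{\Gamma_0(N)\backslash\mathfrak{H}}f(\tau)\overline{g(\tau)}\,y^k\,\frac{dx\,dy}{y^2},\qquad \tau=x+iy.$$ *)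

theory Defs
  imports "HOL-Analysis.Analysis" "HOL-Complex_Analysis.Complex_Analysis" "HOL-Algebra.Coset"
begin

definition upper_half_plane :: "complex set" where
  "upper_half_plane = {\<tau>. Im \<tau> > 0}"

text \<open>The filter of neighbourhoods of the cusp \<open>i\<infinity>\<close>, i.e. \<open>Im \<tau> \<rightarrow> \<infinity>\<close> uniformly in \<open>Re \<tau>\<close>.\<close>

definition at_i_infinity :: "complex filter" where
  "at_i_infinity = filtercomap Im at_top"

text \<open>\<open>qpow \<tau> x\<close> is \<open>q\<^sup>x = exp (2 \<pi> i \<tau> x)\<close>.\<close>

definition qpow :: "complex \<Rightarrow> rat \<Rightarrow> complex" where
  "qpow \<tau> x = exp (2 * of_real pi * \<i> * \<tau> * of_rat x)"


subsection \<open>The modular group\<close>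

definition SL2Z :: "(int^2^2) monoid" where
  "SL2Z = \<lparr>carrier = {A. det A = 1}, mult = (**), one = mat 1\<rparr>"

definition Gamma0 :: "nat \<Rightarrow> (int^2^2) set" where
  "Gamma0 N = {A \<in> carrier SL2Z. int N dvd A$2$1}"

definition index_Gamma0 :: "nat \<Rightarrow> nat" where
  "index_Gamma0 N = card (rcosets\<^bsub>SL2Z\<^esub> (Gamma0 N))"

lemma group_SL2Z: "group SL2Z"
proof (rule groupI)
  fix A :: "int^2^2" assume A: "A \<in> carrier SL2Z"
  define B :: "int^2^2" where "B = vector [vector [A$2$2, - A$1$2], vector [- A$2$1, A$1$1]]"
  have "det A = 1" using A by (simp add: SL2Z_def)
  then have "det B = 1" "B ** A = mat 1"
    by (auto simp: B_def det_2 matrix_matrix_mult_def mat_def vec_eq_iff forall_2 sum_2 algebra_simps)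
  then show "\<exists>B\<in>carrier SL2Z. B \<otimes>\<^bsub>SL2Z\<^esub> A = \<one>\<^bsub>SL2Z\<^esub>"
    by (auto simp: SL2Z_def)
qed (auto simp: SL2Z_def det_mul matrix_mul_assoc)

definition automorphy :: "int^2^2 \<Rightarrow> complex \<Rightarrow> complex" where
  "automorphy A \<tau> = of_int (A$2$1) * \<tau> + of_int (A$2$2)"

definition moebius :: "int^2^2 \<Rightarrow> complex \<Rightarrow> complex" where
  "moebius A \<tau> = (of_int (A$1$1) * \<tau> + of_int (A$1$2)) / automorphy A \<tau>"

text \<open>The function \<open>powr\<close> uses the principal branch of the logarithm, so for half-integral \<open>k\<close> this
  is the principal branch of the square root, and for integral \<open>k\<close> it is the ordinary power.\<close>

definition slash :: "(complex \<Rightarrow> complex) \<Rightarrow> real \<Rightarrow> int^2^2 \<Rightarrow> complex \<Rightarrow> complex" where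
  "slash f k A \<tau> = automorphy A \<tau> powr (- of_real k) * f (moebius A \<tau>)"


subsection \<open>Cusps\<close>

text \<open>Points of the rational projective line.\<close>

datatype cusp = Cusp_Infinity | Cusp_Rat rat

fun act_cusp :: "int^2^2 \<Rightarrow> cusp \<Rightarrow> cusp" where
  "act_cusp A Cusp_Infinity =
     (if A$2$1 = 0 then Cusp_Infinity else Cusp_Rat (of_int (A$1$1) / of_int (A$2$1)))"
| "act_cusp A (Cusp_Rat r) =
     (if of_int (A$2$1) * r + of_int (A$2$2) = 0 then Cusp_Infinity
      else Cusp_Rat ((of_int (A$1$1) * r + of_int (A$1$2)) / (of_int (A$2$1) * r + of_int (A$2$2))))"

text \<open>The denominator in lowest terms, with \<open>\<infinity> = 1/0\<close>.\<close>

fun cusp_denom :: "cusp \<Rightarrow> nat" where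
  "cusp_denom Cusp_Infinity = 0"
| "cusp_denom (Cusp_Rat r) = nat (snd (quotient_of r))"

definition cusp_width :: "nat \<Rightarrow> cusp \<Rightarrow> nat" where
  "cusp_width N c = N div gcd N (cusp_denom c ^ 2)"

definition cusp_representatives :: "nat \<Rightarrow> cusp set \<Rightarrow> bool" where
  "cusp_representatives N C \<longleftrightarrow> (\<forall>x. \<exists>!c. c \<in> C \<and> (\<exists>A\<in>Gamma0 N. act_cusp A c = x))"


subsection \<open>Modular forms\<close>

definition dirichlet_character :: "nat \<Rightarrow> (int \<Rightarrow> complex) \<Rightarrow> bool" where
  "dirichlet_character N chi \<longleftrightarrow>
     (\<forall>m n. chi (m * n) = chi m * chi n) \<and>
     (\<forall>n. chi (n + int N) = chi n) \<and>
     (\<forall>n. chi n \<noteq> 0 \<longleftrightarrow> coprime n (int N))"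

definition theta :: "complex \<Rightarrow> complex" where
  "theta \<tau> = 1 + 2 * (\<Sum>n. qpow \<tau> (of_nat ((Suc n)\<^sup>2)))"

text \<open>For half-integral \<open>k\<close> the exponent \<open>2k\<close> of the theta multiplier is an integer.\<close>

definition modular_transformation ::
    "real \<Rightarrow> nat \<Rightarrow> (int \<Rightarrow> complex) \<Rightarrow> (complex \<Rightarrow> complex) \<Rightarrow> bool" where
  "modular_transformation k N chi f \<longleftrightarrow>
     (if k \<in> \<int> then
        \<forall>A\<in>Gamma0 N. \<forall>\<tau>\<in>upper_half_plane.
          f (moebius A \<tau>) = chi (A$2$2) * automorphy A \<tau> powi \<lfloor>k\<rfloor> * f \<tau>
      else
        4 dvd N \<and>
        (\<forall>A\<in>Gamma0 N. \<forall>\<tau>\<in>upper_half_plane.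
          f (moebius A \<tau>) = chi (A$2$2) * (theta (moebius A \<tau>) / theta \<tau>) powi \<lfloor>2 * k\<rfloor> * f \<tau>))"

definition modular_forms :: "real \<Rightarrow> nat \<Rightarrow> (int \<Rightarrow> complex) \<Rightarrow> (complex \<Rightarrow> complex) set" where
  "modular_forms k N chi =
     {f. f holomorphic_on upper_half_plane \<and>
         modular_transformation k N chi f \<and>
         (\<forall>A\<in>carrier SL2Z. Bfun (slash f k A) at_i_infinity)}"

definition product_vanishes_at_cusps ::
    "real \<Rightarrow> (complex \<Rightarrow> complex) \<Rightarrow> (complex \<Rightarrow> complex) \<Rightarrow> bool" where
  "product_vanishes_at_cusps k f g \<longleftrightarrow>
     (\<forall>A\<in>carrier SL2Z. (slash f k A \<longlongrightarrow> 0) at_i_infinity \<or> (slash g k A \<longlongrightarrow> 0) at_i_infinity)"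

definition has_q_expansion ::
    "(complex \<Rightarrow> complex) \<Rightarrow> rat \<Rightarrow> nat \<Rightarrow> (nat \<Rightarrow> complex) \<Rightarrow> bool" where
  "has_q_expansion h \<alpha> w a \<longleftrightarrow>
     (\<forall>\<tau>\<in>upper_half_plane.
        summable (\<lambda>n. a n * qpow \<tau> (of_nat n / of_nat w)) \<and>
        h \<tau> = qpow \<tau> \<alpha> * (\<Sum>n. a n * qpow \<tau> (of_nat n / of_nat w)))"


subsection \<open>The Petersson product\<close>

text \<open>Translates of \<open>D\<close> may overlap in null sets, so closed fundamental domains as well as exact sets
  of orbit representatives are allowed. Lebesgue null sets are the null sets of the invariant measure.\<close>

definition fundamental_domain :: "(int^2^2) set \<Rightarrow> complex set \<Rightarrow> bool" where
  "fundamental_domain G D \<longleftrightarrow>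
     D \<in> sets borel \<and> D \<subseteq> upper_half_plane \<and>
     (\<forall>\<tau>\<in>upper_half_plane. \<exists>A\<in>G. moebius A \<tau> \<in> D) \<and>
     (\<forall>A\<in>G. A \<noteq> mat 1 \<and> A \<noteq> - mat 1 \<longrightarrow> {\<tau>\<in>D. moebius A \<tau> \<in> D} \<in> null_sets lborel)"

definition petersson_integrand ::
    "real \<Rightarrow> (complex \<Rightarrow> complex) \<Rightarrow> (complex \<Rightarrow> complex) \<Rightarrow> complex \<Rightarrow> complex" where
  "petersson_integrand k f g \<tau> = f \<tau> * cnj (g \<tau>) * of_real (Im \<tau> powr k) / of_real ((Im \<tau>)\<^sup>2)"

text \<open>The integral over the quotient \<open>\<Gamma>\<^sub>0(N)\<setminus>\<HH>\<close> is the integral over a fundamental domain \<open>D\<close>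
  for \<open>\<Gamma>\<^sub>0(N)\<close>; on the type of complex numbers \<open>lborel\<close> is the measure \<open>dx dy\<close>.\<close>

definition petersson ::
    "nat \<Rightarrow> complex set \<Rightarrow> real \<Rightarrow> (complex \<Rightarrow> complex) \<Rightarrow> (complex \<Rightarrow> complex) \<Rightarrow> complex" where
  "petersson N D k f g =
     1 / of_nat (index_Gamma0 N) * (LINT \<tau>:D|lborel. petersson_integrand k f g \<tau>)"


subsection \<open>Bessel functions and the kernel \<open>W\<close>\<close>

text \<open>Modified Bessel function of the second kind, for arguments \<open>x > 0\<close>.\<close>

definition bessel_K :: "real \<Rightarrow> real \<Rightarrow> real" where
  "bessel_K \<nu> x = (LINT t:{0..}|lborel. exp (- x * cosh t) * cosh (\<nu> * t))"

definition W :: "real \<Rightarrow> real \<Rightarrow> real" where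
  "W k x = (\<Sum>j. let m = real (Suc j) in
     (m * x) powr (k - 1) * (m * x * bessel_K (k - 2) (m * x) - bessel_K (k - 1) (m * x)))"

text \<open>The factor \<open>W\<^sub>k (4 \<pi> t\<^sup>1\<^sup>/\<^sup>2) / t\<^sup>k\<^sup>-\<^sup>1\<close> for \<open>t \<ge> 0\<close>. At \<open>t = 0\<close> it is the limiting value if
  \<open>k = 1/2\<close>, and \<open>0\<close> otherwise, which amounts to omitting the term.\<close>

definition W_factor :: "real \<Rightarrow> real \<Rightarrow> real" where
  "W_factor k t =
     (if t = 0 then (if k = 1/2 then 1 / (4 * sqrt (2 * pi)) else 0)
      else W k (4 * pi * sqrt t) / t powr (k - 1))"

end

theory Submission
  imports Defs "HOL-Probability.Probability" "HOL-Number_Theory.Residues"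
begin

text \<open>
  Put \<open>\<phi> r = (2 * pi * r - 1) * exp (- pi * r)\<close>. Poisson summation shows that the sum of
  \<open>\<phi> (|c \<tau> + d|\<^sup>2 / y)\<close> over all integer pairs \<open>(c, d) \<noteq> 0\<close> equals \<open>1\<close> for every \<open>\<tau>\<close>. Collecting the
  multiples of each coprime pair, one gets a kernel \<open>\<kappa> y\<close>, the sum of \<open>2 * \<phi> (m\<^sup>2 / y)\<close> over \<open>m \<ge> 1\<close>, whose
  translates under the stabiliser cosets of \<open>i\<infinity>\<close> in \<open>SL\<^sub>2(\<int>)\<close> add up to a constant. Inserting this partition
  of unity into the Petersson integral and unfolding gives, for each cusp, the integral of
  \<open>f \<cdot> cnj g \<cdot> y\<^sup>k \<kappa> y\<close> over a strip of the width of that cusp. Parseval's identity in \<open>x\<close> reduces it to the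
  Laplace transforms of \<open>y\<^sup>k\<^sup>-\<^sup>2 \<kappa> y\<close>, which are sums of Bessel integrals. The kernel is
  \<open>O (exp (- 1 / y))\<close> as \<open>y \<rightarrow> 0\<close>, so the moderate growth of \<open>f\<close> and \<open>g\<close> at the real line causes no divergence.
\<close>

text \<open>The partition of unity plays the part of the residue of a non-holomorphic Eisenstein
  series and avoids analytic continuation. The origin of \<open>phi\<close> is the theta series
  \<Theta>(t), the sum of exp(-\<pi> t |c \<tau> + d|^2 / y) over all integer pairs. The quadratic
  form has determinant 1, so \<Theta>(1/t) = t \<Theta>(t); differentiating at t = 1 gives
  \<Theta>(1) + 2 \<Theta>'(1) = 0, that is, \<open>phi\<close> sums to 0 over all pairs, and the
  origin contributes -1. Two obstacles shape the estimates. In weight 1/2 the product of the forms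
  need not decay at a cusp; the integrand is then of order y^(-3/2), which suffices because
  \<open>kap\<close> stays bounded, but the constant term cannot be integrated termwise. Near the
  real line, absolute sums of coefficients are not controlled by the size of the forms, so sum and
  integral are exchanged by means of Parseval applied to each form separately. Sums run over
  matrices, not over classes modulo sign: a factor 2 arises in the partition of unity and again in
  the covering by translates of \<open>D\<close>, and cancels.\<close>

no_notation fps_nth (infixl \<open>$\<close> 75)

subsection \<open>Pointwise convergence of Fourier series\<close>

lemma periodic_integer_shift:
  fixes S :: "real \<Rightarrow> 'a"
  assumes per: "\<And>x. S (x + 1) = S x"
  shows "S (x + of_int m) = S x"
proof -
  have nat: "S (x + real n) = S x" for x n
  proof (induction n)
    case (Suc n)
    have "S (x + real (Suc n)) = S ((x + real n) + 1)" by (simp add: algebra_simps)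
    with Suc per show ?case by simp
  qed simp
  show ?thesis
  proof (cases "m \<ge> 0")
    case True
    then show ?thesis using nat[of x "nat m"] by simp
  next
    case False
    then have "S (x + of_int m) = S ((x + of_int m) + real (nat (- m)))" by (rule_tac nat[symmetric])
    with False show ?thesis by simp
  qed
qed

lemma integral_periodic_shift:
  fixes g :: "real \<Rightarrow> complex"
  assumes cont: "continuous_on UNIV g" and per: "\<And>x. g (x + 1) = g x" and s: "0 \<le> s" "s \<le> 1"
  shows "integral {0..1} (\<lambda>x. g (x + s)) = integral {0..1} g"
proof -
  have int: "g integrable_on {a..b}" for a b
    by (intro integrable_continuous_interval continuous_on_subset[OF cont]) auto
  have "integral {0..1} (\<lambda>x. g (x + s)) = integral {0 + s..1 + s} g"
    using integral_shift[of 0 s 1 g] continuous_on_subset[OF cont] by (simp add: o_def)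
  also have "\<dots> = integral {s..1} g + integral {1..1 + s} g"
    using s int by (subst Henstock_Kurzweil_Integration.integral_combine[of s 1 "1 + s" g]) auto
  also have "integral {1..1 + s} g = integral {0..s} (\<lambda>x. g (x + 1))"
    using integral_shift[of 0 1 s g] continuous_on_subset[OF cont] by (simp add: o_def add.commute)
  also have "\<dots> = integral {0..s} g" by (simp add: per)
  also have "integral {s..1} g + integral {0..s} g = integral {0..1} g"
    using Henstock_Kurzweil_Integration.integral_combine[OF s int] by (simp add: add.commute)
  finally show ?thesis .
qed

text \<open>A shift by half a period of the exponential changes its sign, so twice the coefficient
  is an integral of \<open>k x - k (x + s)\<close> against a unimodular factor. Uniform continuity
  makes this small once \<open>s = 1 / (2 * \<bar>n\<bar>)\<close> is small.\<close>

lemma periodic_riemann_lebesgue: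
  fixes k :: "real \<Rightarrow> complex"
  assumes cont: "continuous_on UNIV k" and per: "\<And>x. k (x + 1) = k x" and e: "e > 0"
  shows "\<exists>M. \<forall>n::int. \<bar>n\<bar> > M \<longrightarrow> norm (integral {0..1} (\<lambda>x. k x * cis (- (2 * pi * of_int n * x)))) < e"
proof -
  \<comment> \<open>The interval is long enough to contain both \<open>x\<close> and
    \<open>x + s\<close> for \<open>x\<close> in the unit interval.\<close>
  have "uniformly_continuous_on {0..2} k"
    by (intro compact_uniformly_continuous continuous_on_subset[OF cont]) auto
  then obtain d where d: "d > 0" "\<And>x y. x \<in> {0..2} \<Longrightarrow> y \<in> {0..2} \<Longrightarrow> dist y x < d \<Longrightarrow> dist (k y) (k x) < e"
    using e unfolding uniformly_continuous_on_def by metis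
  define M where "M = \<lceil>1 / d\<rceil> + 1"
  have M: "of_int M > 1 / d" "M \<ge> 1"
    using le_of_int_ceiling[of "1 / d"] d(1) divide_pos_pos[of 1 d]
    by (simp_all add: M_def del: le_of_int_ceiling divide_pos_pos zero_less_divide_1_iff)
  show ?thesis
  proof (intro exI[of _ M] allI impI)
    fix n :: int assume n: "\<bar>n\<bar> > M"
    define s where "s = 1 / (2 * real_of_int \<bar>n\<bar>)"
    have nd: "real_of_int \<bar>n\<bar> > 1 / d" using n M by linarith
    have s: "s > 0" "s \<le> 1" "s < d"
      using n M(2) nd d(1) by (auto simp: s_def field_simps)
    have ns: "2 * pi * of_int n * s = pi * sgn (real_of_int n)"
      using n M(2) by (auto simp: s_def sgn_if)
    define E where "E = (\<lambda>x. cis (- (2 * pi * of_int n * x)))"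
    have "cis (- (pi * sgn (real_of_int n))) = - 1"
      using n M(2) by (auto simp: sgn_if cis.ctr complex_eq_iff)
    then have Es: "E (x + s) = - E x" for x
    proof -
      have "cis (- (2 * pi * of_int n * (x + s))) = cis (- (2 * pi * of_int n * x)) * cis (- (2 * pi * of_int n * s))"
        by (simp only: cis_mult) (simp add: algebra_simps)
      then show ?thesis using \<open>cis (- (pi * sgn (real_of_int n))) = - 1\<close> unfolding ns E_def by simp
    qed
    have contE: "continuous_on A E" for A unfolding E_def by (intro continuous_intros)
    have contk: "continuous_on A k" for A using continuous_on_subset[OF cont] by blast
    have contks: "continuous_on A (\<lambda>x. k (x + s))" for A
      by (rule continuous_on_compose2[OF cont]) (auto intro!: continuous_intros)
    have perE: "E (x + 1) = E x" for x
    proof -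
      have "cis (- (2 * pi * of_int n * (x + 1))) = cis (- (2 * pi * of_int n * x)) * cis (2 * pi * (- of_int n))"
        by (simp only: cis_mult) (simp add: algebra_simps)
      then show ?thesis using cis_multiple_2pi[of "- of_int n"] unfolding E_def by simp
    qed
    let ?d = "integral {0..1} (\<lambda>x. k x * E x)"
    have "?d = integral {0..1} (\<lambda>x. k (x + s) * E (x + s))"
      by (rule integral_periodic_shift[symmetric]) (use s per perE contk contE in \<open>auto intro!: continuous_intros\<close>)
    also have "\<dots> = integral {0..1} (\<lambda>x. - (k (x + s) * E x))" by (simp add: Es)
    finally have "?d + ?d = integral {0..1} (\<lambda>x. k x * E x) + integral {0..1} (\<lambda>x. - (k (x + s) * E x))" by simp
    also have "\<dots> = integral {0..1} (\<lambda>x. k x * E x + - (k (x + s) * E x))"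
      by (rule integral_add[symmetric]) (intro integrable_continuous_interval continuous_intros contk contE contks)+
    finally have dd: "2 * ?d = integral {0..1} (\<lambda>x. (k x - k (x + s)) * E x)" by (simp add: algebra_simps)
    have "norm (integral {0..1} (\<lambda>x. (k x - k (x + s)) * E x)) \<le> e * (1 - 0)"
    proof (rule integral_bound)
      show "continuous_on {0..1} (\<lambda>x. (k x - k (x + s)) * E x)"
        by (intro continuous_intros contk contE contks)
      fix x :: real assume x: "x \<in> {0..1}"
      then have "dist (k x) (k (x + s)) < e" using s by (intro d(2)) (auto simp: dist_norm)
      then show "norm ((k x - k (x + s)) * E x) \<le> e" by (simp add: norm_mult E_def dist_norm)
    qed simp
    then have "norm (2 * ?d) \<le> e" by (subst dd) simp
    then show "norm ?d < e" using e by (simp add: norm_mult E_def)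
  qed
qed

text \<open>Chernoff's argument: dividing \<open>S - S 0\<close> by \<open>cis (2 * pi * x) - 1\<close> makes the partial sums telescope.\<close>

lemma fourier_series_at_0:
  fixes S :: "real \<Rightarrow> complex"
  assumes cont: "continuous_on UNIV S" and per: "\<And>x. S (x + 1) = S x"
    and deriv: "(S has_vector_derivative D) (at 0)"
  shows "(\<lambda>M. \<Sum>n = - int M..int M. integral {0..1} (\<lambda>x. S x * cis (- (2 * pi * of_int n * x)))) \<longlonglongrightarrow> S 0"
proof -
  define e where "e = (\<lambda>x. cis (2 * pi * x) - 1)"
  \<comment> \<open>Numerator and denominator both vanish at integers; the value there is the
    quotient of their derivatives, which makes \<open>k\<close> continuous.\<close>
  define k where "k = (\<lambda>x. if x \<in> \<int> then D / (2 * pi * \<i>) else (S x - S 0) / e x)"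
  have e0: "e x = 0 \<longleftrightarrow> x \<in> \<int>" for x
  proof
    assume "e x = 0"
    then have "cos (2 * pi * x) = 1" by (simp add: e_def complex_eq_iff)
    then obtain m where "2 * pi * x = of_int m * 2 * pi" using cos_one_2pi_int by auto
    then show "x \<in> \<int>" by simp
  next
    assume "x \<in> \<int>"
    then show "e x = 0" by (auto simp: e_def elim!: Ints_cases)
  qed
  have eper: "e (x + 1) = e x" for x
  proof -
    have "cis (2 * pi * (x + 1)) = cis (2 * pi * x) * cis (2 * pi * 1)"
      by (simp only: cis_mult) (simp add: algebra_simps)
    then show ?thesis using cis_multiple_2pi[of 1] unfolding e_def by simp
  qed
  have kper: "k (x + 1) = k x" for x by (simp add: k_def per eper)
  have ke: "k x * e x = S x - S 0" for x
    using e0[of x] periodic_integer_shift[of S 0, OF per] by (auto simp: k_def elim!: Ints_cases)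
  have econt: "continuous_on UNIV e" unfolding e_def by (intro continuous_intros)
  have isk0: "isCont k 0"
  proof -
    have quot: "((\<lambda>h. (f h - f 0) / of_real h) \<longlongrightarrow> D) (at 0)"
      if "(f has_vector_derivative D) (at 0)" for f :: "real \<Rightarrow> complex" and D
    proof -
      have "((\<lambda>h. norm (f h - f 0 - h *\<^sub>R D) / norm h) \<longlongrightarrow> 0) (at 0)"
        using that unfolding has_vector_derivative_def has_derivative_at by simp
      moreover have "\<forall>\<^sub>F h in at 0. norm (f h - f 0 - h *\<^sub>R D) / norm h = norm ((f h - f 0) / of_real h - D)"
      proof (unfold eventually_at_filter, intro always_eventually allI impI)
        fix h :: real assume "h \<noteq> 0"
        then have "(f h - f 0 - h *\<^sub>R D) / of_real h = (f h - f 0) / of_real h - D"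
          by (simp add: scaleR_conv_of_real diff_divide_distrib)
        then show "norm (f h - f 0 - h *\<^sub>R D) / norm h = norm ((f h - f 0) / of_real h - D)"
          by (metis norm_divide norm_of_real real_norm_def)
      qed
      ultimately have "((\<lambda>h. norm ((f h - f 0) / of_real h - D)) \<longlongrightarrow> 0) (at 0)"
        by (rule Lim_transform_eventually)
      then show ?thesis
        by (rule LIM_zero_cancel[OF tendsto_norm_zero_cancel])
    qed
    have "(e has_vector_derivative 2 * pi * \<i>) (at 0)"
      unfolding e_def cis_conv_exp
      by (auto intro!: derivative_eq_intros has_vector_derivative_real_field)
    from tendsto_divide[OF quot[OF deriv] quot[OF this]]
    have "((\<lambda>h. ((S h - S 0) / of_real h) / ((e h - e 0) / of_real h)) \<longlongrightarrow> D / (2 * pi * \<i>)) (at 0)" by simp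
    moreover have "\<forall>\<^sub>F h in at 0. h \<notin> (\<int> :: real set) \<and> h \<noteq> 0"
      unfolding eventually_at by (rule exI[of _ 1]) (auto elim!: Ints_cases)
    then have "\<forall>\<^sub>F h in at 0. ((S h - S 0) / of_real h) / ((e h - e 0) / of_real h) = k h"
      by eventually_elim (simp add: k_def e0)
    ultimately have "(k \<longlongrightarrow> D / (2 * pi * \<i>)) (at 0)"
      using tendsto_cong by force
    then show ?thesis by (simp add: isCont_def k_def)
  qed
  have kcont: "continuous_on UNIV k"
    unfolding continuous_on_eq_continuous_at[OF open_UNIV]
  proof
    fix x :: real
    show "isCont k x"
    proof (cases "x \<in> \<int>")
      case True
      then obtain m where m: "x = of_int m" by (elim Ints_cases)
      have "isCont (\<lambda>y. k (y + of_int (- m))) x"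
        by (rule isCont_o2[of x "\<lambda>y. y + of_int (- m)"]) (use isk0 m in auto)
      then show ?thesis unfolding periodic_integer_shift[of k, OF kper] .
    next
      case False
      have op: "open (- \<int> :: real set)" using closed_Ints by (simp add: open_Compl)
      have "continuous_on (- \<int>) (\<lambda>x. (S x - S 0) / e x)"
        by (intro continuous_intros continuous_on_subset[OF cont] continuous_on_subset[OF econt]) (auto simp: e0)
      then have "continuous_on (- \<int>) k" by (rule continuous_on_eq) (simp add: k_def)
      then show ?thesis using op False by (simp add: continuous_on_eq_continuous_at)
    qed
  qed
  define d where "d = (\<lambda>n::int. integral {0..1} (\<lambda>x. k x * cis (- (2 * pi * of_int n * x))))"
  have contE: "continuous_on A (\<lambda>x. cis (- (2 * pi * of_int n * x)))" for A and n :: int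
    by (intro continuous_intros)
  have contk: "continuous_on A k" for A using continuous_on_subset[OF kcont] by blast
  have contS: "continuous_on A S" for A using continuous_on_subset[OF cont] by blast
  have one: "integral {0..1} (\<lambda>x. cis (- (2 * pi * of_int n * x))) = (if n = 0 then 1 else 0)" for n :: int
  proof (cases "n = 0")
    case False
    have "((\<lambda>x. cis (- (2 * pi * of_int n * x))) has_integral
        (\<i> / (2 * pi * of_int n) * cis (- (2 * pi * of_int n * 1)) - \<i> / (2 * pi * of_int n) * cis (- (2 * pi * of_int n * 0)))) {0..1}"
    proof (rule fundamental_theorem_of_calculus)
      show "((\<lambda>x. \<i> / (2 * pi * of_int n) * cis (- (2 * pi * of_int n * x))) has_vector_derivative
              cis (- (2 * pi * of_int n * x))) (at x within {0..1})" for x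
        unfolding cis_conv_exp using False
        by (auto intro!: derivative_eq_intros has_vector_derivative_real_field simp: field_simps)
    qed auto
    then show ?thesis using False cis_multiple_2pi[of "- of_int n"] by (simp add: integral_unique)
  qed simp
  have step: "integral {0..1} (\<lambda>x. S x * cis (- (2 * pi * of_int n * x))) = (if n = 0 then S 0 else 0) + (d (n - 1) - d n)" for n
  proof -
    have "S x * cis (- (2 * pi * of_int n * x)) = S 0 * cis (- (2 * pi * of_int n * x)) +
        (k x * cis (- (2 * pi * of_int (n - 1) * x)) - k x * cis (- (2 * pi * of_int n * x)))" for x
    proof -
      have "cis (- (2 * pi * of_int (n - 1) * x)) = cis (2 * pi * x) * cis (- (2 * pi * of_int n * x))"
        by (simp add: cis_mult algebra_simps)
      then have "k x * cis (- (2 * pi * of_int (n - 1) * x)) - k x * cis (- (2 * pi * of_int n * x)) = (k x * e x) * cis (- (2 * pi * of_int n * x))"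
        by (simp only: e_def) (simp add: algebra_simps)
      then show ?thesis unfolding ke by (simp add: algebra_simps)
    qed
    then have "integral {0..1} (\<lambda>x. S x * cis (- (2 * pi * of_int n * x))) = integral {0..1} (\<lambda>x. S 0 * cis (- (2 * pi * of_int n * x)) +
        (k x * cis (- (2 * pi * of_int (n - 1) * x)) - k x * cis (- (2 * pi * of_int n * x))))" by simp
    also have "\<dots> = S 0 * (if n = 0 then 1 else 0) + (d (n - 1) - d n)"
      unfolding d_def one[symmetric]
      by (subst integral_add integral_diff integral_mult_right, (intro integrable_continuous_interval continuous_intros contk contE)+)+ simp
    finally show ?thesis by simp
  qed
  have sum: "(\<Sum>n = - int M..int M. integral {0..1} (\<lambda>x. S x * cis (- (2 * pi * of_int n * x)))) = S 0 + (d (- int M - 1) - d (int M))" for M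
  proof -
    have "(\<Sum>n = - int M..int M. d (n - 1) - d n) = d (- int M - 1) - d (int M)"
    proof (induction M)
      case (Suc M)
      moreover have "{- int (Suc M)..int (Suc M)} = insert (- int (Suc M)) (insert (int (Suc M)) {- int M..int M})" by auto
      ultimately have "(\<Sum>n = - int (Suc M)..int (Suc M). d (n - 1) - d n) =
          (d (- int (Suc M) - 1) - d (- int (Suc M))) + ((d (int (Suc M) - 1) - d (int (Suc M))) + (\<Sum>n = - int M..int M. d (n - 1) - d n))"
        by simp
      moreover have "int (Suc M) - 1 = int M" "- int (Suc M) = - int M - 1" by simp_all
      then have "d (int (Suc M) - 1) = d (int M)" "d (- int (Suc M)) = d (- int M - 1)"
        by (simp_all only:)
      ultimately show ?case using Suc by (simp del: of_nat_Suc)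
    qed simp
    then show ?thesis by (simp add: step sum.distrib)
  qed
  \<comment> \<open>Telescoping leaves \<open>S 0\<close> and two boundary coefficients of the
    continuous periodic function \<open>k\<close>, which tend to 0 by
    \<open>periodic_riemann_lebesgue\<close>.\<close>
  show ?thesis
    unfolding sum
  proof (rule LIMSEQ_I)
    fix r :: real assume "r > 0"
    then obtain M where M: "\<And>n::int. \<bar>n\<bar> > M \<Longrightarrow> norm (d n) < r / 2"
      using periodic_riemann_lebesgue[OF kcont kper, of "r / 2"] unfolding d_def by auto
    show "\<exists>no. \<forall>n\<ge>no. norm (S 0 + (d (- int n - 1) - d (int n)) - S 0) < r"
    proof (intro exI[of _ "nat M + 1"] allI impI)
      fix n assume "n \<ge> nat M + 1"
      then have "\<bar>- int n - 1\<bar> > M" "\<bar>int n\<bar> > M" by linarith+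
      then have "norm (d (- int n - 1)) < r / 2" "norm (d (int n)) < r / 2" using M by blast+
      then show "norm (S 0 + (d (- int n - 1) - d (int n)) - S 0) < r"
        using norm_triangle_ineq4[of "d (- int n - 1)" "d (int n)"] by simp
    qed
  qed
qed

subsection \<open>Poisson summation\<close>

text \<open>The range is half-open because the unit intervals starting at its elements fill
  \<open>{- M..M}\<close> exactly; this is how integrals over unit intervals are later added up to
  an integral over the line.\<close>

lemma has_sum_int_imp_sums:
  fixes F :: "int \<Rightarrow> 'a::real_normed_vector"
  assumes "(F has_sum X) UNIV"
  shows "(\<lambda>M. \<Sum>d\<in>{- int M..<int M}. F d) \<longlonglongrightarrow> X"
proof -
  have "filterlim (\<lambda>M. {- int M..<int M}) (finite_subsets_at_top UNIV) sequentially"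
    unfolding filterlim_finite_subsets_at_top
  proof (intro allI impI)
    fix X :: "int set" assume "finite X \<and> X \<subseteq> UNIV"
    then obtain N where N: "\<And>x. x \<in> X \<Longrightarrow> \<bar>x\<bar> \<le> N"
      using finite_imageI[of X abs] by (metis Max_ge imageI)
    show "\<forall>\<^sub>F y in sequentially. finite {- int y..<int y} \<and> X \<subseteq> {- int y..<int y} \<and> {- int y..<int y} \<subseteq> UNIV"
      using eventually_ge_at_top[of "nat N + 1"] by eventually_elim (auto dest!: N)
  qed
  with assms show ?thesis unfolding has_sum_def by (rule filterlim_compose)
qed

text \<open>Pairing \<open>n\<close> with \<open>- n - 1\<close> turns a sum over the integers into
  an ordinary series, the form needed for termwise differentiation.\<close>

lemma sum_int_symmetric_interval:
  fixes F :: "int \<Rightarrow> 'a::comm_monoid_add"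
  shows "(\<Sum>d\<in>{- int M..<int M}. F d) = (\<Sum>n<M. F (int n) + F (- int n - 1))"
proof (induction M)
  case (Suc M)
  have "{- int (Suc M)..<int (Suc M)} = insert (int M) (insert (- int M - 1) {- int M..<int M})" by auto
  with Suc show ?case by (simp add: ac_simps)
qed simp

lemma abs_summable_inverse_1_plus_square_int:
  "(\<lambda>d::int. 1 / (1 + (real_of_int d)\<^sup>2)) summable_on UNIV"
proof -
  have sn: "(\<lambda>n::nat. 1 / (1 + (real n)\<^sup>2)) summable_on UNIV"
  proof (rule norm_summable_imp_summable_on, rule summable_comparison_test')
    show "summable (\<lambda>n. inverse (real n ^ 2))" by (rule inverse_power_summable) auto
    show "norm (norm (1 / (1 + (real n)\<^sup>2))) \<le> inverse (real n ^ 2)" if "n \<ge> 1" for n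
      using that by (simp add: field_simps add_pos_nonneg)
  qed
  have "(\<lambda>d::int. 1 / (1 + (real_of_int d)\<^sup>2)) summable_on (range int)"
    by (subst summable_on_reindex) (use sn in \<open>auto simp: o_def\<close>)
  moreover have "(\<lambda>d::int. 1 / (1 + (real_of_int d)\<^sup>2)) summable_on (range (\<lambda>n. - int n))"
    by (subst summable_on_reindex) (use sn in \<open>auto simp: o_def inj_on_def\<close>)
  ultimately have "(\<lambda>d::int. 1 / (1 + (real_of_int d)\<^sup>2)) summable_on (range int \<union> range (\<lambda>n. - int n))"
    by (rule summable_on_union)
  moreover have "range int \<union> range (\<lambda>n. - int n) = UNIV"
  proof -
    have "x \<in> range int \<union> range (\<lambda>n. - int n)" for x
      by (cases x rule: int_cases2) auto
    then show ?thesis by blast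
  qed
  ultimately show ?thesis by simp
qed

text \<open>Quadratic decay survives bounded shifts. This gives one summable majorant for all
  \<open>x\<close> in a bounded interval, hence uniform convergence of periodised functions.\<close>

lemma one_plus_square_shift_le:
  fixes x y R :: real
  assumes "\<bar>x\<bar> \<le> R"
  shows "1 / (1 + (x + y)\<^sup>2) \<le> 2 * (1 + R\<^sup>2) * (1 / (1 + y\<^sup>2))"
proof -
  have "0 \<le> (2 * x + y)\<^sup>2" by simp
  then have "y\<^sup>2 \<le> 2 * (x + y)\<^sup>2 + 2 * x\<^sup>2" by (simp add: power2_eq_square algebra_simps)
  then have "1 + y\<^sup>2 \<le> 2 * (1 + x\<^sup>2) * (1 + (x + y)\<^sup>2)"
  proof -
    have "0 \<le> x\<^sup>2 * (x + y)\<^sup>2" "0 \<le> x\<^sup>2" by simp_all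
    moreover have "2 * (1 + x\<^sup>2) * (1 + (x + y)\<^sup>2) = 2 + 2 * x\<^sup>2 + 2 * (x + y)\<^sup>2 + 2 * (x\<^sup>2 * (x + y)\<^sup>2)"
      by (simp only: algebra_simps)
    ultimately show ?thesis using \<open>y\<^sup>2 \<le> 2 * (x + y)\<^sup>2 + 2 * x\<^sup>2\<close> by linarith
  qed
  also have "\<dots> \<le> 2 * (1 + R\<^sup>2) * (1 + (x + y)\<^sup>2)"
    using assms by (intro mult_right_mono mult_left_mono add_left_mono) (auto simp: abs_le_square_iff[symmetric])
  finally show ?thesis
    by (simp add: divide_simps add_pos_nonneg sum_power2_gt_zero_iff add_nonneg_eq_0_iff)
qed

lemma integrable_quadratic_decay:
  fixes f :: "real \<Rightarrow> complex"
  assumes "continuous_on UNIV f" "\<And>x. norm (f x) \<le> K / (1 + x\<^sup>2)"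
  shows "integrable lborel f"
proof (rule Bochner_Integration.integrable_bound)
  have "integrable lborel (\<lambda>x::real. inverse (1 + x\<^sup>2))"
    using integrable_inverse_1_plus_square by (simp add: set_integrable_def)
  then show "integrable lborel (\<lambda>x::real. K * inverse (1 + x\<^sup>2))" by simp
  show "f \<in> borel_measurable lborel"
    using borel_measurable_continuous_onI[OF assms(1)] by simp
  show "AE x in lborel. norm (f x) \<le> norm (K * inverse (1 + x\<^sup>2))"
    using assms(2) by (auto simp: divide_inverse intro!: AE_I2 order.trans[OF _ abs_ge_self])
qed

text \<open>Unrestricted sums over the integers are used throughout, so that no order of summation is needed.\<close>

context
  fixes f f' :: "real \<Rightarrow> complex" and K :: real
  assumes deriv: "\<And>x. (f has_vector_derivative f' x) (at x)"
    and bound: "\<And>x. norm (f x) \<le> K / (1 + x\<^sup>2)"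
    and bound': "\<And>x. norm (f' x) \<le> K / (1 + x\<^sup>2)"
begin

private lemma K: "K \<ge> 0"
  using bound[of 0] by (auto intro: order.trans[OF norm_ge_zero])

private lemma majorant:
  assumes "\<bar>x\<bar> \<le> R" "\<And>x. norm (g x) \<le> K / (1 + x\<^sup>2)"
  shows "norm (g (x + y)) \<le> K * (2 * (1 + R\<^sup>2) * (1 / (1 + y\<^sup>2)))"
  using order.trans[OF assms(2)[of "x + y"]] mult_left_mono[OF one_plus_square_shift_le[OF assms(1), of y] K]
  by simp

private lemma summable_majorant: "(\<lambda>d::int. K * (2 * (1 + R\<^sup>2) * (1 / (1 + (of_int d)\<^sup>2)))) summable_on UNIV"
  by (intro summable_on_cmult_right abs_summable_inverse_1_plus_square_int)

lemma poisson_abs_summable: "(\<lambda>d::int. norm (f (x + of_int d))) summable_on UNIV"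
  by (rule summable_on_comparison_test[OF summable_majorant[of "\<bar>x\<bar>"]]) (rule majorant[OF _ bound], auto)

private definition S where "S = (\<lambda>x. \<Sum>\<^sub>\<infinity>d::int. f (x + of_int d))"

private lemma contf: "continuous_on A f"
  using deriv by (intro continuous_on_vector_derivative) (auto intro: has_vector_derivative_at_within)

private lemma uniform_limit_S:
  "uniform_limit {-R..R} (\<lambda>X x. \<Sum>d\<in>X. f (x + of_int d)) S (finite_subsets_at_top UNIV)"
  unfolding S_def by (rule Weierstrass_m_test_general[OF _ summable_majorant[of R]]) (rule majorant[OF _ bound], auto)

private lemma continuous_S: "continuous_on UNIV S"
proof -
  have "isCont S x" for x
  proof -
    have "continuous_on {-(\<bar>x\<bar> + 1)..\<bar>x\<bar> + 1} S"
      by (rule uniform_limit_theorem[OF _ uniform_limit_S])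
        (auto intro!: always_eventually continuous_intros continuous_on_compose2[OF contf[of UNIV]])
    then show ?thesis by (rule continuous_on_interior) auto
  qed
  then show ?thesis by (simp add: continuous_on_eq_continuous_at)
qed

private lemma periodic_S: "S (x + 1) = S x"
proof -
  have "S (x + 1) = (\<Sum>\<^sub>\<infinity>d::int. f (x + of_int (d + 1)))" by (simp add: S_def algebra_simps)
  also have "\<dots> = S x"
    unfolding S_def by (rule infsum_reindex_bij_witness[of _ "\<lambda>d. d - 1" "\<lambda>d. d + 1"]) auto
  finally show ?thesis .
qed

text \<open>Convergence of the Fourier series at 0 asks for a derivative at that point only. The
  bound on \<open>f'\<close> lets the series be differentiated termwise on
  \<open>{-1..1}\<close>.\<close>

private lemma derivative_S: "\<exists>D. (S has_vector_derivative D) (at 0)"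
proof -
  define T where "T = (\<lambda>n x. f (x + of_int (int n)) + f (x + of_int (- int n - 1)))"
  define T' where "T' = (\<lambda>n x. f' (x + of_int (int n)) + f' (x + of_int (- int n - 1)))"
  define mj where "mj = (\<lambda>y::real. K * (2 * (1 + 1\<^sup>2) * (1 / (1 + y\<^sup>2))))"
  have "(\<lambda>n. mj (of_int (int n)) + mj (of_int (- int n - 1))) sums (\<Sum>\<^sub>\<infinity>d::int. mj (of_int d))"
    unfolding sums_def mj_def
    unfolding sum_int_symmetric_interval[of "\<lambda>d::int. K * (2 * (1 + 1\<^sup>2) * (1 / (1 + (of_int d)\<^sup>2)))", symmetric]
    by (rule has_sum_int_imp_sums[OF has_sum_infsum]) (rule summable_majorant)
  then have sm: "summable (\<lambda>n. mj (of_int (int n)) + mj (of_int (- int n - 1)))" by (simp add: sums_iff)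
  have ul: "uniform_limit {-1..1} (\<lambda>n x. \<Sum>i<n. T' i x) (\<lambda>x. \<Sum>i. T' i x) sequentially"
  proof (rule Weierstrass_m_test[OF _ sm])
    fix n and x :: real assume "x \<in> {-1..1}"
    then have x: "\<bar>x\<bar> \<le> 1" by auto
    have "norm (f' (x + of_int (int n))) \<le> mj (of_int (int n))"
         "norm (f' (x + of_int (- int n - 1))) \<le> mj (of_int (- int n - 1))"
      unfolding mj_def by (rule majorant[OF x bound'])+
    then show "norm (T' n x) \<le> mj (of_int (int n)) + mj (of_int (- int n - 1))"
      unfolding T'_def by (rule norm_triangle_mono)
  qed
  have sumsT: "(\<lambda>n. T n x) sums S x" for x
  proof -
    have "(\<lambda>M. \<Sum>d\<in>{- int M..<int M}. f (x + of_int d)) \<longlonglongrightarrow> S x"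
      unfolding S_def by (rule has_sum_int_imp_sums[OF has_sum_infsum[OF abs_summable_summable[OF poisson_abs_summable]]])
    then show ?thesis unfolding sums_def sum_int_symmetric_interval T_def .
  qed
  have "\<exists>g. \<forall>x\<in>{-1..1}. (\<lambda>n. T n x) sums (g x) \<and> (g has_derivative (\<lambda>h. h *\<^sub>R (\<Sum>i. T' i x))) (at x within {-1..1})"
  proof (rule has_derivative_series[where f' = "\<lambda>n x h. h *\<^sub>R T' n x" and x = 0])
    fix n and x :: real
    show "(T n has_derivative (\<lambda>h. h *\<^sub>R T' n x)) (at x within {- 1..1})"
    proof -
      have sh: "((\<lambda>x. f (x + c)) has_vector_derivative f' (x + c)) (at x within {-1..1})" for c
      proof -
        have "((\<lambda>x. x + c) has_vector_derivative 1) (at x within {-1..1})"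
          by (auto intro!: derivative_eq_intros)
        from vector_diff_chain_within[OF this has_vector_derivative_at_within[OF deriv]]
        show ?thesis by (simp add: o_def)
      qed
      show ?thesis
        unfolding T_def T'_def has_vector_derivative_def[symmetric]
        by (intro has_vector_derivative_add sh)
    qed
  next
    fix e :: real assume e: "e > 0"
    show "\<forall>\<^sub>F n in sequentially. \<forall>x\<in>{-1..1}. \<forall>h. norm ((\<Sum>i<n. h *\<^sub>R T' i x) - h *\<^sub>R (\<Sum>i. T' i x)) \<le> e * norm h"
      using uniform_limitD[OF ul e]
    proof eventually_elim
      case (elim n)
      show ?case
      proof (intro ballI allI)
        fix x h :: real assume "x \<in> {-1..1}"
        with elim have "norm ((\<Sum>i<n. T' i x) - (\<Sum>i. T' i x)) \<le> e" by (auto simp: dist_norm less_imp_le)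
        then have "\<bar>h\<bar> * norm ((\<Sum>i<n. T' i x) - (\<Sum>i. T' i x)) \<le> \<bar>h\<bar> * e" by (intro mult_left_mono) auto
        then show "norm ((\<Sum>i<n. h *\<^sub>R T' i x) - h *\<^sub>R (\<Sum>i. T' i x)) \<le> e * norm h"
          by (simp only: scaleR_sum_right[symmetric] scaleR_diff_right[symmetric] norm_scaleR real_norm_def mult.commute)
      qed
    qed
  qed (use sumsT in simp_all)
  then obtain g where g0: "\<forall>x\<in>{-1..1}. (\<lambda>n. T n x) sums (g x) \<and> (g has_derivative (\<lambda>h. h *\<^sub>R (\<Sum>i. T' i x))) (at x within {-1..1})"
    by blast
  then have g: "\<And>x. x \<in> {-1..1} \<Longrightarrow> (\<lambda>n. T n x) sums (g x)"
     "(g has_derivative (\<lambda>h. h *\<^sub>R (\<Sum>i. T' i 0))) (at 0 within {-1..1})" by auto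
  have "g x = S x" if "x \<in> {-1..1}" for x using sums_unique2[OF g(1)[OF that] sumsT] .
  then have "(S has_derivative (\<lambda>h. h *\<^sub>R (\<Sum>i. T' i 0))) (at 0 within {-1..1})"
    using has_derivative_transform[OF _ _ g(2), of S] by simp
  then show ?thesis by (auto simp: has_vector_derivative_def at_within_Icc_at)
qed

text \<open>The exponential has period 1, so it can be moved inside the periodisation. Uniform
  convergence permits integration of each shift, and the shifted unit intervals exhaust the real
  line.\<close>

private lemma coefficient_S:
  "integral {0..1} (\<lambda>x. S x * cis (- (2 * pi * of_int n * x))) = (LINT x|lborel. f x * cis (- (2 * pi * of_int n * x)))"
proof -
  define g where "g = (\<lambda>x. f x * cis (- (2 * pi * of_int n * x)))"
  have contg: "continuous_on A g" for A unfolding g_def by (intro continuous_intros contf)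
  have intg: "integrable lborel g"
    by (rule integrable_quadratic_decay[OF contg, of K]) (use bound in \<open>auto simp: g_def norm_mult\<close>)
  have per: "cis (- (2 * pi * of_int n * (x + of_int d))) = cis (- (2 * pi * of_int n * x))" for x and d :: int
  proof -
    have "cis (- (2 * pi * of_int n * (x + of_int d))) = cis (- (2 * pi * of_int n * x)) * cis (2 * pi * of_int (- n * d))"
      by (simp only: cis_mult) (simp add: algebra_simps)
    also have "cis (2 * pi * of_int (- n * d)) = 1" by (rule cis_multiple_2pi) simp
    finally show ?thesis by simp
  qed
  have "uniform_limit {0..1} (\<lambda>X x. (\<Sum>d\<in>X. f (x + of_int d)) * cis (- (2 * pi * of_int n * x)))
      (\<lambda>x. S x * cis (- (2 * pi * of_int n * x))) (finite_subsets_at_top UNIV)"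
  proof (rule uniform_lim_mult)
    show "uniform_limit {0..1} (\<lambda>X x. \<Sum>d\<in>X. f (x + of_int d)) S (finite_subsets_at_top UNIV)"
      by (rule uniform_limit_on_subset[OF uniform_limit_S[of 1]]) auto
    show "bounded (S ` {0..1})"
      by (intro compact_imp_bounded compact_continuous_image continuous_on_subset[OF continuous_S]) auto
  qed (auto intro!: uniform_limit_const boundedI[of _ 1])
  then have "uniform_limit {0..1} (\<lambda>X x. (\<Sum>d\<in>X. g (x + of_int d)))
      (\<lambda>x. S x * cis (- (2 * pi * of_int n * x))) (finite_subsets_at_top UNIV)"
    by (simp only: sum_distrib_right g_def per)
  then obtain I J where IJ: "\<And>X. ((\<lambda>x. (\<Sum>d\<in>X. g (x + of_int d))) has_integral I X) {0..1}"
      "((\<lambda>x. S x * cis (- (2 * pi * of_int n * x))) has_integral J) {0..1}"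
      "(I \<longlongrightarrow> J) (finite_subsets_at_top UNIV)"
    by (rule uniform_limit_integral)
      (auto intro!: continuous_intros continuous_on_compose2[OF contg[of UNIV]])
  have "(g has_integral (LINT x|lborel. g x)) UNIV" using intg by (rule has_integral_integral_lborel)
  have I: "I X = (\<Sum>d\<in>X. integral {of_int d..of_int d + 1} g)" if "finite X" for X
  proof -
    have "((\<lambda>x. \<Sum>d\<in>X. g (x + of_int d)) has_integral (\<Sum>d\<in>X. integral {of_int d..of_int d + 1} g)) {0..1}"
    proof (rule has_integral_sum[OF that])
      fix d :: int
      have "(g has_integral integral {of_int d..of_int d + 1} g) {of_int d..of_int d + 1}"
        by (intro integrable_integral integrable_continuous_interval contg)
      then show "((\<lambda>x. g (x + of_int d)) has_integral integral {of_int d..of_int d + 1} g) {0..1}"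
        using has_integral_shift_real_ivl[of g _ "of_int d" "of_int d + 1" "of_int d"] by simp
    qed
    with IJ(1) show ?thesis by (rule has_integral_unique)
  qed
  have "((\<lambda>d. integral {of_int d..of_int d + 1} g) has_sum J) UNIV"
    unfolding has_sum_def by (rule Lim_transform_eventually[OF IJ(3)])
      (auto simp: I eventually_finite_subsets_at_top)
  from has_sum_int_imp_sums[OF this]
  have lim1: "(\<lambda>M. \<Sum>d\<in>{- int M..<int M}. integral {of_int d..of_int d + 1} g) \<longlonglongrightarrow> J" .
  have sumI: "(\<Sum>d\<in>{- int M..<int M}. integral {of_int d..of_int d + 1} g) = integral {- real M..real M} g" for M
  proof (induction M)
    case (Suc M)
    have gi: "g integrable_on {a..b}" for a b by (intro integrable_continuous_interval contg)
    have "{- int (Suc M)..<int (Suc M)} = insert (int M) (insert (- int M - 1) {- int M..<int M})" by auto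
    then have "(\<Sum>d\<in>{- int (Suc M)..<int (Suc M)}. integral {of_int d..of_int d + 1} g) =
       integral {real M..real M + 1} g + (integral {- real M - 1..- real M} g + integral {- real M..real M} g)"
      using Suc by simp
    also have "integral {- real M - 1..- real M} g + integral {- real M..real M} g = integral {- real M - 1..real M} g"
      by (rule Henstock_Kurzweil_Integration.integral_combine[OF _ _ gi]) auto
    also have "integral {real M..real M + 1} g + integral {- real M - 1..real M} g = integral {- real M - 1..real M + 1} g"
      by (subst add.commute, rule Henstock_Kurzweil_Integration.integral_combine[OF _ _ gi]) auto
    finally have "(\<Sum>d\<in>{- int (Suc M)..<int (Suc M)}. integral {of_int d..of_int d + 1} g) = integral {- real M - 1..real M + 1} g" .
    moreover have "- real (Suc M) = - real M - 1" "real (Suc M) = real M + 1" by simp_all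
    ultimately show ?case by (simp only:)
  qed simp
  have "(\<lambda>M. LINT x|lborel. indicator {- real M..real M} x *\<^sub>R g x) \<longlonglongrightarrow> (LINT x|lborel. g x)"
  proof (rule integral_dominated_convergence)
    show "integrable lborel (\<lambda>x. norm (g x))" using intg by (rule integrable_norm)
    show "AE x in lborel. (\<lambda>M. indicator {- real M..real M} x *\<^sub>R g x) \<longlonglongrightarrow> g x"
    proof (intro AE_I2 tendsto_eventually)
      fix x :: real
      show "\<forall>\<^sub>F M in sequentially. indicator {- real M..real M} x *\<^sub>R g x = g x"
        using eventually_ge_at_top[of "nat \<lceil>\<bar>x\<bar>\<rceil>"]
      proof eventually_elim
        case (elim M)
        then have "\<bar>x\<bar> \<le> real M" by linarith
        then show ?case by (auto simp: indicator_def abs_le_iff)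
      qed
    qed
  qed (use intg in \<open>auto simp: indicator_def intro!: borel_measurable_integrable\<close>)
  moreover have "(LINT x|lborel. indicator {- real M..real M} x *\<^sub>R g x) = integral {- real M..real M} g" for M
  proof -
    have "set_integrable lborel {- real M..real M} g"
      unfolding set_integrable_def using integrable_mult_indicator[OF _ intg, of "{- real M..real M}"] by simp
    from set_borel_integral_eq_integral(2)[OF this] show ?thesis by (simp add: set_lebesgue_integral_def)
  qed
  ultimately have "J = (LINT x|lborel. g x)" using lim1 unfolding sumI by (intro LIMSEQ_unique) auto
  with IJ(2) show ?thesis by (simp add: g_def integral_unique)
qed

lemma poisson_summation:
  assumes coeff: "(\<lambda>n::int. LINT x|lborel. f x * cis (- (2 * pi * of_int n * x))) summable_on UNIV"
  shows "(\<Sum>\<^sub>\<infinity>d::int. f (of_int d)) = (\<Sum>\<^sub>\<infinity>n::int. LINT x|lborel. f x * cis (- (2 * pi * of_int n * x)))"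
proof -
  let ?c = "\<lambda>n::int. LINT x|lborel. f x * cis (- (2 * pi * of_int n * x))"
  obtain D where "(S has_vector_derivative D) (at 0)" using derivative_S by blast
  from fourier_series_at_0[OF continuous_S periodic_S this]
  have 1: "(\<lambda>M. \<Sum>n = - int M..int M. ?c n) \<longlonglongrightarrow> S 0" by (simp add: coefficient_S)
  have "filterlim (\<lambda>M. {- int M..int M}) (finite_subsets_at_top UNIV) sequentially"
    unfolding filterlim_finite_subsets_at_top
  proof (intro allI impI)
    fix X :: "int set" assume "finite X \<and> X \<subseteq> UNIV"
    then obtain N where N: "\<And>x. x \<in> X \<Longrightarrow> \<bar>x\<bar> \<le> N"
      using finite_imageI[of X abs] by (metis Max_ge imageI)
    show "\<forall>\<^sub>F y in sequentially. finite {- int y..int y} \<and> X \<subseteq> {- int y..int y} \<and> {- int y..int y} \<subseteq> UNIV"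
      using eventually_ge_at_top[of "nat N + 1"] by eventually_elim (auto dest!: N)
  qed
  with has_sum_infsum[OF coeff] have "(\<lambda>M. \<Sum>n = - int M..int M. ?c n) \<longlonglongrightarrow> infsum ?c UNIV"
    unfolding has_sum_def by (rule filterlim_compose)
  with 1 have "S 0 = infsum ?c UNIV" by (rule LIMSEQ_unique)
  then show ?thesis by (simp add: S_def)
qed

end

subsection \<open>The kernel \<open>\<phi>\<close>\<close>

text \<open>The source is the inequality \<open>(1 + x / m) ^ m \<le> exp x\<close>; the constant
  \<open>c\<close> is chosen so that \<open>c * (1 + q) \<le> 1 + s * q / m\<close>.\<close>

lemma exp_power_decay:
  fixes s :: real
  assumes "s > 0"
  obtains K where "K > 0" "\<And>q. q \<ge> 0 \<Longrightarrow> exp (- (s * q)) \<le> K / (1 + q) ^ m"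
proof (cases "m = 0")
  case True
  show ?thesis by (rule that[of 1]) (use True assms in auto)
next
  case False
  define c where "c = min 1 (s / m)"
  have c: "c > 0" "c \<le> 1" "c \<le> s / m" using assms False by (auto simp: c_def)
  show ?thesis
  proof (rule that[of "1 / c ^ m"])
    fix q :: real assume q: "q \<ge> 0"
    have "c + c * q \<le> 1 + s / m * q" using c q by (intro add_mono mult_right_mono) auto
    then have "(c * (1 + q)) ^ m \<le> (1 + s * q / m) ^ m"
      using c q by (intro power_mono) (auto simp: algebra_simps)
    also have "\<dots> \<le> exp (s * q)"
      using assms q False by (intro exp_ge_one_plus_x_over_n_power_n) (auto intro: order.trans[of _ 0])
    finally have "c ^ m * (1 + q) ^ m \<le> exp (s * q)" by (simp add: power_mult_distrib)
    moreover have "(1 + q) ^ m > 0" "c ^ m > 0" using q c by auto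
    ultimately show "exp (- (s * q)) \<le> 1 / c ^ m / (1 + q) ^ m"
      by (simp add: exp_minus divide_simps)
  qed (use c in auto)
qed

lemma gauss_poly_decay:
  fixes u :: real
  assumes "u > 0"
  obtains K where "K > 0" "\<And>x. \<bar>x\<bar> ^ p * exp (- (pi * u * x\<^sup>2)) \<le> K / (1 + x\<^sup>2)"
proof -
  obtain K where K: "K > 0" "\<And>q. q \<ge> 0 \<Longrightarrow> exp (- (pi * u * q)) \<le> K / (1 + q) ^ (p + 1)"
    using exp_power_decay[of "pi * u" "p + 1"] assms by auto
  show ?thesis
  proof (rule that[OF K(1)])
    fix x :: real
    have "\<bar>x\<bar> \<le> 1 + x\<^sup>2"
    proof (cases "\<bar>x\<bar> \<le> 1")
      case False
      then have "\<bar>x\<bar> ^ 1 \<le> \<bar>x\<bar>\<^sup>2" by (intro power_increasing) auto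
      then show ?thesis by simp
    qed (simp add: add_increasing2)
    then have "\<bar>x\<bar> ^ p \<le> (1 + x\<^sup>2) ^ p" by (intro power_mono) auto
    then have "\<bar>x\<bar> ^ p * exp (- (pi * u * x\<^sup>2)) \<le> (1 + x\<^sup>2) ^ p * (K / (1 + x\<^sup>2) ^ (p + 1))"
      using K(1) by (intro mult_mono K(2)) auto
    also have "\<dots> = K / (1 + x\<^sup>2)" by (simp add: divide_simps add_nonneg_eq_0_iff)
    finally show "\<bar>x\<bar> ^ p * exp (- (pi * u * x\<^sup>2)) \<le> K / (1 + x\<^sup>2)" .
  qed
qed

text \<open>The characteristic function of the standard normal distribution, rescaled by
  \<open>c = sqrt (2 * pi * u)\<close> so that the exponent \<open>x^2 / 2\<close> becomes
  \<open>pi * u * x^2\<close>.\<close>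

lemma fourier_gauss:
  fixes u t :: real
  assumes u: "u > 0"
  shows "(LINT x|lborel. complex_of_real (exp (- (pi * u * x\<^sup>2))) * cis (- (2 * pi * t * x)))
       = of_real (exp (- (pi * t\<^sup>2 / u)) / sqrt u)"
proof -
  define c where "c = sqrt (2 * pi * u)"
  have c: "c > 0" "c\<^sup>2 = 2 * pi * u" using u by (auto simp: c_def)
  define s where "s = - 2 * pi * t / c"
  have "complex_of_real (exp (- (s\<^sup>2) / 2)) = char std_normal_distribution s"
    by (simp add: char_std_normal_distribution)
  also have "\<dots> = (LINT x|lborel. std_normal_density x *\<^sub>R iexp (s * x))"
    unfolding char_def by (subst integral_density) (auto simp: normal_density_nonneg)
  also have "\<dots> = \<bar>c\<bar> *\<^sub>R (LINT x|lborel. std_normal_density (0 + c * x) *\<^sub>R iexp (s * (0 + c * x)))"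
    by (rule lborel_integral_real_affine) (use c in auto)
  also have "(\<lambda>x. std_normal_density (0 + c * x) *\<^sub>R iexp (s * (0 + c * x))) =
      (\<lambda>x. of_real (1 / sqrt (2 * pi)) * (complex_of_real (exp (- (pi * u * x\<^sup>2))) * cis (- (2 * pi * t * x))))"
  proof
    fix x
    have "s * (c * x) = - (2 * pi * t * x)" using c by (simp add: s_def)
    moreover have "(c * x)\<^sup>2 / 2 = pi * u * x\<^sup>2" using c(2) by (simp add: power_mult_distrib)
    ultimately show "std_normal_density (0 + c * x) *\<^sub>R iexp (s * (0 + c * x)) =
      of_real (1 / sqrt (2 * pi)) * (complex_of_real (exp (- (pi * u * x\<^sup>2))) * cis (- (2 * pi * t * x)))"
      by (simp add: std_normal_density_def cis_conv_exp scaleR_conv_of_real)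
  qed
  finally have "complex_of_real (exp (- (s\<^sup>2) / 2)) = of_real (\<bar>c\<bar> / sqrt (2 * pi)) *
     (LINT x|lborel. complex_of_real (exp (- (pi * u * x\<^sup>2))) * cis (- (2 * pi * t * x)))"
    by (simp add: scaleR_conv_of_real)
  moreover have "\<bar>c\<bar> / sqrt (2 * pi) = sqrt u" using u by (simp add: c_def real_sqrt_mult)
  moreover have "- (s\<^sup>2) / 2 = - (pi * t\<^sup>2 / u)"
    using c u by (simp add: s_def power_divide power_mult_distrib) (simp add: field_simps power2_eq_square)
  moreover have "sqrt u > 0" using u by simp
  ultimately show ?thesis by (simp add: field_simps)
qed

text \<open>This is the negative of (1 + 2 q d/dq) applied to exp(-\<pi> q). In terms of q = u x^2
  it is the negative derivative of x exp(-\<pi> u x^2) with respect to x, which makes its Fourier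
  transform accessible.\<close>

definition phi :: "real \<Rightarrow> real" where
  "phi q = (2 * pi * q - 1) * exp (- (pi * q))"

lemma has_vector_derivative_cis:
  "((\<lambda>x. cis (c * x)) has_vector_derivative \<i> * of_real c * cis (c * x)) (at x within A)"
proof -
  have "((\<lambda>z. exp (\<i> * of_real c * z)) has_field_derivative \<i> * of_real c * exp (\<i> * of_real c * of_real x)) (at (of_real x))"
    by (auto intro!: derivative_eq_intros)
  from has_vector_derivative_real_field[OF this, of A] show ?thesis
    by (simp add: cis_conv_exp mult.assoc)
qed

text \<open>A suitable combination \<open>h\<close> of this integrand with the Gaussian one is the
  derivative of a function \<open>G\<close> that vanishes at both ends. Its integral is 0, and the
  transform of \<open>phi\<close> becomes a multiple of the Gaussian transform.\<close>

lemma fourier_phi: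
  fixes u t :: real
  assumes u: "u > 0"
  shows "(LINT x|lborel. complex_of_real (phi (u * x\<^sup>2)) * cis (- (2 * pi * t * x)))
       = of_real (- (2 * pi * t\<^sup>2 / u) * exp (- (pi * t\<^sup>2 / u)) / sqrt u)"
proof -
  \<comment> \<open>The part with \<open>- x\<close> is an antiderivative of the \<open>phi\<close>
    term up to the derivative of the exponential; the summand \<open>\<i> * t / u\<close> cancels
    that derivative and leaves a multiple of the Gaussian.\<close>
  define G where "G = (\<lambda>x. (\<i> * t / u - of_real x) * (complex_of_real (exp (- (pi * u * x\<^sup>2))) * cis (- (2 * pi * t * x))))"
  define h where "h = (\<lambda>x. complex_of_real (phi (u * x\<^sup>2)) * cis (- (2 * pi * t * x))
     + of_real (2 * pi * t\<^sup>2 / u) * (complex_of_real (exp (- (pi * u * x\<^sup>2))) * cis (- (2 * pi * t * x))))"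
  obtain K0 where K0: "K0 > 0" "\<And>x. \<bar>x\<bar> ^ 0 * exp (- (pi * u * x\<^sup>2)) \<le> K0 / (1 + x\<^sup>2)" using gauss_poly_decay[OF u, of 0] by blast
  obtain K1 where K1: "K1 > 0" "\<And>x. \<bar>x\<bar> ^ 1 * exp (- (pi * u * x\<^sup>2)) \<le> K1 / (1 + x\<^sup>2)" using gauss_poly_decay[OF u, of 1] by blast
  obtain K2 where K2: "K2 > 0" "\<And>x. \<bar>x\<bar> ^ 2 * exp (- (pi * u * x\<^sup>2)) \<le> K2 / (1 + x\<^sup>2)" using gauss_poly_decay[OF u, of 2] by blast
  have dG: "(G has_vector_derivative h x) (at x)" for x
  proof -
    have 1: "((\<lambda>x. complex_of_real (exp (- (pi * u * x\<^sup>2)))) has_vector_derivative of_real (- (2 * pi * u * x) * exp (- (pi * u * x\<^sup>2)))) (at x)"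
      by (rule has_vector_derivative_of_real) (auto intro!: derivative_eq_intros simp: has_real_derivative_iff_has_vector_derivative[symmetric])
    have 2: "((\<lambda>x. cis (- (2 * pi * t * x))) has_vector_derivative \<i> * of_real (- (2 * pi * t)) * cis (- (2 * pi * t * x))) (at x)"
      using has_vector_derivative_cis[of "- (2 * pi * t)" x UNIV] by simp
    have 3: "((\<lambda>x. \<i> * t / u - of_real x) has_vector_derivative - 1) (at x)"
      by (auto intro!: derivative_eq_intros)
    show ?thesis
      unfolding G_def
      by (rule has_vector_derivative_eq_rhs[OF has_vector_derivative_mult[OF 3 has_vector_derivative_mult[OF 1 2]]])
        (use u in \<open>simp add: h_def phi_def field_simps power2_eq_square\<close>)
  qed
  have i1: "integrable lborel (\<lambda>x. complex_of_real (exp (- (pi * u * x\<^sup>2))) * cis (- (2 * pi * t * x)))"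
    by (rule integrable_quadratic_decay[of _ K0]) (use K0(2) in \<open>auto simp: norm_mult intro!: continuous_intros\<close>)
  have i2: "integrable lborel (\<lambda>x. complex_of_real (phi (u * x\<^sup>2)) * cis (- (2 * pi * t * x)))"
  proof (rule integrable_quadratic_decay[of _ "2 * pi * u * K2 + K0"])
    show "continuous_on UNIV (\<lambda>x. complex_of_real (phi (u * x\<^sup>2)) * cis (- (2 * pi * t * x)))"
      unfolding phi_def by (intro continuous_intros)
    fix x :: real
    have "\<bar>phi (u * x\<^sup>2)\<bar> \<le> 2 * pi * u * (\<bar>x\<bar> ^ 2 * exp (- (pi * u * x\<^sup>2))) + \<bar>x\<bar> ^ 0 * exp (- (pi * u * x\<^sup>2))"
    proof -
      have "\<bar>2 * pi * (u * x\<^sup>2) - 1\<bar> \<le> 2 * pi * (u * x\<^sup>2) + 1" using u by (simp add: abs_le_iff)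
      then have "\<bar>phi (u * x\<^sup>2)\<bar> \<le> (2 * pi * (u * x\<^sup>2) + 1) * exp (- (pi * (u * x\<^sup>2)))"
        unfolding phi_def abs_mult by (intro mult_mono) auto
      then show ?thesis by (simp add: algebra_simps)
    qed
    also have "\<dots> \<le> 2 * pi * u * (K2 / (1 + x\<^sup>2)) + K0 / (1 + x\<^sup>2)"
      using u by (intro add_mono mult_left_mono K2 K0) auto
    finally show "norm (complex_of_real (phi (u * x\<^sup>2)) * cis (- (2 * pi * t * x))) \<le> (2 * pi * u * K2 + K0) / (1 + x\<^sup>2)"
      by (simp add: norm_mult add_divide_distrib)
  qed
  have ih: "integrable lborel h" unfolding h_def by (intro Bochner_Integration.integrable_add integrable_mult_right i1 i2)
  have "continuous_on UNIV h"
    unfolding h_def phi_def by (intro continuous_intros)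
  then have conth: "isCont h x" for x by (simp add: continuous_on_eq_continuous_at)
  have Gbound: "norm (G x) \<le> (\<bar>t / u\<bar> * K0 + K1) * (1 / (1 + x\<^sup>2))" for x
  proof -
    have "norm (\<i> * t / u - of_real x) \<le> \<bar>t / u\<bar> + \<bar>x\<bar>"
      by (rule order.trans[OF norm_triangle_ineq4]) (simp add: norm_mult norm_divide)
    then have "norm (G x) \<le> (\<bar>t / u\<bar> + \<bar>x\<bar>) * exp (- (pi * u * x\<^sup>2))"
      by (simp add: G_def norm_mult mult_right_mono)
    also have "\<dots> = \<bar>t / u\<bar> * (\<bar>x\<bar> ^ 0 * exp (- (pi * u * x\<^sup>2))) + \<bar>x\<bar> ^ 1 * exp (- (pi * u * x\<^sup>2))" by (simp add: algebra_simps)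
    also have "\<dots> \<le> \<bar>t / u\<bar> * (K0 / (1 + x\<^sup>2)) + K1 / (1 + x\<^sup>2)"
      by (intro add_mono mult_left_mono K0 K1) auto
    finally show ?thesis by (simp add: algebra_simps add_divide_distrib)
  qed
  have lim_inf: "(G \<longlongrightarrow> 0) F" if "filterlim (\<lambda>x::real. 1 + x\<^sup>2) at_top F" for F
  proof (rule Lim_null_comparison[OF always_eventually])
    have "((\<lambda>x. (\<bar>t / u\<bar> * K0 + K1) / (1 + x\<^sup>2)) \<longlongrightarrow> 0) F"
      by (intro real_tendsto_divide_at_top[OF tendsto_const that])
    then show "((\<lambda>x. (\<bar>t / u\<bar> * K0 + K1) * (1 / (1 + x\<^sup>2))) \<longlongrightarrow> 0) F" by simp
  qed (use Gbound in auto)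
  have "(LBINT x=-\<infinity>..\<infinity>. h x) = 0 - 0"
  proof (rule interval_integral_FTC_integrable[where F = G])
    show "(G has_vector_derivative h x) (at x)" for x by (rule dG)
    show "set_integrable lborel (einterval (- \<infinity>) \<infinity>) h" using ih by (simp add: set_integrable_def)
    have "filterlim (\<lambda>x::real. 1 + x\<^sup>2) at_top at_bot" "filterlim (\<lambda>x::real. 1 + x\<^sup>2) at_top at_top" by real_asymp+
    from this[THEN lim_inf] show "((G \<circ> real_of_ereal) \<longlongrightarrow> 0) (at_right (- \<infinity>))" "((G \<circ> real_of_ereal) \<longlongrightarrow> 0) (at_left \<infinity>)"
      by (simp_all add: ereal_tendsto_simps)
  qed (use conth in auto)
  then have "(LINT x|lborel. h x) = 0"
    by (simp add: interval_lebesgue_integral_def set_lebesgue_integral_def)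
  then have "(LINT x|lborel. complex_of_real (phi (u * x\<^sup>2)) * cis (- (2 * pi * t * x)))
     + of_real (2 * pi * t\<^sup>2 / u) * (LINT x|lborel. complex_of_real (exp (- (pi * u * x\<^sup>2))) * cis (- (2 * pi * t * x))) = 0"
    unfolding h_def
    by (subst (asm) Bochner_Integration.integral_add[OF i2 integrable_mult_right[OF i1]]) simp
  then have "(LINT x|lborel. complex_of_real (phi (u * x\<^sup>2)) * cis (- (2 * pi * t * x)))
     = - (of_real (2 * pi * t\<^sup>2 / u) * of_real (exp (- (pi * t\<^sup>2 / u)) / sqrt u))"
    unfolding fourier_gauss[OF u] by (simp only: eq_neg_iff_add_eq_0)
  then show ?thesis by simp
qed

lemma summable_on_inverse_1_plus_square_prod:
  "(\<lambda>(c::int, d::int). 1 / (1 + (real_of_int c)\<^sup>2) * (1 / (1 + (real_of_int d)\<^sup>2))) summable_on UNIV"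
proof -
  have "(\<lambda>(c::int, d::int). 1 / (1 + (real_of_int c)\<^sup>2) * (1 / (1 + (real_of_int d)\<^sup>2))) summable_on (SIGMA c:UNIV. UNIV)"
  proof (rule summable_on_SigmaI)
    let ?X = "\<Sum>\<^sub>\<infinity>d::int. 1 / (1 + (real_of_int d)\<^sup>2)"
    show "((\<lambda>d. (\<lambda>(c::int, d::int). 1 / (1 + (real_of_int c)\<^sup>2) * (1 / (1 + (real_of_int d)\<^sup>2))) (c, d)) has_sum
        1 / (1 + (real_of_int c)\<^sup>2) * ?X) UNIV" for c
      by (simp only: prod.case) (intro has_sum_cmult_right has_sum_infsum abs_summable_inverse_1_plus_square_int)
    show "(\<lambda>c::int. 1 / (1 + (real_of_int c)\<^sup>2) * ?X) summable_on UNIV"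
      by (intro summable_on_cmult_left abs_summable_inverse_1_plus_square_int)
  qed auto
  then show ?thesis by simp
qed

text \<open>Since (1 + c^2)(1 + d^2) is at most (1 + c^2 + d^2)^2, decay of order 2 in a positive
  definite form is dominated by a product of two convergent one-dimensional sums.\<close>

lemma summable_on_quadratic_prod:
  fixes F :: "int \<times> int \<Rightarrow> 'a::banach" and q :: "int \<Rightarrow> int \<Rightarrow> real"
  assumes L: "L > 0" "\<And>c d. 1 + (of_int c)\<^sup>2 + (of_int d)\<^sup>2 \<le> L * (1 + q c d)"
    and F: "\<And>c d. norm (F (c, d)) \<le> K / (1 + q c d) ^ 2"
  shows "(\<lambda>p. norm (F p)) summable_on UNIV"
proof (rule summable_on_comparison_test)
  show "(\<lambda>(c::int, d::int). K * L\<^sup>2 * (1 / (1 + (real_of_int c)\<^sup>2) * (1 / (1 + (real_of_int d)\<^sup>2)))) summable_on UNIV"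
    using summable_on_cmult_right[OF summable_on_inverse_1_plus_square_prod, of "K * L\<^sup>2"]
    by (simp add: case_prod_unfold)
  fix p :: "int \<times> int"
  obtain c d where p: "p = (c, d)" by force
  have pos: "1 + q c d > 0"
  proof -
    have "0 < 1 + (real_of_int c)\<^sup>2 + (real_of_int d)\<^sup>2" by (simp add: add_pos_nonneg)
    also have "\<dots> \<le> L * (1 + q c d)" by (rule L)
    finally show ?thesis using L(1) by (simp add: zero_less_mult_iff)
  qed
  have K: "K \<ge> 0"
  proof -
    have "0 \<le> K / (1 + q c d) ^ 2" using order.trans[OF norm_ge_zero F] .
    then show ?thesis using pos by (simp add: zero_le_divide_iff)
  qed
  have "(1 + (of_int c)\<^sup>2) * (1 + (of_int d)\<^sup>2) \<le> (1 + (real_of_int c)\<^sup>2 + (real_of_int d)\<^sup>2)\<^sup>2"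
  proof -
    have "(1 + x) * (1 + y) \<le> (1 + x + y)\<^sup>2" if "x \<ge> 0" "y \<ge> 0" for x y :: real
    proof -
      have "0 \<le> x * y" "0 \<le> x * x" "0 \<le> y * y" using that by auto
      then show ?thesis using that by (simp add: power2_eq_square algebra_simps)
    qed
    then show ?thesis by simp
  qed
  also have "\<dots> \<le> (L * (1 + q c d))\<^sup>2" by (intro power_mono L) auto
  finally have "(1 + (of_int c)\<^sup>2) * (1 + (of_int d)\<^sup>2) \<le> L\<^sup>2 * (1 + q c d)\<^sup>2" by (simp add: power_mult_distrib)
  moreover have "(1 + (real_of_int c)\<^sup>2) > 0" "(1 + (real_of_int d)\<^sup>2) > 0" by (simp_all add: add_pos_nonneg)
  ultimately have "1 / (1 + q c d) ^ 2 \<le> L\<^sup>2 * (1 / (1 + (of_int c)\<^sup>2) * (1 / (1 + (of_int d)\<^sup>2)))"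
    using pos by (simp add: divide_simps mult.commute)
  then have "K * (1 / (1 + q c d) ^ 2) \<le> K * (L\<^sup>2 * (1 / (1 + (of_int c)\<^sup>2) * (1 / (1 + (of_int d)\<^sup>2))))"
    by (rule mult_left_mono[OF _ K])
  with F[of c d] show "norm (F p) \<le> (case p of (c, d) \<Rightarrow> K * L\<^sup>2 * (1 / (1 + (real_of_int c)\<^sup>2) * (1 / (1 + (real_of_int d)\<^sup>2))))"
    by (simp add: p mult.assoc)
qed simp

lemma phi_decay:
  obtains K where "K > 0" "\<And>q. q \<ge> 0 \<Longrightarrow> \<bar>phi q\<bar> \<le> K / (1 + q) ^ 2"
proof -
  obtain K where K: "K > 0" "\<And>q. q \<ge> 0 \<Longrightarrow> exp (- (pi * q)) \<le> K / (1 + q) ^ 3"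
    using exp_power_decay[of pi 3] by auto
  show ?thesis
  proof (rule that[of "2 * pi * K"])
    fix q :: real assume q: "q \<ge> 0"
    have "1 \<le> 2 * pi" using pi_gt3 by simp
    moreover have "0 \<le> 2 * pi * q" using q by simp
    ultimately have "\<bar>2 * pi * q - 1\<bar> \<le> 2 * pi * (1 + q)" by (simp add: abs_le_iff algebra_simps)
    then have "\<bar>phi q\<bar> \<le> 2 * pi * (1 + q) * (K / (1 + q) ^ 3)"
      unfolding phi_def abs_mult using K(2)[OF q] by (intro mult_mono) auto
    also have "\<dots> = 2 * pi * K / (1 + q) ^ 2" using q by (simp add: power3_eq_cube power2_eq_square)
    finally show "\<bar>phi q\<bar> \<le> 2 * pi * K / (1 + q) ^ 2" .
  qed (use K in auto)
qed

text \<open>The shift \<open>a\<close> will be the real part of \<open>c * \<tau>\<close>; it only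
  multiplies the Fourier coefficients by numbers of modulus 1.\<close>

lemma poisson_summation_shift:
  fixes f f' :: "real \<Rightarrow> complex"
  assumes deriv: "\<And>x. (f has_vector_derivative f' x) (at x)"
    and bound: "\<And>x. norm (f x) \<le> K / (1 + x\<^sup>2)"
    and bound': "\<And>x. norm (f' x) \<le> K / (1 + x\<^sup>2)"
    and coeff: "\<And>n::int. (LINT x|lborel. f x * cis (- (2 * pi * of_int n * x))) = c n"
    and summ: "(\<lambda>n. norm (c n)) summable_on UNIV"
  shows "(\<Sum>\<^sub>\<infinity>d::int. f (of_int d + a)) = (\<Sum>\<^sub>\<infinity>n::int. c n * cis (2 * pi * of_int n * a))"
proof -
  have K: "K \<ge> 0" using bound[of 0] by (auto intro: order.trans[OF norm_ge_zero])
  have contf: "continuous_on UNIV f"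
    using deriv by (intro continuous_on_vector_derivative) (auto intro: has_vector_derivative_at_within)
  have c: "(LINT x|lborel. f (x + a) * cis (- (2 * pi * of_int n * x))) = c n * cis (2 * pi * of_int n * a)" for n
  proof -
    have "(LINT x|lborel. f (x + a) * cis (- (2 * pi * of_int n * x))) =
      \<bar>1\<bar> *\<^sub>R (LINT x|lborel. f ((- a + 1 * x) + a) * cis (- (2 * pi * of_int n * (- a + 1 * x))))"
      by (rule lborel_integral_real_affine) auto
    also have "\<dots> = (LINT x|lborel. (f x * cis (- (2 * pi * of_int n * x))) * cis (2 * pi * of_int n * a))"
      by (simp add: cis_mult algebra_simps)
    also have "\<dots> = c n * cis (2 * pi * of_int n * a)" by (simp add: coeff)
    finally show ?thesis .
  qed
  have bd: "norm (h (x + a)) \<le> K * (2 * (1 + a\<^sup>2)) / (1 + x\<^sup>2)" if "\<And>x. norm (h x) \<le> K / (1 + x\<^sup>2)" for h :: "real \<Rightarrow> complex" and x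
    using order.trans[OF that[of "x + a"]] mult_left_mono[OF one_plus_square_shift_le[of a "\<bar>a\<bar>" x] K]
    by (simp add: add.commute)
  have "(\<Sum>\<^sub>\<infinity>d::int. f (of_int d + a)) = (\<Sum>\<^sub>\<infinity>n::int. LINT x|lborel. f (x + a) * cis (- (2 * pi * of_int n * x)))"
  proof (rule poisson_summation[where f = "\<lambda>x. f (x + a)" and f' = "\<lambda>x. f' (x + a)"])
    fix x
    have "((\<lambda>x. x + a) has_vector_derivative 1) (at x)" by (auto intro!: derivative_eq_intros)
    from vector_diff_chain_at[OF this deriv]
    show "((\<lambda>x. f (x + a)) has_vector_derivative f' (x + a)) (at x)" by (simp add: o_def)
    show "norm (f (x + a)) \<le> K * (2 * (1 + a\<^sup>2)) / (1 + x\<^sup>2)" "norm (f' (x + a)) \<le> K * (2 * (1 + a\<^sup>2)) / (1 + x\<^sup>2)"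
      using bd bound bound' by auto
    show "(\<lambda>n::int. LINT x|lborel. f (x + a) * cis (- (2 * pi * of_int n * x))) summable_on UNIV"
      unfolding c by (rule abs_summable_summable) (use summ in \<open>simp add: norm_mult\<close>)
  qed
  then show ?thesis by (simp add: c)
qed

lemma summable_on_poly_gauss:
  assumes "u > 0"
  shows "(\<lambda>n::int. \<bar>of_int n\<bar> ^ p * exp (- (pi * u * (of_int n)\<^sup>2))) summable_on UNIV"
proof -
  obtain K where K: "K > 0" "\<And>x. \<bar>x\<bar> ^ p * exp (- (pi * u * x\<^sup>2)) \<le> K / (1 + x\<^sup>2)" using gauss_poly_decay[OF assms, of p] by blast
  show ?thesis
    by (rule summable_on_comparison_test[OF summable_on_cmult_right[OF abs_summable_inverse_1_plus_square_int, of K]])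
      (use K in auto)
qed

lemma gauss_poisson:
  fixes u :: real
  assumes u: "u > 0"
  shows "(\<Sum>\<^sub>\<infinity>d::int. complex_of_real (exp (- (pi * u * (of_int d + a)\<^sup>2)))) =
     (\<Sum>\<^sub>\<infinity>n::int. complex_of_real (exp (- (pi * (of_int n)\<^sup>2 / u)) / sqrt u) * cis (2 * pi * of_int n * a))"
proof -
  obtain K0 where K0: "K0 > 0" "\<And>x. \<bar>x\<bar> ^ 0 * exp (- (pi * u * x\<^sup>2)) \<le> K0 / (1 + x\<^sup>2)" using gauss_poly_decay[OF u, of 0] by blast
  obtain K1 where K1: "K1 > 0" "\<And>x. \<bar>x\<bar> ^ 1 * exp (- (pi * u * x\<^sup>2)) \<le> K1 / (1 + x\<^sup>2)" using gauss_poly_decay[OF u, of 1] by blast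
  show ?thesis
  proof (rule poisson_summation_shift[where K = "K0 + 2 * pi * u * K1" and f = "\<lambda>x. complex_of_real (exp (- (pi * u * x\<^sup>2)))"
        and f' = "\<lambda>x. of_real (- (2 * pi * u * x) * exp (- (pi * u * x\<^sup>2)))"])
    fix x :: real
    show "((\<lambda>x. complex_of_real (exp (- (pi * u * x\<^sup>2)))) has_vector_derivative of_real (- (2 * pi * u * x) * exp (- (pi * u * x\<^sup>2)))) (at x)"
      by (rule has_vector_derivative_of_real) (auto intro!: derivative_eq_intros simp: has_real_derivative_iff_has_vector_derivative[symmetric])
    have "exp (- (pi * u * x\<^sup>2)) + 0 \<le> K0 / (1 + x\<^sup>2) + 2 * pi * u * (K1 / (1 + x\<^sup>2))"
      using K0(2)[of x] u K1(1) by (intro add_mono) auto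
    then show "norm (complex_of_real (exp (- (pi * u * x\<^sup>2)))) \<le> (K0 + 2 * pi * u * K1) / (1 + x\<^sup>2)"
      by (simp add: add_divide_distrib)
    have "0 + 2 * pi * u * (\<bar>x\<bar> ^ 1 * exp (- (pi * u * x\<^sup>2))) \<le> K0 / (1 + x\<^sup>2) + 2 * pi * u * (K1 / (1 + x\<^sup>2))"
      using u K0(1) by (intro add_mono mult_left_mono K1) auto
    then show "norm (complex_of_real (- (2 * pi * u * x) * exp (- (pi * u * x\<^sup>2)))) \<le> (K0 + 2 * pi * u * K1) / (1 + x\<^sup>2)"
      using u by (simp only: norm_of_real abs_mult abs_minus abs_exp_cancel) (simp add: add_divide_distrib mult.assoc)
    show "(\<lambda>n::int. norm (complex_of_real (exp (- (pi * (of_int n)\<^sup>2 / u)) / sqrt u))) summable_on UNIV"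
      using summable_on_cmult_left[OF summable_on_poly_gauss[of "1 / u" 0], of "1 / sqrt u"] u
      by (simp only: norm_of_real) simp
  qed (rule fourier_gauss[OF u])
qed

lemma phi_poisson:
  fixes u :: real
  assumes u: "u > 0"
  shows "(\<Sum>\<^sub>\<infinity>d::int. complex_of_real (phi (u * (of_int d + a)\<^sup>2))) =
     (\<Sum>\<^sub>\<infinity>n::int. complex_of_real (- (2 * pi * (of_int n)\<^sup>2 / u) * exp (- (pi * (of_int n)\<^sup>2 / u)) / sqrt u) * cis (2 * pi * of_int n * a))"
proof -
  obtain K0 where K0: "K0 > 0" "\<And>x. \<bar>x\<bar> ^ 0 * exp (- (pi * u * x\<^sup>2)) \<le> K0 / (1 + x\<^sup>2)" using gauss_poly_decay[OF u, of 0] by blast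
  obtain K1 where K1: "K1 > 0" "\<And>x. \<bar>x\<bar> ^ 1 * exp (- (pi * u * x\<^sup>2)) \<le> K1 / (1 + x\<^sup>2)" using gauss_poly_decay[OF u, of 1] by blast
  obtain K2 where K2: "K2 > 0" "\<And>x. \<bar>x\<bar> ^ 2 * exp (- (pi * u * x\<^sup>2)) \<le> K2 / (1 + x\<^sup>2)" using gauss_poly_decay[OF u, of 2] by blast
  obtain K3 where K3: "K3 > 0" "\<And>x. \<bar>x\<bar> ^ 3 * exp (- (pi * u * x\<^sup>2)) \<le> K3 / (1 + x\<^sup>2)" using gauss_poly_decay[OF u, of 3] by blast
  define K where "K = K0 + 2 * pi * u * K2 + 6 * pi * u * K1 + 4 * pi\<^sup>2 * u\<^sup>2 * K3"
  have bd: "a0 * (\<bar>x\<bar> ^ 0 * exp (- (pi * u * x\<^sup>2))) + a2 * (\<bar>x\<bar> ^ 2 * exp (- (pi * u * x\<^sup>2)))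
     + a1 * (\<bar>x\<bar> ^ 1 * exp (- (pi * u * x\<^sup>2))) + a3 * (\<bar>x\<bar> ^ 3 * exp (- (pi * u * x\<^sup>2))) \<le> K / (1 + x\<^sup>2)"
    if "a0 \<in> {0..1}" "a2 \<in> {0..2 * pi * u}" "a1 \<in> {0..6 * pi * u}" "a3 \<in> {0..4 * pi\<^sup>2 * u\<^sup>2}" for a0 a1 a2 a3 x
  proof -
    have "a0 * (\<bar>x\<bar> ^ 0 * exp (- (pi * u * x\<^sup>2))) + a2 * (\<bar>x\<bar> ^ 2 * exp (- (pi * u * x\<^sup>2)))
     + a1 * (\<bar>x\<bar> ^ 1 * exp (- (pi * u * x\<^sup>2))) + a3 * (\<bar>x\<bar> ^ 3 * exp (- (pi * u * x\<^sup>2)))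
     \<le> 1 * (K0 / (1 + x\<^sup>2)) + 2 * pi * u * (K2 / (1 + x\<^sup>2)) + 6 * pi * u * (K1 / (1 + x\<^sup>2)) + 4 * pi\<^sup>2 * u\<^sup>2 * (K3 / (1 + x\<^sup>2))"
      using that by (intro add_mono mult_mono K0 K1 K2 K3) auto
    then show ?thesis by (simp add: K_def add_divide_distrib)
  qed
  show ?thesis
  proof (rule poisson_summation_shift[where K = K and f = "\<lambda>x. complex_of_real (phi (u * x\<^sup>2))"
        and f' = "\<lambda>x. of_real ((6 * pi * u * x - 4 * pi\<^sup>2 * u\<^sup>2 * x ^ 3) * exp (- (pi * u * x\<^sup>2)))"])
    fix x :: real
    show "((\<lambda>x. complex_of_real (phi (u * x\<^sup>2))) has_vector_derivative of_real ((6 * pi * u * x - 4 * pi\<^sup>2 * u\<^sup>2 * x ^ 3) * exp (- (pi * u * x\<^sup>2)))) (at x)"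
      unfolding phi_def
      by (rule has_vector_derivative_of_real)
        (auto intro!: derivative_eq_intros simp: has_real_derivative_iff_has_vector_derivative[symmetric] power2_eq_square power3_eq_cube algebra_simps)
    have "\<bar>2 * pi * (u * x\<^sup>2) - 1\<bar> \<le> 2 * pi * (u * x\<^sup>2) + 1" using u by (simp add: abs_le_iff)
    then have "\<bar>phi (u * x\<^sup>2)\<bar> \<le> (2 * pi * (u * x\<^sup>2) + 1) * exp (- (pi * (u * x\<^sup>2)))"
      unfolding phi_def abs_mult by (intro mult_mono) auto
    also have "\<dots> \<le> K / (1 + x\<^sup>2)"
      using bd[of 1 "2 * pi * u" 0 0 x] u by (simp add: algebra_simps)
    finally show "norm (complex_of_real (phi (u * x\<^sup>2))) \<le> K / (1 + x\<^sup>2)" by simp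
    have "\<bar>6 * pi * u * x - 4 * pi\<^sup>2 * u\<^sup>2 * x ^ 3\<bar> \<le> 6 * pi * u * \<bar>x\<bar> + 4 * pi\<^sup>2 * u\<^sup>2 * \<bar>x\<bar> ^ 3"
      using u by (intro order.trans[OF abs_triangle_ineq4]) (simp add: abs_mult power_abs)
    then have "\<bar>(6 * pi * u * x - 4 * pi\<^sup>2 * u\<^sup>2 * x ^ 3) * exp (- (pi * u * x\<^sup>2))\<bar> \<le> (6 * pi * u * \<bar>x\<bar> + 4 * pi\<^sup>2 * u\<^sup>2 * \<bar>x\<bar> ^ 3) * exp (- (pi * u * x\<^sup>2))"
      unfolding abs_mult by (intro mult_mono) auto
    also have "\<dots> \<le> K / (1 + x\<^sup>2)"
      using bd[of 0 0 "6 * pi * u" "4 * pi\<^sup>2 * u\<^sup>2" x] u by (simp add: algebra_simps)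
    finally show "norm (complex_of_real ((6 * pi * u * x - 4 * pi\<^sup>2 * u\<^sup>2 * x ^ 3) * exp (- (pi * u * x\<^sup>2)))) \<le> K / (1 + x\<^sup>2)"
      by (simp only: norm_of_real)
    show "(\<lambda>n::int. norm (complex_of_real (- (2 * pi * (of_int n)\<^sup>2 / u) * exp (- (pi * (of_int n)\<^sup>2 / u)) / sqrt u))) summable_on UNIV"
    proof -
      have "(\<lambda>n::int. norm (complex_of_real (- (2 * pi * (of_int n)\<^sup>2 / u) * exp (- (pi * (of_int n)\<^sup>2 / u)) / sqrt u))) =
        (\<lambda>n. (2 * pi / u / sqrt u) * (\<bar>of_int n\<bar> ^ 2 * exp (- (pi * (1 / u) * (of_int n)\<^sup>2))))"
        using u by (intro ext) (simp only: norm_of_real abs_mult abs_divide abs_minus abs_exp_cancel, simp add: power_abs)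
      then show ?thesis
        using summable_on_cmult_right[OF summable_on_poly_gauss[of "1 / u" 2], of "2 * pi / u / sqrt u"] u by (simp only: zero_less_divide_1_iff)
    qed
  qed (rule fourier_phi[OF u])
qed

subsection \<open>The lattice sum of \<open>\<phi>\<close>\<close>

text \<open>Both integers are recovered from the real part \<open>a\<close> and the imaginary part
  \<open>b\<close> of the linear form: \<open>c\<close> from \<open>b / y\<close>, then
  \<open>d\<close> as \<open>a - c * x\<close>.\<close>

lemma quadratic_form_lower_bound:
  fixes x y :: real
  assumes y: "y > 0"
  obtains L where "L > 0"
    "\<And>c d. 1 + (real_of_int c)\<^sup>2 + (real_of_int d)\<^sup>2 \<le> L * (1 + (norm (of_int c * Complex x y + of_int d))\<^sup>2 / y)"
proof (rule that[of "1 + y * (2 + (1 + 2 * x\<^sup>2) / y\<^sup>2)"])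
  show "1 + y * (2 + (1 + 2 * x\<^sup>2) / y\<^sup>2) > 0" using y by (intro add_pos_nonneg) auto
  fix c d :: int
  define Q where "Q = (norm (of_int c * Complex x y + of_int d))\<^sup>2"
  have Q: "Q = (of_int c * x + of_int d)\<^sup>2 + (of_int c * y)\<^sup>2"
    by (simp add: Q_def cmod_power2)
  define a b where "a = of_int c * x + of_int d" and "b = of_int c * y"
  have Qab: "Q = a\<^sup>2 + b\<^sup>2" by (simp add: Q a_def b_def)
  have c: "(real_of_int c)\<^sup>2 = b\<^sup>2 / y\<^sup>2" using y by (simp add: b_def power_mult_distrib)
  have d: "(real_of_int d)\<^sup>2 \<le> 2 * a\<^sup>2 + 2 * x\<^sup>2 * (b\<^sup>2 / y\<^sup>2)"
  proof -
    have "0 \<le> (a + of_int c * x)\<^sup>2" by simp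
    then have "(a - of_int c * x)\<^sup>2 \<le> 2 * a\<^sup>2 + 2 * (of_int c * x)\<^sup>2" by (simp add: power2_eq_square algebra_simps)
    then show ?thesis unfolding c[symmetric] by (simp add: a_def power_mult_distrib mult_ac)
  qed
  have "(real_of_int c)\<^sup>2 + (real_of_int d)\<^sup>2 \<le> 2 * a\<^sup>2 + (1 + 2 * x\<^sup>2) / y\<^sup>2 * b\<^sup>2"
  proof -
    have "(1 + 2 * x\<^sup>2) / y\<^sup>2 * b\<^sup>2 = b\<^sup>2 / y\<^sup>2 + 2 * x\<^sup>2 * (b\<^sup>2 / y\<^sup>2)"
      by (simp add: add_divide_distrib distrib_right)
    then show ?thesis using d c by linarith
  qed
  also have "\<dots> \<le> (2 + (1 + 2 * x\<^sup>2) / y\<^sup>2) * a\<^sup>2 + (2 + (1 + 2 * x\<^sup>2) / y\<^sup>2) * b\<^sup>2"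
    by (intro add_mono mult_right_mono) auto
  also have "\<dots> = (2 + (1 + 2 * x\<^sup>2) / y\<^sup>2) * Q" by (simp only: Qab distrib_left)
  also have "\<dots> = y * (2 + (1 + 2 * x\<^sup>2) / y\<^sup>2) * (Q / y)" using y by simp
  finally have "1 + (real_of_int c)\<^sup>2 + (real_of_int d)\<^sup>2 \<le> 1 * 1 + y * (2 + (1 + 2 * x\<^sup>2) / y\<^sup>2) * (Q / y)" by simp
  also have "\<dots> \<le> (1 + y * (2 + (1 + 2 * x\<^sup>2) / y\<^sup>2)) * 1 + (1 + y * (2 + (1 + 2 * x\<^sup>2) / y\<^sup>2)) * (Q / y)"
    using y by (intro add_mono mult_right_mono) (auto simp: Q_def)
  finally show "1 + (real_of_int c)\<^sup>2 + (real_of_int d)\<^sup>2 \<le> (1 + y * (2 + (1 + 2 * x\<^sup>2) / y\<^sup>2)) * (1 + (norm (of_int c * Complex x y + of_int d))\<^sup>2 / y)"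
    unfolding Q_def[symmetric] by (simp only: distrib_left)
qed

lemma summable_on_int_quadratic_decay:
  fixes h :: "int \<Rightarrow> 'a::banach"
  assumes "\<And>d. norm (h d) \<le> M * (1 / (1 + (of_int d)\<^sup>2))"
  shows "h summable_on UNIV"
proof (rule abs_summable_summable)
  show "(\<lambda>d. norm (h d)) summable_on UNIV"
    by (rule summable_on_comparison_test[OF summable_on_cmult_right[OF abs_summable_inverse_1_plus_square_int, of M]])
      (use assms in auto)
qed

lemma phi_lattice_summable:
  assumes "Im \<tau> > 0"
  shows "(\<lambda>(c::int, d::int). norm (phi ((norm (of_int c * \<tau> + of_int d))\<^sup>2 / Im \<tau>))) summable_on UNIV"
proof -
  obtain K where K: "K > 0" "\<And>q. q \<ge> 0 \<Longrightarrow> \<bar>phi q\<bar> \<le> K / (1 + q) ^ 2" by (rule phi_decay) blast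
  obtain L where L: "L > 0"
    "\<And>c d. 1 + (real_of_int c)\<^sup>2 + (real_of_int d)\<^sup>2 \<le> L * (1 + (norm (of_int c * \<tau> + of_int d))\<^sup>2 / Im \<tau>)"
    using quadratic_form_lower_bound[OF assms, of "Re \<tau>"] by auto
  have "(\<lambda>p. norm ((\<lambda>(c, d). phi ((norm (of_int c * \<tau> + of_int d))\<^sup>2 / Im \<tau>)) p)) summable_on (UNIV :: (int \<times> int) set)"
    by (rule summable_on_quadratic_prod[OF L, of _ K]) (use assms in \<open>auto intro!: K(2)\<close>)
  then show ?thesis by (simp add: case_prod_unfold)
qed

text \<open>After Poisson summation over \<open>d\<close> the double sum becomes antisymmetric under exchanging the
  two summation indices.\<close>

lemma phi_lattice_sum_complex:
  assumes "Im \<tau> > 0"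
  shows "(\<Sum>\<^sub>\<infinity>(c::int, d::int). complex_of_real (phi ((norm (of_int c * \<tau> + of_int d))\<^sup>2 / Im \<tau>))) = 0"
proof -
  define x y where "x = Re \<tau>" and "y = Im \<tau>"
  have y: "y > 0" using assms by (simp add: y_def)
  \<comment> \<open>The result of Poisson summation in row \<open>c\<close>. In the factor c^2 -
    n^2, the transform of \<open>phi\<close> contributes -n^2 and the Gaussian term of
    \<open>split\<close> contributes c^2; all other factors are symmetric in \<open>c\<close> and
    \<open>n\<close>.\<close>
  define G where "G = (\<lambda>(c::int) (n::int). of_real (2 * pi * (y * sqrt y) * ((of_int c)\<^sup>2 - (of_int n)\<^sup>2)
      * exp (- (pi * y * ((of_int c)\<^sup>2 + (of_int n)\<^sup>2)))) * cis (2 * pi * of_int n * (of_int c * x)))"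
  have row: "(\<Sum>\<^sub>\<infinity>d::int. complex_of_real (phi ((norm (of_int c * \<tau> + of_int d))\<^sup>2 / y))) = (\<Sum>\<^sub>\<infinity>n. G c n)" for c :: int
  proof -
    define a where "a = of_int c * x"
    define e where "e = exp (- (pi * ((of_int c)\<^sup>2 * y)))"
    have iy: "1 / y > 0" using y by simp
    have norm2: "(norm (of_int c * \<tau> + of_int d))\<^sup>2 / y = 1 / y * (of_int d + a)\<^sup>2 + (of_int c)\<^sup>2 * y" for d :: int
    proof -
      have "(norm (of_int c * \<tau> + of_int d))\<^sup>2 = (of_int d + a)\<^sup>2 + (of_int c * y)\<^sup>2"
        by (simp add: cmod_power2 a_def x_def y_def add.commute)
      moreover have "(of_int c * y)\<^sup>2 / y = (of_int c)\<^sup>2 * y" using y by (simp add: power2_eq_square)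
      ultimately show ?thesis by (simp add: add_divide_distrib)
    qed
    \<comment> \<open>\<open>phi\<close> is not multiplicative over sums: \<open>phi (q + r)\<close>
      contains a Gaussian cross term, so the Poisson formulas for \<open>phi\<close> and for the
      Gaussian are both used.\<close>
    have split: "complex_of_real (phi ((norm (of_int c * \<tau> + of_int d))\<^sup>2 / y)) =
        of_real e * (complex_of_real (phi (1 / y * (of_int d + a)\<^sup>2)) +
        of_real (2 * pi * (of_int c)\<^sup>2 * y) * complex_of_real (exp (- (pi * (1 / y) * (of_int d + a)\<^sup>2))))" for d :: int
    proof -
      have "exp (- (pi * (q + r))) = exp (- (pi * r)) * exp (- (pi * q))" for q r :: real
        by (simp only: exp_add[symmetric]) (simp add: algebra_simps)
      then have "phi (q + r) = exp (- (pi * r)) * (phi q + 2 * pi * r * exp (- (pi * q)))" for q r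
        by (simp only: phi_def) (simp only: algebra_simps)
      then show ?thesis unfolding norm2 by (simp add: e_def mult.assoc)
    qed
    have s1: "(\<lambda>d::int. complex_of_real (phi (1 / y * (of_int d + a)\<^sup>2))) summable_on UNIV"
    proof -
      obtain K where K: "K > 0" "\<And>q. q \<ge> 0 \<Longrightarrow> \<bar>phi q\<bar> \<le> K / (1 + q) ^ 2" by (rule phi_decay) blast
      have "norm (complex_of_real (phi (1 / y * (of_int d + a)\<^sup>2))) \<le> K * (1 + y) * (2 * (1 + \<bar>a\<bar>\<^sup>2) * (1 / (1 + (of_int d)\<^sup>2)))" for d :: int
      proof -
        define z where "z = (a + of_int d)\<^sup>2"
        have z: "z \<ge> 0" by (simp add: z_def)
        have "norm (complex_of_real (phi (1 / y * (of_int d + a)\<^sup>2))) \<le> K / (1 + z / y) ^ 2"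
          using K(2)[of "z / y"] z y by (simp add: z_def add.commute)
        also have "\<dots> \<le> K / (1 + z / y)"
        proof -
          have "1 + z / y \<ge> 1" using z y by simp
          then have "1 + z / y \<le> (1 + z / y) ^ 2" "1 + z / y > 0" using power_increasing[of 1 2 "1 + z / y"] by simp_all
          then show ?thesis using K(1) by (intro divide_left_mono) auto
        qed
        also have "\<dots> \<le> K * (1 + y) * (1 / (1 + z))"
        proof -
          define w where "w = z / y"
          have w: "z = y * w" "w \<ge> 0" using y z by (auto simp: w_def)
          have gen: "1 / A \<le> t * (1 / B)" if "B \<le> t * A" "A > 0" "B > 0" for A B t :: real
            using that by (simp add: field_simps)
          have "1 / (1 + w) \<le> (1 + y) * (1 / (1 + y * w))"
            by (rule gen) (use y w(2) in \<open>auto simp: algebra_simps add_pos_nonneg\<close>)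
          then have "1 / (1 + z / y) \<le> (1 + y) * (1 / (1 + z))" by (simp add: w_def[symmetric] w(1)[symmetric])
          from mult_left_mono[OF this, of K] K(1) show ?thesis by (simp add: mult.assoc)
        qed
        also have "\<dots> \<le> K * (1 + y) * (2 * (1 + \<bar>a\<bar>\<^sup>2) * (1 / (1 + (of_int d)\<^sup>2)))"
          unfolding z_def using K(1) y by (intro mult_left_mono one_plus_square_shift_le) auto
        finally show ?thesis .
      qed
      note bd = this
      show ?thesis
        by (rule summable_on_int_quadratic_decay[of _ "K * (1 + y) * (2 * (1 + \<bar>a\<bar>\<^sup>2))"]) (insert bd, simp only: mult.assoc)
    qed
    have s2: "(\<lambda>d::int. complex_of_real (exp (- (pi * (1 / y) * (of_int d + a)\<^sup>2)))) summable_on UNIV"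
    proof -
      obtain K where K: "K > 0" "\<And>x. \<bar>x\<bar> ^ 0 * exp (- (pi * (1 / y) * x\<^sup>2)) \<le> K / (1 + x\<^sup>2)"
        using gauss_poly_decay[OF iy, of 0] by blast
      have "norm (complex_of_real (exp (- (pi * (1 / y) * (of_int d + a)\<^sup>2)))) \<le> K * (2 * (1 + \<bar>a\<bar>\<^sup>2) * (1 / (1 + (of_int d)\<^sup>2)))" for d :: int
      proof -
        have "norm (complex_of_real (exp (- (pi * (1 / y) * (of_int d + a)\<^sup>2)))) \<le> K * (1 / (1 + (a + of_int d)\<^sup>2))"
          using K(2)[of "of_int d + a"] by (simp add: add.commute)
        also have "\<dots> \<le> K * (2 * (1 + \<bar>a\<bar>\<^sup>2) * (1 / (1 + (of_int d)\<^sup>2)))"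
          using K(1) by (intro mult_left_mono one_plus_square_shift_le) auto
        finally show ?thesis .
      qed
      note bd = this
      show ?thesis
        by (rule summable_on_int_quadratic_decay[of _ "K * (2 * (1 + \<bar>a\<bar>\<^sup>2))"]) (insert bd, simp only: mult.assoc)
    qed
    let ?A = "\<lambda>n::int. complex_of_real (- (2 * pi * (of_int n)\<^sup>2 / (1 / y)) * exp (- (pi * (of_int n)\<^sup>2 / (1 / y))) / sqrt (1 / y)) * cis (2 * pi * of_int n * a)"
    let ?B = "\<lambda>n::int. complex_of_real (exp (- (pi * (of_int n)\<^sup>2 / (1 / y))) / sqrt (1 / y)) * cis (2 * pi * of_int n * a)"
    have A: "?A summable_on UNIV"
    proof (rule abs_summable_summable)
      have "(\<lambda>n. norm (?A n)) = (\<lambda>n. (2 * pi * y * sqrt y) * (\<bar>of_int n\<bar> ^ 2 * exp (- (pi * y * (of_int n)\<^sup>2))))"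
        using y by (intro ext) (simp add: norm_mult norm_divide real_sqrt_divide mult_ac flip: of_int_power)
      then show "(\<lambda>n. norm (?A n)) summable_on UNIV" using summable_on_cmult_right[OF summable_on_poly_gauss[OF y, of 2]] by presburger
    qed
    have B: "?B summable_on UNIV"
    proof (rule abs_summable_summable)
      have "(\<lambda>n. norm (?B n)) = (\<lambda>n. sqrt y * (\<bar>of_int n\<bar> ^ 0 * exp (- (pi * y * (of_int n)\<^sup>2))))"
        using y by (intro ext) (simp add: norm_mult norm_divide real_sqrt_divide mult_ac)
      then show "(\<lambda>n. norm (?B n)) summable_on UNIV" using summable_on_cmult_right[OF summable_on_poly_gauss[OF y, of 0]] by presburger
    qed
    have "(\<Sum>\<^sub>\<infinity>d::int. complex_of_real (phi ((norm (of_int c * \<tau> + of_int d))\<^sup>2 / y))) =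
       of_real e * (infsum ?A UNIV + of_real (2 * pi * (of_int c)\<^sup>2 * y) * infsum ?B UNIV)"
      unfolding split infsum_cmult_right' infsum_add[OF s1 summable_on_cmult_right[OF s2]]
      by (simp only: phi_poisson[OF iy] gauss_poisson[OF iy])
    also have "\<dots> = (\<Sum>\<^sub>\<infinity>n. of_real e * (?A n + of_real (2 * pi * (of_int c)\<^sup>2 * y) * ?B n))"
      unfolding infsum_cmult_right' infsum_add[OF A summable_on_cmult_right[OF B]] ..
    also have "\<dots> = (\<Sum>\<^sub>\<infinity>n. G c n)"
    proof (rule infsum_cong)
      fix n :: int
      have "exp (- (pi * y * ((of_int c)\<^sup>2 + (of_int n)\<^sup>2))) = e * exp (- (pi * (of_int n)\<^sup>2 * y))"
        by (simp only: e_def exp_add[symmetric]) (simp add: algebra_simps)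
      moreover have "1 / sqrt (1 / y) = sqrt y" by (simp add: real_sqrt_divide)
      ultimately show "of_real e * (?A n + of_real (2 * pi * (of_int c)\<^sup>2 * y) * ?B n) = G c n"
        using y by (simp add: G_def a_def real_sqrt_divide) (simp add: algebra_simps)
    qed
    finally show ?thesis .
  qed
  have sumG: "(\<lambda>p. norm ((\<lambda>(c, n). G c n) p)) summable_on UNIV"
  proof -
    obtain K where K: "K > 0" "\<And>q. q \<ge> 0 \<Longrightarrow> exp (- (pi * y * q)) \<le> K / (1 + q) ^ 3"
      using exp_power_decay[of "pi * y" 3] y by auto
    show ?thesis
    proof (rule summable_on_quadratic_prod[where L = 1 and q = "\<lambda>c d. (of_int c)\<^sup>2 + (of_int d)\<^sup>2" and K = "2 * pi * (y * sqrt y) * K"])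
      fix c n :: int
      define q where "q = (real_of_int c)\<^sup>2 + (real_of_int n)\<^sup>2"
      have q: "q \<ge> 0" "\<bar>(real_of_int c)\<^sup>2 - (real_of_int n)\<^sup>2\<bar> \<le> 1 + q" unfolding q_def by (auto simp: abs_le_iff)
      have "norm (G c n) = 2 * pi * (y * sqrt y) * (\<bar>(real_of_int c)\<^sup>2 - (real_of_int n)\<^sup>2\<bar> * exp (- (pi * y * q)))"
        unfolding G_def q_def norm_mult norm_cis norm_of_real abs_mult using y by (simp add: mult.assoc)
      also have "\<dots> \<le> 2 * pi * (y * sqrt y) * ((1 + q) * (K / (1 + q) ^ 3))"
        using q K(2)[OF q(1)] y by (intro mult_left_mono mult_mono) auto
      also have "\<dots> = 2 * pi * (y * sqrt y) * K / (1 + q) ^ 2" using q by (simp add: power3_eq_cube power2_eq_square)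
      finally show "norm (case (c, n) of (c, n) \<Rightarrow> G c n) \<le> 2 * pi * (y * sqrt y) * K / (1 + ((real_of_int c)\<^sup>2 + (real_of_int n)\<^sup>2)) ^ 2"
        by (simp add: q_def)
    qed auto
  qed
  then have sG: "(\<lambda>(c, n). G c n) summable_on UNIV \<times> UNIV" using abs_summable_summable by auto
  have anti: "G c n = - G n c" for c n
    unfolding G_def by (simp add: mult_ac add.commute left_diff_distrib right_diff_distrib)
  \<comment> \<open>Absolute summability allows the order of summation to be exchanged, and
    antisymmetry then makes the sum equal to its own negative.\<close>
  have "(\<Sum>\<^sub>\<infinity>c. \<Sum>\<^sub>\<infinity>n. G c n) = (\<Sum>\<^sub>\<infinity>n. \<Sum>\<^sub>\<infinity>c. G c n)"
    by (rule infsum_swap_banach[OF sG])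
  also have "\<dots> = (\<Sum>\<^sub>\<infinity>n. - (\<Sum>\<^sub>\<infinity>c. G n c))"
  proof (rule infsum_cong)
    fix n
    have "(\<lambda>c. G c n) = (\<lambda>c. - G n c)" using anti by blast
    then show "(\<Sum>\<^sub>\<infinity>c. G c n) = - (\<Sum>\<^sub>\<infinity>c. G n c)" by (metis infsum_uminus)
  qed
  also have "\<dots> = - (\<Sum>\<^sub>\<infinity>n. \<Sum>\<^sub>\<infinity>c. G n c)" by (rule infsum_uminus)
  finally have zero: "(\<Sum>\<^sub>\<infinity>c. \<Sum>\<^sub>\<infinity>n. G c n) = 0" by simp
  have sphi: "(\<lambda>(c::int, d::int). complex_of_real (phi ((norm (of_int c * \<tau> + of_int d))\<^sup>2 / Im \<tau>))) summable_on UNIV \<times> UNIV"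
    using phi_lattice_summable[OF assms]
    by (rule_tac abs_summable_summable) (simp add: case_prod_unfold)
  show ?thesis
    using infsum_Sigma'_banach[OF sphi] zero row by (simp add: y_def)
qed

text \<open>The sum over all pairs is 0, and the removed pair contributes
  \<open>phi 0 = - 1\<close>.\<close>

lemma phi_lattice_sum:
  assumes "Im \<tau> > 0"
  shows "((\<lambda>(c::int, d::int). phi ((norm (of_int c * \<tau> + of_int d))\<^sup>2 / Im \<tau>)) has_sum 1) (UNIV - {(0, 0)})"
proof -
  let ?f = "\<lambda>(c::int, d::int). phi ((norm (of_int c * \<tau> + of_int d))\<^sup>2 / Im \<tau>)"
  have "?f summable_on UNIV"
    using phi_lattice_summable[OF assms]
    by (rule_tac abs_summable_summable) (simp add: case_prod_unfold)
  then have hs: "(?f has_sum infsum ?f UNIV) UNIV" by (rule has_sum_infsum)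
  then have "((\<lambda>p. complex_of_real (?f p)) has_sum of_real (infsum ?f UNIV)) UNIV" by (rule has_sum_of_real)
  then have "complex_of_real (infsum ?f UNIV) = (\<Sum>\<^sub>\<infinity>p. complex_of_real (?f p))" by (rule infsumI[symmetric])
  also have "\<dots> = 0" using phi_lattice_sum_complex[OF assms] by (simp add: case_prod_unfold)
  finally have "(?f has_sum 0) UNIV" using hs by simp
  from has_sum_Diff[OF this has_sum_finite[of "{(0, 0)}" ?f]] show ?thesis by (simp add: phi_def)
qed

subsection \<open>The kernel at the cusps\<close>

lemma set_integrable_powr_at_infinity:
  assumes "s < -1"
  shows "set_integrable lborel {1..} (\<lambda>y::real. y powr s)"
proof -
  have "((\<lambda>y. y powr s) has_integral - (1 powr (s + 1)) / (s + 1)) {1..}"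
    by (rule has_integral_powr_to_inf) (use assms in auto)
  then have "(\<lambda>y::real. y powr s) absolutely_integrable_on {1..}"
    by (intro nonnegative_absolutely_integrable_1) (auto simp: integrable_on_def)
  then have "integrable lebesgue (\<lambda>y::real. indicator {1..} y *\<^sub>R y powr s)"
    by (simp add: set_integrable_def)
  then show ?thesis
    unfolding set_integrable_def by (subst (asm) integrable_completion) auto
qed

text \<open>The exponent -3/2 is what weight 1/2 leaves at infinity: a factor y^(1/2) from the forms
  and y^(-2) from the measure, with \<open>kap\<close> bounded.\<close>

lemma set_integrable_Ioi_criterion:
  fixes f :: "real \<Rightarrow> 'a::{banach, second_countable_topology}"
  assumes meas: "f \<in> borel_measurable borel"
    and A: "\<And>y. 0 < y \<Longrightarrow> y \<le> 1 \<Longrightarrow> norm (f y) \<le> A"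
    and B: "\<And>y. y \<ge> 1 \<Longrightarrow> norm (f y) \<le> B * y powr (-3/2)"
  shows "set_integrable lborel {0<..} f"
proof -
  have "set_integrable lborel {0<..1} f"
  proof (rule set_integrable_bound)
    show "set_integrable lborel {0<..1} (\<lambda>_::real. A)"
      by (simp add: set_integrable_def)
    show "AE y in lborel. y \<in> {0<..1} \<longrightarrow> norm (f y) \<le> norm A"
      using A by (auto intro!: AE_I2 intro: order.trans[OF _ abs_ge_self])
  qed (use meas in \<open>simp add: set_borel_measurable_def\<close>)
  moreover have "set_integrable lborel {1..} f"
  proof (rule set_integrable_bound)
    show "set_integrable lborel {1..} (\<lambda>y::real. B * y powr (-3/2))"
      using set_integrable_mult_right[OF set_integrable_powr_at_infinity[of "-3/2"]] by simp
    show "AE y in lborel. y \<in> {1..} \<longrightarrow> norm (f y) \<le> norm (B * y powr (-3/2))"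
      using B by (auto intro!: AE_I2 intro: order.trans[OF _ abs_ge_self] simp del: abs_mult)
  qed (use meas in \<open>simp add: set_borel_measurable_def\<close>)
  ultimately have "set_integrable lborel ({0<..1} \<union> {1..}) f"
    by (rule set_integrable_Un) auto
  also have "{0<..1} \<union> {1..} = {0::real<..}" by auto
  finally show ?thesis .
qed

lemma powr_exp_inverse_bounded:
  fixes p \<delta> :: real
  assumes "\<delta> > 0"
  obtains K where "K > 0" "\<And>y. 0 < y \<Longrightarrow> y \<le> 1 \<Longrightarrow> y powr p * exp (- (\<delta> / y)) \<le> K"
proof -
  define m where "m = nat \<lceil>\<bar>p\<bar>\<rceil>"
  obtain K where K: "K > 0" "\<And>q. q \<ge> 0 \<Longrightarrow> exp (- (\<delta> * q)) \<le> K / (1 + q) ^ m"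
    using exp_power_decay[of \<delta> m] assms by auto
  show ?thesis
  proof (rule that[OF K(1)])
    fix y :: real assume y: "0 < y" "y \<le> 1"
    have m: "real m \<ge> - p" unfolding m_def by linarith
    have "y powr p * exp (- (\<delta> / y)) \<le> y powr (- real m) * (K / (1 + 1 / y) ^ m)"
      using K(2)[of "1 / y"] y m by (intro mult_mono powr_mono') auto
    also have "\<dots> \<le> y powr (- real m) * (K / (1 / y) ^ m)"
    proof -
      have "(1 / y) ^ m \<le> (1 + 1 / y) ^ m" "(1 / y) ^ m > 0" using y by (auto intro!: power_mono)
      then show ?thesis using K(1) by (intro mult_left_mono divide_left_mono mult_pos_pos) auto
    qed
    also have "y powr (- real m) = (1 / y) ^ m"
      using y by (simp only: powr_minus powr_realpow power_one_over divide_inverse mult_1 power_inverse)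
    also have "(1 / y) ^ m * (K / (1 / y) ^ m) = K" using y by (simp only: times_divide_eq_right) simp
    finally show "y powr p * exp (- (\<delta> / y)) \<le> K" .
  qed
qed

lemma powr_exp_bounded:
  fixes p \<delta> :: real
  assumes "\<delta> > 0"
  obtains K where "K > 0" "\<And>y. y \<ge> 1 \<Longrightarrow> y powr p * exp (- (\<delta> * y)) \<le> K"
proof -
  obtain K where K: "K > 0" "\<And>y. 0 < y \<Longrightarrow> y \<le> 1 \<Longrightarrow> y powr (- p) * exp (- (\<delta> / y)) \<le> K"
    using powr_exp_inverse_bounded[OF assms, of "- p"] by blast
  show ?thesis
  proof (rule that[OF K(1)])
    fix y :: real assume "y \<ge> 1"
    then show "y powr p * exp (- (\<delta> * y)) \<le> K"
      using K(2)[of "1 / y"] by (simp add: powr_divide powr_minus_divide)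
  qed
qed

text \<open>Since \<open>phi 0 = - 1\<close>, this is also 1 plus the sum of
  \<open>phi (n\<^sup>2 / y)\<close> over all integers \<open>n\<close>. The factor 2 normalises the
  later sum over coprime pairs to be 1 when a pair is identified with its negative.\<close>

definition kap :: "real \<Rightarrow> real" where
  "kap y = (\<Sum>n. 2 * phi ((real (Suc n))\<^sup>2 / y))"

text \<open>Because \<pi> > 1, one factor \<open>exp (- q)\<close> can be kept for decay as
  \<open>y\<close> tends to 0, while \<open>exp (- ((pi - 1) * q))\<close> pays for the polynomial
  and for summability.\<close>

lemma phi_exp_decay:
  obtains K where "K > 0" "\<And>q. q \<ge> 0 \<Longrightarrow> \<bar>phi q\<bar> \<le> K * exp (- q) / (1 + q)"
proof -
  have "pi - 1 > 0" using pi_gt3 by simp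
  then obtain K where K: "K > 0" "\<And>q. q \<ge> 0 \<Longrightarrow> exp (- ((pi - 1) * q)) \<le> K / (1 + q) ^ 2"
    using exp_power_decay[of "pi - 1" 2] by auto
  show ?thesis
  proof (rule that[of "2 * pi * K"])
    fix q :: real assume q: "q \<ge> 0"
    have "1 \<le> 2 * pi" using pi_gt3 by simp
    moreover have "0 \<le> 2 * pi * q" using q by simp
    ultimately have "\<bar>2 * pi * q - 1\<bar> \<le> 2 * pi * (1 + q)" by (simp add: abs_le_iff algebra_simps)
    moreover have "exp (- (pi * q)) = exp (- ((pi - 1) * q)) * exp (- q)"
      by (simp only: exp_add[symmetric]) (simp add: algebra_simps)
    then have "exp (- (pi * q)) \<le> K / (1 + q) ^ 2 * exp (- q)"
      using mult_right_mono[OF K(2)[OF q], of "exp (- q)"] by simp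
    ultimately have "\<bar>phi q\<bar> \<le> 2 * pi * (1 + q) * (K / (1 + q) ^ 2 * exp (- q))"
      unfolding phi_def abs_mult by (intro mult_mono) auto
    also have "\<dots> = 2 * pi * K * exp (- q) / (1 + q)" using q by (simp add: power2_eq_square)
    finally show "\<bar>phi q\<bar> \<le> 2 * pi * K * exp (- q) / (1 + q)" .
  qed (use K in auto)
qed

lemma summable_inverse_1_plus_square_Suc: "summable (\<lambda>n. 1 / (1 + (real (Suc n))\<^sup>2))"
proof (rule summable_comparison_test'[OF _ ])
  show "summable (\<lambda>n. inverse (real (Suc n) ^ 2))"
    using inverse_power_summable[of 2] summable_Suc_iff[of "\<lambda>n. inverse (real n ^ 2)"] by simp
  show "norm (1 / (1 + (real (Suc n))\<^sup>2)) \<le> inverse (real (Suc n) ^ 2)" for n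
    by (auto simp: divide_inverse intro!: le_imp_inverse_le)
qed

lemma phi_term_bound:
  obtains K where "K > 0"
    "\<And>y n. y > 0 \<Longrightarrow> \<bar>phi ((real (Suc n))\<^sup>2 / y)\<bar> \<le> K * (1 + y) * exp (- (1 / y)) * (1 / (1 + (real (Suc n))\<^sup>2))"
proof -
  obtain K where K: "K > 0" "\<And>q. q \<ge> 0 \<Longrightarrow> \<bar>phi q\<bar> \<le> K * exp (- q) / (1 + q)" by (rule phi_exp_decay) blast
  show ?thesis
  proof (rule that[OF K(1)])
    fix y :: real and n :: nat assume y: "y > 0"
    define m where "m = (real (Suc n))\<^sup>2"
    have m: "m \<ge> 1" by (simp add: m_def)
    define w where "w = m / y"
    have w: "m = y * w" "w \<ge> 0" using y m by (auto simp: w_def)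
    have gen: "1 / A \<le> t * (1 / B)" if "B \<le> t * A" "A > 0" "B > 0" for A B t :: real
      using that by (simp add: field_simps)
    have "1 / (1 + w) \<le> (1 + y) * (1 / (1 + y * w))"
      by (rule gen) (use y w(2) in \<open>auto simp: algebra_simps add_pos_nonneg\<close>)
    moreover have "exp (- w) \<le> exp (- (1 / y))" using m y by (simp add: w_def divide_right_mono)
    ultimately have "exp (- w) * (1 / (1 + w)) \<le> exp (- (1 / y)) * ((1 + y) * (1 / (1 + y * w)))"
      using w y by (intro mult_mono) auto
    then have "K * (exp (- w) * (1 / (1 + w))) \<le> K * (exp (- (1 / y)) * ((1 + y) * (1 / (1 + y * w))))"
      using K(1) by (intro mult_left_mono) auto
    with K(2)[OF w(2)] show "\<bar>phi ((real (Suc n))\<^sup>2 / y)\<bar> \<le> K * (1 + y) * exp (- (1 / y)) * (1 / (1 + (real (Suc n))\<^sup>2))"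
      unfolding m_def[symmetric] w_def[symmetric] w(1)[symmetric] by (simp add: mult_ac)
  qed
qed

lemma summable_phi_terms:
  assumes "y > 0"
  shows "summable (\<lambda>n. \<bar>phi ((real (Suc n))\<^sup>2 / y)\<bar>)"
proof -
  obtain K where K: "\<And>y n. y > 0 \<Longrightarrow> \<bar>phi ((real (Suc n))\<^sup>2 / y)\<bar> \<le> K * (1 + y) * exp (- (1 / y)) * (1 / (1 + (real (Suc n))\<^sup>2))"
    using phi_term_bound by blast
  show ?thesis
  proof (rule summable_comparison_test'[OF summable_mult[OF summable_inverse_1_plus_square_Suc, of "K * (1 + y) * exp (- (1 / y))"], where N = 0])
    show "norm \<bar>phi ((real (Suc n))\<^sup>2 / y)\<bar> \<le> K * (1 + y) * exp (- (1 / y)) * (1 / (1 + (real (Suc n))\<^sup>2))" for n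
      unfolding real_norm_def abs_idempotent by (rule K[OF assms])
  qed
qed

lemma kap_sums: "y > 0 \<Longrightarrow> (\<lambda>n. 2 * phi ((real (Suc n))\<^sup>2 / y)) sums kap y"
  unfolding kap_def by (rule summable_sums[OF summable_mult[OF summable_rabs_cancel[OF summable_phi_terms]]])

text \<open>The bound is uniform in the number of terms, as dominated convergence in the Laplace
  transform requires. Its growth in \<open>y\<close> is harmless there because of the factor
  \<open>exp (- (4 * pi * t * y))\<close>.\<close>

lemma kap_partial_sum_bound:
  obtains K where "K > 0"
    "\<And>y N. y > 0 \<Longrightarrow> \<bar>\<Sum>n<N. 2 * phi ((real (Suc n))\<^sup>2 / y)\<bar> \<le> K * (1 + y) * exp (- (1 / y))"
    "\<And>y. y > 0 \<Longrightarrow> \<bar>kap y\<bar> \<le> K * (1 + y) * exp (- (1 / y))"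
proof -
  obtain K where K: "K > 0" "\<And>y n. y > 0 \<Longrightarrow> \<bar>phi ((real (Suc n))\<^sup>2 / y)\<bar> \<le> K * (1 + y) * exp (- (1 / y)) * (1 / (1 + (real (Suc n))\<^sup>2))"
    using phi_term_bound by blast
  define T where "T = (\<Sum>n. 1 / (1 + (real (Suc n))\<^sup>2))"
  have T: "T > 0" unfolding T_def by (rule suminf_pos[OF summable_inverse_1_plus_square_Suc]) (auto intro!: add_pos_nonneg)
  have part: "\<bar>\<Sum>n<N. 2 * phi ((real (Suc n))\<^sup>2 / y)\<bar> \<le> 2 * K * T * (1 + y) * exp (- (1 / y))" if y: "y > 0" for y N
  proof -
    have "\<bar>\<Sum>n<N. 2 * phi ((real (Suc n))\<^sup>2 / y)\<bar> \<le> (\<Sum>n<N. \<bar>2 * phi ((real (Suc n))\<^sup>2 / y)\<bar>)" by (rule sum_abs)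
    also have "\<dots> \<le> (\<Sum>n<N. 2 * (K * (1 + y) * exp (- (1 / y)) * (1 / (1 + (real (Suc n))\<^sup>2))))"
      unfolding abs_mult by (intro sum_mono mult_mono K(2)[OF y]) auto
    also have "\<dots> = 2 * (K * (1 + y) * exp (- (1 / y)) * (\<Sum>n<N. 1 / (1 + (real (Suc n))\<^sup>2)))"
      by (simp only: sum_distrib_left)
    also have "\<dots> \<le> 2 * (K * (1 + y) * exp (- (1 / y)) * T)"
      unfolding T_def using K(1) y
      by (intro mult_left_mono sum_le_suminf[OF summable_inverse_1_plus_square_Suc]) auto
    finally show ?thesis by (simp only: mult_ac)
  qed
  show ?thesis
  proof (rule that[OF _ part])
    show "2 * K * T > 0" using K T by simp
    fix y :: real assume y: "y > 0"
    have "(\<lambda>N. \<bar>\<Sum>n<N. 2 * phi ((real (Suc n))\<^sup>2 / y)\<bar>) \<longlonglongrightarrow> \<bar>kap y\<bar>"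
      using kap_sums[OF y] unfolding sums_def by (rule tendsto_rabs)
    then show "\<bar>kap y\<bar> \<le> 2 * K * T * (1 + y) * exp (- (1 / y))"
      by (rule LIMSEQ_le_const2) (use part[OF y] in auto)
  qed
qed

lemma kap_measurable [measurable]: "kap \<in> borel_measurable borel"
  unfolding kap_def phi_def by measurable

lemma has_sum_int_symmetric:
  fixes F :: "int \<Rightarrow> real"
  assumes "F summable_on UNIV" "\<And>n. F (- n) = F n" "(\<lambda>n. 2 * F (int (Suc n))) sums s"
  shows "infsum F UNIV = F 0 + s"
proof -
  have s1: "(F \<circ> (\<lambda>n. int (Suc n))) summable_on UNIV"
    by (subst summable_on_reindex[symmetric]) (auto intro: summable_on_subset_banach[OF assms(1)] simp: inj_on_def)
  have "(F has_sum infsum (F \<circ> (\<lambda>n. int (Suc n))) UNIV) (range (\<lambda>n. int (Suc n)))"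
    by (subst has_sum_reindex) (use s1 in \<open>auto simp: inj_on_def\<close>)
  moreover have "(F has_sum infsum (F \<circ> (\<lambda>n. int (Suc n))) UNIV) (range (\<lambda>n. - int (Suc n)))"
    by (subst has_sum_reindex) (use s1 assms(2) in \<open>auto simp: inj_on_def o_def simp del: of_nat_Suc\<close>)
  moreover have "infsum (F \<circ> (\<lambda>n. int (Suc n))) UNIV = s / 2"
  proof -
    have "(\<lambda>n. F (int (Suc n))) sums infsum (F \<circ> (\<lambda>n. int (Suc n))) UNIV"
      using has_sum_imp_sums[OF has_sum_infsum[OF s1]] by (simp add: o_def)
    moreover have "(\<lambda>n. F (int (Suc n))) sums (s / 2)"
      using sums_divide[OF assms(3), of 2] by simp
    ultimately show ?thesis by (rule sums_unique2)
  qed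
  ultimately have "(F has_sum (s / 2 + s / 2)) (range (\<lambda>n. int (Suc n)) \<union> range (\<lambda>n. - int (Suc n)))"
    by (intro has_sum_Un_disjoint) auto
  then have "(F has_sum (F 0 + s)) ({0} \<union> (range (\<lambda>n. int (Suc n)) \<union> range (\<lambda>n. - int (Suc n))))"
    using has_sum_finite[of "{0}" F] by (intro has_sum_Un_disjoint) (auto simp: image_iff)
  moreover have "{0} \<union> (range (\<lambda>n. int (Suc n)) \<union> range (\<lambda>n. - int (Suc n))) = UNIV"
  proof -
    have "x \<in> {0} \<union> (range (\<lambda>n. int (Suc n)) \<union> range (\<lambda>n. - int (Suc n)))" for x
    proof (cases x rule: int_cases2)
      case (nonneg n) then show ?thesis by (cases n) auto
    next
      case (nonpos n) then show ?thesis by (cases n) auto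
    qed
    then show ?thesis by blast
  qed
  ultimately show ?thesis by (simp add: infsumI)
qed

lemma phi_int_summable:
  assumes "y > 0"
  shows "(\<lambda>d::int. phi ((of_int d)\<^sup>2 / y)) summable_on UNIV"
proof -
  obtain K where K: "K > 0" "\<And>q. q \<ge> 0 \<Longrightarrow> \<bar>phi q\<bar> \<le> K * exp (- q) / (1 + q)" by (rule phi_exp_decay) blast
  show ?thesis
  proof (rule summable_on_int_quadratic_decay[of _ "K * (1 + y)"])
    fix d :: int
    define w where "w = (real_of_int d)\<^sup>2 / y"
    have w: "(real_of_int d)\<^sup>2 = y * w" "w \<ge> 0" using assms by (auto simp: w_def)
    have gen: "1 / A \<le> t * (1 / B)" if "B \<le> t * A" "A > 0" "B > 0" for A B t :: real
      using that by (simp add: field_simps)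
    have "norm (phi w) \<le> K * (exp (- w) * (1 / (1 + w)))" using K(2)[OF w(2)] by simp
    also have "\<dots> \<le> K * (1 * ((1 + y) * (1 / (1 + y * w))))"
      using K(1) assms w by (intro mult_left_mono mult_mono gen) (auto simp: algebra_simps add_pos_nonneg)
    finally show "norm (phi ((of_int d)\<^sup>2 / y)) \<le> K * (1 + y) * (1 / (1 + (of_int d)\<^sup>2))"
      unfolding w(1) using assms by simp
  qed
qed

text \<open>Termwise estimates only give growth like \<open>y\<close> at infinity. Poisson summation
  rewrites \<open>kap y - 1\<close> as a sum that is bounded for \<open>y \<ge> 1\<close>; this
  boundedness is indispensable for the constant term in weight 1/2.\<close>

lemma kap_bound:
  obtains K where "K > 0" "\<And>y. y > 0 \<Longrightarrow> \<bar>kap y\<bar> \<le> K * exp (- (1 / y))"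
proof -
  obtain K where K: "K > 0" "\<And>y. y > 0 \<Longrightarrow> \<bar>kap y\<bar> \<le> K * (1 + y) * exp (- (1 / y))"
    using kap_partial_sum_bound by metis
  obtain L where L: "L > 0" "\<And>q. q \<ge> 0 \<Longrightarrow> exp (- (pi * q)) \<le> L / (1 + q) ^ 3"
    using exp_power_decay[of pi 3] by auto
  define R where "R = (\<Sum>\<^sub>\<infinity>n::int. 1 / (1 + (real_of_int n)\<^sup>2))"
  have R: "R \<ge> 0" unfolding R_def by (intro infsum_nonneg) auto
  have large: "\<bar>kap y\<bar> \<le> 1 + 2 * pi * L * R" if y: "y \<ge> 1" for y
  proof -
    have y0: "y > 0" "1 / y > 0" using y by auto
    let ?t = "\<lambda>n::int. complex_of_real (- (2 * pi * (of_int n)\<^sup>2 / (1 / y)) * exp (- (pi * (of_int n)\<^sup>2 / (1 / y))) / sqrt (1 / y)) * cis (2 * pi * of_int n * 0)"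
    have sym: "infsum (\<lambda>d::int. phi ((of_int d)\<^sup>2 / y)) UNIV = phi ((of_int 0)\<^sup>2 / y) + kap y"
      by (rule has_sum_int_symmetric[OF phi_int_summable[OF y0(1)]]) (use kap_sums[OF y0(1)] in auto)
    have "complex_of_real (kap y - 1) = of_real (infsum (\<lambda>d::int. phi ((of_int d)\<^sup>2 / y)) UNIV)"
      unfolding sym by (simp add: phi_def)
    also have "\<dots> = (\<Sum>\<^sub>\<infinity>d::int. complex_of_real (phi ((of_int d)\<^sup>2 / y)))"
      by (intro infsumI[symmetric] has_sum_of_real has_sum_infsum phi_int_summable y0)
    also have "\<dots> = (\<Sum>\<^sub>\<infinity>n::int. ?t n)"
      using phi_poisson[OF y0(2), of 0] by simp
    finally have eq: "complex_of_real (kap y - 1) = (\<Sum>\<^sub>\<infinity>n::int. ?t n)" .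
    have tb: "norm (?t n) \<le> 2 * pi * L * (1 / (1 + (of_int n)\<^sup>2))" for n :: int
    proof -
      define z where "z = (real_of_int n)\<^sup>2"
      define w where "w = z * y"
      have z: "z \<ge> 0" by (simp add: z_def)
      have w: "w \<ge> z" "w \<ge> 0" using y z by (auto simp: w_def mult_le_cancel_left1)
      have "1 / sqrt (1 / y) = sqrt y" by (simp add: real_sqrt_divide)
      then have "norm (?t n) = 2 * pi * (w * sqrt y * exp (- (pi * w)))"
        using y by (simp add: norm_mult norm_divide z_def w_def real_sqrt_divide mult_ac flip: of_int_power)
      also have "\<dots> \<le> 2 * pi * (L * (1 / (1 + z)))"
      proof (intro mult_left_mono)
        have sy: "sqrt y \<le> y" using y by (simp add: real_le_lsqrt self_le_power)
        \<comment> \<open>For nonzero \<open>n\<close> one has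
          \<open>sqrt y \<le> y \<le> w\<close>; the term for \<open>n = 0\<close> vanishes.\<close>
        have "w * sqrt y \<le> (1 + w) ^ 2"
        proof (cases "n = 0")
          case True then show ?thesis by (simp add: w_def z_def)
        next
          case False
          then have "1 \<le> \<bar>n\<bar>" by simp
          then have "1 \<le> n\<^sup>2" using power_mono[of 1 "\<bar>n\<bar>" 2] by simp
          then have "real_of_int 1 \<le> z" unfolding z_def by (simp only: of_int_power[symmetric] of_int_le_iff)
          then have "y \<le> w" using y by (simp add: w_def mult_le_cancel_right1)
          with sy w have "w * sqrt y \<le> w * w" by (intro mult_left_mono) auto
          also have "\<dots> \<le> (1 + w) ^ 2" using w by (simp add: power2_eq_square algebra_simps)
          finally show ?thesis .
        qed
        then have "w * sqrt y * exp (- (pi * w)) \<le> (1 + w) ^ 2 * (L / (1 + w) ^ 3)"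
          using L(2)[OF w(2)] w by (intro mult_mono) auto
        also have "\<dots> = L / (1 + w)" using w by (simp add: power3_eq_cube power2_eq_square)
        also have "\<dots> \<le> L * (1 / (1 + z))" using L(1) w z by (simp add: divide_left_mono frac_le)
        finally show "w * sqrt y * exp (- (pi * w)) \<le> L * (1 / (1 + z))" .
      qed auto
      finally show ?thesis by (simp add: z_def mult.assoc)
    qed
    have sn: "(\<lambda>n. norm (?t n)) summable_on UNIV"
      by (rule summable_on_int_quadratic_decay[of _ "2 * pi * L"]) (simp only: real_norm_def abs_norm_cancel tb)
    have "norm (\<Sum>\<^sub>\<infinity>n::int. ?t n) \<le> (\<Sum>\<^sub>\<infinity>n::int. norm (?t n))" by (rule norm_infsum_bound[OF sn])
    also have "\<dots> \<le> (\<Sum>\<^sub>\<infinity>n::int. 2 * pi * L * (1 / (1 + (of_int n)\<^sup>2)))"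
      by (rule infsum_mono[OF sn summable_on_cmult_right[OF abs_summable_inverse_1_plus_square_int] tb])
    also have "\<dots> = 2 * pi * L * R" unfolding R_def by (rule infsum_cmult_right')
    finally have "norm (complex_of_real (kap y - 1)) \<le> 2 * pi * L * R" unfolding eq .
    then show ?thesis by (simp only: norm_of_real)
  qed
  define M where "M = max (2 * K) ((1 + 2 * pi * L * R) * exp 1)"
  show ?thesis
  proof (rule that[of M])
    show "M > 0" using K by (simp add: M_def)
    fix y :: real assume y: "y > 0"
    show "\<bar>kap y\<bar> \<le> M * exp (- (1 / y))"
    proof (cases "y \<le> 1")
      case True
      have "\<bar>kap y\<bar> \<le> K * (1 + y) * exp (- (1 / y))" by (rule K(2)[OF y])
      also have "\<dots> \<le> (2 * K) * exp (- (1 / y))" using K(1) True by (intro mult_right_mono) auto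
      also have "\<dots> \<le> M * exp (- (1 / y))" by (intro mult_right_mono) (auto simp: M_def)
      finally show ?thesis .
    next
      case False
      have "\<bar>kap y\<bar> \<le> (1 + 2 * pi * L * R) * (exp 1 * exp (- 1))" using large[of y] False by (simp add: exp_minus)
      also have "\<dots> \<le> (1 + 2 * pi * L * R) * (exp 1 * exp (- (1 / y)))"
        using False L R by (intro mult_left_mono) auto
      also have "\<dots> = ((1 + 2 * pi * L * R) * exp 1) * exp (- (1 / y))" by simp
      also have "\<dots> \<le> M * exp (- (1 / y))" by (intro mult_right_mono) (auto simp: M_def)
      finally show ?thesis .
    qed
  qed
qed

subsection \<open>Laplace transform and Bessel functions\<close>

lemma cosh_real_ge_quadratic: "1 + s\<^sup>2 / 2 \<le> cosh (s::real)"
proof -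
  have "(\<Sum>n\<in>{0,2}. if even n then s ^ n /\<^sub>R fact n else 0) \<le> (\<Sum>n. if even n then s ^ n /\<^sub>R fact n else 0)"
    by (rule sum_le_suminf[OF sums_summable[OF cosh_converges]]) (auto simp: zero_le_even_power)
  then show ?thesis
    using sums_unique[OF cosh_converges[of s]] by (simp add: numeral_2_eq_2[symmetric] fact_2)
qed

text \<open>Completing a square bounds \<open>\<nu> * s\<close> by a constant plus x s^2 / 4, which
  is half of the quadratic lower bound x s^2 / 2 for \<open>x * cosh s\<close>; the other half gives
  the decay.\<close>

lemma exp_cosh_decay:
  fixes x \<nu> :: real
  assumes "x > 0"
  obtains K where "K > 0" "\<And>s. exp (\<nu> * s) * exp (- x * cosh s) \<le> K / (1 + s\<^sup>2)"
proof -
  obtain K where K: "K > 0" "\<And>q. q \<ge> 0 \<Longrightarrow> exp (- (x / 4 * q)) \<le> K / (1 + q) ^ 1"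
    using exp_power_decay[of "x / 4" 1] assms by auto
  show ?thesis
  proof (rule that[of "exp (\<nu>\<^sup>2 / x) * K"])
    fix s :: real
    have "0 \<le> (\<nu> - x * s / 2)\<^sup>2 / x" using assms by simp
    also have "(\<nu> - x * s / 2)\<^sup>2 / x = \<nu>\<^sup>2 / x - \<nu> * s + x * s\<^sup>2 / 4"
      using assms by (simp add: power2_eq_square field_simps)
    finally have 1: "\<nu> * s \<le> \<nu>\<^sup>2 / x + x * s\<^sup>2 / 4" by simp
    have "x * (1 + s\<^sup>2 / 2) \<le> x * cosh s" using assms by (intro mult_left_mono cosh_real_ge_quadratic) auto
    moreover have "x * (1 + s\<^sup>2 / 2) = x + x * s\<^sup>2 / 2" by (simp add: distrib_left)
    ultimately have 2: "x * s\<^sup>2 / 2 \<le> x * cosh s" using assms by linarith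
    have "exp (\<nu> * s) * exp (- x * cosh s) \<le> exp (\<nu>\<^sup>2 / x + - (x / 4 * s\<^sup>2))"
      unfolding exp_add[symmetric] using 1 2 by simp
    also have "\<dots> \<le> exp (\<nu>\<^sup>2 / x) * (K / (1 + s\<^sup>2) ^ 1)"
      unfolding exp_add by (intro mult_left_mono K) auto
    finally show "exp (\<nu> * s) * exp (- x * cosh s) \<le> exp (\<nu>\<^sup>2 / x) * K / (1 + s\<^sup>2)" by simp
  qed (use K in auto)
qed

lemma integrable_exp_cosh:
  fixes x \<nu> :: real
  assumes "x > 0"
  shows "integrable lborel (\<lambda>s. exp (\<nu> * s) * exp (- x * cosh s))"
proof -
  obtain K where K: "K > 0" "\<And>s. exp (\<nu> * s) * exp (- x * cosh s) \<le> K / (1 + s\<^sup>2)"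
    using exp_cosh_decay[OF assms, of \<nu>] by blast
  show ?thesis
  proof (rule Bochner_Integration.integrable_bound)
  have "integrable lborel (\<lambda>x::real. inverse (1 + x\<^sup>2))"
    using integrable_inverse_1_plus_square by (simp add: set_integrable_def)
  then show "integrable lborel (\<lambda>s::real. K * inverse (1 + s\<^sup>2))" by simp
  show "AE s in lborel. norm (exp (\<nu> * s) * exp (- x * cosh s)) \<le> norm (K * inverse (1 + s\<^sup>2))"
  proof (rule AE_I2)
    fix s :: real
    have "norm (exp (\<nu> * s) * exp (- x * cosh s)) = exp (\<nu> * s) * exp (- x * cosh s)" by simp
    also have "\<dots> \<le> K * inverse (1 + s\<^sup>2)" using K(2)[of s] by (simp only: divide_inverse)
    also have "\<dots> \<le> norm (K * inverse (1 + s\<^sup>2))" by simp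
    finally show "norm (exp (\<nu> * s) * exp (- x * cosh s)) \<le> norm (K * inverse (1 + s\<^sup>2))" .
  qed
  qed (simp add: cosh_def)
qed

text \<open>Averaging with the reflection of \<open>s\<close> replaces the exponential by
  \<open>cosh (\<nu> * s)\<close>, and the even integrand counts the half-line twice.\<close>

lemma bessel_K_full_line:
  assumes x: "x > 0"
  shows "(LINT s|lborel. exp (\<nu> * s) * exp (- x * cosh s)) = 2 * bessel_K \<nu> x"
proof -
  let ?h = "\<lambda>s. exp (- x * cosh s) * cosh (\<nu> * s)"
  have int: "integrable lborel (\<lambda>s. exp (\<nu> * s) * exp (- x * cosh s))" for \<nu> by (rule integrable_exp_cosh[OF x])
  have refl: "(LINT s|lborel. exp (\<nu> * s) * exp (- x * cosh s)) = (LINT s|lborel. exp (- \<nu> * s) * exp (- x * cosh s))"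
    using lborel_integral_real_affine[of "-1" "\<lambda>s. exp (\<nu> * s) * exp (- x * cosh s)" 0] by simp
  have h: "?h = (\<lambda>s. 1 / 2 * (exp (\<nu> * s) * exp (- x * cosh s) + exp (- \<nu> * s) * exp (- x * cosh s)))"
  proof
    fix s
    have "cosh (\<nu> * s) = (exp (\<nu> * s) + exp (- \<nu> * s)) / 2" by (simp add: cosh_def)
    then show "?h s = 1 / 2 * (exp (\<nu> * s) * exp (- x * cosh s) + exp (- \<nu> * s) * exp (- x * cosh s))"
      unfolding \<open>cosh (\<nu> * s) = _\<close> by (simp add: field_simps)
  qed
  have inth: "integrable lborel ?h" unfolding h by (intro integrable_mult_right Bochner_Integration.integrable_add int)
  have full: "(LINT s|lborel. exp (\<nu> * s) * exp (- x * cosh s)) = (LINT s|lborel. ?h s)"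
    unfolding h using refl
    by (simp only: integral_mult_right_zero Bochner_Integration.integral_add[OF int int]) simp
  have si: "set_integrable lborel A ?h" if "A \<in> sets borel" for A
    unfolding set_integrable_def by (rule integrable_mult_indicator) (use that inth in auto)
  have "(LINT s:UNIV|lborel. ?h s) = (LINT s:{..<0} \<union> {0..}|lborel. ?h s)"
    by (rule arg_cong[where f = "\<lambda>A. set_lebesgue_integral lborel A _"]) auto
  also have "\<dots> = (LINT s:{..<0}|lborel. ?h s) + (LINT s:{0..}|lborel. ?h s)"
    by (rule set_integral_Un[OF _ si si]) auto
  also have "(LINT s:{..<0}|lborel. ?h s) = (LINT s|lborel. indicator {..<0} (- s) *\<^sub>R ?h (- s))"
    unfolding set_lebesgue_integral_def
    using lborel_integral_real_affine[of "-1" "\<lambda>s. indicator {..<0} s *\<^sub>R ?h s" 0] by simp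
  also have "\<dots> = (LINT s:{0..}|lborel. ?h s)"
    unfolding set_lebesgue_integral_def
  proof (rule integral_cong_AE)
    have "AE s in lborel. s \<noteq> (0::real)" by (rule AE_lborel_singleton)
    then show "AE s in lborel. indicator {..<0} (- s) *\<^sub>R ?h (- s) = indicator {0..} s *\<^sub>R ?h s"
      by eventually_elim (auto simp: indicator_def)
  qed (simp_all add: cosh_def)
  finally have "(LINT s|lborel. ?h s) = 2 * bessel_K \<nu> x"
    by (simp add: bessel_K_def set_lebesgue_integral_def)
  with full show ?thesis by simp
qed

text \<open>The substitution y = c exp(s) with c = sqrt(B / A) balances the two terms of the
  exponent: both coefficients become sqrt(A B), and the sum is a multiple of cosh s.\<close>

lemma bessel_integral:
  fixes A B \<nu> :: real
  assumes A: "A > 0" and B: "B > 0"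
  shows "set_integrable lborel {0<..} (\<lambda>y. y powr (\<nu> - 1) * exp (- A * y - B / y))" (is ?thesis1)
    and "(LINT y:{0<..}|lborel. y powr (\<nu> - 1) * exp (- A * y - B / y)) = 2 * (B / A) powr (\<nu> / 2) * bessel_K \<nu> (2 * sqrt (A * B))" (is ?thesis2)
proof -
  define c where "c = sqrt (B / A)"
  define x where "x = 2 * sqrt (A * B)"
  have c: "c > 0" and x: "x > 0" using A B by (auto simp: c_def x_def)
  have Ac: "A * c = sqrt (A * B)"
  proof -
    have "A * c = sqrt (A\<^sup>2 * (B / A))" unfolding c_def real_sqrt_mult using A by simp
    also have "A\<^sup>2 * (B / A) = A * B" using A by (simp add: power2_eq_square)
    finally show ?thesis .
  qed
  have Bc: "B / c = sqrt (A * B)"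
  proof -
    have "B = sqrt (A * B) * c" unfolding c_def real_sqrt_mult[symmetric] using A B by (simp add: power2_eq_square[symmetric])
    then show ?thesis using c by (simp add: field_simps)
  qed
  let ?f = "\<lambda>y. y powr (\<nu> - 1) * exp (- A * y - B / y)"
  have fg: "?f (c * exp s) * (c * exp s) = c powr \<nu> * (exp (\<nu> * s) * exp (- x * cosh s))" for s
  proof -
    have pos: "c * exp s > 0" using c by simp
    have "(c * exp s) powr (\<nu> - 1) * (c * exp s) = (c * exp s) powr \<nu>"
      using powr_add[of "c * exp s" "\<nu> - 1" 1] pos by simp
    also have "\<dots> = c powr \<nu> * exp (\<nu> * s)" using c by (simp add: powr_mult exp_powr_real mult.commute)
    finally have 1: "(c * exp s) powr (\<nu> - 1) * (c * exp s) = c powr \<nu> * exp (\<nu> * s)" .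
    have "- A * (c * exp s) - B / (c * exp s) = - (A * c) * exp s - (B / c) * exp (- s)"
      by (simp add: exp_minus divide_inverse)
    also have "\<dots> = - x * cosh s" unfolding Ac Bc x_def cosh_def by (simp add: field_simps)
    finally have 2: "- A * (c * exp s) - B / (c * exp s) = - x * cosh s" .
    have "?f (c * exp s) * (c * exp s) = ((c * exp s) powr (\<nu> - 1) * (c * exp s)) * exp (- A * (c * exp s) - B / (c * exp s))"
      by (simp only: mult_ac)
    then show ?thesis unfolding 1 2 by (simp only: mult.assoc)
  qed
  note subst = interval_integral_substitution_nonneg[of "-\<infinity>" \<infinity> "\<lambda>s. c * exp s" "\<lambda>s. c * exp s" ?f 0 \<infinity>]
  have prems: "set_integrable lborel (einterval 0 \<infinity>) ?f"
    "(LBINT y=0..\<infinity>. ?f y) = (LBINT s=-\<infinity>..\<infinity>. ?f (c * exp s) * (c * exp s))"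
  proof -
    have l0: "((\<lambda>s. c * exp s) \<longlongrightarrow> 0) at_bot" "filterlim (\<lambda>s. c * exp s) at_top at_top"
      using c by real_asymp+
    have "((ereal \<circ> (\<lambda>s. c * exp s) \<circ> real_of_ereal) \<longlongrightarrow> 0) (at_right (- \<infinity>))"
      using l0(1) by (simp add: ereal_tendsto_simps zero_ereal_def)
    moreover have "((ereal \<circ> (\<lambda>s. c * exp s) \<circ> real_of_ereal) \<longlongrightarrow> \<infinity>) (at_left \<infinity>)"
      using l0(2) by (simp add: ereal_tendsto_simps)
    moreover have "set_integrable lborel (einterval (- \<infinity>) \<infinity>) (\<lambda>s. ?f (c * exp s) * (c * exp s))"
      unfolding fg using integrable_exp_cosh[OF x, of \<nu>] by (simp add: set_integrable_def)
    moreover have "isCont ?f (c * exp s)" for s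
      using c by (intro continuous_intros) auto
    ultimately show "set_integrable lborel (einterval 0 \<infinity>) ?f"
      "(LBINT y=0..\<infinity>. ?f y) = (LBINT s=-\<infinity>..\<infinity>. ?f (c * exp s) * (c * exp s))"
      using c by (intro subst; auto intro!: derivative_eq_intros continuous_intros)+
  qed
  have ei: "einterval 0 \<infinity> = {0::real<..}" by (simp add: zero_ereal_def)
  show ?thesis1 using prems(1) by (simp only: ei)
  have "(LINT y:{0<..}|lborel. ?f y) = (LBINT y=0..\<infinity>. ?f y)"
    by (simp add: interval_lebesgue_integral_def ei)
  also have "\<dots> = (LINT s|lborel. c powr \<nu> * (exp (\<nu> * s) * exp (- x * cosh s)))"
    unfolding prems(2) fg by (simp add: interval_lebesgue_integral_def set_lebesgue_integral_def)
  also have "\<dots> = c powr \<nu> * (2 * bessel_K \<nu> x)" by (simp only: integral_mult_right_zero bessel_K_full_line[OF x])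
  also have "c powr \<nu> = (B / A) powr (\<nu> / 2)"
    using A B by (simp add: c_def powr_half_sqrt[symmetric] powr_powr)
  finally show ?thesis2 by (simp add: x_def)
qed

lemma kap_laplace_integrable:
  assumes "t > 0"
  shows "set_integrable lborel {0<..} (\<lambda>y. y powr p * exp (- (4 * pi * t * y)) * ((1 + y) * exp (- (1 / y))))"
proof -
  have eq: "y powr p * exp (- (4 * pi * t * y)) * ((1 + y) * exp (- (1 / y))) =
      y powr ((p + 1) - 1) * exp (- (4 * pi * t) * y - 1 / y) + y powr ((p + 2) - 1) * exp (- (4 * pi * t) * y - 1 / y)"
    if "y > 0" for y
  proof -
    have "y powr ((p + 2) - 1) = y powr p * y" using powr_add[of y p 1] that by (simp add: add.commute)
    moreover have "exp (- (4 * pi * t * y)) * exp (- (1 / y)) = exp (- (4 * pi * t) * y - 1 / y)"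
      by (simp only: exp_add[symmetric]) simp
    ultimately show ?thesis by (simp add: algebra_simps)
  qed
  have "set_integrable lborel {0<..} (\<lambda>y. y powr ((p + 1) - 1) * exp (- (4 * pi * t) * y - 1 / y) + y powr ((p + 2) - 1) * exp (- (4 * pi * t) * y - 1 / y))"
    using assms by (intro set_integral_add bessel_integral) auto
  then show ?thesis
    by (subst set_integrable_cong[OF refl refl eq]) auto
qed

text \<open>For positive \<open>t\<close> termwise integration is legitimate. The two summands of
  \<open>phi\<close> give Bessel integrals of orders \<open>k - 2\<close> and \<open>k - 1\<close>
  with A = 4 \<pi> t and B = \<pi> m^2, whose common argument 2 sqrt(A B) is
  \<open>m * x\<close>.\<close>

lemma kap_laplace:
  assumes t: "t > 0"
  shows "set_integrable lborel {0<..} (\<lambda>y. y powr (k - 2) * exp (- (4 * pi * t * y)) * kap y)"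
    and "(LINT y:{0<..}|lborel. y powr (k - 2) * exp (- (4 * pi * t * y)) * kap y)
      = 4 * (8 * pi) powr (- (k - 1)) * (W k (4 * pi * sqrt t) / t powr (k - 1))"
proof -
  define x where "x = 4 * pi * sqrt t"
  have x: "x > 0" using t by (simp add: x_def)
  define C where "C = 4 * (8 * pi) powr (- (k - 1)) / t powr (k - 1)"
  let ?w = "\<lambda>m. (m * x) powr (k - 1) * (m * x * bessel_K (k - 2) (m * x) - bessel_K (k - 1) (m * x))"
  let ?T = "\<lambda>n y. y powr (k - 2) * exp (- (4 * pi * t * y)) * (2 * phi ((real (Suc n))\<^sup>2 / y))"
  obtain K where K: "K > 0"
    "\<And>y N. y > 0 \<Longrightarrow> \<bar>\<Sum>n<N. 2 * phi ((real (Suc n))\<^sup>2 / y)\<bar> \<le> K * (1 + y) * exp (- (1 / y))"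
    "\<And>y. y > 0 \<Longrightarrow> \<bar>kap y\<bar> \<le> K * (1 + y) * exp (- (1 / y))"
    using kap_partial_sum_bound by metis
  have trm: "set_integrable lborel {0<..} (?T n)" "(LINT y:{0<..}|lborel. ?T n y) = C * ?w (real (Suc n))" for n
  proof -
    define m where "m = real (Suc n)"
    have m: "m > 0" by (simp add: m_def)
    have AB: "4 * pi * t > 0" "pi * m\<^sup>2 > 0" using t m by auto
    have T: "?T n y = 4 * pi * m\<^sup>2 * (y powr ((k - 2) - 1) * exp (- (4 * pi * t) * y - pi * m\<^sup>2 / y))
        - 2 * (y powr ((k - 1) - 1) * exp (- (4 * pi * t) * y - pi * m\<^sup>2 / y))" if "y > 0" for y
    proof -
      have p: "y powr (k - 2) = y powr ((k - 2) - 1) * y" using powr_add[of y "k - 2 - 1" 1] that by simp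
      have e: "exp (- (4 * pi * t * y)) * exp (- (pi * (m\<^sup>2 / y))) = exp (- (4 * pi * t) * y - pi * m\<^sup>2 / y)"
        by (simp only: exp_add[symmetric]) simp
      have "?T n y = (y powr (k - 2) * (4 * pi * (m\<^sup>2 / y) - 2)) * (exp (- (4 * pi * t * y)) * exp (- (pi * (m\<^sup>2 / y))))"
        unfolding m_def[symmetric] phi_def by (simp only: algebra_simps)
      also have "y powr (k - 2) * (4 * pi * (m\<^sup>2 / y) - 2) = 4 * pi * m\<^sup>2 * y powr ((k - 2) - 1) - 2 * y powr ((k - 1) - 1)"
        using that by (simp add: p right_diff_distrib)
      finally show ?thesis unfolding e by (simp only: algebra_simps)
    qed
    note I = bessel_integral[OF AB]
    have i1: "set_integrable lborel {0<..} (\<lambda>y. 4 * pi * m\<^sup>2 * (y powr ((k - 2) - 1) * exp (- (4 * pi * t) * y - pi * m\<^sup>2 / y)))"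
      and i2: "set_integrable lborel {0<..} (\<lambda>y. 2 * (y powr ((k - 1) - 1) * exp (- (4 * pi * t) * y - pi * m\<^sup>2 / y)))"
      by (intro set_integrable_mult_right I(1))+
    show "set_integrable lborel {0<..} (?T n)"
      by (subst set_integrable_cong[OF refl refl T]) (use set_integral_diff(1)[OF i1 i2] in auto)
    \<comment> \<open>Here B / A = m^2 / (4 t) is the square of \<open>m * x / (8 * pi * t)\<close>,
      which is the origin of the power of \<open>8 * pi\<close> in the final formula.\<close>
    have sq: "((m * x / (8 * pi * t))\<^sup>2) powr (\<nu> / 2) = (m * x) powr \<nu> / (8 * pi * t) powr \<nu>" for \<nu>
    proof -
      have pos: "m * x / (8 * pi * t) > 0" using m x t by simp
      then have "((m * x / (8 * pi * t))\<^sup>2) powr (\<nu> / 2) = ((m * x / (8 * pi * t)) powr 2) powr (\<nu> / 2)" by simp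
      also have "\<dots> = (m * x / (8 * pi * t)) powr \<nu>" by (simp only: powr_powr) simp
      finally show ?thesis using m x t by (simp add: powr_divide)
    qed
    have "(LINT y:{0<..}|lborel. ?T n y) = (LINT y:{0<..}|lborel. 4 * pi * m\<^sup>2 * (y powr ((k - 2) - 1) * exp (- (4 * pi * t) * y - pi * m\<^sup>2 / y))
        - 2 * (y powr ((k - 1) - 1) * exp (- (4 * pi * t) * y - pi * m\<^sup>2 / y)))"
      by (rule set_lebesgue_integral_cong) (use T in auto)
    also have "\<dots> = 4 * pi * m\<^sup>2 * (2 * (pi * m\<^sup>2 / (4 * pi * t)) powr ((k - 2) / 2) * bessel_K (k - 2) (2 * sqrt (4 * pi * t * (pi * m\<^sup>2))))
        - 2 * (2 * (pi * m\<^sup>2 / (4 * pi * t)) powr ((k - 1) / 2) * bessel_K (k - 1) (2 * sqrt (4 * pi * t * (pi * m\<^sup>2))))"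
      unfolding set_integral_diff(2)[OF i1 i2] set_integral_mult_right I(2) ..
    also have "2 * sqrt (4 * pi * t * (pi * m\<^sup>2)) = m * x"
    proof -
      have "4 * pi * t * (pi * m\<^sup>2) = (2 * pi * m)\<^sup>2 * t" by (simp add: power2_eq_square)
      then show ?thesis using m by (simp add: real_sqrt_mult x_def)
    qed
    also have "pi * m\<^sup>2 / (4 * pi * t) = (m * x / (8 * pi * t))\<^sup>2"
      using t by (simp add: x_def power_divide power_mult_distrib) (simp add: power2_eq_square)
    also have "((m * x / (8 * pi * t))\<^sup>2) powr ((k - 2) / 2) = (m * x) powr (k - 2) / (8 * pi * t) powr (k - 2)" by (rule sq)
    also have "((m * x / (8 * pi * t))\<^sup>2) powr ((k - 1) / 2) = (m * x) powr (k - 1) / (8 * pi * t) powr (k - 1)" by (rule sq)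
    also have "(m * x) powr (k - 2) / (8 * pi * t) powr (k - 2) = (m * x) powr (k - 1) / (8 * pi * t) powr (k - 1) * (8 * pi * t / (m * x))"
    proof -
      have "z powr (k - 1) = z powr (k - 2) * z" if "z > 0" for z :: real
        using powr_add[of z "k - 2" 1] that by simp
      from this[of "m * x"] this[of "8 * pi * t"] show ?thesis using m x t by simp
    qed
    also have "4 * pi * m\<^sup>2 * (2 * ((m * x) powr (k - 1) / (8 * pi * t) powr (k - 1) * (8 * pi * t / (m * x))) * bessel_K (k - 2) (m * x))
        - 2 * (2 * ((m * x) powr (k - 1) / (8 * pi * t) powr (k - 1)) * bessel_K (k - 1) (m * x))
        = 4 / (8 * pi * t) powr (k - 1) * ((m * x) powr (k - 1) * ((16 * pi\<^sup>2 * t * m\<^sup>2 / (m * x)) * bessel_K (k - 2) (m * x) - bessel_K (k - 1) (m * x)))"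
      by (simp add: algebra_simps power2_eq_square)
    also have "16 * pi\<^sup>2 * t * m\<^sup>2 / (m * x) = m * x"
    proof -
      have "x\<^sup>2 = 16 * pi\<^sup>2 * t" using t by (simp add: x_def power_mult_distrib)
      then have "16 * pi\<^sup>2 * t * m\<^sup>2 = (m * x) * (m * x)" by (simp add: power2_eq_square)
      then show ?thesis using m x by simp
    qed
    also have "4 / (8 * pi * t) powr (k - 1) = C"
    proof -
      have "(8 * pi * t) powr (k - 1) = (8 * pi) powr (k - 1) * t powr (k - 1)"
        by (rule powr_mult)
      then show ?thesis unfolding C_def powr_minus[of "8 * pi" "k - 1"] by (simp only: divide_inverse inverse_mult_distrib mult.assoc)
    qed
    finally show "(LINT y:{0<..}|lborel. ?T n y) = C * ?w (real (Suc n))" unfolding m_def .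
  qed
  have meas: "(\<lambda>y. indicator {0<..} y *\<^sub>R (y powr (k - 2) * exp (- (4 * pi * t * y)) * kap y)) \<in> borel_measurable lborel" by simp
  define w where "w = (\<lambda>y::real. K * (indicator {0<..} y *\<^sub>R (y powr (k - 2) * exp (- (4 * pi * t * y)) * ((1 + y) * exp (- (1 / y))))))"
  have intw: "integrable lborel w"
    using kap_laplace_integrable[OF t, of "k - 2"] unfolding w_def set_integrable_def by (rule integrable_mult_right)
  let ?s = "\<lambda>N y. indicator {0<..} y *\<^sub>R (y powr (k - 2) * exp (- (4 * pi * t * y)) * (\<Sum>n<N. 2 * phi ((real (Suc n))\<^sup>2 / y)))"
  have DCT: "AE y in lborel. (\<lambda>N. ?s N y) \<longlonglongrightarrow> indicator {0<..} y *\<^sub>R (y powr (k - 2) * exp (- (4 * pi * t * y)) * kap y)"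
    "AE y in lborel. norm (?s N y) \<le> w y" for N
  proof -
    show "AE y in lborel. (\<lambda>N. ?s N y) \<longlonglongrightarrow> indicator {0<..} y *\<^sub>R (y powr (k - 2) * exp (- (4 * pi * t * y)) * kap y)"
    proof (rule AE_I2)
      fix y :: real
      show "(\<lambda>N. ?s N y) \<longlonglongrightarrow> indicator {0<..} y *\<^sub>R (y powr (k - 2) * exp (- (4 * pi * t * y)) * kap y)"
        using kap_sums[of y, unfolded sums_def] by (cases "y > 0") (auto intro!: tendsto_intros)
    qed
    show "AE y in lborel. norm (?s N y) \<le> w y"
    proof (rule AE_I2)
      fix y :: real
      show "norm (?s N y) \<le> w y"
      proof (cases "y > 0")
        case True
        have "y powr (k - 2) * exp (- (4 * pi * t * y)) * \<bar>\<Sum>n<N. 2 * phi ((real (Suc n))\<^sup>2 / y)\<bar>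
            \<le> y powr (k - 2) * exp (- (4 * pi * t * y)) * (K * (1 + y) * exp (- (1 / y)))"
          by (intro mult_left_mono K(2)[OF True]) auto
        then show ?thesis using True by (simp add: w_def abs_mult mult_ac)
      qed (simp add: w_def)
    qed
  qed
  have smeas: "?s N \<in> borel_measurable lborel" for N unfolding phi_def by simp
  show "set_integrable lborel {0<..} (\<lambda>y. y powr (k - 2) * exp (- (4 * pi * t * y)) * kap y)"
    unfolding set_integrable_def by (rule integrable_dominated_convergence[OF meas smeas intw DCT])
  have lim: "(\<lambda>N. LINT y|lborel. ?s N y) \<longlonglongrightarrow> (LINT y:{0<..}|lborel. y powr (k - 2) * exp (- (4 * pi * t * y)) * kap y)"
    unfolding set_lebesgue_integral_def by (rule integral_dominated_convergence[OF meas smeas intw DCT])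
  have "(LINT y|lborel. ?s N y) = (\<Sum>n<N. C * ?w (real (Suc n)))" for N
  proof -
    have "?s N = (\<lambda>y. \<Sum>n<N. indicator {0<..} y *\<^sub>R ?T n y)"
      by (intro ext) (simp only: sum_distrib_left scaleR_sum_right)
    then have "(LINT y|lborel. ?s N y) = (\<Sum>n<N. LINT y:{0<..}|lborel. ?T n y)"
      unfolding set_lebesgue_integral_def
      using trm(1) by (simp only:) (intro Bochner_Integration.integral_sum, simp add: set_integrable_def)
    then show ?thesis unfolding trm(2) .
  qed
  with lim have sums: "(\<lambda>n. C * ?w (real (Suc n))) sums (LINT y:{0<..}|lborel. y powr (k - 2) * exp (- (4 * pi * t * y)) * kap y)"
    by (simp only: sums_def)
  have "C > 0" using t by (simp add: C_def)
  then have "(\<lambda>n. ?w (real (Suc n))) sums ((LINT y:{0<..}|lborel. y powr (k - 2) * exp (- (4 * pi * t * y)) * kap y) / C)"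
    using sums_divide[OF sums, of C] by simp
  then have "W k x = (LINT y:{0<..}|lborel. y powr (k - 2) * exp (- (4 * pi * t * y)) * kap y) / C"
    unfolding W_def Let_def by (rule sums_unique[symmetric])
  then show "(LINT y:{0<..}|lborel. y powr (k - 2) * exp (- (4 * pi * t * y)) * kap y)
      = 4 * (8 * pi) powr (- (k - 1)) * (W k (4 * pi * sqrt t) / t powr (k - 1))"
  proof -
    have "(LINT y:{0<..}|lborel. y powr (k - 2) * exp (- (4 * pi * t * y)) * kap y) = C * W k x"
      using \<open>W k x = _\<close> \<open>C > 0\<close> by simp
    then show ?thesis by (simp only: C_def x_def times_divide_eq_left times_divide_eq_right)
  qed
qed

section \<open>Theta inversion and the constant term in weight 1/2\<close>

lemma gauss_poisson_real:
assumes y: "y > 0"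
shows "(\<Sum>\<^sub>\<infinity>d::int. exp (- (pi * (1 / y) * (of_int d)\<^sup>2))) = sqrt y * (\<Sum>\<^sub>\<infinity>d::int. exp (- (pi * y * (of_int d)\<^sup>2)))"
proof -
  have s: "(\<lambda>d::int. exp (- (pi * c * (of_int d)\<^sup>2))) summable_on UNIV" if "c > 0" for c
    using summable_on_poly_gauss[OF that, of 0] by simp
  have "complex_of_real (\<Sum>\<^sub>\<infinity>d::int. exp (- (pi * (1 / y) * (of_int d)\<^sup>2))) = (\<Sum>\<^sub>\<infinity>d::int. complex_of_real (exp (- (pi * (1 / y) * (of_int d)\<^sup>2))))"
    using y by (intro infsumI[symmetric] has_sum_of_real has_sum_infsum s) auto
  also have "\<dots> = (\<Sum>\<^sub>\<infinity>n::int. complex_of_real (sqrt y * exp (- (pi * y * (of_int n)\<^sup>2))))"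
    using gauss_poisson[of "1 / y" 0] y by (simp add: real_sqrt_divide mult_ac)
  also have "\<dots> = complex_of_real (sqrt y * (\<Sum>\<^sub>\<infinity>d::int. exp (- (pi * y * (of_int d)\<^sup>2))))"
    using y by (intro infsumI has_sum_of_real has_sum_cmult_right has_sum_infsum s) auto
  finally show ?thesis by (simp only: of_real_eq_iff)
qed

text \<open>The constant term in weight \<open>1/2\<close>: each term of \<open>kap\<close> contributes \<open>0\<close> to the integral, so sum and
  integral cannot be interchanged, and the value comes from the limit at infinity of the antiderivative.\<close>

lemma kap_weight_half:
  shows "set_integrable lborel {0<..} (\<lambda>y. y powr (-3/2) * kap y)"
    and "(LINT y:{0<..}|lborel. y powr (-3/2) * kap y) = 2"
proof -
  define f where "f = (\<lambda>n y. 4 * (y powr (-1/2) * exp (- (pi * (real (Suc n))\<^sup>2 / y))))"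
  define f' where "f' = (\<lambda>n y. y powr (-3/2) * (2 * phi ((real (Suc n))\<^sup>2 / y)))"
  define F where "F = (\<lambda>y. \<Sum>n. f n y)"
  define F' where "F' = (\<lambda>y. \<Sum>n. f' n y)"
  have F': "F' y = y powr (-3/2) * kap y" if "y > 0" for y
    unfolding F'_def f'_def by (rule sums_unique[symmetric, OF sums_mult[OF kap_sums[OF that]]])
  have df: "(f n has_field_derivative f' n y) (at y)" if y: "y > 0" for n y
  proof -
    define m where "m = (real (Suc n))\<^sup>2"
    have p1: "y powr (-1/2 - 1) = y powr (-3/2)" by simp
    have p2: "y powr (-1/2) = y powr (-3/2) * y" using powr_add[of y "-3/2" 1] y by simp
    have "((\<lambda>y. 4 * (y powr (-1/2) * exp (- (pi * m / y)))) has_field_derivative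
       4 * ((-1/2) * y powr (-1/2 - 1) * exp (- (pi * m / y)) + y powr (-1/2) * (exp (- (pi * m / y)) * (pi * m / y\<^sup>2)))) (at y)"
      using y by (auto intro!: derivative_eq_intros simp: power2_eq_square)
    moreover have "4 * ((-1/2) * y powr (-1/2 - 1) * exp (- (pi * m / y)) + y powr (-1/2) * (exp (- (pi * m / y)) * (pi * m / y\<^sup>2)))
       = y powr (-3/2) * (2 * phi (m / y))"
      unfolding p1 p2 phi_def using y by (simp add: field_simps power2_eq_square)
    ultimately show ?thesis by (simp add: f_def f'_def m_def)
  qed
  obtain K where K: "K > 0"
    "\<And>y n. y > 0 \<Longrightarrow> \<bar>phi ((real (Suc n))\<^sup>2 / y)\<bar> \<le> K * (1 + y) * exp (- (1 / y)) * (1 / (1 + (real (Suc n))\<^sup>2))"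
    using phi_term_bound by blast
  have ul: "uniform_limit {a..b} (\<lambda>N y. \<Sum>n<N. f' n y) F' sequentially" if "0 < a" "a \<le> b" for a b
    unfolding F'_def
  proof (rule Weierstrass_m_test)
    show "summable (\<lambda>n. a powr (-3/2) * (2 * (K * (1 + b) * 1)) * (1 / (1 + (real (Suc n))\<^sup>2)))"
      by (intro summable_mult summable_inverse_1_plus_square_Suc)
    fix n y assume y: "y \<in> {a..b}"
    have "norm (f' n y) = y powr (-3/2) * (2 * \<bar>phi ((real (Suc n))\<^sup>2 / y)\<bar>)"
      by (simp add: f'_def abs_mult)
    also have "\<dots> \<le> a powr (-3/2) * (2 * (K * (1 + b) * 1 * (1 / (1 + (real (Suc n))\<^sup>2))))"
    proof (intro mult_mono)
      show "y powr (-3/2) \<le> a powr (-3/2)" using y that by (intro powr_mono2') auto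
      have "\<bar>phi ((real (Suc n))\<^sup>2 / y)\<bar> \<le> K * (1 + y) * exp (- (1 / y)) * (1 / (1 + (real (Suc n))\<^sup>2))"
        using y that by (intro K) auto
      also have "\<dots> \<le> K * (1 + b) * 1 * (1 / (1 + (real (Suc n))\<^sup>2))"
        using y that K(1) by (intro mult_mono) auto
      finally show "\<bar>phi ((real (Suc n))\<^sup>2 / y)\<bar> \<le> K * (1 + b) * 1 * (1 / (1 + (real (Suc n))\<^sup>2))" .
    qed auto
    finally show "norm (f' n y) \<le> a powr (-3/2) * (2 * (K * (1 + b) * 1)) * (1 / (1 + (real (Suc n))\<^sup>2))"
      by (simp only: mult.assoc)
  qed
  have contF': "isCont F' y" if y: "y > 0" for y
  proof -
    have "continuous_on {y/2..2*y} F'"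
    proof (rule uniform_limit_theorem[OF _ ul])
      show "\<forall>\<^sub>F N in sequentially. continuous_on {y / 2..2 * y} (\<lambda>y. \<Sum>n<N. f' n y)"
        unfolding f'_def phi_def using y by (intro always_eventually allI continuous_intros) auto
    qed (use y in auto)
    then show ?thesis by (rule continuous_on_interior) (use y in auto)
  qed
  have sumf: "(\<lambda>n. f n y) sums (2 * y powr (-1/2) * ((\<Sum>\<^sub>\<infinity>d::int. exp (- (pi * (1 / y) * (of_int d)\<^sup>2))) - 1))" if y: "y > 0" for y
  proof -
    let ?e = "\<lambda>d::int. exp (- (pi * (1 / y) * (of_int d)\<^sup>2))"
    have s: "?e summable_on UNIV" using summable_on_poly_gauss[of "1 / y" 0] y by simp
    have s1: "(?e \<circ> (\<lambda>n. int (Suc n))) summable_on UNIV"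
      by (subst summable_on_reindex[symmetric]) (rule inj_onI, simp, rule summable_on_subset_banach[OF s], simp)
    from has_sum_imp_sums[OF has_sum_infsum[OF s1]] have s2: "summable (\<lambda>n. ?e (int (Suc n)))"
      by (auto simp: o_def sums_iff)
    then have s3: "(\<lambda>n. 2 * ?e (int (Suc n))) sums (2 * (\<Sum>n. ?e (int (Suc n))))"
      by (intro sums_mult summable_sums)
    have "infsum ?e UNIV = ?e 0 + 2 * (\<Sum>n. ?e (int (Suc n)))"
      by (rule has_sum_int_symmetric[OF s _ s3]) simp
    then have "2 * (\<Sum>n. ?e (int (Suc n))) = infsum ?e UNIV - 1" by simp
    with s3 have "(\<lambda>n. 2 * ?e (int (Suc n))) sums (infsum ?e UNIV - 1)" by (simp only:)
    from sums_mult[OF this, of "2 * y powr (-1/2)"] show ?thesis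
      by (simp add: f_def)
  qed
  have Fderiv: "(F has_field_derivative F' y) (at y)" if y: "y > 0" for y
    unfolding F_def F'_def
  proof (rule has_field_derivative_series'(2))
    show "uniformly_convergent_on {y/2..2*y} (\<lambda>N y. \<Sum>n<N. f' n y)"
      unfolding uniformly_convergent_on_def using ul[of "y / 2" "2 * y"] y by auto
    show "summable (\<lambda>n. f n y)" using sumf[OF y] by (simp add: sums_iff)
  qed (use y df in \<open>auto intro: has_field_derivative_at_within\<close>)
  \<comment> \<open>Theta inversion rewrites \<open>F\<close> as twice a theta value minus a term of
    order y^(-1/2), so the limit 2 at infinity becomes visible although every single
    \<open>f n\<close> tends to 0 there.\<close>
  have Fval: "F y = 2 * y powr (-1/2) * (sqrt y * (\<Sum>\<^sub>\<infinity>d::int. exp (- (pi * y * (of_int d)\<^sup>2))) - 1)" if "y > 0" for y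
    unfolding F_def gauss_poisson_real[OF that, symmetric] using sumf[OF that] by (rule sums_unique[symmetric])
  \<comment> \<open>Used at both ends of the half-line: directly as \<open>y\<close> tends to
    infinity, and with \<open>1 / y\<close> in place of \<open>y\<close> near 0.\<close>
  have theta_bound: "\<exists>M>0. \<forall>y\<ge>1. \<bar>(\<Sum>\<^sub>\<infinity>d::int. exp (- (pi * y * (of_int d)\<^sup>2))) - 1\<bar> \<le> M * exp (- y)"
  proof -
    obtain L where L: "L > 0" "\<And>q. q \<ge> 0 \<Longrightarrow> exp (- ((pi - 1) * q)) \<le> L / (1 + q) ^ 1"
      using exp_power_decay[of "pi - 1" 1] pi_gt3 by auto
    define R where "R = (\<Sum>\<^sub>\<infinity>n\<in>- {0::int}. 1 / (1 + (real_of_int n)\<^sup>2))"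
    have sR: "(\<lambda>n::int. 1 / (1 + (real_of_int n)\<^sup>2)) summable_on - {0}"
      by (rule summable_on_subset_banach[OF abs_summable_inverse_1_plus_square_int]) auto
    have R: "R \<ge> 0" unfolding R_def by (intro infsum_nonneg) auto
    have "\<bar>(\<Sum>\<^sub>\<infinity>d::int. exp (- (pi * y * (of_int d)\<^sup>2))) - 1\<bar> \<le> (L * R + 1) * exp (- y)" if y: "y \<ge> 1" for y
    proof -
      let ?e = "\<lambda>d::int. exp (- (pi * y * (of_int d)\<^sup>2))"
      have s: "?e summable_on UNIV" using summable_on_poly_gauss[of y 0] y by simp
      have s': "?e summable_on - {0}" by (rule summable_on_subset_banach[OF s]) auto
      have "(?e has_sum (?e 0 + infsum ?e (- {0}))) ({0} \<union> - {0})"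
        using has_sum_finite[of "{0}" ?e] has_sum_infsum[OF s'] by (intro has_sum_Un_disjoint) auto
      then have "infsum ?e ({0} \<union> - {0}) = ?e 0 + infsum ?e (- {0})" by (rule infsumI)
      moreover have "{0} \<union> - {0} = (UNIV :: int set)" by auto
      ultimately have "infsum ?e UNIV = 1 + infsum ?e (- {0})" by simp
      moreover have "infsum ?e (- {0}) \<le> (\<Sum>\<^sub>\<infinity>n\<in>- {0::int}. (L * exp (- y)) * (1 / (1 + (real_of_int n)\<^sup>2)))"
      proof (rule infsum_mono[OF s' summable_on_cmult_right[OF sR]])
        fix d :: int assume "d \<in> - {0}"
        then have "1 \<le> \<bar>d\<bar>" by simp
        then have "1 \<le> d\<^sup>2" using power_mono[of 1 "\<bar>d\<bar>" 2] by simp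
        define z where "z = (real_of_int d)\<^sup>2"
        have z: "z \<ge> 1" unfolding z_def using \<open>1 \<le> d\<^sup>2\<close> by (metis of_int_1_le_iff of_int_power)
        have w: "y * z \<ge> y" "y * z \<ge> z" using y z by (auto simp: mult_le_cancel_left1 mult_le_cancel_right1)
        have "?e d = exp (- ((pi - 1) * (y * z))) * exp (- (y * z))"
          unfolding z_def by (simp only: exp_add[symmetric]) (simp add: algebra_simps)
        also have "\<dots> \<le> L / (1 + y * z) ^ 1 * exp (- y)"
          using w y z L by (intro mult_mono) auto
        also have "\<dots> \<le> L / (1 + z) * exp (- y)"
        proof (rule mult_right_mono)
          show "L / (1 + y * z) ^ 1 \<le> L / (1 + z)"
            unfolding power_one_right using w z L(1) by (intro divide_left_mono mult_pos_pos) linarith+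
        qed auto
        finally show "?e d \<le> (L * exp (- y)) * (1 / (1 + (real_of_int d)\<^sup>2))" by (simp add: z_def)
      qed
      moreover have "(\<Sum>\<^sub>\<infinity>n\<in>- {0::int}. (L * exp (- y)) * (1 / (1 + (real_of_int n)\<^sup>2))) = L * exp (- y) * R"
        unfolding R_def by (rule infsum_cmult_right')
      moreover have "infsum ?e (- {0}) \<ge> 0" by (intro infsum_nonneg) auto
      moreover have "L * exp (- y) * R \<le> (L * R + 1) * exp (- y)" by (simp add: algebra_simps)
      ultimately show ?thesis by linarith
    qed
    then show ?thesis using L(1) R by (intro exI[of _ "L * R + 1"]) (auto intro: add_nonneg_pos)
  qed
  then obtain M where M: "M > 0" "\<And>y. y \<ge> 1 \<Longrightarrow> \<bar>(\<Sum>\<^sub>\<infinity>d::int. exp (- (pi * y * (of_int d)\<^sup>2))) - 1\<bar> \<le> M * exp (- y)" by blast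
  have theta_lim: "((\<lambda>y. \<Sum>\<^sub>\<infinity>d::int. exp (- (pi * y * (of_int d)\<^sup>2))) \<longlongrightarrow> 1) at_top"
  proof (rule LIM_zero_cancel, rule Lim_null_comparison)
    show "\<forall>\<^sub>F y in at_top. norm ((\<Sum>\<^sub>\<infinity>d::int. exp (- (pi * y * (of_int d)\<^sup>2))) - 1) \<le> M * exp (- y)"
      using eventually_ge_at_top[of 1] by eventually_elim (use M(2) in auto)
    show "((\<lambda>y. M * exp (- y)) \<longlongrightarrow> 0) at_top" by real_asymp
  qed
  have lim_top: "(F \<longlongrightarrow> 2) at_top"
  proof -
    have "((\<lambda>y. 2 * (y powr (-1/2) * sqrt y) * (\<Sum>\<^sub>\<infinity>d::int. exp (- (pi * y * (of_int d)\<^sup>2))) - 2 * y powr (-1/2)) \<longlongrightarrow> 2 * 1 * 1 - 0) at_top"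
    proof (intro tendsto_diff tendsto_mult theta_lim tendsto_const)
      show "((\<lambda>y. y powr (-1/2) * sqrt y) \<longlongrightarrow> 1) at_top" by real_asymp
      show "((\<lambda>y. 2 * y powr (-1/2)) \<longlongrightarrow> (0::real)) at_top" by real_asymp
    qed
    moreover have "\<forall>\<^sub>F y in at_top. 2 * (y powr (-1/2) * sqrt y) * (\<Sum>\<^sub>\<infinity>d::int. exp (- (pi * y * (of_int d)\<^sup>2))) - 2 * y powr (-1/2) = F y"
      using eventually_gt_at_top[of 0] by eventually_elim (simp add: Fval algebra_simps)
    ultimately show ?thesis by (simp add: tendsto_cong)
  qed
  have lim_0: "(F \<longlongrightarrow> 0) (at_right 0)"
  proof (rule Lim_null_comparison)
    show "\<forall>\<^sub>F y in at_right 0. norm (F y) \<le> 2 * y powr (-1/2) * (M * exp (- (1 / y)))"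
      unfolding eventually_at_right_field
    proof (intro exI[of _ 1] conjI allI impI)
      fix y :: real assume y: "0 < y" "y < 1"
      have "F y = 2 * y powr (-1/2) * ((\<Sum>\<^sub>\<infinity>d::int. exp (- (pi * (1 / y) * (of_int d)\<^sup>2))) - 1)"
        unfolding F_def using sumf[OF y(1)] by (rule sums_unique[symmetric])
      then show "norm (F y) \<le> 2 * y powr (-1/2) * (M * exp (- (1 / y)))"
        using M(2)[of "1 / y"] y by (simp add: abs_mult)
    qed auto
    show "((\<lambda>y. 2 * y powr (-1/2) * (M * exp (- (1 / y)))) \<longlongrightarrow> 0) (at_right 0)" by real_asymp
  qed
  show si: "set_integrable lborel {0<..} (\<lambda>y. y powr (-3/2) * kap y)"
  proof -
    obtain B where B: "B > 0" "\<And>y. y > 0 \<Longrightarrow> \<bar>kap y\<bar> \<le> B * exp (- (1 / y))" using kap_bound by blast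
    obtain A where A: "A > 0" "\<And>y::real. 0 < y \<Longrightarrow> y \<le> 1 \<Longrightarrow> y powr (-3/2) * exp (- (1 / y)) \<le> A"
      using powr_exp_inverse_bounded[OF zero_less_one, of "-3/2"] by blast
    show ?thesis
    proof (rule set_integrable_Ioi_criterion)
      fix y :: real assume y: "0 < y" "y \<le> 1"
      have "norm (y powr (-3/2) * kap y) \<le> y powr (-3/2) * (B * exp (- (1 / y)))"
        using B(2)[OF y(1)] by (simp add: abs_mult mult_left_mono)
      also have "\<dots> = B * (y powr (-3/2) * exp (- (1 / y)))" by (simp only: mult_ac)
      also have "\<dots> \<le> B * A" using B(1) by (intro mult_left_mono A y) auto
      finally show "norm (y powr (-3/2) * kap y) \<le> B * A" .
    next
      fix y :: real assume y: "y \<ge> 1"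
      have "norm (y powr (-3/2) * kap y) \<le> y powr (-3/2) * (B * exp (- (1 / y)))"
        using B(2)[of y] y by (simp add: abs_mult mult_left_mono)
      also have "\<dots> \<le> y powr (-3/2) * (B * 1)" using B(1) y by (intro mult_left_mono) auto
      finally show "norm (y powr (-3/2) * kap y) \<le> B * y powr (-3/2)" by (simp add: mult.commute)
    qed measurable
  qed
  have ei: "einterval 0 \<infinity> = {0::real<..}" by (simp add: zero_ereal_def)
  have "(LBINT y=0..\<infinity>. F' y) = 2 - 0"
  proof (rule interval_integral_FTC_integrable)
    show "(F has_vector_derivative F' y) (at y)" "isCont F' y" if "0 < ereal y" for y
      using Fderiv[of y] contF'[of y] that by (auto simp: has_real_derivative_iff_has_vector_derivative)
    have "set_integrable lborel {0<..} F'"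
      by (subst set_integrable_cong[OF refl refl F']) (use si in auto)
    then show "set_integrable lborel (einterval 0 \<infinity>) F'" by (simp only: ei)
    show "((F \<circ> real_of_ereal) \<longlongrightarrow> 0) (at_right 0)" "((F \<circ> real_of_ereal) \<longlongrightarrow> 2) (at_left \<infinity>)"
      using lim_0 lim_top by (simp_all add: ereal_tendsto_simps zero_ereal_def)
  qed auto
  then have "(LINT y:{0<..}|lborel. F' y) = 2"
    by (simp add: interval_lebesgue_integral_def ei)
  moreover have "(LINT y:{0<..}|lborel. F' y) = (LINT y:{0<..}|lborel. y powr (-3/2) * kap y)"
    by (rule set_lebesgue_integral_cong) (use F' in auto)
  ultimately show "(LINT y:{0<..}|lborel. y powr (-3/2) * kap y) = 2" by simp
qed

text \<open>Covers every exponent that occurs with a nonzero coefficient. For \<open>t = 0\<close>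
  the prescribed limit value 1 / (4 sqrt(2 \<pi>)) agrees with the integral, since 4 sqrt(8 \<pi>) /
  (4 sqrt(2 \<pi>)) = 2.\<close>

lemma kap_W_factor:
  assumes "k > 0" "t \<ge> 0" "t > 0 \<or> k = 1/2"
  shows "set_integrable lborel {0<..} (\<lambda>y. y powr (k - 2) * exp (- (4 * pi * t * y)) * kap y)"
    and "(LINT y:{0<..}|lborel. y powr (k - 2) * exp (- (4 * pi * t * y)) * kap y) = 4 * (8 * pi) powr (- (k - 1)) * W_factor k t"
proof -
  have "set_integrable lborel {0<..} (\<lambda>y. y powr (k - 2) * exp (- (4 * pi * t * y)) * kap y) \<and>
    (LINT y:{0<..}|lborel. y powr (k - 2) * exp (- (4 * pi * t * y)) * kap y) = 4 * (8 * pi) powr (- (k - 1)) * W_factor k t"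
  proof (cases "t = 0")
    case True
    then have k: "k = 1/2" using assms by auto
    have "8 * pi = 2\<^sup>2 * (2 * pi)" by simp
    then have "sqrt (8 * pi) = 2 * sqrt (2 * pi)" by (simp only: real_sqrt_mult real_sqrt_abs abs_numeral)
    then have "(8 * pi) powr (1/2) = 2 * sqrt (2 * pi)" by (subst powr_half_sqrt) auto
    then have "4 * (8 * pi) powr (- (k - 1)) * W_factor k t = 2" unfolding k True W_factor_def by simp
    moreover have "1/2 - 2 = (-3/2 :: real)" by simp
    ultimately show ?thesis using kap_weight_half by (simp add: k True)
  next
    case False
    then show ?thesis using kap_laplace[of t k] assms by (simp add: W_factor_def)
  qed
  then show "set_integrable lborel {0<..} (\<lambda>y. y powr (k - 2) * exp (- (4 * pi * t * y)) * kap y)"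
    and "(LINT y:{0<..}|lborel. y powr (k - 2) * exp (- (4 * pi * t * y)) * kap y) = 4 * (8 * pi) powr (- (k - 1)) * W_factor k t" by auto
qed

subsection \<open>The modular group and cusps\<close>

lemma matrix_mult_2 [simp]:
  fixes A B :: "'a::semiring_1^2^2"
  shows "(A ** B)$1$1 = A$1$1 * B$1$1 + A$1$2 * B$2$1" "(A ** B)$1$2 = A$1$1 * B$1$2 + A$1$2 * B$2$2"
    "(A ** B)$2$1 = A$2$1 * B$1$1 + A$2$2 * B$2$1" "(A ** B)$2$2 = A$2$1 * B$1$2 + A$2$2 * B$2$2"
  by (simp_all add: matrix_matrix_mult_def sum_2)

lemma matrix_2_eqI:
  fixes A B :: "'a^2^2"
  assumes "A$1$1 = B$1$1" "A$1$2 = B$1$2" "A$2$1 = B$2$1" "A$2$2 = B$2$2"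
  shows "A = B"
  using assms by (simp add: vec_eq_iff forall_2)

lemma mat_1_entries [simp]:
  "(mat 1 :: 'a::semiring_1^2^2)$1$1 = 1" "(mat 1 :: 'a^2^2)$1$2 = 0" "(mat 1 :: 'a^2^2)$2$1 = 0" "(mat 1 :: 'a^2^2)$2$2 = 1"
  by (simp_all add: mat_def)

abbreviation SL2 :: "(int^2^2) set" where "SL2 \<equiv> carrier SL2Z"

lemma SL2_iff: "A \<in> SL2 \<longleftrightarrow> A$1$1 * A$2$2 - A$1$2 * A$2$1 = 1"
  by (simp add: SL2Z_def det_2)

text \<open>The inverse on \<open>SL2\<close>, but given by its entries, so that identities such as
  \<open>adj_mult\<close> hold for all matrices and reduce to polynomial arithmetic.\<close>

definition adj :: "int^2^2 \<Rightarrow> int^2^2" where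
  "adj A = vector [vector [A$2$2, - A$1$2], vector [- A$2$1, A$1$1]]"

lemma adj_entries [simp]:
  "adj A$1$1 = A$2$2" "adj A$1$2 = - A$1$2" "adj A$2$1 = - A$2$1" "adj A$2$2 = A$1$1"
  by (simp_all add: adj_def)

definition Tmat :: "int \<Rightarrow> int^2^2" where
  "Tmat j = vector [vector [1, j], vector [0, 1]]"

lemma Tmat_entries [simp]: "Tmat j$1$1 = 1" "Tmat j$1$2 = j" "Tmat j$2$1 = 0" "Tmat j$2$2 = 1"
  by (simp_all add: Tmat_def)

lemma SL2_mult: "A \<in> SL2 \<Longrightarrow> B \<in> SL2 \<Longrightarrow> A ** B \<in> SL2"
  by (simp add: SL2Z_def det_mul)

lemma SL2_adj: "A \<in> SL2 \<Longrightarrow> adj A \<in> SL2"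
  by (simp add: SL2_iff algebra_simps)

lemma SL2_one: "mat 1 \<in> SL2" and SL2_minus_one: "- mat 1 \<in> SL2" and SL2_Tmat: "Tmat j \<in> SL2"
  by (simp_all add: SL2_iff)

lemma SL2_uminus: "A \<in> SL2 \<Longrightarrow> - A \<in> SL2"
  by (simp add: SL2_iff)

lemma adj_mult_left: "A \<in> SL2 \<Longrightarrow> adj A ** A = mat 1"
  by (rule matrix_2_eqI) (auto simp: SL2_iff algebra_simps)

lemma adj_mult_right: "A \<in> SL2 \<Longrightarrow> A ** adj A = mat 1"
  by (rule matrix_2_eqI) (auto simp: SL2_iff algebra_simps)

lemma adj_adj [simp]: "adj (adj A) = A"
  by (rule matrix_2_eqI) auto

lemma adj_mult: "adj (A ** B) = adj B ** adj A"
  by (rule matrix_2_eqI) (auto simp: algebra_simps)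

lemma adj_cancel_left: "A \<in> SL2 \<Longrightarrow> adj A ** (A ** B) = B" "A \<in> SL2 \<Longrightarrow> A ** (adj A ** B) = B"
  by (simp_all add: matrix_mul_assoc adj_mult_left adj_mult_right)

lemma adj_cancel_right: "A \<in> SL2 \<Longrightarrow> (B ** A) ** adj A = B" "A \<in> SL2 \<Longrightarrow> (B ** adj A) ** A = B"
  by (simp_all add: matrix_mul_assoc[symmetric] adj_mult_left adj_mult_right)

lemma Tmat_add: "Tmat i ** Tmat j = Tmat (i + j)"
  by (rule matrix_2_eqI) auto

lemma adj_Tmat: "adj (Tmat j) = Tmat (- j)"
  by (rule matrix_2_eqI) auto

lemma Gamma0_SL2: "A \<in> Gamma0 N \<Longrightarrow> A \<in> SL2"
  and Gamma0_dvd: "A \<in> Gamma0 N \<Longrightarrow> int N dvd A$2$1"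
  by (auto simp: Gamma0_def)

lemma Gamma0_mult: "A \<in> Gamma0 N \<Longrightarrow> B \<in> Gamma0 N \<Longrightarrow> A ** B \<in> Gamma0 N"
  by (auto simp: Gamma0_def SL2_mult)

lemma Gamma0_adj: "A \<in> Gamma0 N \<Longrightarrow> adj A \<in> Gamma0 N"
  by (auto simp: Gamma0_def SL2_adj)

lemma Gamma0_one: "mat 1 \<in> Gamma0 N" and Gamma0_minus_one: "- mat 1 \<in> Gamma0 N"
  by (auto simp: Gamma0_def SL2_one SL2_minus_one)

lemma Gamma0_uminus: "A \<in> Gamma0 N \<Longrightarrow> - A \<in> Gamma0 N"
  by (auto simp: Gamma0_def SL2_uminus)

lemma upper_half_plane_iff [simp]: "\<tau> \<in> upper_half_plane \<longleftrightarrow> Im \<tau> > 0"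
  by (simp add: upper_half_plane_def)

lemma linear_form_nonzero:
  assumes "Im \<tau> > 0" "(c, d) \<noteq> (0, 0)"
  shows "of_int c * \<tau> + of_int d \<noteq> 0"
proof
  assume "of_int c * \<tau> + of_int d = 0"
  then have "Im (of_int c * \<tau> + of_int d) = 0" "Re (of_int c * \<tau> + of_int d) = 0" by simp_all
  with assms show False by auto
qed

lemma automorphy_nonzero:
  assumes "A \<in> SL2" "Im \<tau> > 0"
  shows "automorphy A \<tau> \<noteq> 0"
  unfolding automorphy_def by (rule linear_form_nonzero) (use assms in \<open>auto simp: SL2_iff\<close>)

lemma Im_moebius:
  assumes "A \<in> SL2"
  shows "Im (moebius A \<tau>) = Im \<tau> / (norm (automorphy A \<tau>))\<^sup>2"
proof -
  let ?a = "real_of_int (A$1$1)" and ?b = "real_of_int (A$1$2)" and ?c = "real_of_int (A$2$1)" and ?d = "real_of_int (A$2$2)"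
  have det: "?a * ?d - ?b * ?c = 1"
    using assms unfolding SL2_iff by (metis of_int_1 of_int_diff of_int_mult)
  have "Im (moebius A \<tau>) = (?a * Im \<tau> * (?c * Re \<tau> + ?d) - (?a * Re \<tau> + ?b) * (?c * Im \<tau>)) / (norm (automorphy A \<tau>))\<^sup>2"
    by (simp add: moebius_def Im_divide automorphy_def cmod_power2)
  also have "?a * Im \<tau> * (?c * Re \<tau> + ?d) - (?a * Re \<tau> + ?b) * (?c * Im \<tau>) = Im \<tau> * (?a * ?d - ?b * ?c)"
    by (simp only: algebra_simps)
  finally show ?thesis by (simp only: det mult_1_right)
qed

lemma Im_moebius_pos: "A \<in> SL2 \<Longrightarrow> Im \<tau> > 0 \<Longrightarrow> Im (moebius A \<tau>) > 0"
  by (simp add: Im_moebius automorphy_nonzero)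

lemma automorphy_mult:
  assumes "B \<in> SL2" "Im \<tau> > 0"
  shows "automorphy (A ** B) \<tau> = automorphy A (moebius B \<tau>) * automorphy B \<tau>"
  using automorphy_nonzero[OF assms] by (simp add: automorphy_def moebius_def field_simps)

lemma moebius_mult:
  assumes "A \<in> SL2" "B \<in> SL2" "Im \<tau> > 0"
  shows "moebius (A ** B) \<tau> = moebius A (moebius B \<tau>)"
proof -
  have n1: "automorphy B \<tau> \<noteq> 0" using assms automorphy_nonzero by blast
  have n2: "automorphy A (moebius B \<tau>) \<noteq> 0" using assms automorphy_nonzero Im_moebius_pos by blast
  have "of_int ((A ** B)$1$1) * \<tau> + of_int ((A ** B)$1$2) = (of_int (A$1$1) * moebius B \<tau> + of_int (A$1$2)) * automorphy B \<tau>"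
    using n1 by (simp add: automorphy_def moebius_def field_simps)
  then show ?thesis
    unfolding moebius_def[of "A ** B"] automorphy_mult[OF assms(2,3)] moebius_def[of A] using n1 n2 by simp
qed

lemma moebius_one [simp]: "moebius (mat 1) \<tau> = \<tau>"
  by (simp add: moebius_def automorphy_def)

lemma moebius_uminus [simp]: "moebius (- A) \<tau> = moebius A \<tau>"
proof -
  have "automorphy (- A) \<tau> = - automorphy A \<tau>" by (simp add: automorphy_def)
  moreover have "of_int ((- A)$1$1) * \<tau> + of_int ((- A)$1$2) = - (of_int (A$1$1) * \<tau> + of_int (A$1$2))" by simp
  ultimately show ?thesis unfolding moebius_def by (simp only: minus_divide_divide)
qed

lemma moebius_Tmat [simp]: "moebius (Tmat j) \<tau> = \<tau> + of_int j"
  by (simp add: moebius_def automorphy_def)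

lemma moebius_adj_cancel:
  assumes "A \<in> SL2" "Im \<tau> > 0"
  shows "moebius (adj A) (moebius A \<tau>) = \<tau>" "moebius A (moebius (adj A) \<tau>) = \<tau>"
  using assms moebius_mult[of "adj A" A \<tau>] moebius_mult[of A "adj A" \<tau>]
  by (simp_all add: SL2_adj adj_mult_left adj_mult_right)

lemma SL2_same_bottom_row:
  assumes "A \<in> SL2" "B \<in> SL2" "A$2$1 = B$2$1" "A$2$2 = B$2$2"
  obtains j where "A = Tmat j ** B"
proof (rule that)
  let ?M = "A ** adj B"
  have "?M = Tmat (?M$1$2)"
    using assms by (intro matrix_2_eqI) (auto simp: SL2_iff algebra_simps)
  then show "A = Tmat (?M$1$2) ** B" using adj_cancel_right(2)[OF assms(2), of A] by simp
qed

lemma SL2_fix_infinity: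
  assumes "M \<in> SL2" "M$2$1 = 0"
  obtains j where "M = Tmat j \<or> M = - Tmat j"
proof -
  have "M$1$1 * M$2$2 = 1" using assms by (simp add: SL2_iff)
  then have "(M$1$1 = 1 \<and> M$2$2 = 1) \<or> (M$1$1 = - 1 \<and> M$2$2 = - 1)" by (rule zmult_eq_1_iff[THEN iffD1])
  then show ?thesis
  proof
    assume "M$1$1 = 1 \<and> M$2$2 = 1"
    then have "M = Tmat (M$1$2)" using assms by (intro matrix_2_eqI) auto
    then show ?thesis using that by blast
  next
    assume "M$1$1 = - 1 \<and> M$2$2 = - 1"
    then have "M = - Tmat (- M$1$2)" using assms by (intro matrix_2_eqI) auto
    then show ?thesis using that by blast
  qed
qed

lemma SL2_with_bottom_row:
  assumes "coprime c d"
  obtains A where "A \<in> SL2" "A$2$1 = c" "A$2$2 = d"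
proof -
  obtain u v where "u * c + v * d = 1"
    using bezout_int[of c d] assms by (auto simp: coprime_iff_gcd_eq_1)
  then show ?thesis
    by (intro that[of "vector [vector [v, - u], vector [c, d]]"]) (auto simp: SL2_iff algebra_simps)
qed

lemma SL2_bottom_row_coprime: "A \<in> SL2 \<Longrightarrow> coprime (A$2$1) (A$2$2)"
proof (rule coprimeI)
  fix x assume "A \<in> SL2" "x dvd A$2$1" "x dvd A$2$2"
  then have "x dvd A$1$1 * A$2$2 - A$1$2 * A$2$1" by (intro dvd_diff dvd_mult)
  then show "is_unit x" using \<open>A \<in> SL2\<close> by (simp add: SL2_iff)
qed

lemma SL2_left_column_coprime: "A \<in> SL2 \<Longrightarrow> coprime (A$1$1) (A$2$1)"
  unfolding SL2_iff by (metis coprimeI dvd_diff dvd_mult dvd_mult2)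

text \<open>Stated for images of \<open>Cusp_Infinity\<close>; the cusps in \<open>C\<close> have
  this form through \<gamma>, and for them the action is read off from the first column of a matrix
  product.\<close>

lemma act_cusp_mult:
  assumes "A \<in> SL2" "B \<in> SL2"
  shows "act_cusp A (act_cusp B Cusp_Infinity) = act_cusp (A ** B) Cusp_Infinity"
proof (cases "B$2$1 = 0")
  case True
  then have "B$1$1 \<noteq> 0" using assms(2) by (auto simp: SL2_iff)
  with True show ?thesis by (simp add: field_simps)
next
  case False
  define p q :: rat where "p = of_int (B$1$1)" and "q = of_int (B$2$1)"
  have q: "q \<noteq> 0" using False by (simp add: q_def)
  have 1: "of_int (A$2$1) * (p / q) + of_int (A$2$2) = of_int ((A ** B)$2$1) / q"
    "of_int (A$1$1) * (p / q) + of_int (A$1$2) = of_int ((A ** B)$1$1) / q"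
    using q by (simp_all add: p_def q_def field_simps)
  have "act_cusp A (act_cusp B Cusp_Infinity) = act_cusp A (Cusp_Rat (p / q))"
    using False by (simp add: p_def q_def)
  also have "\<dots> = act_cusp (A ** B) Cusp_Infinity"
    unfolding act_cusp.simps 1 using q by (simp del: matrix_mult_2)
  finally show ?thesis .
qed

lemma act_cusp_infinity_eq:
  assumes "A \<in> SL2" "B \<in> SL2" "act_cusp A Cusp_Infinity = act_cusp B Cusp_Infinity"
  obtains j where "B = A ** Tmat j \<or> B = - (A ** Tmat j)"
proof -
  have "(adj A ** B)$2$1 = 0"
  proof (cases "A$2$1 = 0")
    case True
    with assms(3) show ?thesis by (auto split: if_splits)
  next
    case False
    with assms(3) have B: "B$2$1 \<noteq> 0" and "rat_of_int (A$1$1) / of_int (A$2$1) = of_int (B$1$1) / of_int (B$2$1)"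
      by (auto split: if_splits)
    then have "rat_of_int (A$1$1 * B$2$1) = rat_of_int (B$1$1 * A$2$1)" using False by (simp add: field_simps)
    then have "A$1$1 * B$2$1 = B$1$1 * A$2$1" by (simp only: of_int_eq_iff)
    then show ?thesis by simp
  qed
  then obtain j where j: "adj A ** B = Tmat j \<or> adj A ** B = - Tmat j"
    using SL2_fix_infinity[of "adj A ** B"] assms SL2_adj SL2_mult by metis
  have B: "B = A ** (adj A ** B)" by (rule adj_cancel_left(2)[OF assms(1), symmetric])
  have "A ** (- X) = - (A ** X)" for X :: "int^2^2" by (rule matrix_2_eqI) auto
  then show ?thesis using that[of j] j B by metis
qed

lemma cusp_denom_act_infinity:
  assumes "A \<in> SL2"
  shows "cusp_denom (act_cusp A Cusp_Infinity) = nat \<bar>A$2$1\<bar>"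
proof (cases "A$2$1 = 0")
  case False
  have cop: "coprime (A$1$1) (A$2$1)" by (rule SL2_left_column_coprime[OF assms])
  have "snd (quotient_of (of_int (A$1$1) / of_int (A$2$1))) = \<bar>A$2$1\<bar>"
  proof (cases "A$2$1 > 0")
    case True
    then have "quotient_of (Fract (A$1$1) (A$2$1)) = (A$1$1, A$2$1)"
      using cop by (simp add: quotient_of_Fract normalize_def Let_def)
    with True show ?thesis by (simp add: Fract_of_int_quotient)
  next
    case neg: False
    then have "quotient_of (Fract (- A$1$1) (- A$2$1)) = (- A$1$1, - A$2$1)"
      using cop False by (simp add: quotient_of_Fract normalize_def Let_def del: minus_rat_cancel)
    moreover have "Fract (- A$1$1) (- A$2$1) = of_int (A$1$1) / of_int (A$2$1)"
      by (simp add: Fract_of_int_quotient)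
    ultimately show ?thesis using neg by simp
  qed
  with False show ?thesis by simp
qed simp

text \<open>The lower left entry of the conjugated translation is -C^2 j, where C is the denominator
  of the cusp up to sign. That N divides C^2 j means that N / gcd(N, C^2) divides j, so the width is
  the index of the stabiliser.\<close>

lemma cusp_width_dvd_iff:
  assumes "N \<ge> 1" "A \<in> SL2"
  shows "int (cusp_width N (act_cusp A Cusp_Infinity)) dvd j \<longleftrightarrow> A ** Tmat j ** adj A \<in> Gamma0 N"
proof -
  define C where "C = nat \<bar>A$2$1\<bar> ^ 2"
  have intC: "int C = (A$2$1)\<^sup>2" by (simp add: C_def)
  define g where "g = gcd N C"
  have g: "g > 0" using assms(1) by (simp add: g_def)
  obtain n c where nc: "N = n * g" "C = c * g" "coprime n c"
    using gcd_coprime_exists[of N C] g unfolding g_def by auto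
  have "cusp_width N (act_cusp A Cusp_Infinity) = n"
  proof -
    have "cusp_width N (act_cusp A Cusp_Infinity) = N div g"
      by (simp only: cusp_width_def cusp_denom_act_infinity[OF assms(2)] C_def g_def)
    then show ?thesis using nc(1) g by simp
  qed
  moreover have "A ** Tmat j ** adj A \<in> Gamma0 N \<longleftrightarrow> int N dvd int C * j"
  proof -
    have "(A ** Tmat j ** adj A)$2$1 = - (int C * j)"
      by (simp add: intC algebra_simps power2_eq_square)
    moreover have "A ** Tmat j ** adj A \<in> SL2" using assms by (intro SL2_mult SL2_adj SL2_Tmat)
    ultimately show ?thesis by (simp add: Gamma0_def del: matrix_mult_2)
  qed
  moreover have "int N dvd int C * j \<longleftrightarrow> int n dvd j"
  proof -
    have "int N dvd int C * j \<longleftrightarrow> int g * int n dvd int g * (int c * j)" by (simp add: nc mult_ac)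
    also have "\<dots> \<longleftrightarrow> int n dvd int c * j" using g by simp
    also have "\<dots> \<longleftrightarrow> int n dvd j" using nc(3) by (simp add: coprime_dvd_mult_right_iff)
    finally show ?thesis .
  qed
  ultimately show ?thesis by simp
qed

subsection \<open>Translates of the kernel\<close>

text \<open>The indicator of a unit strip selects one element from each coset of the translations,
  so that a sum over cosets can be written as a sum over all of \<open>SL2\<close>.\<close>

definition strip_kernel :: "complex \<Rightarrow> real" where
  "strip_kernel \<tau> = indicator {0..<1} (Re \<tau>) * kap (Im \<tau>)"

lemma coprime_multiples_bij:
  "bij_betw (\<lambda>((c, d), n). (int (Suc n) * c, int (Suc n) * d)) ({(c, d). coprime c d} \<times> UNIV) (UNIV - {(0, 0)})"
proof (rule bij_betw_imageI)
  show "inj_on (\<lambda>((c, d), n). (int (Suc n) * c, int (Suc n) * d)) ({(c, d). coprime c d} \<times> UNIV)"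
  proof (rule inj_onI)
    fix x y :: "(int \<times> int) \<times> nat"
    assume xy: "x \<in> {(c, d). coprime c d} \<times> UNIV" "y \<in> {(c, d). coprime c d} \<times> UNIV"
      "(\<lambda>((c, d), n). (int (Suc n) * c, int (Suc n) * d)) x = (\<lambda>((c, d), n). (int (Suc n) * c, int (Suc n) * d)) y"
    obtain c d n c' d' n' where x: "x = ((c, d), n)" and y: "y = ((c', d'), n')" by (metis surj_pair)
    have cop: "coprime (c::int) d" "coprime (c'::int) d'"
      and eq: "int (Suc n) * c = int (Suc n') * c'" "int (Suc n) * d = int (Suc n') * d'"
      using xy unfolding x y by (auto simp del: of_nat_Suc)
    have "int (Suc n) = gcd (int (Suc n) * c) (int (Suc n) * d)"
      using cop by (simp add: gcd_mult_distrib_int[symmetric] del: of_nat_Suc)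
    also have "\<dots> = int (Suc n')"
      unfolding eq using cop by (simp add: gcd_mult_distrib_int[symmetric] del: of_nat_Suc)
    finally have "int (Suc n) = int (Suc n')" .
    with eq show "x = y" by (simp add: x y del: of_nat_Suc)
  qed
  show "(\<lambda>((c, d), n). (int (Suc n) * c, int (Suc n) * d)) ` ({(c, d). coprime c d} \<times> UNIV) = UNIV - {(0, 0)}"
  proof (intro equalityI subsetI)
    fix p :: "int \<times> int" assume "p \<in> UNIV - {(0, 0)}"
    then obtain c d where p: "p = (c, d)" "c \<noteq> 0 \<or> d \<noteq> 0" by (cases p) auto
    then have g: "gcd c d > 0" by auto
    obtain c' d' where cd: "c = c' * gcd c d" "d = d' * gcd c d" "coprime c' d'"
      using gcd_coprime_exists[of c d] g by auto
    have "int (Suc (nat (gcd c d) - 1)) = gcd c d" using g by simp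
    then have "p = (\<lambda>((c, d), n). (int (Suc n) * c, int (Suc n) * d)) ((c', d'), nat (gcd c d) - 1)"
      using cd p by (simp add: mult.commute del: of_nat_Suc)
    then show "p \<in> (\<lambda>((c, d), n). (int (Suc n) * c, int (Suc n) * d)) ` ({(c, d). coprime c d} \<times> UNIV)"
      using cd(3) by (intro image_eqI[of _ _ "((c', d'), nat (gcd c d) - 1)"]) auto
  qed auto
qed

text \<open>Every nonzero pair is a unique positive multiple of a coprime pair; summing over the
  multiples first produces \<open>kap\<close> at the height of the transformed point.\<close>

lemma kap_coprime_sum:
  assumes "Im \<tau> > 0"
  shows "((\<lambda>(c, d). kap (Im \<tau> / (norm (of_int c * \<tau> + of_int d))\<^sup>2)) has_sum 2) {(c::int, d::int). coprime c d}"
proof -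
  let ?P = "{(c::int, d::int). coprime c d}"
  let ?g = "\<lambda>((c::int, d::int), n). 2 * phi ((real (Suc n))\<^sup>2 / (Im \<tau> / (norm (of_int c * \<tau> + of_int d))\<^sup>2))"
  have "((\<lambda>p. 2 * (\<lambda>(c::int, d::int). phi ((norm (of_int c * \<tau> + of_int d))\<^sup>2 / Im \<tau>)) p) has_sum 2 * 1) (UNIV - {(0, 0)})"
    by (rule has_sum_cmult_right[OF phi_lattice_sum[OF assms]])
  then have "((\<lambda>x. 2 * (\<lambda>(c::int, d::int). phi ((norm (of_int c * \<tau> + of_int d))\<^sup>2 / Im \<tau>)) ((\<lambda>((c, d), n). (int (Suc n) * c, int (Suc n) * d)) x)) has_sum 2) (?P \<times> UNIV)"
    by (subst has_sum_reindex_bij_betw[OF coprime_multiples_bij]) simp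
  also have "?this \<longleftrightarrow> (?g has_sum 2) (?P \<times> UNIV)"
  proof (rule has_sum_cong)
    fix x assume "x \<in> ?P \<times> (UNIV :: nat set)"
    obtain c d n where x: "x = ((c, d), n)" by (cases x) auto
    have "(norm (of_int (int (Suc n) * c) * \<tau> + of_int (int (Suc n) * d)))\<^sup>2 = (real (Suc n))\<^sup>2 * (norm (of_int c * \<tau> + of_int d))\<^sup>2"
    proof -
      have "of_int (int (Suc n) * c) * \<tau> + of_int (int (Suc n) * d) = of_real (real (Suc n)) * (of_int c * \<tau> + of_int d)"
        by (simp add: algebra_simps)
      then show ?thesis by (simp only: norm_mult norm_of_real power_mult_distrib power2_abs)
    qed
    then show "2 * (\<lambda>(c::int, d::int). phi ((norm (of_int c * \<tau> + of_int d))\<^sup>2 / Im \<tau>)) ((\<lambda>((c, d), n). (int (Suc n) * c, int (Suc n) * d)) x) = ?g x"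
      unfolding x by (simp del: of_nat_Suc of_int_mult)
  qed
  finally have gs: "(?g has_sum 2) (Sigma ?P (\<lambda>_. UNIV))" .
  show ?thesis
  proof (rule has_sum_SigmaD[OF gs])
    fix p assume "p \<in> ?P"
    then obtain c d where p: "p = (c, d)" "coprime c d" by auto
    have y: "Im \<tau> / (norm (of_int c * \<tau> + of_int d))\<^sup>2 > 0"
    proof -
      have "(c, d) \<noteq> (0, 0)" using p(2) by auto
      then show ?thesis using linear_form_nonzero[OF assms, of c d] assms by simp
    qed
    have "summable (\<lambda>n. norm (2 * phi ((real (Suc n))\<^sup>2 / (Im \<tau> / (norm (of_int c * \<tau> + of_int d))\<^sup>2))))"
      using summable_mult[OF summable_phi_terms[OF y], of 2] by (simp add: abs_mult)
    from norm_summable_imp_has_sum[OF this kap_sums[OF y]]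
    show "((\<lambda>n. ?g (p, n)) has_sum (\<lambda>(c, d). kap (Im \<tau> / (norm (of_int c * \<tau> + of_int d))\<^sup>2)) p) UNIV"
      by (simp add: p)
  qed
qed

text \<open>For each coprime bottom row exactly one matrix moves \<open>\<tau>\<close> into the
  strip. A matrix and its negative have the same effect but different bottom rows, hence the total
  is 2 and not 1.\<close>

lemma strip_kernel_sum:
  assumes "Im \<tau> > 0"
  shows "((\<lambda>A. strip_kernel (moebius A \<tau>)) has_sum 2) SL2"
proof -
  let ?R = "{A \<in> SL2. Re (moebius A \<tau>) \<in> {0..<1}}"
  let ?P = "{(c::int, d::int). coprime c d}"
  have bij: "bij_betw (\<lambda>A. (A$2$1, A$2$2)) ?R ?P"
  proof (rule bij_betw_imageI)
    show "inj_on (\<lambda>A. (A$2$1, A$2$2)) ?R"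
    proof (rule inj_onI)
      fix A B assume AB: "A \<in> ?R" "B \<in> ?R" "(A$2$1, A$2$2) = (B$2$1, B$2$2)"
      then obtain j where j: "A = Tmat j ** B" using SL2_same_bottom_row[of A B] by auto
      then have "moebius A \<tau> = moebius B \<tau> + of_int j"
        using AB assms by (simp add: moebius_mult SL2_Tmat)
      then have "\<bar>real_of_int j\<bar> < 1" using AB by auto
      then have "j = 0" by linarith
      with j show "A = B" by (simp add: matrix_2_eqI)
    qed
    show "(\<lambda>A. (A$2$1, A$2$2)) ` ?R = ?P"
    proof (intro equalityI subsetI)
      fix p assume "p \<in> ?P"
      then obtain c d where p: "p = (c, d)" "coprime c d" by auto
      obtain A where A: "A \<in> SL2" "A$2$1 = c" "A$2$2 = d" using SL2_with_bottom_row[OF p(2)] .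
      define j where "j = - \<lfloor>Re (moebius A \<tau>)\<rfloor>"
      have "moebius (Tmat j ** A) \<tau> = moebius A \<tau> + of_int j"
        using A assms by (simp add: moebius_mult SL2_Tmat)
      then have "Tmat j ** A \<in> ?R"
        using A by (auto simp: SL2_mult SL2_Tmat j_def) linarith
      moreover have "p = ((Tmat j ** A)$2$1, (Tmat j ** A)$2$2)" using A p by simp
      ultimately show "p \<in> (\<lambda>A. (A$2$1, A$2$2)) ` ?R" by blast
    qed (auto simp: SL2_bottom_row_coprime)
  qed
  have "((\<lambda>A. (\<lambda>(c, d). kap (Im \<tau> / (norm (of_int c * \<tau> + of_int d))\<^sup>2)) ((\<lambda>A. (A$2$1, A$2$2)) A)) has_sum 2) ?R"
    using has_sum_reindex_bij_betw[OF bij] kap_coprime_sum[OF assms] by blast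
  moreover have "((\<lambda>A. (\<lambda>(c, d). kap (Im \<tau> / (norm (of_int c * \<tau> + of_int d))\<^sup>2)) ((\<lambda>A. (A$2$1, A$2$2)) A)) has_sum 2) ?R
      \<longleftrightarrow> ((\<lambda>A. strip_kernel (moebius A \<tau>)) has_sum 2) SL2"
    by (rule has_sum_cong_neutral) (auto simp: strip_kernel_def Im_moebius automorphy_def)
  ultimately show ?thesis by simp
qed

section \<open>Cosets of \<Gamma>_0(N) indexed by cusps and translations\<close>

locale coset_representatives =
  fixes N :: nat and C :: "cusp set" and \<gamma> :: "cusp \<Rightarrow> int^2^2"
  assumes N: "N \<ge> 1" and C: "cusp_representatives N C"
    and \<gamma>: "\<And>c. c \<in> C \<Longrightarrow> \<gamma> c \<in> SL2 \<and> act_cusp (\<gamma> c) Cusp_Infinity = c"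
begin

definition J :: "(cusp \<times> int) set" where
  "J = (SIGMA c:C. {0..<int (cusp_width N c)})"

text \<open>Representatives of the cosets of \<open>Gamma0 N\<close> in \<open>SL2\<close>: a cusp
  of width w accounts for w cosets, which differ by translations.\<close>

definition \<beta> :: "cusp \<times> int \<Rightarrow> int^2^2" where
  "\<beta> = (\<lambda>(c, i). \<gamma> c ** Tmat i)"

lemma width_pos: "cusp_width N c > 0"
proof -
  have "gcd N (cusp_denom c ^ 2) \<le> N" "gcd N (cusp_denom c ^ 2) > 0" using N by (auto intro: dvd_imp_le)
  then show ?thesis by (simp add: cusp_width_def div_greater_zero_iff)
qed

lemma \<beta>_SL2: "j \<in> J \<Longrightarrow> \<beta> j \<in> SL2"
  using \<gamma> by (auto simp: J_def \<beta>_def intro!: SL2_mult SL2_Tmat)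

lemma representative_unique:
  assumes "c \<in> C" "c' \<in> C" "A \<in> Gamma0 N" "act_cusp A c = c'"
  shows "c = c'"
proof -
  have "\<exists>!c. c \<in> C \<and> (\<exists>A\<in>Gamma0 N. act_cusp A c = c')"
    using C unfolding cusp_representatives_def by blast
  moreover have "act_cusp (mat 1) c' = c'"
    using \<gamma>[OF assms(2)] act_cusp_mult[OF SL2_one, of "\<gamma> c'"] by simp
  ultimately show ?thesis using assms Gamma0_one by blast
qed

lemma width_dvd_iff: "c \<in> C \<Longrightarrow> int (cusp_width N c) dvd j \<longleftrightarrow> \<gamma> c ** Tmat j ** adj (\<gamma> c) \<in> Gamma0 N"
  using cusp_width_dvd_iff[OF N, of "\<gamma> c" j] \<gamma> by force

text \<open>The cusp \<open>A\<close>(\<infinity>) is equivalent to a representative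
  \<open>c\<close>, so \<open>A\<close> agrees up to sign with
  \<open>\<delta> ** \<gamma> c ** Tmat j\<close>. Reducing \<open>j\<close> modulo the width
  changes the left factor by an element of \<open>Gamma0 N\<close>.\<close>

lemma coset_exists:
  assumes A: "A \<in> SL2"
  shows "\<exists>j\<in>J. A ** adj (\<beta> j) \<in> Gamma0 N"
proof -
  obtain c \<delta> where c: "c \<in> C" "\<delta> \<in> Gamma0 N" "act_cusp \<delta> c = act_cusp A Cusp_Infinity"
    using C unfolding cusp_representatives_def by metis
  have g: "\<gamma> c \<in> SL2" "act_cusp (\<gamma> c) Cusp_Infinity = c" using \<gamma> c by auto
  have dg: "\<delta> ** \<gamma> c \<in> SL2" using c g by (intro SL2_mult) (auto intro: Gamma0_SL2)
  have "act_cusp (\<delta> ** \<gamma> c) Cusp_Infinity = act_cusp A Cusp_Infinity"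
    using act_cusp_mult[OF Gamma0_SL2[OF c(2)] g(1)] g(2) c(3) by simp
  then obtain j where j: "A = \<delta> ** \<gamma> c ** Tmat j \<or> A = - (\<delta> ** \<gamma> c ** Tmat j)"
    using act_cusp_infinity_eq[OF dg A] by blast
  define w where "w = int (cusp_width N c)"
  have w: "w > 0" using width_pos by (simp add: w_def)
  define i where "i = j mod w"
  have i: "(c, i) \<in> J" using w c by (simp add: J_def i_def w_def)
  have wd: "w dvd j - i" by (simp add: i_def)
  have X: "\<delta> ** (\<gamma> c ** Tmat (j - i) ** adj (\<gamma> c)) \<in> Gamma0 N"
    using wd width_dvd_iff[OF c(1)] by (intro Gamma0_mult[OF c(2)]) (simp add: w_def)
  have "\<delta> ** \<gamma> c ** Tmat j ** adj (\<beta> (c, i)) = \<delta> ** (\<gamma> c ** Tmat (j - i) ** adj (\<gamma> c))"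
    using Tmat_add[of j "- i"] by (simp add: \<beta>_def adj_mult adj_Tmat matrix_mul_assoc[symmetric]) (simp add: matrix_mul_assoc)
  moreover have "(- Y) ** Z = - (Y ** Z)" for Y Z :: "int^2^2" by (rule matrix_2_eqI) auto
  ultimately have "A ** adj (\<beta> (c, i)) \<in> Gamma0 N" using j X Gamma0_uminus by metis
  with i show ?thesis by blast
qed

text \<open>The quotient of the two elements of \<open>Gamma0 N\<close> carries one cusp to the
  other, so the cusps coincide; then the difference of the translations is divisible by the
  width.\<close>

lemma coset_unique:
  assumes A: "A \<in> SL2" and j: "j \<in> J" "A ** adj (\<beta> j) \<in> Gamma0 N" and j': "j' \<in> J" "A ** adj (\<beta> j') \<in> Gamma0 N"
  shows "j = j'"
proof -
  obtain c i c' i' where ji: "j = (c, i)" "j' = (c', i')" by (cases j; cases j')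
  have c: "c \<in> C" "c' \<in> C" using j j' by (auto simp: ji J_def)
  have g: "\<gamma> c \<in> SL2" "act_cusp (\<gamma> c) Cusp_Infinity = c" "\<gamma> c' \<in> SL2" "act_cusp (\<gamma> c') Cusp_Infinity = c'"
    using \<gamma> c by auto
  define \<delta> where "\<delta> = adj (A ** adj (\<beta> j')) ** (A ** adj (\<beta> j))"
  have d: "\<delta> \<in> Gamma0 N" unfolding \<delta>_def by (intro Gamma0_mult Gamma0_adj j j')
  have "\<delta> = \<beta> j' ** (adj A ** A) ** adj (\<beta> j)"
    unfolding \<delta>_def adj_mult adj_adj by (simp only: matrix_mul_assoc)
  also have "\<dots> = \<gamma> c' ** Tmat (i' - i) ** adj (\<gamma> c)"
    unfolding adj_mult_left[OF A] using Tmat_add[of i' "- i"]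
    by (simp add: ji \<beta>_def adj_mult adj_Tmat matrix_mul_assoc[symmetric]) (simp add: matrix_mul_assoc)
  finally have deq: "\<delta> = \<gamma> c' ** Tmat (i' - i) ** adj (\<gamma> c)" .
  then have "\<delta> ** \<gamma> c = \<gamma> c' ** Tmat (i' - i)" using adj_cancel_right(2)[OF g(1)] by simp
  moreover have "act_cusp (\<gamma> c' ** Tmat (i' - i)) Cusp_Infinity = c'"
    using act_cusp_mult[OF g(3) SL2_Tmat] g(4) by simp
  ultimately have "act_cusp \<delta> c = c'"
    using act_cusp_mult[OF Gamma0_SL2[OF d] g(1)] g(2) by simp
  then have cc: "c = c'" using representative_unique c d by blast
  then have "int (cusp_width N c) dvd i' - i" using width_dvd_iff[OF c(1)] deq d by simp
  moreover have "0 \<le> i" "i < int (cusp_width N c)" "0 \<le> i'" "i' < int (cusp_width N c)"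
    using j j' cc by (auto simp: ji J_def)
  then have "\<bar>i' - i\<bar> < int (cusp_width N c)" by linarith
  ultimately have "i' - i = 0" using zdvd_imp_le[of _ "\<bar>i' - i\<bar>"] by fastforce
  then show ?thesis using cc ji by simp
qed

text \<open>The bottom row of \<open>\<gamma> c\<close> modulo N determines the cusp: if two bottom
  rows agree modulo N, then N divides the lower left entry of
  \<open>\<gamma> c' ** adj (\<gamma> c)\<close>.\<close>

lemma finite_C: "finite C"
proof (rule inj_on_finite)
  let ?f = "\<lambda>c. ((\<gamma> c)$2$1 mod int N, (\<gamma> c)$2$2 mod int N)"
  show "inj_on ?f C"
  proof (rule inj_onI)
    fix c c' assume c: "c \<in> C" "c' \<in> C" "?f c = ?f c'"
    have g: "\<gamma> c \<in> SL2" "act_cusp (\<gamma> c) Cusp_Infinity = c" "\<gamma> c' \<in> SL2" "act_cusp (\<gamma> c') Cusp_Infinity = c'"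
      using \<gamma> c by auto
    have "int N dvd (\<gamma> c')$2$1 - (\<gamma> c)$2$1" "int N dvd (\<gamma> c')$2$2 - (\<gamma> c)$2$2"
      using c(3) by (auto simp: mod_eq_dvd_iff[symmetric])
    then have "int N dvd ((\<gamma> c')$2$1 - (\<gamma> c)$2$1) * (\<gamma> c)$2$2 - ((\<gamma> c')$2$2 - (\<gamma> c)$2$2) * (\<gamma> c)$2$1"
      by (rule dvd_diff[OF dvd_mult2 dvd_mult2])
    then have "int N dvd (\<gamma> c' ** adj (\<gamma> c))$2$1" by (simp add: algebra_simps)
    then have d: "\<gamma> c' ** adj (\<gamma> c) \<in> Gamma0 N" using g by (auto simp: Gamma0_def intro!: SL2_mult SL2_adj simp del: matrix_mult_2)
    have "act_cusp (\<gamma> c' ** adj (\<gamma> c)) c = c'"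
      using act_cusp_mult[OF Gamma0_SL2[OF d] g(1)] g(2,4) adj_cancel_right(2)[OF g(1), of "\<gamma> c'"] by simp
    then show "c = c'" using representative_unique c d by blast
  qed
  show "?f ` C \<subseteq> {0..<int N} \<times> {0..<int N}" using N by auto
qed simp

lemma finite_J: "finite J"
  using finite_C by (auto simp: J_def)

end

subsection \<open>The modulus of the theta multiplier\<close>

lemma dirichlet_character_periodic:
  assumes chi: "dirichlet_character N chi"
  shows "chi (n + k * int N) = chi n"
proof -
  have per: "chi (n + int N) = chi n" for n using chi by (simp add: dirichlet_character_def)
  have nat: "chi (n + int m * int N) = chi n" for m n
  proof (induction m)
    case (Suc m)
    have "chi (n + int (Suc m) * int N) = chi ((n + int m * int N) + int N)" by (simp add: algebra_simps)
    with Suc per show ?case by simp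
  qed simp
  show ?thesis
  proof (cases "k \<ge> 0")
    case True then show ?thesis using nat[of n "nat k"] by simp
  next
    case False
    then show ?thesis using nat[of "n + k * int N" "nat (- k)"] by simp
  qed
qed

text \<open>By Euler's theorem the value is a root of unity of order dividing
  \<open>totient N\<close>.\<close>

lemma dirichlet_character_norm:
  assumes chi: "dirichlet_character N chi" and N: "N \<ge> 1" and d: "coprime d (int N)"
  shows "norm (chi d) = 1"
proof -
  have mult: "chi (m * n) = chi m * chi n" for m n using chi by (simp add: dirichlet_character_def)
  have "chi 1 \<noteq> 0" using chi by (simp add: dirichlet_character_def)
  then have chi1: "chi 1 = 1" using mult[of 1 1] by simp
  have pow: "chi (n ^ t) = chi n ^ t" for n t by (induction t) (auto simp: chi1 mult)
  have cong: "chi m = chi n" if "m mod int N = n mod int N" for m n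
  proof -
    have "m = n + (m div int N - n div int N) * int N"
      using that div_mult_mod_eq[of m "int N"] div_mult_mod_eq[of n "int N"] unfolding left_diff_distrib by linarith
    then show ?thesis using dirichlet_character_periodic[OF chi] by metis
  qed
  define a where "a = nat (d mod int N)"
  have a: "int a = d mod int N" using N by (simp add: a_def)
  have "coprime (int a) (int N)" unfolding a using d by (simp add: coprime_iff_gcd_eq_1 gcd_red_int[symmetric] gcd.commute)
  then have "coprime a N" by simp
  then have "[a ^ totient N = 1] (mod N)" by (rule euler_theorem)
  then have "int (a ^ totient N mod N) = int (1 mod N)" by (simp only: cong_def)
  then have "int (a ^ totient N) mod int N = int 1 mod int N" by (simp only: of_nat_mod)
  then have "chi (int (a ^ totient N)) = chi (int 1)" by (rule cong)
  then have "chi (int (a ^ totient N)) = 1" using chi1 by (simp only: of_nat_1)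
  then have "chi (int a) ^ totient N = 1" using pow by simp
  moreover have "chi (int a) = chi d" by (rule cong) (simp add: a)
  ultimately have "norm (chi d) ^ totient N = 1 ^ totient N" by (metis norm_one norm_power power_one)
  moreover have "totient N > 0" using N by simp
  ultimately show ?thesis using power_eq_imp_eq_base[of "norm (chi d)" "totient N" 1] by simp
qed

section \<open>Inversion formula and invariants of the theta function\<close>

definition theta_term :: "nat \<Rightarrow> complex \<Rightarrow> complex" where
  "theta_term n \<tau> = exp (2 * of_real pi * \<i> * \<tau> * of_real ((real (Suc n))\<^sup>2))"

lemma theta_altdef: "theta \<tau> = 1 + 2 * (\<Sum>n. theta_term n \<tau>)"
proof -
  have "qpow \<tau> (of_nat ((Suc n)\<^sup>2)) = theta_term n \<tau>" for n
    unfolding qpow_def theta_term_def of_rat_of_nat_eq by (simp only: of_nat_power of_real_power of_real_of_nat_eq)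
  then show ?thesis by (simp only: theta_def)
qed

lemma norm_theta_term: "norm (theta_term n \<tau>) = exp (- (2 * pi * Im \<tau> * (real (Suc n))\<^sup>2))"
  by (simp add: theta_term_def flip: of_real_power)

lemma theta_uniform_limit:
  assumes "y > 0"
  shows "uniform_limit {\<tau>. Im \<tau> \<ge> y} (\<lambda>N \<tau>. \<Sum>n<N. theta_term n \<tau>) (\<lambda>\<tau>. \<Sum>n. theta_term n \<tau>) sequentially"
proof -
  obtain K where K: "K > 0" "\<And>x. \<bar>x\<bar> ^ 0 * exp (- (pi * (2 * y) * x\<^sup>2)) \<le> K / (1 + x\<^sup>2)"
    using gauss_poly_decay[of "2 * y" 0] assms by auto
  show ?thesis
  proof (rule Weierstrass_m_test)
    show "summable (\<lambda>n. K * (1 / (1 + (real (Suc n))\<^sup>2)))" by (intro summable_mult summable_inverse_1_plus_square_Suc)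
    fix n \<tau> assume "\<tau> \<in> {\<tau>. y \<le> Im \<tau>}"
    then have "norm (theta_term n \<tau>) \<le> exp (- (pi * (2 * y) * (real (Suc n))\<^sup>2))"
      unfolding norm_theta_term by (simp add: mult_right_mono mult_left_mono)
    also have "\<dots> \<le> K * (1 / (1 + (real (Suc n))\<^sup>2))" using K(2)[of "real (Suc n)"] by simp
    finally show "norm (theta_term n \<tau>) \<le> K * (1 / (1 + (real (Suc n))\<^sup>2))" .
  qed
qed

lemma open_upper_half_plane: "open {\<tau>. Im \<tau> > 0}"
  by (simp add: open_halfspace_Im_gt)

lemma theta_holomorphic: "theta holomorphic_on {\<tau>. Im \<tau> > 0}"
proof -
  have "(\<lambda>\<tau>. \<Sum>n. theta_term n \<tau>) holomorphic_on {\<tau>. Im \<tau> > 0}"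
  proof (rule holomorphic_uniform_sequence[OF open_upper_half_plane])
    show "(\<lambda>\<tau>. \<Sum>n<N. theta_term n \<tau>) holomorphic_on {\<tau>. 0 < Im \<tau>}" for N
      unfolding theta_term_def by (intro holomorphic_intros)
    fix x assume x: "x \<in> {\<tau>. 0 < Im \<tau>}"
    have sub: "cball x (Im x / 2) \<subseteq> {\<tau>. Im \<tau> \<ge> Im x / 2}"
    proof
      fix z assume "z \<in> cball x (Im x / 2)"
      then have "\<bar>Im (x - z)\<bar> \<le> Im x / 2"
        using abs_Im_le_cmod[of "x - z"] by (simp add: dist_norm)
      then have "Im x / 2 \<le> Im z" unfolding minus_complex.simps by linarith
      then show "z \<in> {\<tau>. Im \<tau> \<ge> Im x / 2}" by simp
    qed
    show "\<exists>d>0. cball x d \<subseteq> {\<tau>. 0 < Im \<tau>} \<and> uniform_limit (cball x d) (\<lambda>N \<tau>. \<Sum>n<N. theta_term n \<tau>) (\<lambda>\<tau>. \<Sum>n. theta_term n \<tau>) sequentially"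
    proof (intro exI[of _ "Im x / 2"] conjI)
      show "uniform_limit (cball x (Im x / 2)) (\<lambda>N \<tau>. \<Sum>n<N. theta_term n \<tau>) (\<lambda>\<tau>. \<Sum>n. theta_term n \<tau>) sequentially"
        by (rule uniform_limit_on_subset[OF theta_uniform_limit sub]) (use x in auto)
    qed (use sub x in auto)
  qed
  then show ?thesis unfolding theta_altdef[abs_def] by (intro holomorphic_intros)
qed

lemma theta_translate: "theta (\<tau> + of_int j) = theta \<tau>"
proof -
  have "theta_term n (\<tau> + of_int j) = theta_term n \<tau>" for n
  proof -
    have "theta_term n (\<tau> + of_int j) = theta_term n \<tau> * exp (2 * of_int (j * (int (Suc n))\<^sup>2) * pi * \<i>)"
      unfolding theta_term_def exp_add[symmetric] by (rule arg_cong[where f = exp]) (simp add: algebra_simps)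
    also have "exp (2 * of_int (j * (int (Suc n))\<^sup>2) * pi * \<i>) = 1"
      by (rule exp_integer_2pi) auto
    finally show ?thesis by simp
  qed
  then show ?thesis by (simp add: theta_altdef)
qed

lemma theta_imaginary_axis:
  assumes y: "y > 0"
  shows "theta (\<i> * of_real y) = of_real (\<Sum>\<^sub>\<infinity>d::int. exp (- (pi * (2 * y) * (of_int d)\<^sup>2)))"
proof -
  let ?e = "\<lambda>d::int. exp (- (pi * (2 * y) * (of_int d)\<^sup>2))"
  have s: "?e summable_on UNIV" using summable_on_poly_gauss[of "2 * y" 0] y by simp
  have trm: "theta_term n (\<i> * of_real y) = of_real (?e (int (Suc n)))" for n
    unfolding theta_term_def exp_of_real[symmetric] by (rule arg_cong[where f = exp]) (simp add: algebra_simps)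
  have "summable (\<lambda>n. norm (theta_term n (\<i> * of_real y)))"
  proof -
    obtain K where K: "K > 0" "\<And>x. \<bar>x\<bar> ^ 0 * exp (- (pi * (2 * y) * x\<^sup>2)) \<le> K / (1 + x\<^sup>2)"
      using gauss_poly_decay[of "2 * y" 0] y by auto
    show ?thesis
    proof (rule summable_comparison_test'[OF summable_mult[OF summable_inverse_1_plus_square_Suc, of K], where N = 0])
      show "norm (norm (theta_term n (\<i> * of_real y))) \<le> K * (1 / (1 + (real (Suc n))\<^sup>2))" for n
        using K(2)[of "real (Suc n)"] unfolding norm_theta_term by (simp add: mult_ac)
    qed
  qed
  then have "summable (\<lambda>n. ?e (int (Suc n)))" by (simp add: trm del: of_nat_Suc)
  then have "(\<lambda>n. 2 * ?e (int (Suc n))) sums (2 * (\<Sum>n. ?e (int (Suc n))))" by (intro sums_mult summable_sums)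
  from has_sum_int_symmetric[OF s _ this]
  have "infsum ?e UNIV = 1 + 2 * (\<Sum>n. ?e (int (Suc n)))" by simp
  moreover have "(\<Sum>n. theta_term n (\<i> * of_real y)) = of_real (\<Sum>n. ?e (int (Suc n)))"
    unfolding trm by (rule suminf_of_real[symmetric]) fact
  ultimately show ?thesis by (simp add: theta_altdef)
qed

lemma Im_inversion: "Im (- 1 / (4 * \<tau>)) = Im \<tau> / (4 * (norm \<tau>)\<^sup>2)"
proof -
  have "Im (- 1 / (4 * \<tau>)) = 4 * Im \<tau> / (16 * (norm \<tau>)\<^sup>2)"
    by (simp add: Im_divide cmod_power2 power_mult_distrib)
  then show ?thesis by simp
qed

lemma Im_inversion_pos: "Im \<tau> > 0 \<Longrightarrow> Im (- 1 / (4 * \<tau>)) > 0"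
  unfolding Im_inversion by (intro divide_pos_pos mult_pos_pos) auto

text \<open>On the imaginary axis this is Poisson summation for the Gaussian; the identity theorem
  extends it. Squaring makes both sides holomorphic without a choice of square root.\<close>

lemma theta_inversion:
  assumes "Im \<tau> > 0"
  shows "theta (- 1 / (4 * \<tau>)) ^ 2 = - 2 * \<i> * \<tau> * theta \<tau> ^ 2"
proof -
  let ?H = "{\<tau>. Im \<tau> > 0}"
  let ?h = "\<lambda>\<tau>. theta (- 1 / (4 * \<tau>)) ^ 2 - (- 2 * \<i> * \<tau> * theta \<tau> ^ 2)"
  have "(theta \<circ> (\<lambda>\<tau>. - 1 / (4 * \<tau>))) holomorphic_on ?H"
    by (rule holomorphic_on_compose_gen[OF _ theta_holomorphic]) (use Im_inversion_pos in \<open>auto intro!: holomorphic_intros simp del: Im_divide_numeral\<close>)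
  then have hol: "?h holomorphic_on ?H"
    using theta_holomorphic by (intro holomorphic_intros) (simp_all add: o_def)
  have "?h \<tau> = 0"
  proof (rule analytic_continuation[OF hol open_upper_half_plane, where U = "{\<i> * of_real y | y. y > 0}" and \<xi> = \<i>])
    show "connected ?H" by (intro convex_connected convex_halfspace_Im_gt)
    show "{\<i> * of_real y | y. y > 0} \<subseteq> ?H" by auto
    show "\<i> islimpt {\<i> * of_real y | y. y > 0}"
      unfolding islimpt_approachable
    proof (intro allI impI)
      fix e :: real assume e: "e > 0"
      show "\<exists>x'\<in>{\<i> * of_real y | y. y > 0}. x' \<noteq> \<i> \<and> dist x' \<i> < e"
      proof (intro bexI[of _ "\<i> * of_real (1 + e / 2)"] conjI)
        show "\<i> * of_real (1 + e / 2) \<noteq> \<i>" using e by (simp add: complex_eq_iff)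
        have "\<i> * of_real (1 + e / 2) - \<i> = \<i> * of_real (e / 2)" by (simp add: algebra_simps)
        then show "dist (\<i> * of_real (1 + e / 2)) \<i> < e"
          using e by (simp add: dist_norm norm_mult del: of_real_add of_real_divide)
        show "\<i> * of_real (1 + e / 2) \<in> {\<i> * of_real y | y. y > 0}" using e by (intro CollectI exI[of _ "1 + e / 2"]) auto
      qed
    qed
    fix z assume "z \<in> {\<i> * of_real y | y. y > 0}"
    then obtain y where z: "z = \<i> * of_real y" "y > 0" by auto
    have "- 1 / (4 * z) = \<i> * of_real (1 / (4 * y))" using z by (simp add: field_simps)
    then have "theta (- 1 / (4 * z)) = of_real (\<Sum>\<^sub>\<infinity>d::int. exp (- (pi * (2 * (1 / (4 * y))) * (of_int d)\<^sup>2)))"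
      using theta_imaginary_axis[of "1 / (4 * y)"] z by simp
    also have "2 * (1 / (4 * y)) = 1 / (2 * y)" by simp
    also have "(\<Sum>\<^sub>\<infinity>d::int. exp (- (pi * (1 / (2 * y)) * (of_int d)\<^sup>2))) = sqrt (2 * y) * (\<Sum>\<^sub>\<infinity>d::int. exp (- (pi * (2 * y) * (of_int d)\<^sup>2)))"
      by (rule gauss_poisson_real) (use z in auto)
    also have "of_real \<dots> = of_real (sqrt (2 * y)) * theta z"
      using theta_imaginary_axis[OF z(2)] z(1) by simp
    finally have t: "theta (- 1 / (4 * z)) = of_real (sqrt (2 * y)) * theta z" .
    have "(complex_of_real (sqrt (2 * y)))\<^sup>2 = of_real (2 * y)" using z by (simp flip: of_real_power)
    moreover have "- 2 * \<i> * z = of_real (2 * y)" by (simp add: z(1) complex_eq_iff)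
    ultimately show "?h z = 0" unfolding t power_mult_distrib by (simp only: diff_self)
  qed (use assms in auto)
  then show ?thesis by (simp only: right_minus_eq)
qed

text \<open>The square of the invariant |\<theta>|^2 y^(1/2), so that the imaginary part enters
  linearly.\<close>

definition theta_invariant :: "complex \<Rightarrow> real" where
  "theta_invariant \<tau> = norm (theta \<tau>) ^ 4 * Im \<tau>"

lemma theta_invariant_translate: "theta_invariant (\<tau> + of_int j) = theta_invariant \<tau>"
  by (simp add: theta_invariant_def theta_translate)

lemma theta_invariant_inversion:
  assumes "Im \<tau> > 0"
  shows "theta_invariant (- 1 / (4 * \<tau>)) = theta_invariant \<tau>"
proof -
  have nz: "\<tau> \<noteq> 0" using assms by auto
  have "norm (theta (- 1 / (4 * \<tau>)) ^ 2) = norm (- 2 * \<i> * \<tau> * theta \<tau> ^ 2)"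
    by (simp only: theta_inversion[OF assms])
  then have "norm (theta (- 1 / (4 * \<tau>))) ^ 2 = 2 * norm \<tau> * norm (theta \<tau>) ^ 2"
    by (simp add: norm_mult norm_power)
  then have "(norm (theta (- 1 / (4 * \<tau>))) ^ 2) ^ 2 = 4 * (norm \<tau>)\<^sup>2 * (norm (theta \<tau>) ^ 2) ^ 2"
    by (simp add: power_mult_distrib)
  then have "norm (theta (- 1 / (4 * \<tau>))) ^ 4 = 4 * (norm \<tau>)\<^sup>2 * norm (theta \<tau>) ^ 4"
    by (simp flip: power_mult)
  moreover note Im_inversion[of \<tau>]
  ultimately show ?thesis using nz by (simp add: theta_invariant_def)
qed

text \<open>The map is the translation by -j conjugated by the inversion that sends \<tau> to -1/(4
  \<tau>); the invariant is preserved by all three factors.\<close>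

lemma theta_invariant_V:
  assumes "Im \<tau> > 0"
  shows "theta_invariant (\<tau> / (4 * of_int j * \<tau> + 1)) = theta_invariant \<tau>"
proof -
  have nz: "\<tau> \<noteq> 0" using assms by auto
  have nz2: "4 * of_int j * \<tau> + 1 \<noteq> 0" using linear_form_nonzero[OF assms, of "4 * j" 1] by simp
  define \<sigma> where "\<sigma> = - 1 / (4 * \<tau>) - of_int j"
  have im: "Im (- 1 / (4 * \<tau>)) > 0" by (rule Im_inversion_pos[OF assms])
  then have ims: "Im \<sigma> > 0" by (simp add: \<sigma>_def)
  define P where "P = 4 * of_int j * \<tau> + 1"
  have "4 * \<sigma> = - (P / \<tau>)" using nz by (simp add: \<sigma>_def P_def field_simps)
  then have "- 1 / (4 * \<sigma>) = \<tau> / (4 * of_int j * \<tau> + 1)" using nz nz2 by (simp add: P_def[symmetric])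
  then have "theta_invariant (\<tau> / (4 * of_int j * \<tau> + 1)) = theta_invariant \<sigma>"
    using theta_invariant_inversion[OF ims] by simp
  also have "\<dots> = theta_invariant (- 1 / (4 * \<tau>))"
    using theta_invariant_translate[of "- 1 / (4 * \<tau>)" "- j"] by (simp add: \<sigma>_def)
  also have "\<dots> = theta_invariant \<tau>" by (rule theta_invariant_inversion[OF assms])
  finally show ?thesis .
qed

text \<open>The remainder of least absolute value: the factor 1/2 gained here makes the descent in
  \<open>theta_invariant_Gamma0_4\<close> contract.\<close>

lemma centered_remainder:
  fixes c d :: int
  assumes "c \<noteq> 0"
  obtains n where "2 * \<bar>d + n * c\<bar> \<le> \<bar>c\<bar>"
proof -
  define r where "r = (d + \<bar>c\<bar> div 2) mod \<bar>c\<bar> - \<bar>c\<bar> div 2"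
  have "0 \<le> (d + \<bar>c\<bar> div 2) mod \<bar>c\<bar>" "(d + \<bar>c\<bar> div 2) mod \<bar>c\<bar> < \<bar>c\<bar>" using assms by auto
  moreover have "2 * (\<bar>c\<bar> div 2) \<le> \<bar>c\<bar>" "\<bar>c\<bar> \<le> 2 * (\<bar>c\<bar> div 2) + 1" by presburger+
  moreover have "2 * \<bar>X - h\<bar> \<le> a" if "0 \<le> X" "X < a" "2 * h \<le> a" "a \<le> 2 * h + 1" for X h a :: int
    using that by arith
  ultimately have r: "2 * \<bar>r\<bar> \<le> \<bar>c\<bar>" unfolding r_def by blast
  have "r = d + (- ((d + \<bar>c\<bar> div 2) div \<bar>c\<bar>) * sgn c) * c"
  proof -
    have "\<bar>c\<bar> = sgn c * c" by (simp add: abs_sgn)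
    then show ?thesis unfolding r_def
      using minus_div_mult_eq_mod[of "d + \<bar>c\<bar> div 2" "\<bar>c\<bar>"] by (simp add: mult.assoc)
  qed
  with r show ?thesis using that by metis
qed

text \<open>Euclidean descent: \<open>\<Gamma>\<^sub>0(4)\<close> is generated by \<open>-1\<close>, \<open>\<tau> \<mapsto> \<tau> + 1\<close> and \<open>\<tau> \<mapsto> \<tau> / (4 \<tau> + 1)\<close>.\<close>

lemma theta_invariant_Gamma0_4:
  assumes "A \<in> Gamma0 4" "Im \<tau> > 0"
  shows "theta_invariant (moebius A \<tau>) = theta_invariant \<tau>"
  using assms
proof (induction "nat \<bar>A$2$1\<bar>" arbitrary: A \<tau> rule: less_induct)
  case less
  let ?c = "A$2$1" and ?d = "A$2$2"
  have A: "A \<in> SL2" and dvd: "4 dvd ?c" using less.prems by (auto simp: Gamma0_def)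
  show ?case
  proof (cases "?c = 0")
    case True
    then obtain j where "A = Tmat j \<or> A = - Tmat j" using SL2_fix_infinity[OF A] by blast
    then show ?thesis by (auto simp: theta_invariant_translate)
  next
    case False
    obtain n where n: "2 * \<bar>?d + n * ?c\<bar> \<le> \<bar>?c\<bar>" using centered_remainder[OF False] by blast
    define d' where "d' = ?d + n * ?c"
    have "odd ?d"
    proof
      assume "even ?d"
      moreover have "even ?c" using dvd by presburger
      ultimately have "even (A$1$1 * ?d - A$1$2 * ?c)" by simp
      with A show False by (simp add: SL2_iff)
    qed
    then have odd: "odd d'" using dvd by (auto simp: d'_def)
    then have d0: "d' \<noteq> 0" by auto
    \<comment> \<open>Equality is impossible: \<open>d'\<close> is odd, so \<open>2 * d'\<close> is
      congruent to 2 modulo 4, whereas the lower left entry is divisible by 4.\<close>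
    have lt: "2 * \<bar>d'\<bar> < \<bar>?c\<bar>"
    proof -
      have "2 * \<bar>d'\<bar> \<noteq> \<bar>?c\<bar>" using odd dvd by presburger
      with n show ?thesis by (simp add: d'_def)
    qed
    \<comment> \<open>Only multiples of \<open>4 * d'\<close> may be added to the lower left entry
      within \<Gamma>_0(4). The new entry is at most \<open>2 * \<bar>d'\<bar>\<close> in absolute
      value, which is strictly smaller than the old one.\<close>
    obtain m where m: "2 * \<bar>?c + m * (4 * d')\<bar> \<le> \<bar>4 * d'\<bar>" using centered_remainder[of "4 * d'" ?c] d0 by auto
    define V :: "int^2^2" where "V = vector [vector [1, 0], vector [4 * m, 1]]"
    have V: "V$1$1 = 1" "V$1$2 = 0" "V$2$1 = 4 * m" "V$2$2 = 1" by (simp_all add: V_def)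
    have VS: "V \<in> SL2" by (simp add: SL2_iff V)
    have V4: "V \<in> Gamma0 4" using VS V by (simp add: Gamma0_def)
    have T4: "Tmat n \<in> Gamma0 4" using SL2_Tmat by (simp add: Gamma0_def)
    define A' where "A' = A ** Tmat n ** V"
    have A': "A' \<in> Gamma0 4" unfolding A'_def by (intro Gamma0_mult less.prems T4 V4)
    have "A'$2$1 = ?c + m * (4 * d')" by (simp add: A'_def V d'_def algebra_simps)
    then have "\<bar>A'$2$1\<bar> < \<bar>?c\<bar>"
    proof -
      have "\<bar>X\<bar> < a" if "2 * \<bar>X\<bar> \<le> \<bar>4 * b\<bar>" "2 * \<bar>b\<bar> < a" for X a b :: int
        using that by linarith
      then show ?thesis using m lt \<open>A'$2$1 = _\<close> by metis
    qed
    then have small: "nat \<bar>A'$2$1\<bar> < nat \<bar>?c\<bar>" by simp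
    define \<sigma> where "\<sigma> = moebius (adj V) (moebius (Tmat (- n)) \<tau>)"
    have im1: "Im (moebius (Tmat (- n)) \<tau>) > 0" using less.prems by simp
    have ims: "Im \<sigma> > 0" unfolding \<sigma>_def by (rule Im_moebius_pos[OF SL2_adj[OF VS] im1])
    have Vs: "moebius V \<sigma> = moebius (Tmat (- n)) \<tau>"
      unfolding \<sigma>_def by (rule moebius_adj_cancel(2)[OF VS im1])
    have "moebius A' \<sigma> = moebius A \<tau>"
      unfolding A'_def using ims less.prems(2)
      by (simp add: moebius_mult SL2_mult A SL2_Tmat VS Vs)
    moreover have "theta_invariant (moebius A' \<sigma>) = theta_invariant \<sigma>"
      by (rule less.hyps[OF small A' ims])
    moreover have "theta_invariant \<sigma> = theta_invariant (moebius V \<sigma>)"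
      using theta_invariant_V[OF ims, of m] by (simp add: moebius_def automorphy_def V)
    moreover have "theta_invariant (moebius V \<sigma>) = theta_invariant \<tau>"
      unfolding Vs using theta_invariant_translate[of \<tau> "- n"] by simp
    ultimately show ?thesis by simp
  qed
qed

subsection \<open>The invariant function \<open>f \<cdot> cnj g \<cdot> y powr k\<close>\<close>

definition invariant_product :: "real \<Rightarrow> (complex \<Rightarrow> complex) \<Rightarrow> (complex \<Rightarrow> complex) \<Rightarrow> complex \<Rightarrow> complex" where
  "invariant_product k f g \<tau> = f \<tau> * cnj (g \<tau>) * of_real (Im \<tau> powr k)"

lemma powr_square: "(r powr k)\<^sup>2 = (r\<^sup>2) powr k" for r :: real
  unfolding power2_eq_square powr_mult ..

lemma Gamma0_coprime: "A \<in> Gamma0 N \<Longrightarrow> coprime (A$2$2) (int N)"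
proof (rule coprimeI)
  fix x assume A: "A \<in> Gamma0 N" and x: "x dvd A$2$2" "x dvd int N"
  then have "x dvd A$2$1" using Gamma0_dvd dvd_trans by blast
  then show "is_unit x" using SL2_bottom_row_coprime[OF Gamma0_SL2[OF A]] x by (meson coprime_common_divisor)
qed

text \<open>Since \<open>\<Gamma>\<^sub>0(4)\<close>-invariance of \<open>|\<theta>|\<^sup>4 y\<close> determines the modulus of the theta multiplier, only zeros
  of \<open>\<theta>\<close> need care; there \<open>x / 0 = 0\<close> makes the transformation law for \<open>A = 1\<close> force \<open>f \<tau> = 0\<close>.\<close>

lemma modular_multiplier:
  assumes k: "k > 0" "k \<in> \<int> \<or> k - 1/2 \<in> \<int>" and N: "N \<ge> 1" and chi: "dirichlet_character N chi"
    and A: "A \<in> Gamma0 N" and \<tau>: "Im \<tau> > 0"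
  obtains u where "(norm u)\<^sup>2 = (norm (automorphy A \<tau>))\<^sup>2 powr k"
      "\<And>f. f \<in> modular_forms k N chi \<Longrightarrow> f (moebius A \<tau>) = u * f \<tau>"
proof -
  define r where "r = norm (automorphy A \<tau>)"
  have r: "r > 0" using automorphy_nonzero[OF Gamma0_SL2[OF A] \<tau>] by (simp add: r_def)
  have chi1: "norm (chi (A$2$2)) = 1" by (rule dirichlet_character_norm[OF chi N Gamma0_coprime[OF A]])
  show ?thesis
  proof (cases "k \<in> \<int>")
    case True
    then have kf: "of_int \<lfloor>k\<rfloor> = k" by (auto elim!: Ints_cases)
    show ?thesis
    proof (rule that[of "chi (A$2$2) * automorphy A \<tau> powi \<lfloor>k\<rfloor>"])
      have "r powi \<lfloor>k\<rfloor> = r powr k" using powr_real_of_int'[of r "\<lfloor>k\<rfloor>"] r kf by simp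
      then have "(norm (automorphy A \<tau> powi \<lfloor>k\<rfloor>))\<^sup>2 = (r powr k)\<^sup>2"
        by (simp only: norm_power_int r_def)
      also have "\<dots> = r\<^sup>2 powr k" by (rule powr_square)
      finally show "(norm (chi (A$2$2) * automorphy A \<tau> powi \<lfloor>k\<rfloor>))\<^sup>2 = (norm (automorphy A \<tau>))\<^sup>2 powr k"
        by (simp add: norm_mult chi1 r_def)
      fix f assume "f \<in> modular_forms k N chi"
      then show "f (moebius A \<tau>) = chi (A$2$2) * automorphy A \<tau> powi \<lfloor>k\<rfloor> * f \<tau>"
        using True A \<tau> by (auto simp: modular_forms_def modular_transformation_def)
    qed
  next
    case False
    define n where "n = \<lfloor>2 * k\<rfloor>"
    have "k - 1/2 \<in> \<int>" using k False by blast
    then obtain m where "k - 1/2 = of_int m" by (elim Ints_cases)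
    then have "2 * k = of_int (2 * m + 1)" by simp
    then have n: "of_int n = 2 * k" unfolding n_def by (metis floor_of_int)
    have np: "n > 0" using n k(1) by (metis mult_pos_pos of_int_0_less_iff zero_less_numeral)
    have law: "4 dvd N \<and> f (moebius B z) = chi (B$2$2) * (theta (moebius B z) / theta z) powi n * f z"
      if "f \<in> modular_forms k N chi" "B \<in> Gamma0 N" "Im z > 0" for f B z
      using that False by (auto simp: modular_forms_def modular_transformation_def n_def)
    show ?thesis
    \<comment> \<open>Since \<open>law\<close> includes \<open>4 dvd N\<close>, there are no forms
      at all when N is not divisible by 4, and any multiplier of the right modulus serves.\<close>
    proof (cases "theta \<tau> = 0 \<or> \<not> 4 dvd N")
      case zero: True
      have f0: "f \<tau> = 0 \<and> f (moebius A \<tau>) = 0" if "f \<in> modular_forms k N chi" for f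
      proof -
        have "f \<tau> = 0" using law[OF that Gamma0_one \<tau>] zero np by (auto simp: power_int_0_left_if)
        then show ?thesis using law[OF that A \<tau>] by simp
      qed
      show ?thesis
      proof (rule that[of "of_real (r powr k)"])
        show "(norm (complex_of_real (r powr k)))\<^sup>2 = (norm (automorphy A \<tau>))\<^sup>2 powr k"
          using powr_square[of r k] by (simp add: r_def)
        fix f assume "f \<in> modular_forms k N chi"
        then show "f (moebius A \<tau>) = complex_of_real (r powr k) * f \<tau>" using f0[of f] by simp
      qed
    next
      case nz: False
      define t where "t = norm (theta (moebius A \<tau>) / theta \<tau>)"
      have "int 4 dvd int N" using nz by (simp only: int_dvd_int_iff) simp
      then have A4: "A \<in> Gamma0 4" using A by (auto simp: Gamma0_def intro: dvd_trans)
      have "norm (theta (moebius A \<tau>)) ^ 4 * (Im \<tau> / r\<^sup>2) = norm (theta \<tau>) ^ 4 * Im \<tau>"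
        using theta_invariant_Gamma0_4[OF A4 \<tau>]
        by (simp add: theta_invariant_def Im_moebius[OF Gamma0_SL2[OF A]] r_def)
      then have "norm (theta (moebius A \<tau>)) ^ 4 = norm (theta \<tau>) ^ 4 * r\<^sup>2"
        using \<tau> r by (simp add: field_simps)
      then have t4: "t ^ 4 = r\<^sup>2" using nz by (simp add: t_def norm_divide power_divide)
      then have tpos: "t > 0" using r by (cases "t = 0") (auto simp: t_def)
      show ?thesis
      proof (rule that[of "chi (A$2$2) * (theta (moebius A \<tau>) / theta \<tau>) powi n"])
        have "t powi n = t powr (2 * k)" using powr_real_of_int'[of t n] tpos n by simp
        then have "(norm ((theta (moebius A \<tau>) / theta \<tau>) powi n))\<^sup>2 = (t powr (2 * k))\<^sup>2"
          by (simp only: norm_power_int t_def)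
        also have "t powr (2 * k) = t\<^sup>2 powr k"
          by (simp only: mult_2 powr_add power2_eq_square powr_mult)
        also have "(t\<^sup>2 powr k)\<^sup>2 = (t ^ 4) powr k" unfolding powr_square by (simp flip: power_mult)
        finally show "(norm (chi (A$2$2) * (theta (moebius A \<tau>) / theta \<tau>) powi n))\<^sup>2 = (norm (automorphy A \<tau>))\<^sup>2 powr k"
          by (simp add: norm_mult chi1 t4 r_def)
      qed (use law A \<tau> in blast)
    qed
  qed
qed

lemma invariant_product_Gamma0:
  assumes k: "k > 0" "k \<in> \<int> \<or> k - 1/2 \<in> \<int>" and N: "N \<ge> 1" and chi: "dirichlet_character N chi"
    and f: "f \<in> modular_forms k N chi" and g: "g \<in> modular_forms k N chi"
    and A: "A \<in> Gamma0 N" and \<tau>: "Im \<tau> > 0"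
  shows "invariant_product k f g (moebius A \<tau>) = invariant_product k f g \<tau>"
proof -
  obtain u where u: "(norm u)\<^sup>2 = (norm (automorphy A \<tau>))\<^sup>2 powr k"
      "\<And>f. f \<in> modular_forms k N chi \<Longrightarrow> f (moebius A \<tau>) = u * f \<tau>"
    using modular_multiplier[OF k N chi A \<tau>] by blast
  have nz: "automorphy A \<tau> \<noteq> 0" by (rule automorphy_nonzero[OF Gamma0_SL2[OF A] \<tau>])
  have "invariant_product k f g (moebius A \<tau>) = (u * cnj u) * of_real ((Im \<tau> / (norm (automorphy A \<tau>))\<^sup>2) powr k) * (f \<tau> * cnj (g \<tau>))"
    by (simp add: invariant_product_def u(2)[OF f] u(2)[OF g] Im_moebius[OF Gamma0_SL2[OF A]])
  also have "(Im \<tau> / (norm (automorphy A \<tau>))\<^sup>2) powr k = Im \<tau> powr k / (norm (automorphy A \<tau>))\<^sup>2 powr k"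
    by (rule powr_divide)
  also have "(u * cnj u) * of_real (Im \<tau> powr k / (norm (automorphy A \<tau>))\<^sup>2 powr k) = of_real (Im \<tau> powr k)"
    unfolding complex_norm_square[symmetric] u(1)[symmetric] using nz u(1) by auto
  finally show ?thesis by (simp add: invariant_product_def mult_ac)
qed

text \<open>Only the absolute value of the automorphy factor survives, so the principal branch and
  its failure to be multiplicative in half-integral weight do no harm.\<close>

lemma slash_mult_cnj_slash:
  assumes A: "A \<in> SL2" and \<tau>: "Im \<tau> > 0"
  shows "invariant_product k f g (moebius A \<tau>) = slash f k A \<tau> * cnj (slash g k A \<tau>) * of_real (Im \<tau> powr k)"
proof -
  let ?j = "automorphy A \<tau>"
  have nz: "?j \<noteq> 0" by (rule automorphy_nonzero[OF A \<tau>])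
  have n: "norm (?j powr (- of_real k)) = norm ?j powr (- k)"
    using norm_powr_real_powr'[of "- of_real k" ?j] by simp
  have "(?j powr (- of_real k)) * cnj (?j powr (- of_real k)) = of_real ((norm ?j powr (- k))\<^sup>2)"
    unfolding n[symmetric] complex_norm_square ..
  moreover have "(norm ?j powr (- k))\<^sup>2 * Im \<tau> powr k = (Im \<tau> / (norm ?j)\<^sup>2) powr k"
  proof -
    have "(norm ?j powr (- k))\<^sup>2 = 1 / (norm ?j)\<^sup>2 powr k"
      unfolding powr_square[symmetric] powr_minus by (simp add: power_inverse divide_inverse)
    moreover have "(Im \<tau> / (norm ?j)\<^sup>2) powr k = Im \<tau> powr k / (norm ?j)\<^sup>2 powr k" by (rule powr_divide)
    ultimately show ?thesis by simp
  qed
  ultimately have eq: "(?j powr (- of_real k)) * cnj (?j powr (- of_real k)) * of_real (Im \<tau> powr k) = of_real ((Im \<tau> / (norm ?j)\<^sup>2) powr k)"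
    by (simp only: of_real_mult[symmetric])
  show ?thesis
    unfolding invariant_product_def slash_def Im_moebius[OF A] eq[symmetric]
    by (simp only: complex_cnj_mult mult_ac)
qed

lemma norm_slash_square:
  assumes A: "A \<in> SL2" and \<tau>: "Im \<tau> > 0"
  shows "norm (invariant_product k f f (moebius A \<tau>)) = (norm (slash f k A \<tau>))\<^sup>2 * Im \<tau> powr k"
  unfolding slash_mult_cnj_slash[OF assms] by (simp add: norm_mult power2_eq_square)

section \<open>Moderate growth of modular forms\<close>

lemma continuous_on_moebius: "A \<in> SL2 \<Longrightarrow> continuous_on {\<tau>. Im \<tau> > 0} (moebius A)"
  unfolding moebius_def[abs_def]
  by (intro continuous_intros) (auto simp: automorphy_def[abs_def] intro!: continuous_intros dest!: automorphy_nonzero)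

text \<open>If the lower left entry is nonzero, the modulus of the automorphy factor is at least
  \<open>Im \<tau>\<close>; otherwise the matrix is a translation up to sign and preserves the
  height.\<close>

lemma Im_moebius_le:
  assumes "A \<in> SL2" "Im \<tau> > 0"
  shows "Im (moebius A \<tau>) \<le> max (Im \<tau>) (1 / Im \<tau>)"
proof (cases "A$2$1 = 0")
  case True
  then have "\<bar>A$2$2\<bar> = 1" using assms(1) by (auto simp: SL2_iff zmult_eq_1_iff)
  then have "norm (automorphy A \<tau>) = 1" using True by (simp add: automorphy_def norm_of_int flip: of_int_abs)
  then show ?thesis by (simp add: Im_moebius[OF assms(1)])
next
  case False
  have "1 \<le> \<bar>A$2$1\<bar>" using False by simp
  then have c: "1 \<le> \<bar>real_of_int (A$2$1)\<bar>" by linarith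
  have "Im \<tau> \<le> \<bar>real_of_int (A$2$1)\<bar> * Im \<tau>" using c assms(2) by simp
  also have "\<dots> = \<bar>Im (automorphy A \<tau>)\<bar>" using assms(2) by (simp add: automorphy_def abs_mult)
  also have "\<dots> \<le> norm (automorphy A \<tau>)" by (rule abs_Im_le_cmod)
  finally have "(Im \<tau>)\<^sup>2 \<le> (norm (automorphy A \<tau>))\<^sup>2" using assms(2) by (intro power_mono) auto
  then have "Im \<tau> / (norm (automorphy A \<tau>))\<^sup>2 \<le> Im \<tau> / (Im \<tau>)\<^sup>2"
    using assms(2) automorphy_nonzero[OF assms] by (intro divide_left_mono) auto
  then show ?thesis using assms(2) by (simp add: Im_moebius[OF assms(1)] power2_eq_square)
qed

text \<open>With the coarse bound 1/2 on the height, a point that is too low satisfies |\<sigma>|^2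
  \<le> 1/2, so inversion at least doubles its imaginary part. Induction on the number of doublings
  replaces an extremal argument.\<close>

lemma reduction:
  assumes "Im \<tau> > 0"
  shows "\<exists>A\<in>SL2. \<bar>Re (moebius A \<tau>)\<bar> \<le> 1/2 \<and> Im (moebius A \<tau>) \<ge> 1/2"
proof -
  have translate: "\<exists>A\<in>SL2. \<bar>Re (moebius A \<tau>)\<bar> \<le> 1/2 \<and> Im (moebius A \<tau>) = Im \<tau>" if "Im \<tau> > 0" for \<tau>
  proof -
    define j where "j = - \<lfloor>Re \<tau> + 1/2\<rfloor>"
    have "\<bar>Re \<tau> + of_int j\<bar> \<le> 1/2"
      unfolding j_def abs_le_iff of_int_minus using floor_correct[of "Re \<tau> + 1/2"] by (intro conjI) linarith+
    then show ?thesis by (intro bexI[of _ "Tmat j"]) (auto simp: SL2_Tmat)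
  qed
  have "\<exists>A\<in>SL2. \<bar>Re (moebius A \<tau>)\<bar> \<le> 1/2 \<and> Im (moebius A \<tau>) \<ge> 1/2" if "Im \<tau> > 0" "2 ^ n * Im \<tau> \<ge> 1/2" for n \<tau>
    using that
  proof (induction n arbitrary: \<tau>)
    case 0
    then show ?case using translate[of \<tau>] by auto
  next
    case (Suc n)
    obtain A where A: "A \<in> SL2" "\<bar>Re (moebius A \<tau>)\<bar> \<le> 1/2" "Im (moebius A \<tau>) = Im \<tau>"
      using translate[OF Suc.prems(1)] by blast
    show ?case
    proof (cases "Im \<tau> \<ge> 1/2")
      case True with A show ?thesis by auto
    next
      case False
      define S :: "int^2^2" where "S = vector [vector [0, - 1], vector [1, 0]]"
      have S: "S$1$1 = 0" "S$1$2 = - 1" "S$2$1 = 1" "S$2$2 = 0" by (simp_all add: S_def)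
      have SS: "S \<in> SL2" by (simp add: SL2_iff S)
      define \<sigma> where "\<sigma> = moebius A \<tau>"
      have \<sigma>: "Im \<sigma> > 0" "Im \<sigma> < 1/2" "\<bar>Re \<sigma>\<bar> \<le> 1/2" using A False Suc.prems by (auto simp: \<sigma>_def)
      have "(Re \<sigma>)\<^sup>2 \<le> (1/2)\<^sup>2" "(Im \<sigma>)\<^sup>2 \<le> (1/2)\<^sup>2" using \<sigma> by (auto simp: abs_le_square_iff[symmetric] intro: power_mono)
      then have n: "(norm \<sigma>)\<^sup>2 \<le> 1/2" unfolding cmod_power2 by (simp add: power_divide)
      have nz: "\<sigma> \<noteq> 0" using \<sigma> by auto
      have "Im (moebius S \<sigma>) = Im \<sigma> / (norm \<sigma>)\<^sup>2" by (simp add: Im_moebius[OF SS] automorphy_def S)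
      also have "\<dots> \<ge> Im \<sigma> / (1/2)" using n nz \<sigma>(1) by (intro divide_left_mono) auto
      finally have im: "Im (moebius S \<sigma>) \<ge> 2 * Im \<tau>" using A(3) by (simp add: \<sigma>_def)
      have "2 ^ n * (2 * Im \<tau>) \<le> 2 ^ n * Im (moebius S \<sigma>)" using im by (intro mult_left_mono) auto
      moreover have "2 ^ n * (2 * Im \<tau>) = 2 ^ Suc n * Im \<tau>" by simp
      ultimately have "2 ^ n * Im (moebius S \<sigma>) \<ge> 1/2" using Suc.prems(2) by linarith
      then obtain B where B: "B \<in> SL2" "\<bar>Re (moebius B (moebius S \<sigma>))\<bar> \<le> 1/2" "Im (moebius B (moebius S \<sigma>)) \<ge> 1/2"
        using Suc.IH[of "moebius S \<sigma>"] Im_moebius_pos[OF SS \<sigma>(1)] by blast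
      have "moebius (B ** (S ** A)) \<tau> = moebius B (moebius S \<sigma>)"
        using Suc.prems(1) A(1) B(1) SS by (simp add: moebius_mult SL2_mult \<sigma>_def)
      with B show ?thesis by (intro bexI[of _ "B ** (S ** A)"]) (auto intro!: SL2_mult SS A)
    qed
  qed
  moreover obtain n where "1 / 2 / Im \<tau> < 2 ^ n" using real_arch_pow[of 2 "1 / 2 / Im \<tau>"] by auto
  then have "2 ^ n * Im \<tau> \<ge> 1/2" using assms by (simp add: field_simps)
  ultimately show ?thesis using assms by blast
qed

text \<open>High points are covered by boundedness at i\<infinity>, and the rest of the region is
  compact. Only the norm of the slash is shown to be continuous, so the branch of the power does not
  enter.\<close>

lemma slash_bounded_on_region:
  assumes f: "f \<in> modular_forms k N chi" and A: "A \<in> SL2"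
  shows "\<exists>K. \<forall>\<tau>. \<bar>Re \<tau>\<bar> \<le> 1/2 \<longrightarrow> Im \<tau> \<ge> 1/2 \<longrightarrow> norm (slash f k A \<tau>) \<le> K"
proof -
  have "Bfun (slash f k A) at_i_infinity" using f A by (auto simp: modular_forms_def)
  then obtain K where "\<forall>\<^sub>F \<tau> in at_i_infinity. norm (slash f k A \<tau>) \<le> K" by (auto simp: Bfun_def)
  then obtain Y where Y: "\<And>\<tau>. Im \<tau> \<ge> Y \<Longrightarrow> norm (slash f k A \<tau>) \<le> K"
    unfolding at_i_infinity_def eventually_filtercomap eventually_at_top_linorder by blast
  define Q where "Q = cbox (Complex (-1/2) (1/2)) (Complex (1/2) (max Y (1/2)))"
  have hol: "f holomorphic_on {\<tau>. Im \<tau> > 0}" using f by (simp add: modular_forms_def upper_half_plane_def)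
  have Q: "Q \<subseteq> {\<tau>. Im \<tau> > 0}" by (auto simp: Q_def in_cbox_complex_iff)
  have "continuous_on {\<tau>. Im \<tau> > 0} (\<lambda>\<tau>. norm (automorphy A \<tau>) powr (- k) * norm (f (moebius A \<tau>)))"
  proof (intro continuous_intros continuous_on_compose2[OF holomorphic_on_imp_continuous_on[OF hol] continuous_on_moebius[OF A]])
    show "continuous_on {\<tau>. 0 < Im \<tau>} (automorphy A)" unfolding automorphy_def[abs_def] by (intro continuous_intros)
  qed (use A Im_moebius_pos automorphy_nonzero in auto)
  then have "continuous_on Q (\<lambda>\<tau>. norm (automorphy A \<tau>) powr (- k) * norm (f (moebius A \<tau>)))"
    by (rule continuous_on_subset[OF _ Q])
  then have "bounded ((\<lambda>\<tau>. norm (automorphy A \<tau>) powr (- k) * norm (f (moebius A \<tau>))) ` Q)"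
    by (intro compact_imp_bounded compact_continuous_image) (auto simp: Q_def)
  then obtain L where L: "\<And>\<tau>. \<tau> \<in> Q \<Longrightarrow> norm (norm (automorphy A \<tau>) powr (- k) * norm (f (moebius A \<tau>))) \<le> L"
    unfolding bounded_iff by blast
  have ns: "norm (slash f k A \<tau>) = norm (automorphy A \<tau>) powr (- k) * norm (f (moebius A \<tau>))" for \<tau>
    using norm_powr_real_powr'[of "- of_real k" "automorphy A \<tau>"] by (simp add: slash_def norm_mult)
  show ?thesis
  proof (intro exI[of _ "max K L"] allI impI)
    fix \<tau> assume \<tau>: "\<bar>Re \<tau>\<bar> \<le> 1/2" "Im \<tau> \<ge> 1/2"
    show "norm (slash f k A \<tau>) \<le> max K L"
    proof (cases "Im \<tau> \<ge> Y")
      case True then show ?thesis using Y by (simp add: le_max_iff_disj)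
    next
      case False
      then have "\<tau> \<in> Q" using \<tau> by (auto simp: Q_def in_cbox_complex_iff)
      then have "norm (slash f k A \<tau>) \<le> L" using L unfolding ns by fastforce
      then show ?thesis by simp
    qed
  qed
qed

text \<open>Move \<tau> into the region of \<open>reduction\<close> and decompose the remaining
  matrix into an element of \<open>Gamma0 N\<close> and one of finitely many
  \<open>\<beta> j\<close>. The height of the reduced point is bounded by
  \<open>Im_moebius_le\<close>.\<close>

lemma (in coset_representatives) growth:
  assumes k: "k > 0" "k \<in> \<int> \<or> k - 1/2 \<in> \<int>" and chi: "dirichlet_character N chi"
    and f: "f \<in> modular_forms k N chi"
  obtains K where "K > 0" "\<And>M \<tau>. M \<in> SL2 \<Longrightarrow> Im \<tau> > 0 \<Longrightarrow> norm (invariant_product k f f (moebius M \<tau>)) \<le> K * max (Im \<tau>) (1 / Im \<tau>) powr k"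
proof -
  have "\<forall>j\<in>J. \<exists>K. \<forall>\<tau>. \<bar>Re \<tau>\<bar> \<le> 1/2 \<longrightarrow> Im \<tau> \<ge> 1/2 \<longrightarrow> norm (slash f k (\<beta> j) \<tau>) \<le> K"
    using slash_bounded_on_region[OF f \<beta>_SL2] by blast
  then obtain Kj where Kj: "\<And>j \<tau>. j \<in> J \<Longrightarrow> \<bar>Re \<tau>\<bar> \<le> 1/2 \<Longrightarrow> Im \<tau> \<ge> 1/2 \<Longrightarrow> norm (slash f k (\<beta> j) \<tau>) \<le> Kj j"
    by metis
  define K where "K = 1 + (\<Sum>j\<in>J. (Kj j)\<^sup>2)"
  have K: "K > 0" unfolding K_def by (intro add_pos_nonneg sum_nonneg) auto
  show ?thesis
  proof (rule that[OF K])
    fix M \<tau> assume M: "M \<in> SL2" and \<tau>: "Im \<tau> > 0"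
    obtain A where A: "A \<in> SL2" "\<bar>Re (moebius A \<tau>)\<bar> \<le> 1/2" "Im (moebius A \<tau>) \<ge> 1/2" using reduction[OF \<tau>] by blast
    define \<sigma> where "\<sigma> = moebius A \<tau>"
    have \<sigma>: "Im \<sigma> > 0" using A by (simp add: \<sigma>_def)
    obtain j where j: "j \<in> J" "(M ** adj A) ** adj (\<beta> j) \<in> Gamma0 N" using coset_exists[OF SL2_mult[OF M SL2_adj[OF A(1)]]] by blast
    have B: "\<beta> j \<in> SL2" by (rule \<beta>_SL2[OF j(1)])
    have "moebius M \<tau> = moebius ((M ** adj A) ** adj (\<beta> j)) (moebius (\<beta> j) \<sigma>)"
    proof -
      have "moebius ((M ** adj A) ** adj (\<beta> j)) (moebius (\<beta> j) \<sigma>) = moebius (M ** adj A) (moebius (adj (\<beta> j)) (moebius (\<beta> j) \<sigma>))"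
        by (rule moebius_mult[OF SL2_mult[OF M SL2_adj[OF A(1)]] SL2_adj[OF B] Im_moebius_pos[OF B \<sigma>]])
      also have "\<dots> = moebius M (moebius (adj A) \<sigma>)"
        unfolding moebius_adj_cancel(1)[OF B \<sigma>] by (rule moebius_mult[OF M SL2_adj[OF A(1)] \<sigma>])
      also have "moebius (adj A) \<sigma> = \<tau>" unfolding \<sigma>_def by (rule moebius_adj_cancel(1)[OF A(1) \<tau>])
      finally show ?thesis ..
    qed
    then have "norm (invariant_product k f f (moebius M \<tau>)) = norm (invariant_product k f f (moebius (\<beta> j) \<sigma>))"
      using invariant_product_Gamma0[OF k N chi f f j(2) Im_moebius_pos[OF B \<sigma>]] by simp
    also have "\<dots> = (norm (slash f k (\<beta> j) \<sigma>))\<^sup>2 * Im \<sigma> powr k" by (rule norm_slash_square[OF B \<sigma>])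
    also have "\<dots> \<le> K * max (Im \<tau>) (1 / Im \<tau>) powr k"
    proof (rule mult_mono)
      have "(norm (slash f k (\<beta> j) \<sigma>))\<^sup>2 \<le> (Kj j)\<^sup>2" using Kj[OF j(1)] A unfolding \<sigma>_def by (intro power_mono) auto
      also have "\<dots> \<le> (\<Sum>j\<in>J. (Kj j)\<^sup>2)" using finite_J j(1) by (intro member_le_sum) auto
      finally show "(norm (slash f k (\<beta> j) \<sigma>))\<^sup>2 \<le> K" by (simp add: K_def)
      show "Im \<sigma> powr k \<le> max (Im \<tau>) (1 / Im \<tau>) powr k"
        using Im_moebius_le[OF A(1) \<tau>] \<sigma> k by (intro powr_mono2) (auto simp: \<sigma>_def)
    qed (use K in auto)
    finally show "norm (invariant_product k f f (moebius M \<tau>)) \<le> K * max (Im \<tau>) (1 / Im \<tau>) powr k" .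
  qed
qed

subsection \<open>The hyperbolic measure\<close>

definition hyperbolic_measure :: "complex measure" where
  "hyperbolic_measure = density lborel (\<lambda>\<tau>. ennreal (indicator upper_half_plane \<tau> / (Im \<tau>)\<^sup>2))"

text \<open>The change of variables theorem is formulated for \<open>real^'n\<close>; this
  identification carries integrals over the complex plane there.\<close>

definition vec_complex :: "real^2 \<Rightarrow> complex" where
  "vec_complex v = Complex (v$1) (v$2)"

definition complex_vec :: "complex \<Rightarrow> real^2" where
  "complex_vec z = vector [Re z, Im z]"

lemma complex_vec_entries [simp]: "complex_vec z$1 = Re z" "complex_vec z$2 = Im z"
  by (simp_all add: complex_vec_def)

lemma vec_complex_Re_Im [simp]: "Re (vec_complex v) = v$1" "Im (vec_complex v) = v$2"
  by (simp_all add: vec_complex_def)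

lemma vec_complex_inverse [simp]: "complex_vec (vec_complex v) = v" "vec_complex (complex_vec z) = z"
  by (auto simp: vec_eq_iff forall_2 complex_eq_iff)

lemma vec_complex_eq_iff [simp]: "vec_complex v = vec_complex w \<longleftrightarrow> v = w" "complex_vec z = complex_vec z' \<longleftrightarrow> z = z'"
  by (metis vec_complex_inverse)+

lemma linear_vec_complex: "linear vec_complex"
  by (rule linearI) (auto simp: complex_eq_iff)

lemma linear_complex_vec: "linear complex_vec"
  by (rule linearI) (auto simp: vec_eq_iff forall_2)

lemma borel_vec_complex [measurable]: "vec_complex \<in> borel \<rightarrow>\<^sub>M borel"
  using linear_vec_complex by (intro borel_measurable_continuous_onI linear_continuous_on) (simp add: linear_conv_bounded_linear)

lemma prod_Basis_2: "(\<Prod>b\<in>Basis. (x::real^2) \<bullet> b) = x$1 * x$2"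
proof -
  have neq: "axis 1 1 \<noteq> (axis 2 1 :: real^2)" by (simp add: axis_eq_axis)
  have "(Basis :: (real^2) set) = {axis 1 1, axis 2 1}"
    by (auto simp: Basis_vec_def UNIV_2)
  then have "(\<Prod>b\<in>Basis. x \<bullet> b) = (\<Prod>b\<in>{axis 1 1, axis 2 1}. x \<bullet> b)"
    by (rule_tac arg_cong)
  also have "\<dots> = x \<bullet> axis 1 1 * (x \<bullet> axis 2 1)"
    using neq by simp
  finally show ?thesis by (simp add: inner_axis)
qed

lemma lborel_complex: "(lborel :: complex measure) = distr lborel borel vec_complex"
proof (rule lborel_eqI)
  fix l u :: complex
  assume le: "\<And>b. b \<in> Basis \<Longrightarrow> l \<bullet> b \<le> u \<bullet> b"
  have lu: "Re l \<le> Re u" "Im l \<le> Im u" using le[of 1] le[of \<i>] by (auto simp: Basis_complex_def)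
  have "vec_complex -` box l u = box (complex_vec l) (complex_vec u)"
    by (auto simp: in_box_complex_iff mem_box_cart forall_2)
  then have "emeasure (distr lborel borel vec_complex) (box l u) = emeasure lborel (box (complex_vec l) (complex_vec u))"
    by (simp add: emeasure_distr)
  also have "\<dots> = (\<Prod>b\<in>Basis. (complex_vec u - complex_vec l) \<bullet> b)"
  proof (rule emeasure_lborel_box)
    fix b :: "real^2" assume "b \<in> Basis"
    then have "b = axis 1 1 \<or> b = axis 2 1" by (auto simp: Basis_vec_def UNIV_2)
    then show "complex_vec l \<bullet> b \<le> complex_vec u \<bullet> b" using lu by (auto simp: inner_axis)
  qed
  also have "\<dots> = (\<Prod>b\<in>Basis. (u - l) \<bullet> b)"
    unfolding prod_Basis_2 by (simp add: Basis_complex_def)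
  finally show "emeasure (distr lborel borel vec_complex) (box l u) = (\<Prod>b\<in>Basis. (u - l) \<bullet> b)" .
qed simp

text \<open>The real Jacobian of a holomorphic map is the squared modulus of its complex
  derivative.\<close>

lemma det_complex_multiplication:
  "det (matrix (\<lambda>h. complex_vec (w * vec_complex h))) = (norm w)\<^sup>2"
  unfolding cmod_power2 by (simp add: det_2 matrix_def axis_def power2_eq_square)

lemma nn_integral_absolutely_integrable:
  fixes q :: "real^2 \<Rightarrow> real"
  assumes [measurable]: "q \<in> borel_measurable borel" and S: "S \<in> sets borel" and nonneg: "\<And>x. x \<in> S \<Longrightarrow> q x \<ge> 0"
  shows "q absolutely_integrable_on S \<longleftrightarrow> (\<integral>\<^sup>+x. ennreal (indicator S x * q x) \<partial>lborel) < \<infinity>"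
    and "q absolutely_integrable_on S \<Longrightarrow> (\<integral>\<^sup>+x. ennreal (indicator S x * q x) \<partial>lborel) = ennreal (integral S q)"
proof -
  note S[measurable]
  have m: "(\<lambda>x. indicator S x *\<^sub>R q x) \<in> borel_measurable lborel" by simp
  have nn: "indicator S x *\<^sub>R q x \<ge> 0" for x using nonneg by (simp add: indicator_def)
  have iff: "q absolutely_integrable_on S \<longleftrightarrow> integrable lborel (\<lambda>x. indicator S x *\<^sub>R q x)"
    unfolding set_integrable_def by (rule integrable_completion[OF m])
  then show "q absolutely_integrable_on S \<longleftrightarrow> (\<integral>\<^sup>+x. ennreal (indicator S x * q x) \<partial>lborel) < \<infinity>"
    unfolding integrable_iff_bounded using m nn by simp
  assume a: "q absolutely_integrable_on S"
  then have "set_integrable lborel S q" using iff by (simp add: set_integrable_def)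
  from set_borel_integral_eq_integral(2)[OF this] have "(LINT x|lborel. indicator S x *\<^sub>R q x) = integral S q"
    by (simp add: set_lebesgue_integral_def)
  moreover have "(\<integral>\<^sup>+x. ennreal (indicator S x *\<^sub>R q x) \<partial>lborel) = ennreal (LINT x|lborel. indicator S x *\<^sub>R q x)"
    using a iff nn by (intro nn_integral_eq_integral) auto
  ultimately show "(\<integral>\<^sup>+x. ennreal (indicator S x * q x) \<partial>lborel) = ennreal (integral S q)" by simp
qed

text \<open>The change of variables theorem also takes integrands with values in
  \<open>real^'n\<close>; vectors with one component carry the real-valued ones.\<close>

lemma absolutely_integrable_vec1:
  fixes q :: "real^2 \<Rightarrow> real"
  shows "(\<lambda>x. vec (q x) :: real^1) absolutely_integrable_on S \<longleftrightarrow> q absolutely_integrable_on S"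
    and "q absolutely_integrable_on S \<Longrightarrow> integral S (\<lambda>x. vec (q x) :: real^1) = vec (integral S q)"
proof -
  have lv: "bounded_linear (vec :: real \<Rightarrow> real^1)"
    unfolding linear_conv_bounded_linear[symmetric] by (rule linearI) (simp_all add: vec_eq_iff)
  have 1: "(\<lambda>x. vec (q x) :: real^1) absolutely_integrable_on S" if "q absolutely_integrable_on S"
    using absolutely_integrable_linear[OF that lv] by (simp add: o_def)
  moreover have "q absolutely_integrable_on S" if "(\<lambda>x. vec (q x) :: real^1) absolutely_integrable_on S"
    using absolutely_integrable_linear[OF that bounded_linear_vec_nth[of 1]] by (simp add: o_def)
  ultimately show "(\<lambda>x. vec (q x) :: real^1) absolutely_integrable_on S \<longleftrightarrow> q absolutely_integrable_on S" by blast
  assume "q absolutely_integrable_on S"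
  then have "q integrable_on S" by (rule set_lebesgue_integral_eq_integral(1))
  from integral_linear[OF this lv] show "integral S (\<lambda>x. vec (q x) :: real^1) = vec (integral S q)" by (simp add: o_def)
qed

section \<open>Invariance of the hyperbolic measure under the modular group\<close>

lemma borel_moebius [measurable]: "moebius A \<in> borel \<rightarrow>\<^sub>M borel"
  unfolding moebius_def[abs_def] automorphy_def[abs_def] by measurable

lemma borel_upper_half_plane [measurable]: "upper_half_plane \<in> sets borel"
  unfolding upper_half_plane_def by (rule borel_open[OF open_upper_half_plane])

lemma moebius_has_derivative:
  assumes "A \<in> SL2" "Im \<tau> > 0"
  shows "(moebius A has_field_derivative 1 / (automorphy A \<tau>)\<^sup>2) (at \<tau>)"
proof -
  have nz: "automorphy A \<tau> \<noteq> 0" by (rule automorphy_nonzero[OF assms])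
  have det: "of_int (A$1$1) * of_int (A$2$2) - of_int (A$1$2) * of_int (A$2$1) = (1::complex)"
    using assms(1) unfolding SL2_iff by (metis of_int_1 of_int_diff of_int_mult)
  have "(moebius A has_field_derivative (of_int (A$1$1) * automorphy A \<tau> - (of_int (A$1$1) * \<tau> + of_int (A$1$2)) * of_int (A$2$1)) / (automorphy A \<tau> * automorphy A \<tau>)) (at \<tau>)"
    unfolding moebius_def[abs_def] using nz by (auto intro!: derivative_eq_intros simp: automorphy_def[abs_def])
  moreover have "of_int (A$1$1) * automorphy A \<tau> - (of_int (A$1$1) * \<tau> + of_int (A$1$2)) * of_int (A$2$1) = of_int (A$1$1) * of_int (A$2$2) - of_int (A$1$2) * of_int (A$2$1)"
    by (simp add: automorphy_def algebra_simps)
  ultimately show ?thesis by (simp add: det power2_eq_square)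
qed

text \<open>The Jacobian contributes |c \<tau> + d|^(-4), and the density y^(-2) changes by the
  inverse of this factor.\<close>

lemma nn_integral_moebius_vec:
  assumes A: "A \<in> SL2" and E: "E \<in> sets borel"
  defines "S \<equiv> {v :: real^2. v$2 > 0}"
  shows "(\<integral>\<^sup>+v. ennreal (indicator S v * (indicator E (moebius A (vec_complex v)) / (v$2)\<^sup>2)) \<partial>lborel)
    = (\<integral>\<^sup>+v. ennreal (indicator S v * (indicator E (vec_complex v) / (v$2)\<^sup>2)) \<partial>lborel)"
proof -
  note E[measurable]
  have Sb[measurable]: "S \<in> sets borel" unfolding S_def by (simp add: open_halfspace_component_gt_cart borel_open)
  define g where "g = (\<lambda>v. complex_vec (moebius A (vec_complex v)))"
  define g' where "g' = (\<lambda>v h. complex_vec (1 / (automorphy A (vec_complex v))\<^sup>2 * vec_complex h))"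
  let ?q = "\<lambda>v. indicator E (vec_complex v) / (v$2)\<^sup>2 :: real"
  let ?q1 = "\<lambda>v. indicator E (moebius A (vec_complex v)) / (v$2)\<^sup>2 :: real"
  have q1: "\<bar>det (matrix (g' v))\<bar> *\<^sub>R (vec (?q (g v)) :: real^1) = vec (?q1 v)" if "v \<in> S" for v
  proof -
    have v: "Im (vec_complex v) > 0" using that by (simp add: S_def)
    define j where "j = norm (automorphy A (vec_complex v))"
    have j: "j > 0" using automorphy_nonzero[OF A v] by (simp add: j_def)
    have "\<bar>det (matrix (g' v))\<bar> = (1 / j\<^sup>2)\<^sup>2"
      unfolding g'_def det_complex_multiplication by (simp add: norm_divide norm_power j_def)
    moreover have "g v$2 = v$2 / j\<^sup>2" by (simp add: g_def Im_moebius[OF A] j_def)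
    moreover have "vec_complex (g v) = moebius A (vec_complex v)" by (simp add: g_def)
    moreover have "(1 / J)\<^sup>2 * (X / (y / J)\<^sup>2) = X / y\<^sup>2" if "J > 0" for J X y :: real
      using that by (simp add: power_divide)
    ultimately have "\<bar>det (matrix (g' v))\<bar> * ?q (g v) = ?q1 v"
      using j by (metis zero_less_power)
    then show ?thesis by (simp add: vec_eq_iff)
  qed
  have inj: "inj_on g S"
  proof (rule inj_onI)
    fix v w assume vw: "v \<in> S" "w \<in> S" "g v = g w"
    then have "moebius A (vec_complex v) = moebius A (vec_complex w)" by (simp add: g_def)
    moreover have "moebius (adj A) (moebius A (vec_complex v)) = vec_complex v" "moebius (adj A) (moebius A (vec_complex w)) = vec_complex w"
      using moebius_adj_cancel(1)[OF A] vw by (simp_all add: S_def)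
    ultimately have "vec_complex v = vec_complex w" by metis
    then show "v = w" by simp
  qed
  have im: "g ` S = S"
  proof (intro equalityI subsetI)
    fix v assume "v \<in> S"
    then have v: "Im (vec_complex v) > 0" by (simp add: S_def)
    let ?w = "complex_vec (moebius (adj A) (vec_complex v))"
    have "g ?w = v" by (simp add: g_def moebius_adj_cancel(2)[OF A v])
    moreover have "?w \<in> S" using Im_moebius_pos[OF SL2_adj[OF A] v] by (simp add: S_def)
    ultimately show "v \<in> g ` S" by (metis imageI)
  next
    fix v assume "v \<in> g ` S"
    then show "v \<in> S" using Im_moebius_pos[OF A] by (auto simp: g_def S_def)
  qed
  have der: "(g has_derivative g' v) (at v within S)" if "v \<in> S" for v
  proof -
    have v: "Im (vec_complex v) > 0" using that by (simp add: S_def)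
    have 1: "(vec_complex has_derivative vec_complex) (at v within S)"
      using linear_vec_complex by (simp add: linear_imp_has_derivative)
    have 2: "(moebius A has_derivative (\<lambda>h. 1 / (automorphy A (vec_complex v))\<^sup>2 * h)) (at (vec_complex v))"
      using moebius_has_derivative[OF A v] unfolding has_field_derivative_def .
    have 3: "(complex_vec has_derivative complex_vec) (at x)" for x
      using linear_complex_vec by (simp add: linear_imp_has_derivative)
    from has_derivative_compose[OF has_derivative_compose[OF 1 2] 3]
    show ?thesis by (simp add: g_def g'_def)
  qed
  have cov: "(\<lambda>v. vec (?q1 v) :: real^1) absolutely_integrable_on S \<and> integral S (\<lambda>v. vec (?q1 v) :: real^1) = b
    \<longleftrightarrow> (\<lambda>v. vec (?q v) :: real^1) absolutely_integrable_on S \<and> integral S (\<lambda>v. vec (?q v) :: real^1) = b" for b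
  proof -
    let ?L = "\<lambda>v. \<bar>det (matrix (g' v))\<bar> *\<^sub>R (vec (?q (g v)) :: real^1)"
    have Sl: "S \<in> sets lebesgue" using sets_completionI_sets[of S lborel] Sb by simp
    note cv = has_absolute_integral_change_of_variables[OF Sl der inj, of "\<lambda>v. vec (?q v) :: real^1" b, unfolded im]
    have 1: "?L absolutely_integrable_on S \<longleftrightarrow> (\<lambda>v. vec (?q1 v) :: real^1) absolutely_integrable_on S"
      by (rule set_integrable_cong[OF refl refl q1])
    have 2: "integral S ?L = integral S (\<lambda>v. vec (?q1 v) :: real^1)"
      by (rule Henstock_Kurzweil_Integration.integral_cong[OF q1])
    show ?thesis using cv unfolding 1 2 .
  qed
  have qm: "?q \<in> borel_measurable borel" "?q1 \<in> borel_measurable borel"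
    by (measurable; simp)+
  note n = nn_integral_absolutely_integrable[OF qm(1) Sb] nn_integral_absolutely_integrable[OF qm(2) Sb]
  show ?thesis
  proof (cases "?q absolutely_integrable_on S")
    case True
    then have "?q1 absolutely_integrable_on S" "integral S ?q1 = integral S ?q"
      using cov[of "vec (integral S ?q)"] absolutely_integrable_vec1[where q = "?q" and S = S] absolutely_integrable_vec1[where q = "?q1" and S = S]
      by (auto simp: vec_eq_iff)
    with True show ?thesis using n by simp
  next
    \<comment> \<open>Change of variables transfers absolute integrability in both directions; when
      it fails, both nonnegative integrals are infinite and hence equal.\<close>
    case False
    then have "\<not> ?q1 absolutely_integrable_on S"
      using cov absolutely_integrable_vec1(1)[where q = "?q" and S = S] absolutely_integrable_vec1(1)[where q = "?q1" and S = S] by blast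
    with False n(1,3) show ?thesis by (simp add: top.not_eq_extremum[symmetric])
  qed
qed

lemma emeasure_hyperbolic:
  assumes [measurable]: "E \<in> sets borel"
  shows "emeasure hyperbolic_measure E = (\<integral>\<^sup>+v. ennreal (indicator {v :: real^2. v$2 > 0} v * (indicator E (vec_complex v) / (v$2)\<^sup>2)) \<partial>lborel)"
proof -
  have "emeasure hyperbolic_measure E = (\<integral>\<^sup>+\<tau>. ennreal (indicator upper_half_plane \<tau> / (Im \<tau>)\<^sup>2) * indicator E \<tau> \<partial>lborel)"
    unfolding hyperbolic_measure_def by (rule emeasure_density) auto
  also have "\<dots> = (\<integral>\<^sup>+v. ennreal (indicator upper_half_plane (vec_complex v) / (Im (vec_complex v))\<^sup>2) * indicator E (vec_complex v) \<partial>lborel)"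
    by (subst lborel_complex, subst nn_integral_distr) auto
  also have "\<dots> = (\<integral>\<^sup>+v. ennreal (indicator {v :: real^2. v$2 > 0} v * (indicator E (vec_complex v) / (v$2)\<^sup>2)) \<partial>lborel)"
    by (rule nn_integral_cong) (auto simp: indicator_def)
  finally show ?thesis .
qed

lemma sets_hyperbolic [simp, measurable_cong]: "sets hyperbolic_measure = sets borel"
  by (simp add: hyperbolic_measure_def)

lemma space_hyperbolic [simp]: "space hyperbolic_measure = UNIV"
  by (simp add: hyperbolic_measure_def)

lemma distr_hyperbolic_moebius:
  assumes A: "A \<in> SL2"
  shows "distr hyperbolic_measure borel (moebius A) = hyperbolic_measure"
proof (rule measure_eqI)
  fix E assume "E \<in> sets (distr hyperbolic_measure borel (moebius A))"
  then have E[measurable]: "E \<in> sets borel" by simp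
  have pre: "moebius A -` E \<in> sets borel" using measurable_sets[OF borel_moebius E, of A] by simp
  have "emeasure (distr hyperbolic_measure borel (moebius A)) E = emeasure hyperbolic_measure (moebius A -` E)"
    by (subst emeasure_distr) auto
  also have "\<dots> = emeasure hyperbolic_measure E"
    unfolding emeasure_hyperbolic[OF pre] emeasure_hyperbolic[OF E] nn_integral_moebius_vec[OF A E, symmetric]
    by (simp add: indicator_vimage)
  finally show "emeasure (distr hyperbolic_measure borel (moebius A)) E = emeasure hyperbolic_measure E" .
qed simp

lemma nn_integral_hyperbolic_moebius:
  assumes "A \<in> SL2" "h \<in> borel_measurable borel"
  shows "(\<integral>\<^sup>+\<tau>. h (moebius A \<tau>) \<partial>hyperbolic_measure) = (\<integral>\<^sup>+\<tau>. h \<tau> \<partial>hyperbolic_measure)"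
  using nn_integral_distr[of "moebius A" hyperbolic_measure borel h] assms
  by (simp add: distr_hyperbolic_moebius)

lemma AE_hyperbolic_upper: "AE \<tau> in hyperbolic_measure. Im \<tau> > 0"
  unfolding hyperbolic_measure_def by (subst AE_density) (auto simp: indicator_def)

lemma sigma_finite_hyperbolic: "sigma_finite_measure hyperbolic_measure"
  unfolding hyperbolic_measure_def
  by (subst sigma_finite_measure.sigma_finite_iff_density_finite[OF sigma_finite_lborel]) auto

subsection \<open>Unfolding\<close>

lemma countable_matrices: "countable (X :: (int^2^2) set)"
proof -
  have "inj (\<lambda>A :: int^2^2. (A$1$1, A$1$2, A$2$1, A$2$2))"
    by (rule injI) (auto intro: matrix_2_eqI)
  then have "countable (UNIV :: (int^2^2) set)"
    by (rule countable_image_inj_on[rotated]) (rule countableI_type)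
  then show ?thesis by (rule countable_subset[rotated]) auto
qed

lemma strip_kernel_measurable [measurable]: "strip_kernel \<in> borel_measurable borel"
  unfolding strip_kernel_def[abs_def] by measurable

locale unfolding_setup = coset_representatives +
  fixes D :: "complex set"
  assumes D: "fundamental_domain (Gamma0 N) D"
begin

lemma D_measurable [measurable]: "D \<in> sets borel"
  and D_upper: "D \<subseteq> upper_half_plane"
  using D by (auto simp: fundamental_domain_def)

definition domain_measure :: "complex measure" where
  "domain_measure = density lborel (\<lambda>\<tau>. ennreal (indicator D \<tau> / (Im \<tau>)\<^sup>2))"

lemma sets_domain [simp, measurable_cong]: "sets domain_measure = sets borel"
  and space_domain [simp]: "space domain_measure = UNIV"
  by (simp_all add: domain_measure_def)

lemma sigma_finite_domain: "sigma_finite_measure domain_measure"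
  unfolding domain_measure_def
  by (subst sigma_finite_measure.sigma_finite_iff_density_finite[OF sigma_finite_lborel]) auto

lemma AE_domain: "AE \<tau> in domain_measure. \<tau> \<in> D"
  unfolding domain_measure_def by (subst AE_density) (auto simp: indicator_def)

lemma nn_integral_domain:
  assumes [measurable]: "h \<in> borel_measurable borel"
  shows "(\<integral>\<^sup>+\<tau>. h \<tau> \<partial>domain_measure) = (\<integral>\<^sup>+\<tau>. indicator D \<tau> * h \<tau> \<partial>hyperbolic_measure)"
  unfolding domain_measure_def hyperbolic_measure_def
  by (subst (1 2) nn_integral_density) (use D_upper in \<open>auto simp: indicator_def intro!: nn_integral_cong\<close>)

text \<open>Some \<open>A0\<close> moves the point into \<open>D\<close>, and outside the overlaps
  of translates any other element doing so is \<open>A0\<close> or its negative. The number is 2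
  because \<open>Gamma0 N\<close> contains -1.\<close>

lemma AE_translate_count:
  assumes B: "B \<in> SL2"
  shows "AE \<sigma> in hyperbolic_measure. (\<integral>\<^sup>+\<delta>. indicator D (moebius (adj \<delta> ** B) \<sigma>) \<partial>count_space (Gamma0 N)) = 2"
proof -
  define Z where "Z = (\<Union>A\<in>Gamma0 N - {mat 1, - mat 1}. {\<tau>\<in>D. moebius A \<tau> \<in> D})"
  have "Z \<in> null_sets lborel"
    unfolding Z_def using D by (intro null_sets_UN' countable_matrices) (auto simp: fundamental_domain_def)
  then have "AE \<sigma> in lborel. \<sigma> \<notin> Z" by (rule AE_not_in)
  then have Z: "AE \<sigma> in hyperbolic_measure. \<sigma> \<notin> Z"
    unfolding hyperbolic_measure_def by (subst AE_density) auto
  have Zb: "Z \<in> sets borel" using \<open>Z \<in> null_sets lborel\<close> by auto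
  have inv: "AE \<sigma> in hyperbolic_measure. P (moebius A \<sigma>)" if "AE \<sigma> in hyperbolic_measure. P \<sigma>" "A \<in> SL2" "{\<sigma>. P \<sigma>} \<in> sets borel" for P A
  proof -
    have "AE \<sigma> in distr hyperbolic_measure borel (moebius A). P \<sigma>"
      unfolding distr_hyperbolic_moebius[OF that(2)] by (rule that(1))
    then show ?thesis by (subst (asm) AE_distr_iff) (use that(3) in auto)
  qed
  \<comment> \<open>The whole orbit has to avoid the overlaps. This excludes only a null set, since
    the group is countable and each Moebius map preserves the measure.\<close>
  have "AE \<sigma> in hyperbolic_measure. \<forall>A\<in>Gamma0 N. moebius A \<sigma> \<notin> Z"
  proof (subst AE_ball_countable)
    show "\<forall>A\<in>Gamma0 N. AE \<sigma> in hyperbolic_measure. moebius A \<sigma> \<notin> Z"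
    proof
      fix A assume "A \<in> Gamma0 N"
      moreover have "{\<sigma>. \<sigma> \<notin> Z} \<in> sets borel" using Zb by (simp add: Collect_neg_eq Compl_in_sets_lebesgue sets.compl_sets borel_comp)
      ultimately show "AE \<sigma> in hyperbolic_measure. moebius A \<sigma> \<notin> Z" by (intro inv Z) (auto intro: Gamma0_SL2)
    qed
  qed (rule countable_matrices)
  then have "AE \<sigma> in hyperbolic_measure. (\<forall>A\<in>Gamma0 N. moebius A \<sigma> \<notin> Z) \<and> Im \<sigma> > 0"
    using AE_hyperbolic_upper by (rule AE_conjI)
  then have "AE \<sigma> in hyperbolic_measure. (\<forall>A\<in>Gamma0 N. moebius A (moebius B \<sigma>) \<notin> Z) \<and> Im (moebius B \<sigma>) > 0"
  proof (rule inv[OF _ B])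
    have "{\<sigma>. (\<forall>A\<in>Gamma0 N. moebius A \<sigma> \<notin> Z) \<and> Im \<sigma> > 0} = (\<Inter>A\<in>Gamma0 N. moebius A -` (- Z)) \<inter> {\<sigma>. Im \<sigma> > 0}" by auto
    also have "\<dots> \<in> sets borel"
    proof (intro sets.Int sets.countable_INT')
      show "(\<lambda>A. moebius A -` (- Z)) ` Gamma0 N \<subseteq> sets borel"
        using measurable_sets[OF borel_moebius, of "- Z"] Zb by (auto simp: borel_comp)
      show "{\<sigma>. Im \<sigma> > 0} \<in> sets borel" by (rule borel_open[OF open_upper_half_plane])
    qed (use Gamma0_one countable_matrices in auto)
    finally show "{\<sigma>. (\<forall>A\<in>Gamma0 N. moebius A \<sigma> \<notin> Z) \<and> Im \<sigma> > 0} \<in> sets borel" .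
  qed
  with AE_hyperbolic_upper show ?thesis
  proof eventually_elim
    case (elim \<sigma>)
    define s where "s = moebius B \<sigma>"
    have s: "Im s > 0" using elim by (simp add: s_def)
    have "s \<in> upper_half_plane" using s by simp
    then have "\<exists>A\<in>Gamma0 N. moebius A s \<in> D" using D unfolding fundamental_domain_def by blast
    then obtain A0 where A0: "A0 \<in> Gamma0 N" "moebius A0 s \<in> D" by blast
    have A0S: "A0 \<in> SL2" using A0 Gamma0_SL2 by blast
    have mB: "moebius (adj \<delta> ** B) \<sigma> = moebius (adj \<delta>) s" if "\<delta> \<in> Gamma0 N" for \<delta>
      unfolding s_def using elim(1) by (intro moebius_mult SL2_adj B Gamma0_SL2[OF that])
    have "{\<delta> \<in> Gamma0 N. moebius (adj \<delta> ** B) \<sigma> \<in> D} = {adj A0, - adj A0}"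
    proof (intro equalityI subsetI)
      fix \<delta> assume "\<delta> \<in> {\<delta> \<in> Gamma0 N. moebius (adj \<delta> ** B) \<sigma> \<in> D}"
      then have \<delta>: "\<delta> \<in> Gamma0 N" "moebius (adj \<delta>) s \<in> D" using mB by auto
      have dS: "\<delta> \<in> SL2" using \<delta> Gamma0_SL2 by blast
      let ?M = "adj \<delta> ** adj A0"
      have M: "?M \<in> Gamma0 N" by (intro Gamma0_mult Gamma0_adj \<delta> A0)
      have "moebius ?M (moebius A0 s) = moebius (adj \<delta>) (moebius (adj A0) (moebius A0 s))"
        by (rule moebius_mult) (use dS A0S s in \<open>auto intro: SL2_adj Im_moebius_pos\<close>)
      then have "moebius ?M (moebius A0 s) \<in> D" using \<delta>(2) by (simp add: moebius_adj_cancel(1)[OF A0S s])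
      moreover have "moebius A0 s \<notin> Z" using elim(2) A0(1) unfolding s_def by blast
      ultimately have "?M = mat 1 \<or> ?M = - mat 1" using A0(2) M unfolding Z_def by blast
      moreover have "adj \<delta> = ?M ** A0" by (rule adj_cancel_right(2)[OF A0S, symmetric])
      moreover have "(- mat 1) ** A0 = - A0" by (rule matrix_2_eqI) auto
      ultimately have "adj \<delta> = A0 \<or> adj \<delta> = - A0" by auto
      moreover have "adj (- A0) = - adj A0" by (rule matrix_2_eqI) auto
      ultimately have "\<delta> = adj A0 \<or> \<delta> = - adj A0" by (metis adj_adj)
      then show "\<delta> \<in> {adj A0, - adj A0}" by simp
    next
      have m: "moebius (adj (- adj A0)) s = moebius A0 s"
      proof -
        have "adj (- adj A0) = - A0" by (rule matrix_2_eqI) auto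
        then show ?thesis by simp
      qed
      fix \<delta> assume "\<delta> \<in> {adj A0, - adj A0}"
      then have "\<delta> \<in> Gamma0 N" "moebius (adj \<delta>) s = moebius A0 s"
        using A0 m by (auto simp: Gamma0_adj Gamma0_uminus)
      then show "\<delta> \<in> {\<delta> \<in> Gamma0 N. moebius (adj \<delta> ** B) \<sigma> \<in> D}"
        using A0 mB[of \<delta>] by simp
    qed
    moreover have "adj A0 \<noteq> - adj A0"
    proof
      assume eq: "adj A0 = - adj A0"
      have "A0$2$2 = - (A0$2$2)" "A0$1$2 = - (A0$1$2)"
        using arg_cong[OF eq, of "\<lambda>M. M$1$1"] arg_cong[OF eq, of "\<lambda>M. M$1$2"] by auto
      then show False using A0S by (simp add: SL2_iff)
    qed
    ultimately have card: "card {\<delta> \<in> Gamma0 N. moebius (adj \<delta> ** B) \<sigma> \<in> D} = 2" "finite {\<delta> \<in> Gamma0 N. moebius (adj \<delta> ** B) \<sigma> \<in> D}"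
      by simp_all
    have "(\<integral>\<^sup>+\<delta>. indicator D (moebius (adj \<delta> ** B) \<sigma>) \<partial>count_space (Gamma0 N)) =
      (\<integral>\<^sup>+\<delta>. indicator {\<delta> \<in> Gamma0 N. moebius (adj \<delta> ** B) \<sigma> \<in> D} \<delta> \<partial>count_space (Gamma0 N))"
      by (rule nn_integral_cong) (auto simp: indicator_def)
    also have "\<dots> = emeasure (count_space (Gamma0 N)) {\<delta> \<in> Gamma0 N. moebius (adj \<delta> ** B) \<sigma> \<in> D}"
      by (rule nn_integral_indicator) auto
    also have "\<dots> = 2" using card by (subst emeasure_count_space_finite) auto
    finally show ?case .
  qed
qed

text \<open>Defined through the inverse of \<open>A\<close>, so that
  \<open>\<beta> (coset_index A) ** A\<close> lies in \<open>Gamma0 N\<close>: an invariant function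
  then takes the same value at \<open>\<tau>\<close> and at the image of
  \<open>moebius A \<tau>\<close> under this \<open>\<beta>\<close>.\<close>

definition coset_index :: "int^2^2 \<Rightarrow> cusp \<times> int" where
  "coset_index A = (THE j. j \<in> J \<and> adj A ** adj (\<beta> j) \<in> Gamma0 N)"

lemma coset_index:
  assumes "A \<in> SL2"
  shows "coset_index A \<in> J" "\<beta> (coset_index A) ** A \<in> Gamma0 N"
proof -
  have "\<exists>!j. j \<in> J \<and> adj A ** adj (\<beta> j) \<in> Gamma0 N"
    using coset_exists[OF SL2_adj[OF assms]] coset_unique[OF SL2_adj[OF assms]] by blast
  from theI'[OF this] have "coset_index A \<in> J" and *: "adj A ** adj (\<beta> (coset_index A)) \<in> Gamma0 N"
    by (simp_all add: coset_index_def)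
  then show "coset_index A \<in> J" by simp
  show "\<beta> (coset_index A) ** A \<in> Gamma0 N" using Gamma0_adj[OF *] by (simp add: adj_mult)
qed

lemma coset_index_eq:
  assumes "j \<in> J" "\<delta> \<in> Gamma0 N"
  shows "coset_index (adj (\<beta> j) ** \<delta>) = j"
proof -
  have A: "adj (\<beta> j) ** \<delta> \<in> SL2" using assms by (intro SL2_mult SL2_adj \<beta>_SL2 Gamma0_SL2[OF assms(2)])
  have eq: "adj (adj (\<beta> j) ** \<delta>) ** adj (\<beta> j) = adj \<delta>"
    by (simp add: adj_mult adj_cancel_right(1)[OF \<beta>_SL2[OF assms(1)]])
  then have m: "adj (adj (\<beta> j) ** \<delta>) ** adj (\<beta> j) \<in> Gamma0 N" using Gamma0_adj assms by simp
  show ?thesis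
    unfolding coset_index_def
  proof (rule the_equality)
    fix j' assume "j' \<in> J \<and> adj (adj (\<beta> j) ** \<delta>) ** adj (\<beta> j') \<in> Gamma0 N"
    then show "j' = j" using coset_unique[OF SL2_adj[OF A] _ _ assms(1) m] by blast
  qed (use assms m in auto)
qed

lemma coset_bij: "bij_betw (\<lambda>(j, \<delta>). adj (\<beta> j) ** \<delta>) (J \<times> Gamma0 N) SL2"
proof (rule bij_betw_imageI)
  show "inj_on (\<lambda>(j, \<delta>). adj (\<beta> j) ** \<delta>) (J \<times> Gamma0 N)"
  proof (rule inj_onI, clarify)
    fix j \<delta> j' \<delta>' assume *: "j \<in> J" "\<delta> \<in> Gamma0 N" "j' \<in> J" "\<delta>' \<in> Gamma0 N" "adj (\<beta> j) ** \<delta> = adj (\<beta> j') ** \<delta>'"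
    then have jj: "j = j'" using coset_index_eq by metis
    have "\<delta> = \<beta> j ** (adj (\<beta> j) ** \<delta>)" by (rule adj_cancel_left(2)[OF \<beta>_SL2[OF *(1)], symmetric])
    also have "\<dots> = \<delta>'" using *(5) jj adj_cancel_left(2)[OF \<beta>_SL2[OF *(1)], of \<delta>'] by metis
    finally show "j = j' \<and> \<delta> = \<delta>'" using jj by simp
  qed
  show "(\<lambda>(j, \<delta>). adj (\<beta> j) ** \<delta>) ` (J \<times> Gamma0 N) = SL2"
  proof (intro equalityI subsetI)
    fix A assume A: "A \<in> SL2"
    have "A = adj (\<beta> (coset_index A)) ** (\<beta> (coset_index A) ** A)"
      by (rule adj_cancel_left(1)[OF \<beta>_SL2[OF coset_index(1)[OF A]], symmetric])
    then show "A \<in> (\<lambda>(j, \<delta>). adj (\<beta> j) ** \<delta>) ` (J \<times> Gamma0 N)"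
      using coset_index[OF A] by (intro image_eqI[of _ _ "(coset_index A, \<beta> (coset_index A) ** A)"]) auto
  qed (auto intro!: SL2_mult SL2_adj \<beta>_SL2 intro: Gamma0_SL2[of _ N])
qed

abbreviation "source \<equiv> count_space SL2 \<Otimes>\<^sub>M domain_measure"
abbreviation "target \<equiv> count_space J \<Otimes>\<^sub>M hyperbolic_measure"

definition unfold_map :: "(int^2^2) \<times> complex \<Rightarrow> (cusp \<times> int) \<times> complex" where
  "unfold_map = (\<lambda>(A, \<tau>). (coset_index A, moebius A \<tau>))"

lemma countable_J: "countable J"
  using finite_J by (rule countable_finite)

lemma unfold_map_measurable [measurable]: "unfold_map \<in> source \<rightarrow>\<^sub>M target"
  unfolding unfold_map_def
proof (rule measurable_pair_measure_countable1[OF countable_matrices])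
  fix A assume A: "A \<in> SL2"
  have "(\<lambda>\<tau>. (coset_index A, moebius A \<tau>)) \<in> domain_measure \<rightarrow>\<^sub>M target"
    using coset_index(1)[OF A] by (intro measurable_Pair measurable_const) auto
  then show "(\<lambda>\<tau>. case (A, \<tau>) of (A, \<tau>) \<Rightarrow> (coset_index A, moebius A \<tau>)) \<in> domain_measure \<rightarrow>\<^sub>M target" by simp
qed

text \<open>Each matrix is written as \<open>adj (\<beta> j) ** \<delta>\<close>. For fixed
  \<open>j\<close> the images of \<open>D\<close>, as \<open>\<delta>\<close> varies, cover almost
  every point of the half-plane exactly twice.\<close>

lemma nn_integral_unfold:
  assumes h[measurable]: "h \<in> borel_measurable target"
  shows "(\<integral>\<^sup>+p. h (unfold_map p) \<partial>source) = (\<integral>\<^sup>+p. 2 * h p \<partial>target)"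
proof -
  interpret dm: sigma_finite_measure domain_measure by (rule sigma_finite_domain)
  interpret hm: sigma_finite_measure hyperbolic_measure by (rule sigma_finite_hyperbolic)
  interpret gm: sigma_finite_measure "count_space (Gamma0 N)" by (rule sigma_finite_measure_count_space_countable[OF countable_matrices])
  interpret jg: pair_sigma_finite "count_space (Gamma0 N)" hyperbolic_measure ..
  have hs[measurable]: "(\<lambda>\<sigma>. h (j, \<sigma>)) \<in> borel_measurable borel" if "j \<in> J" for j
    using measurable_compose[OF measurable_Pair1'[of j "count_space J" hyperbolic_measure] h] that
    by (simp add: measurable_cong_sets[OF sets_hyperbolic refl])
  have inner: "(\<integral>\<^sup>+\<tau>. h (j, moebius (adj (\<beta> j) ** \<delta>) \<tau>) \<partial>domain_measure) =
      (\<integral>\<^sup>+\<sigma>. indicator D (moebius (adj \<delta> ** \<beta> j) \<sigma>) * h (j, \<sigma>) \<partial>hyperbolic_measure)" if j: "j \<in> J" and \<delta>: "\<delta> \<in> Gamma0 N" for j \<delta>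
  proof -
    note [measurable] = hs[OF j]
    let ?A = "adj \<delta> ** \<beta> j"
    have A: "?A \<in> SL2" by (intro SL2_mult SL2_adj \<beta>_SL2 j Gamma0_SL2[OF \<delta>])
    have adjA: "adj (\<beta> j) ** \<delta> = adj ?A" by (simp add: adj_mult)
    have "(\<integral>\<^sup>+\<tau>. h (j, moebius (adj (\<beta> j) ** \<delta>) \<tau>) \<partial>domain_measure) = (\<integral>\<^sup>+\<tau>. indicator D \<tau> * h (j, moebius (adj ?A) \<tau>) \<partial>hyperbolic_measure)"
      unfolding adjA by (rule nn_integral_domain) measurable
    also have "\<dots> = (\<integral>\<^sup>+\<sigma>. indicator D (moebius ?A \<sigma>) * h (j, moebius (adj ?A) (moebius ?A \<sigma>)) \<partial>hyperbolic_measure)"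
      by (rule nn_integral_hyperbolic_moebius[OF A, symmetric]) measurable
    also have "\<dots> = (\<integral>\<^sup>+\<sigma>. indicator D (moebius ?A \<sigma>) * h (j, \<sigma>) \<partial>hyperbolic_measure)"
    proof (rule nn_integral_cong_AE)
      show "AE \<sigma> in hyperbolic_measure. indicator D (moebius ?A \<sigma>) * h (j, moebius (adj ?A) (moebius ?A \<sigma>)) = indicator D (moebius ?A \<sigma>) * h (j, \<sigma>)"
        using AE_hyperbolic_upper by eventually_elim (simp only: moebius_adj_cancel(1)[OF A])
    qed
    finally show ?thesis .
  qed
  have "(\<integral>\<^sup>+p. h (unfold_map p) \<partial>source) = (\<integral>\<^sup>+A. \<integral>\<^sup>+\<tau>. h (unfold_map (A, \<tau>)) \<partial>domain_measure \<partial>count_space SL2)"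
    by (rule dm.nn_integral_fst[symmetric]) measurable
  also have "\<dots> = (\<integral>\<^sup>+p. \<integral>\<^sup>+\<tau>. h (unfold_map ((\<lambda>(j, \<delta>). adj (\<beta> j) ** \<delta>) p, \<tau>)) \<partial>domain_measure \<partial>count_space (J \<times> Gamma0 N))"
    by (rule nn_integral_bij_count_space[OF coset_bij, symmetric])
  also have "\<dots> = (\<integral>\<^sup>+p. \<integral>\<^sup>+\<sigma>. indicator D (moebius (adj (snd p) ** \<beta> (fst p)) \<sigma>) * h (fst p, \<sigma>) \<partial>hyperbolic_measure \<partial>count_space (J \<times> Gamma0 N))"
    by (rule nn_integral_cong) (auto simp: unfold_map_def coset_index_eq inner)
  also have "\<dots> = (\<integral>\<^sup>+j. \<integral>\<^sup>+\<delta>. \<integral>\<^sup>+\<sigma>. indicator D (moebius (adj \<delta> ** \<beta> j) \<sigma>) * h (j, \<sigma>) \<partial>hyperbolic_measure \<partial>count_space (Gamma0 N) \<partial>count_space J)"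
    unfolding pair_measure_countable[OF countable_J countable_matrices, symmetric]
    by (subst gm.nn_integral_fst[symmetric]) (auto simp: pair_measure_countable[OF countable_J countable_matrices])
  also have "\<dots> = (\<integral>\<^sup>+j. \<integral>\<^sup>+\<sigma>. 2 * h (j, \<sigma>) \<partial>hyperbolic_measure \<partial>count_space J)"
  proof (rule nn_integral_cong)
    fix j assume "j \<in> space (count_space J)"
    then have j: "j \<in> J" by simp
    note [measurable] = hs[OF j]
    have m: "(\<lambda>(\<delta>, \<sigma>). indicator D (moebius (adj \<delta> ** \<beta> j) \<sigma>) * h (j, \<sigma>)) \<in> borel_measurable (count_space (Gamma0 N) \<Otimes>\<^sub>M hyperbolic_measure)"
      by (rule measurable_pair_measure_countable1[OF countable_matrices]) simp
    have "(\<integral>\<^sup>+\<delta>. \<integral>\<^sup>+\<sigma>. indicator D (moebius (adj \<delta> ** \<beta> j) \<sigma>) * h (j, \<sigma>) \<partial>hyperbolic_measure \<partial>count_space (Gamma0 N))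
      = (\<integral>\<^sup>+\<sigma>. \<integral>\<^sup>+\<delta>. indicator D (moebius (adj \<delta> ** \<beta> j) \<sigma>) * h (j, \<sigma>) \<partial>count_space (Gamma0 N) \<partial>hyperbolic_measure)"
      using jg.Fubini'[OF m] by simp
    also have "\<dots> = (\<integral>\<^sup>+\<sigma>. 2 * h (j, \<sigma>) \<partial>hyperbolic_measure)"
    proof (rule nn_integral_cong_AE)
      show "AE \<sigma> in hyperbolic_measure. (\<integral>\<^sup>+\<delta>. indicator D (moebius (adj \<delta> ** \<beta> j) \<sigma>) * h (j, \<sigma>) \<partial>count_space (Gamma0 N)) = 2 * h (j, \<sigma>)"
        using AE_translate_count[OF \<beta>_SL2[OF j]]
        by eventually_elim (subst nn_integral_multc, auto)
    qed
    finally show "(\<integral>\<^sup>+\<delta>. \<integral>\<^sup>+\<sigma>. indicator D (moebius (adj \<delta> ** \<beta> j) \<sigma>) * h (j, \<sigma>) \<partial>hyperbolic_measure \<partial>count_space (Gamma0 N))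
       = (\<integral>\<^sup>+\<sigma>. 2 * h (j, \<sigma>) \<partial>hyperbolic_measure)" .
  qed
  also have "\<dots> = (\<integral>\<^sup>+p. 2 * h p \<partial>target)"
    by (rule hm.nn_integral_fst) measurable
  finally show ?thesis .
qed

text \<open>Recorded as an equality of measures, because complex-valued integrals and their
  integrability can then be transported along \<open>unfold_map\<close>.\<close>

lemma distr_unfold_map: "distr source target unfold_map = density target (\<lambda>_. 2)"
proof (rule measure_eqI)
  fix X assume "X \<in> sets (distr source target unfold_map)"
  then have X[measurable]: "X \<in> sets target" by simp
  have "emeasure (distr source target unfold_map) X = (\<integral>\<^sup>+p. indicator X p \<partial>distr source target unfold_map)" by simp
  also have "\<dots> = (\<integral>\<^sup>+p. indicator X (unfold_map p) \<partial>source)"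
    by (rule nn_integral_distr) measurable
  also have "\<dots> = (\<integral>\<^sup>+p. 2 * indicator X p \<partial>target)"
    by (rule nn_integral_unfold) measurable
  also have "\<dots> = emeasure (density target (\<lambda>_. 2)) X"
    by (rule emeasure_density[symmetric]) auto
  finally show "emeasure (distr source target unfold_map) X = emeasure (density target (\<lambda>_. 2)) X" .
qed simp

text \<open>Integrability over \<open>D\<close> is a conclusion: it is obtained by Fubini from
  integrability over the strips. The factor 2 of the partition of unity cancels the factor 2 of the
  pushforward.\<close>

theorem unfolding_integral:
  fixes F :: "complex \<Rightarrow> complex"
  assumes F[measurable]: "F \<in> borel_measurable borel"
    and inv: "\<And>A \<tau>. A \<in> Gamma0 N \<Longrightarrow> Im \<tau> > 0 \<Longrightarrow> F (moebius A \<tau>) = F \<tau>"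
    and int: "\<And>j. j \<in> J \<Longrightarrow> integrable hyperbolic_measure (\<lambda>\<sigma>. F (moebius (\<beta> j) \<sigma>) * of_real (strip_kernel \<sigma>))"
  shows "integrable domain_measure F"
    and "(LINT \<tau>|domain_measure. F \<tau>) = (\<Sum>j\<in>J. LINT \<sigma>|hyperbolic_measure. F (moebius (\<beta> j) \<sigma>) * of_real (strip_kernel \<sigma>))"
proof -
  interpret dm: sigma_finite_measure domain_measure by (rule sigma_finite_domain)
  interpret hm: sigma_finite_measure hyperbolic_measure by (rule sigma_finite_hyperbolic)
  interpret sm: sigma_finite_measure "count_space SL2" by (rule sigma_finite_measure_count_space_countable[OF countable_matrices])
  interpret jm: sigma_finite_measure "count_space J" by (rule sigma_finite_measure_count_space_countable[OF countable_J])
  interpret s: pair_sigma_finite "count_space SL2" domain_measure ..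
  interpret t: pair_sigma_finite "count_space J" hyperbolic_measure ..
  define G where "G = (\<lambda>(j, \<sigma>). F (moebius (\<beta> j) \<sigma>) * of_real (strip_kernel \<sigma>))"
  have G[measurable]: "G \<in> borel_measurable target"
    unfolding G_def by (rule measurable_pair_measure_countable1[OF countable_J]) simp
  have intG: "integrable target G"
  proof (rule t.Fubini_integrable[OF G])
    show "integrable (count_space J) (\<lambda>x. LINT y|hyperbolic_measure. norm (G (x, y)))"
      by (rule integrable_count_space[OF finite_J])
    show "AE x in count_space J. integrable hyperbolic_measure (\<lambda>y. G (x, y))"
      using int by (simp add: AE_count_space G_def)
  qed
  have LG: "(LINT p|target. G p) = (\<Sum>j\<in>J. LINT \<sigma>|hyperbolic_measure. F (moebius (\<beta> j) \<sigma>) * of_real (strip_kernel \<sigma>))"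
    using t.integral_fst'[OF intG] finite_J by (simp add: lebesgue_integral_count_space_finite G_def)
  have "integrable (density target (\<lambda>_. ennreal 2)) G"
    by (subst integrable_density) (use intG in \<open>simp_all add: integrable_scaleR_right\<close>)
  then have "integrable (distr source target unfold_map) G" by (simp add: distr_unfold_map)
  then have intP: "integrable source (\<lambda>p. G (unfold_map p))"
    by (subst (asm) integrable_distr_eq) auto
  have "(LINT p|source. G (unfold_map p)) = (LINT p|distr source target unfold_map. G p)"
    by (rule integral_distr[symmetric]) auto
  also have "\<dots> = (LINT p|density target (\<lambda>_. ennreal 2). G p)" by (simp add: distr_unfold_map)
  also have "\<dots> = 2 * (LINT p|target. G p)"
    by (subst integral_density) (auto simp: scaleR_conv_of_real)
  finally have LP: "(LINT p|source. G (unfold_map p)) = 2 * (LINT p|target. G p)" .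
  \<comment> \<open>Invariance under \<open>Gamma0 N\<close> removes the coset representative, so
    the sum over matrices only involves the kernel.\<close>
  have inner: "(LINT A|count_space SL2. G (unfold_map (A, \<tau>))) = 2 * F \<tau>" if "\<tau> \<in> D" for \<tau>
  proof -
    have \<tau>: "Im \<tau> > 0" using that D_upper by auto
    have hs: "((\<lambda>A. strip_kernel (moebius A \<tau>)) has_sum 2) SL2" by (rule strip_kernel_sum[OF \<tau>])
    have "(\<lambda>A. norm (strip_kernel (moebius A \<tau>))) summable_on SL2"
      using has_sum_imp_summable[OF hs] by (rule summable_on_iff_abs_summable_on_real[THEN iffD1])
    then have ab: "Infinite_Set_Sum.abs_summable_on (\<lambda>A. strip_kernel (moebius A \<tau>)) SL2"
      by (simp only: abs_summable_equivalent)
    have K: "(LINT A|count_space SL2. strip_kernel (moebius A \<tau>)) = 2"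
      using infsetsum_infsum[OF ab] infsumI[OF hs] by (simp add: infsetsum_def)
    have "(LINT A|count_space SL2. G (unfold_map (A, \<tau>))) = (LINT A|count_space SL2. F \<tau> * of_real (strip_kernel (moebius A \<tau>)))"
    proof (rule Bochner_Integration.integral_cong[OF refl])
      fix A assume "A \<in> space (count_space SL2)"
      then have A: "A \<in> SL2" by simp
      note c = coset_index[OF A]
      have "moebius (\<beta> (coset_index A)) (moebius A \<tau>) = moebius (\<beta> (coset_index A) ** A) \<tau>"
        by (rule moebius_mult[OF \<beta>_SL2[OF c(1)] A \<tau>, symmetric])
      then show "G (unfold_map (A, \<tau>)) = F \<tau> * of_real (strip_kernel (moebius A \<tau>))"
        using inv[OF c(2) \<tau>] by (simp add: G_def unfold_map_def)
    qed
    also have "\<dots> = F \<tau> * of_real (LINT A|count_space SL2. strip_kernel (moebius A \<tau>))" by simp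
    finally show ?thesis by (simp add: K)
  qed
  have AEin: "AE \<tau> in domain_measure. (LINT A|count_space SL2. G (unfold_map (A, \<tau>))) = 2 * F \<tau>"
    using AE_domain by eventually_elim (rule inner)
  have intP': "integrable source (case_prod (\<lambda>A \<tau>. G (unfold_map (A, \<tau>))))" using intP by (simp add: case_prod_unfold)
  have "integrable domain_measure (\<lambda>\<tau>. LINT A|count_space SL2. G (unfold_map (A, \<tau>)))"
    by (rule s.integrable_snd[OF intP'])
  then have "integrable domain_measure (\<lambda>\<tau>. 2 * F \<tau>)"
    by (rule integrable_cong_AE_imp) (use AEin in auto)
  from integrable_mult_right[OF this, of "1/2"] show "integrable domain_measure F" by simp
  have "2 * (LINT \<tau>|domain_measure. F \<tau>) = (LINT \<tau>|domain_measure. 2 * F \<tau>)" by simp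
  also have "\<dots> = (LINT \<tau>|domain_measure. LINT A|count_space SL2. G (unfold_map (A, \<tau>)))"
    by (rule integral_cong_AE) (use AEin in \<open>auto intro: borel_measurable_integrable s.integrable_snd[OF intP']\<close>)
  also have "\<dots> = (LINT p|source. G (unfold_map p))"
    unfolding s.integral_snd[OF intP'] by (simp only: case_prod_unfold prod.collapse)
  finally show "(LINT \<tau>|domain_measure. F \<tau>) = (\<Sum>j\<in>J. LINT \<sigma>|hyperbolic_measure. F (moebius (\<beta> j) \<sigma>) * of_real (strip_kernel \<sigma>))"
    unfolding LP LG by simp
qed

end

subsection \<open>Fourier expansions at the cusps\<close>

definition cusp_exponent :: "rat \<Rightarrow> nat \<Rightarrow> nat \<Rightarrow> real" where
  "cusp_exponent \<alpha> w n = of_rat \<alpha> + real n / real w"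

definition q_term :: "real \<Rightarrow> complex \<Rightarrow> complex" where
  "q_term t \<tau> = exp (2 * of_real pi * \<i> * of_real t * \<tau>)"

lemma norm_q_term: "norm (q_term t \<tau>) = exp (- (2 * pi * t * Im \<tau>))"
  by (simp add: q_term_def)

lemma complex_of_rat: "(of_rat r :: complex) = of_real (of_rat r)"
proof (cases r)
  case (Fract a b)
  then show ?thesis by (simp add: of_rat_rat)
qed

lemma qpow_q_term: "qpow \<tau> r = q_term (of_rat r) \<tau>"
  by (simp add: qpow_def q_term_def complex_of_rat mult_ac)

lemma q_term_add: "q_term s \<tau> * q_term t \<tau> = q_term (s + t) \<tau>"
  by (simp add: q_term_def exp_add[symmetric] distrib_left distrib_right)

lemma q_term_power: "q_term (real n * t) \<tau> = q_term t \<tau> ^ n"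
  unfolding q_term_def exp_of_nat_mult[symmetric] by (simp add: mult_ac)

text \<open>The hypothesis provides mere convergence at every point. Absolute convergence follows
  because a power series converges absolutely strictly inside any point of convergence.\<close>

lemma has_q_expansion_sums:
  assumes h: "has_q_expansion h \<alpha> w a" and w: "w > 0" and \<tau>: "Im \<tau> > 0"
  shows "summable (\<lambda>n. norm (a n) * exp (- (2 * pi * cusp_exponent \<alpha> w n * Im \<tau>)))"
    and "(\<lambda>n. a n * q_term (cusp_exponent \<alpha> w n) \<tau>) sums h \<tau>"
proof -
  define z where "z = (\<lambda>\<tau>. q_term (1 / real w) \<tau>)"
  have zp: "qpow \<tau> (of_nat n / of_nat w) = z \<tau> ^ n" for n \<tau>
    using q_term_power[of n "1 / real w" \<tau>] by (simp add: qpow_q_term z_def of_rat_divide)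
  have split: "qpow \<tau> \<alpha> * z \<tau> ^ n = q_term (cusp_exponent \<alpha> w n) \<tau>" for n \<tau>
    unfolding cusp_exponent_def q_term_add[symmetric] zp[symmetric] by (simp add: qpow_q_term of_rat_divide)
  \<comment> \<open>A point at half the height of \<open>\<tau>\<close>, where the power series
    variable has larger modulus.\<close>
  define \<sigma> where "\<sigma> = \<i> * of_real (Im \<tau> / 2)"
  have "summable (\<lambda>n. a n * z \<sigma> ^ n)"
    using h \<tau> unfolding has_q_expansion_def zp by (simp add: \<sigma>_def)
  moreover have "norm (z \<tau>) < norm (z \<sigma>)"
    using w \<tau> by (auto simp: z_def norm_q_term \<sigma>_def intro!: divide_strict_right_mono)
  ultimately have "summable (\<lambda>n. norm (a n * z \<tau> ^ n))" by (rule powser_insidea)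
  then have "summable (\<lambda>n. norm (qpow \<tau> \<alpha>) * norm (a n * z \<tau> ^ n))" by (rule summable_mult)
  also have "(\<lambda>n. norm (qpow \<tau> \<alpha>) * norm (a n * z \<tau> ^ n)) = (\<lambda>n. norm (a n) * exp (- (2 * pi * cusp_exponent \<alpha> w n * Im \<tau>)))"
  proof
    fix n
    have "norm (qpow \<tau> \<alpha>) * norm (a n * z \<tau> ^ n) = norm (a n) * norm (qpow \<tau> \<alpha> * z \<tau> ^ n)"
      by (simp add: norm_mult)
    then show "norm (qpow \<tau> \<alpha>) * norm (a n * z \<tau> ^ n) = norm (a n) * exp (- (2 * pi * cusp_exponent \<alpha> w n * Im \<tau>))"
      unfolding split norm_q_term .
  qed
  finally show "summable (\<lambda>n. norm (a n) * exp (- (2 * pi * cusp_exponent \<alpha> w n * Im \<tau>)))" .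
  have "summable (\<lambda>n. a n * z \<tau> ^ n)" "h \<tau> = qpow \<tau> \<alpha> * (\<Sum>n. a n * z \<tau> ^ n)"
    using h \<tau> unfolding has_q_expansion_def zp by auto
  then have "(\<lambda>n. qpow \<tau> \<alpha> * (a n * z \<tau> ^ n)) sums h \<tau>" by (simp add: sums_mult summable_sums)
  then show "(\<lambda>n. a n * q_term (cusp_exponent \<alpha> w n) \<tau>) sums h \<tau>"
    unfolding split[symmetric] by (simp only: mult_ac)
qed

text \<open>The common shift \<open>s\<close> cancels in the difference of two exponents, so the
  product has period \<open>w\<close> in \<open>x\<close> even at an irregular cusp.\<close>

lemma q_term_orthogonality:
  fixes n m w :: nat and s y :: real
  assumes w: "w > 0"
  shows "((\<lambda>x. q_term (s + real n / real w) (Complex x y) * cnj (q_term (s + real m / real w) (Complex x y)))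
    has_integral (if n = m then of_real (real w * exp (- (4 * pi * (s + real n / real w) * y))) else 0)) {0..real w}"
proof -
  let ?tn = "s + real n / real w" and ?tm = "s + real m / real w"
  define r where "r = 2 * pi * (?tn - ?tm)"
  have eq: "q_term ?tn (Complex x y) * cnj (q_term ?tm (Complex x y)) = of_real (exp (- (2 * pi * (?tn + ?tm) * y))) * cis (r * x)" for x
  proof -
    have 1: "q_term t (Complex x y) = of_real (exp (- (2 * pi * t * y))) * cis (2 * pi * t * x)" for t
      unfolding q_term_def cis_conv_exp exp_of_real[symmetric] exp_add[symmetric]
      by (rule arg_cong[where f = exp]) (simp add: complex_eq_iff)
    have 2: "cnj (cis z) = cis (- z)" for z by (simp add: cis_cnj)
    have "q_term ?tn (Complex x y) * cnj (q_term ?tm (Complex x y)) =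
      of_real (exp (- (2 * pi * ?tn * y)) * exp (- (2 * pi * ?tm * y))) * (cis (2 * pi * ?tn * x) * cis (- (2 * pi * ?tm * x)))"
      unfolding 1 complex_cnj_mult complex_cnj_complex_of_real 2 by (simp only: of_real_mult mult_ac)
    also have "exp (- (2 * pi * ?tn * y)) * exp (- (2 * pi * ?tm * y)) = exp (- (2 * pi * (?tn + ?tm) * y))"
      by (simp only: exp_add[symmetric]) (simp add: algebra_simps)
    also have "cis (2 * pi * ?tn * x) * cis (- (2 * pi * ?tm * x)) = cis (r * x)"
      by (simp only: cis_mult r_def) (simp add: algebra_simps)
    finally show ?thesis .
  qed
  show ?thesis
  proof (cases "n = m")
    case True
    have e: "2 * pi * (?tn + ?tm) * y = 4 * pi * ?tn * y" using True by (simp add: algebra_simps)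
    have "r = 0" using True by (simp add: r_def)
    then show ?thesis
      unfolding eq e using True has_integral_const_real[of "of_real (exp (- (4 * pi * ?tn * y))) :: complex" 0 "real w"]
      by (simp add: scaleR_conv_of_real)
  next
    case False
    then have r: "r \<noteq> 0" using w by (simp add: r_def field_simps)
    have "((\<lambda>x. cis (r * x)) has_integral (cis (r * real w) / (\<i> * r) - cis (r * 0) / (\<i> * r))) {0..real w}"
    proof (rule fundamental_theorem_of_calculus)
      fix x :: real
      have "((\<lambda>x. cis (r * x) * (1 / (\<i> * r))) has_vector_derivative (\<i> * of_real r * cis (r * x)) * (1 / (\<i> * r))) (at x within {0..real w})"
        by (rule has_vector_derivative_mult_left[OF has_vector_derivative_cis])
      then show "((\<lambda>x. cis (r * x) / (\<i> * r)) has_vector_derivative cis (r * x)) (at x within {0..real w})"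
        using r by simp
    qed simp
    moreover have "cis (r * real w) = 1"
    proof -
      have "r * real w = 2 * pi * of_int (int n - int m)" using w by (simp add: r_def field_simps)
      then show ?thesis by (simp only: cis_multiple_2pi Ints_of_int)
    qed
    ultimately have "((\<lambda>x. cis (r * x)) has_integral 0) {0..real w}" by simp
    from has_integral_mult_right[OF this] show ?thesis unfolding eq using False by simp
  qed
qed

text \<open>The products of partial sums converge uniformly on one period, and orthogonality leaves
  the diagonal; no separate treatment of the double series is required.\<close>

lemma q_series_parseval:
  fixes a b :: "nat \<Rightarrow> complex" and w :: nat and s y :: real and h1 h2 :: "complex \<Rightarrow> complex"
  defines "t \<equiv> \<lambda>n. s + real n / real w"
  assumes w: "w > 0"
    and sa: "summable (\<lambda>n. norm (a n) * exp (- (2 * pi * t n * y)))"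
    and sb: "summable (\<lambda>n. norm (b n) * exp (- (2 * pi * t n * y)))"
    and h1: "\<And>x. (\<lambda>n. a n * q_term (t n) (Complex x y)) sums h1 (Complex x y)"
    and h2: "\<And>x. (\<lambda>n. b n * q_term (t n) (Complex x y)) sums h2 (Complex x y)"
  shows "\<exists>I. ((\<lambda>x. h1 (Complex x y) * cnj (h2 (Complex x y))) has_integral of_nat w * I) {0..real w} \<and>
      (\<lambda>n. a n * cnj (b n) * of_real (exp (- (4 * pi * t n * y)))) sums I"
proof -
  have ul: "uniform_limit {0..real w} (\<lambda>N x. \<Sum>n<N. c n * q_term (t n) (Complex x y)) (\<lambda>x. h (Complex x y)) sequentially"
    and bd: "bounded ((\<lambda>x. h (Complex x y)) ` {0..real w})"
    if sc: "summable (\<lambda>n. norm (c n) * exp (- (2 * pi * t n * y)))"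
      and hc: "\<And>x. (\<lambda>n. c n * q_term (t n) (Complex x y)) sums h (Complex x y)" for c h
  proof -
    have eq: "(\<lambda>x. h (Complex x y)) = (\<lambda>x. \<Sum>n. c n * q_term (t n) (Complex x y))"
      using hc by (auto simp: sums_iff)
    show "uniform_limit {0..real w} (\<lambda>N x. \<Sum>n<N. c n * q_term (t n) (Complex x y)) (\<lambda>x. h (Complex x y)) sequentially"
      unfolding eq by (rule Weierstrass_m_test[OF _ sc]) (simp add: norm_mult norm_q_term)
    have "norm (h (Complex x y)) \<le> (\<Sum>n. norm (c n) * exp (- (2 * pi * t n * y)))" for x
    proof -
      have "summable (\<lambda>n. norm (c n * q_term (t n) (Complex x y)))" using sc by (simp add: norm_mult norm_q_term)
      from summable_norm[OF this] show ?thesis using hc[of x] by (simp add: sums_iff norm_mult norm_q_term)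
    qed
    then show "bounded ((\<lambda>x. h (Complex x y)) ` {0..real w})" by (auto simp: bounded_iff)
  qed
  let ?P = "\<lambda>N x. \<Sum>n<N. a n * q_term (t n) (Complex x y)"
  let ?Q = "\<lambda>N x. \<Sum>n<N. b n * q_term (t n) (Complex x y)"
  have "uniform_limit {0..real w} (\<lambda>N x. cnj (?Q N x)) (\<lambda>x. cnj (h2 (Complex x y))) sequentially"
    by (rule bounded_linear.uniform_limit[OF bounded_linear_cnj ul[OF sb h2]])
  moreover have "bounded ((\<lambda>x. cnj (h2 (Complex x y))) ` {0..real w})"
    using bd[OF sb h2] by (auto simp: bounded_iff)
  ultimately have "uniform_limit {0..real w} (\<lambda>N x. ?P N x * cnj (?Q N x)) (\<lambda>x. h1 (Complex x y) * cnj (h2 (Complex x y))) sequentially"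
    by (intro uniform_lim_mult ul[OF sa h1] bd[OF sa h1])
  moreover have "continuous_on {0..real w} (\<lambda>x. ?P N x * cnj (?Q N x))" for N
  proof -
    have "continuous_on {0..real w} (\<lambda>x. q_term r (Complex x y))" for r
      unfolding q_term_def Complex_eq by (intro continuous_intros)
    then show ?thesis by (intro continuous_intros)
  qed
  ultimately obtain I J where IJ: "\<And>N. ((\<lambda>x. ?P N x * cnj (?Q N x)) has_integral I N) {0..real w}"
      "((\<lambda>x. h1 (Complex x y) * cnj (h2 (Complex x y))) has_integral J) {0..real w}" "I \<longlonglongrightarrow> J"
    by (rule uniform_limit_integral) auto
  have I: "I N = of_nat w * (\<Sum>n<N. a n * cnj (b n) * of_real (exp (- (4 * pi * t n * y))))" for N
  proof -
    have "((\<lambda>x. \<Sum>n<N. \<Sum>m<N. (a n * cnj (b m)) * (q_term (t n) (Complex x y) * cnj (q_term (t m) (Complex x y)))) has_integral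
      (\<Sum>n<N. \<Sum>m<N. (a n * cnj (b m)) * (if n = m then of_real (real w * exp (- (4 * pi * t n * y))) else 0))) {0..real w}"
      unfolding t_def by (intro has_integral_sum has_integral_mult_right q_term_orthogonality w) auto
    also have "(\<lambda>x. \<Sum>n<N. \<Sum>m<N. (a n * cnj (b m)) * (q_term (t n) (Complex x y) * cnj (q_term (t m) (Complex x y)))) = (\<lambda>x. ?P N x * cnj (?Q N x))"
      by (simp only: cnj_sum sum_product complex_cnj_mult mult_ac)
    finally have "I N = (\<Sum>n<N. \<Sum>m<N. (a n * cnj (b m)) * (if n = m then of_real (real w * exp (- (4 * pi * t n * y))) else 0))"
      using IJ(1) has_integral_unique by blast
    also have "\<dots> = (\<Sum>n<N. a n * cnj (b n) * of_real (real w * exp (- (4 * pi * t n * y))))"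
      by (intro sum.cong refl) (simp add: if_distrib[of "\<lambda>z. _ * z"] sum.delta' cong: if_cong)
    also have "\<dots> = of_nat w * (\<Sum>n<N. a n * cnj (b n) * of_real (exp (- (4 * pi * t n * y))))"
      by (simp add: sum_distrib_left mult_ac)
    finally show ?thesis .
  qed
  have "(\<lambda>N. I N / of_nat w) \<longlonglongrightarrow> J / of_nat w" using w by (intro tendsto_divide IJ tendsto_const) auto
  moreover have "I N / of_nat w = (\<Sum>n<N. a n * cnj (b n) * of_real (exp (- (4 * pi * t n * y))))" for N
    using w by (simp add: I)
  ultimately have "(\<lambda>n. a n * cnj (b n) * of_real (exp (- (4 * pi * t n * y)))) sums (J / of_nat w)" by (simp add: sums_def)
  moreover have "((\<lambda>x. h1 (Complex x y) * cnj (h2 (Complex x y))) has_integral of_nat w * (J / of_nat w)) {0..real w}"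
    using IJ(2) w by simp
  ultimately show ?thesis by blast
qed

text \<open>If every exponent with a nonzero coefficient is at least \<epsilon>, the factor exp(-2
  \<pi> \<epsilon> (y - 1)) can be taken out of the comparison with height 1.\<close>

lemma q_series_decay:
  fixes t :: "nat \<Rightarrow> real"
  assumes s: "summable (\<lambda>n. norm (a n) * exp (- (2 * pi * t n * 1)))"
    and \<epsilon>: "\<And>n. a n \<noteq> 0 \<Longrightarrow> \<epsilon> \<le> t n" and y: "y \<ge> 1"
    and sy: "summable (\<lambda>n. norm (a n) * exp (- (2 * pi * t n * y)))"
  shows "(\<Sum>n. norm (a n) * exp (- (2 * pi * t n * y))) \<le> exp (- (2 * pi * \<epsilon> * (y - 1))) * (\<Sum>n. norm (a n) * exp (- (2 * pi * t n * 1)))"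
proof -
  have "(\<Sum>n. norm (a n) * exp (- (2 * pi * t n * y))) \<le> (\<Sum>n. exp (- (2 * pi * \<epsilon> * (y - 1))) * (norm (a n) * exp (- (2 * pi * t n * 1))))"
  proof (rule suminf_le[OF _ sy summable_mult[OF s]])
    fix n
    show "norm (a n) * exp (- (2 * pi * t n * y)) \<le> exp (- (2 * pi * \<epsilon> * (y - 1))) * (norm (a n) * exp (- (2 * pi * t n * 1)))"
    proof (cases "a n = 0")
      case False
      have "exp (- (2 * pi * t n * y)) = exp (- (2 * pi * t n * (y - 1))) * exp (- (2 * pi * t n * 1))"
        by (simp only: exp_add[symmetric]) (simp add: algebra_simps)
      also have "\<dots> \<le> exp (- (2 * pi * \<epsilon> * (y - 1))) * exp (- (2 * pi * t n * 1))"
        using \<epsilon>[OF False] y by (intro mult_right_mono) (auto intro!: mult_right_mono mult_left_mono)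
      finally have "norm (a n) * exp (- (2 * pi * t n * y)) \<le> norm (a n) * (exp (- (2 * pi * \<epsilon> * (y - 1))) * exp (- (2 * pi * t n * 1)))"
        by (intro mult_left_mono) auto
      then show ?thesis by (simp only: mult_ac)
    qed simp
  qed
  also have "\<dots> = exp (- (2 * pi * \<epsilon> * (y - 1))) * (\<Sum>n. norm (a n) * exp (- (2 * pi * t n * 1)))"
    by (rule suminf_mult[OF s])
  finally show ?thesis .
qed

text \<open>A zero exponent forces \<open>\<alpha> = 0\<close> and \<open>n = 0\<close>; all other
  exponents are at least 1 / w. Along the imaginary axis the function therefore tends to its
  constant coefficient.\<close>

lemma q_expansion_vanishing:
  assumes h: "has_q_expansion h \<alpha> w a" and w: "w > 0" and \<alpha>: "0 \<le> \<alpha>"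
    and lim: "(h \<longlongrightarrow> 0) at_i_infinity" and t0: "cusp_exponent \<alpha> w n = 0"
  shows "a n = 0"
proof (rule ccontr)
  assume an: "a n \<noteq> 0"
  have nn: "of_rat \<alpha> \<ge> (0::real)" using \<alpha> by simp
  have n0: "n = 0" "of_rat \<alpha> = (0::real)"
    using t0 nn w by (auto simp: cusp_exponent_def add_nonneg_eq_0_iff)
  let ?t = "cusp_exponent \<alpha> w"
  have t: "?t m \<ge> 1 / real w" if "m \<noteq> 0" for m
  proof -
    have "1 / real w \<le> real m / real w" using that by (intro divide_right_mono) auto
    then show ?thesis unfolding cusp_exponent_def using nn by linarith
  qed
  define a' where "a' = a(0 := 0)"
  have sa: "summable (\<lambda>n. norm (a n) * exp (- (2 * pi * ?t n * y)))" if "y > 0" for y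
    using has_q_expansion_sums(1)[OF h w, of "Complex 0 y"] that by simp
  have sa': "summable (\<lambda>n. norm (a' n) * exp (- (2 * pi * ?t n * y)))" if "y > 0" for y
    by (rule summable_comparison_test'[OF sa[OF that], where N = 0]) (simp add: a'_def)
  define K where "K = (\<Sum>n. norm (a' n) * exp (- (2 * pi * ?t n * 1)))"
  have bound: "norm (h (Complex 0 y) - a 0) \<le> exp (- (2 * pi * (1 / real w) * (y - 1))) * K" if y: "y \<ge> 1" for y
  proof -
    have "(\<lambda>n. a n * q_term (?t n) (Complex 0 y)) sums h (Complex 0 y)"
      using has_q_expansion_sums(2)[OF h w, of "Complex 0 y"] y by simp
    moreover have "(\<lambda>n. if n = 0 then a 0 else 0) sums a 0" by (rule sums_single)
    ultimately have "(\<lambda>n. a n * q_term (?t n) (Complex 0 y) - (if n = 0 then a 0 else 0)) sums (h (Complex 0 y) - a 0)"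
      by (rule sums_diff)
    also have "(\<lambda>n. a n * q_term (?t n) (Complex 0 y) - (if n = 0 then a 0 else 0)) = (\<lambda>n. a' n * q_term (?t n) (Complex 0 y))"
      by (auto simp: a'_def cusp_exponent_def n0 q_term_def)
    finally have s: "(\<lambda>n. a' n * q_term (?t n) (Complex 0 y)) sums (h (Complex 0 y) - a 0)" .
    have "summable (\<lambda>n. norm (a' n * q_term (?t n) (Complex 0 y)))"
      using sa'[of y] y by (simp add: norm_mult norm_q_term)
    from summable_norm[OF this] have "norm (h (Complex 0 y) - a 0) \<le> (\<Sum>n. norm (a' n) * exp (- (2 * pi * ?t n * y)))"
      using s by (simp add: sums_iff norm_mult norm_q_term)
    also have "\<dots> \<le> exp (- (2 * pi * (1 / real w) * (y - 1))) * K"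
      unfolding K_def
    proof (rule q_series_decay)
      show "1 / real w \<le> ?t n" if "a' n \<noteq> 0" for n using that t[of n] by (auto simp: a'_def split: if_splits)
    qed (use sa'[of 1] sa'[of y] y in simp_all)
    finally show ?thesis .
  qed
  have "filterlim (\<lambda>y. Complex 0 y) at_i_infinity at_top"
    unfolding at_i_infinity_def filterlim_filtercomap_iff by (simp add: o_def filterlim_ident)
  then have l1: "((\<lambda>y. h (Complex 0 y)) \<longlongrightarrow> 0) at_top" by (rule filterlim_compose[OF lim])
  have "((\<lambda>y. h (Complex 0 y) - a 0) \<longlongrightarrow> 0) at_top"
  proof (rule Lim_null_comparison)
    show "\<forall>\<^sub>F y in at_top. norm (h (Complex 0 y) - a 0) \<le> exp (- (2 * pi * (1 / real w) * (y - 1))) * K"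
      using eventually_ge_at_top[of 1] by eventually_elim (rule bound)
    have "0 < 1 / real w" using w by simp
    then show "((\<lambda>y. exp (- (2 * pi * (1 / real w) * (y - 1))) * K) \<longlongrightarrow> 0) at_top" by real_asymp
  qed
  from LIM_zero_cancel[OF this] l1 have "a 0 = 0" using tendsto_unique[OF trivial_limit_at_top_linorder] by blast
  then show False using an n0 by simp
qed

subsection \<open>Integrals over strips\<close>

text \<open>The height comes first, so that the inner integral of Fubini's theorem runs over
  \<open>x\<close>, where Parseval applies.\<close>

lemma lborel_complex_pair: "(lborel :: complex measure) = distr (lborel \<Otimes>\<^sub>M lborel) borel (\<lambda>(y, x). Complex x y)"
proof (rule lborel_eqI)
  have [measurable]: "(\<lambda>(y, x). Complex x y) \<in> lborel \<Otimes>\<^sub>M lborel \<rightarrow>\<^sub>M borel"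
    unfolding Complex_eq by measurable
  fix l u :: complex
  assume le: "\<And>b. b \<in> Basis \<Longrightarrow> l \<bullet> b \<le> u \<bullet> b"
  have lu: "Re l \<le> Re u" "Im l \<le> Im u" using le[of 1] le[of \<i>] by (auto simp: Basis_complex_def)
  have "(\<lambda>(y, x). Complex x y) -` box l u = {Im l<..<Im u} \<times> {Re l<..<Re u}"
    by (auto simp: in_box_complex_iff)
  then have "emeasure (distr (lborel \<Otimes>\<^sub>M lborel) borel (\<lambda>(y, x). Complex x y)) (box l u)
      = emeasure (lborel \<Otimes>\<^sub>M lborel) ({Im l<..<Im u} \<times> {Re l<..<Re u})"
    by (subst emeasure_distr) (auto simp: space_pair_measure)
  also have "\<dots> = emeasure lborel {Im l<..<Im u} * emeasure lborel {Re l<..<Re u}"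
    by (rule lborel.emeasure_pair_measure_Times) auto
  also have "\<dots> = (\<Prod>b\<in>Basis. (u - l) \<bullet> b)"
    using lu by (simp add: Basis_complex_def ennreal_mult[symmetric] mult.commute)
  finally show "emeasure (distr (lborel \<Otimes>\<^sub>M lborel) borel (\<lambda>(y, x). Complex x y)) (box l u) = (\<Prod>b\<in>Basis. (u - l) \<bullet> b)" .
qed simp

text \<open>The majorant depends on the height alone, and the strip has finite width, so
  integrability of \<open>m\<close> on the half-line suffices.\<close>

lemma strip_fubini:
  fixes G :: "complex \<Rightarrow> complex" and I :: "real \<Rightarrow> complex"
  assumes [measurable]: "G \<in> borel_measurable borel" and w: "w \<ge> 0" and m: "set_integrable lborel {0<..} m"
    and bound: "\<And>\<tau>. Im \<tau> > 0 \<Longrightarrow> norm (G \<tau>) \<le> m (Im \<tau>)"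
    and I: "\<And>y. y > 0 \<Longrightarrow> ((\<lambda>x. G (Complex x y)) has_integral I y) {0..w}"
  shows "integrable lborel (\<lambda>\<tau>. (indicator {0..<w} (Re \<tau>) * indicator {0<..} (Im \<tau>)) *\<^sub>R G \<tau>)"
    and "(LINT \<tau>|lborel. (indicator {0..<w} (Re \<tau>) * indicator {0<..} (Im \<tau>)) *\<^sub>R G \<tau>) = (LINT y:{0<..}|lborel. I y)"
proof -
  let ?H = "\<lambda>\<tau>. (indicator {0..<w} (Re \<tau>) * indicator {0<..} (Im \<tau>) :: real) *\<^sub>R G \<tau>"
  have [measurable]: "(\<lambda>(y, x). Complex x y) \<in> lborel \<Otimes>\<^sub>M lborel \<rightarrow>\<^sub>M borel"
    unfolding Complex_eq by measurable
  have [measurable]: "(\<lambda>x. Complex x y) \<in> borel \<rightarrow>\<^sub>M borel" for y unfolding Complex_eq by measurable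
  define M where "M y = indicator {0<..} y * m y" for y
  have im: "integrable lborel M" using m by (simp add: set_integrable_def M_def[abs_def])
  note borel_measurable_integrable[OF im, measurable]
  have iw: "integrable lborel (\<lambda>x. indicator {0..<w} x * c :: real)" for c
    using w by (intro integrable_mult_left integrable_real_indicator) auto
  have "integrable (lborel \<Otimes>\<^sub>M lborel) (\<lambda>(y, x). M y * indicator {0..<w} x)"
  proof (rule lborel_pair.Fubini_integrable)
    have "integrable lborel (\<lambda>y. norm (M y) * w)"
      using im by (intro integrable_mult_left integrable_norm)
    moreover have "(\<lambda>y. LINT x|lborel. norm ((\<lambda>(y, x). M y * indicator {0..<w} x) (y, x))) = (\<lambda>y. norm (M y) * w)"
      using w by (simp add: abs_mult)
    ultimately show "integrable lborel (\<lambda>y. LINT x|lborel. norm ((\<lambda>(y, x). M y * indicator {0..<w} x) (y, x)))" by simp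
  qed (use iw in \<open>auto simp: mult.commute\<close>)
  then have ip: "integrable (lborel \<Otimes>\<^sub>M lborel) (\<lambda>(y, x). ?H (Complex x y))"
  proof (rule Bochner_Integration.integrable_bound)
    show "AE p in lborel \<Otimes>\<^sub>M lborel. norm ((\<lambda>(y, x). ?H (Complex x y)) p) \<le> norm ((\<lambda>(y, x). M y * indicator {0..<w} x) p)"
    proof (rule AE_I2)
      fix p :: "real \<times> real"
      obtain y x where p: "p = (y, x)" by (cases p)
      show "norm ((\<lambda>(y, x). ?H (Complex x y)) p) \<le> norm ((\<lambda>(y, x). M y * indicator {0..<w} x) p)"
        using bound[of "Complex x y"] by (auto simp: p M_def indicator_def intro: order_trans)
    qed
  qed simp
  have "integrable (distr (lborel \<Otimes>\<^sub>M lborel) borel (\<lambda>(y, x). Complex x y)) ?H"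
    using ip by (subst integrable_distr_eq) (auto simp: case_prod_beta')
  then show "integrable lborel ?H" by (simp only: lborel_complex_pair[symmetric])
  have "(LINT \<tau>|lborel. ?H \<tau>) = (LINT \<tau>|distr (lborel \<Otimes>\<^sub>M lborel) borel (\<lambda>(y, x). Complex x y). ?H \<tau>)"
    by (simp only: lborel_complex_pair[symmetric])
  also have "\<dots> = (LINT p|(lborel \<Otimes>\<^sub>M lborel). ?H ((\<lambda>(y, x). Complex x y) p))"
    by (rule integral_distr) auto
  also have "\<dots> = (LINT p|(lborel \<Otimes>\<^sub>M lborel). (\<lambda>(y, x). ?H (Complex x y)) p)"
    by (simp only: case_prod_beta')
  also have "\<dots> = (LINT y|lborel. LINT x|lborel. ?H (Complex x y))"
    using lborel_pair.integral_fst'[OF ip] by simp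
  also have "\<dots> = (LINT y|lborel. indicator {0<..} y *\<^sub>R I y)"
  proof (rule Bochner_Integration.integral_cong[OF refl])
    fix y :: real
    show "(LINT x|lborel. ?H (Complex x y)) = indicator {0<..} y *\<^sub>R I y"
    proof (cases "y > 0")
      case True
      have si: "set_integrable lborel {0..w} (\<lambda>x. G (Complex x y))"
      proof (rule set_integrable_bound)
        show "set_integrable lborel {0..w} (\<lambda>x. m y)"
          unfolding set_integrable_def using w by (simp only: real_scaleR_def) (intro integrable_mult_left integrable_real_indicator, auto)
        show "set_borel_measurable lborel {0..w} (\<lambda>x. G (Complex x y))"
          unfolding set_borel_measurable_def by measurable
        show "AE x in lborel. x \<in> {0..w} \<longrightarrow> norm (G (Complex x y)) \<le> norm (m y)"
          using bound[of "Complex _ y"] True by (intro AE_I2) (auto intro!: order_trans[OF _ abs_ge_self])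
      qed
      have "(LINT x|lborel. ?H (Complex x y)) = (LINT x|lborel. indicator {0..w} x *\<^sub>R G (Complex x y))"
      proof (rule integral_cong_AE)
        show "AE x in lborel. ?H (Complex x y) = indicator {0..w} x *\<^sub>R G (Complex x y)"
          using AE_lborel_singleton[of w] by eventually_elim (use True in \<open>auto simp: indicator_def\<close>)
      qed measurable
      also have "\<dots> = integral {0..w} (\<lambda>x. G (Complex x y))"
        using set_borel_integral_eq_integral(2)[OF si] by (simp add: set_lebesgue_integral_def)
      also have "\<dots> = I y" using I[OF True] by (rule integral_unique)
      finally show ?thesis using True by simp
    qed simp
  qed
  finally show "(LINT \<tau>|lborel. ?H \<tau>) = (LINT y:{0<..}|lborel. I y)"
    by (simp add: set_lebesgue_integral_def)
qed

text \<open>Below height 1 this is the moderate growth of the forms. Above it, y^(1/2) is the size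
  of y^k in weight 1/2 with nonzero constant terms; in all other cases there is exponential
  decay.\<close>

definition cusp_majorant :: "real \<Rightarrow> real \<Rightarrow> real" where
  "cusp_majorant k y = (if y \<le> 1 then y powr (- k) else y powr (1/2))"

lemma set_integrable_cusp_majorant:
  "set_integrable lborel {0<..} (\<lambda>y. cusp_majorant k y * (y powr (-2) * exp (- (1 / y))))"
proof -
  obtain K where K: "K > 0" "\<And>y. 0 < y \<Longrightarrow> y \<le> 1 \<Longrightarrow> y powr (- k - 2) * exp (- (1 / y)) \<le> K"
    using powr_exp_inverse_bounded[of 1 "- k - 2"] by auto
  show ?thesis
  proof (rule set_integrable_Ioi_criterion)
    show "(\<lambda>y. cusp_majorant k y * (y powr (-2) * exp (- (1 / y)))) \<in> borel_measurable borel"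
      unfolding cusp_majorant_def by measurable
    show "norm (cusp_majorant k y * (y powr (-2) * exp (- (1 / y)))) \<le> K" if "0 < y" "y \<le> 1" for y
    proof -
      have "y powr (- k) * (y powr (-2) * exp (- (1 / y))) = y powr (- k - 2) * exp (- (1 / y))"
        unfolding mult.assoc[symmetric] powr_add[symmetric] by simp
      moreover have "norm (cusp_majorant k y * (y powr (-2) * exp (- (1 / y)))) = y powr (- k) * (y powr (-2) * exp (- (1 / y)))"
        using that by (simp add: cusp_majorant_def)
      ultimately show ?thesis using K(2)[OF that] by (simp only:)
    qed
    show "norm (cusp_majorant k y * (y powr (-2) * exp (- (1 / y)))) \<le> 1 * y powr (- 3 / 2)" if y: "y \<ge> 1" for y
    proof -
      have e: "exp (- (1 / y)) \<le> 1" using y by simp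
      have c: "cusp_majorant k y = y powr (1/2)" using y by (auto simp: cusp_majorant_def)
      have "y powr (1/2) * (y powr (-2) * exp (- (1 / y))) = y powr (- 3 / 2) * exp (- (1 / y))"
        using powr_add[of y "1/2" "-2"] by (simp add: mult.assoc[symmetric])
      also have "\<dots> \<le> y powr (- 3 / 2) * 1" by (intro mult_left_mono e) auto
      finally show ?thesis by (simp add: c)
    qed
  qed
qed

text \<open>Isolates what the strip integral needs at a single cusp: common exponents, moderate
  growth, and vanishing of one of the two constant terms unless the weight is 1/2. Modularity itself
  no longer occurs.\<close>

locale expansion_pair =
  fixes k s :: real and w :: nat and a b :: "nat \<Rightarrow> complex" and h1 h2 :: "complex \<Rightarrow> complex"
  assumes k: "k > 0" and w: "w > 0" and s: "s \<ge> 0"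
    and summable_a: "\<And>y. y > 0 \<Longrightarrow> summable (\<lambda>n. norm (a n) * exp (- (2 * pi * (s + real n / real w) * y)))"
    and summable_b: "\<And>y. y > 0 \<Longrightarrow> summable (\<lambda>n. norm (b n) * exp (- (2 * pi * (s + real n / real w) * y)))"
    and h1: "\<And>\<tau>. Im \<tau> > 0 \<Longrightarrow> (\<lambda>n. a n * q_term (s + real n / real w) \<tau>) sums h1 \<tau>"
    and h2: "\<And>\<tau>. Im \<tau> > 0 \<Longrightarrow> (\<lambda>n. b n * q_term (s + real n / real w) \<tau>) sums h2 \<tau>"
    and moderate_growth: "\<exists>K>0. \<forall>\<tau>. Im \<tau> > 0 \<longrightarrow>
        (norm (h1 \<tau>))\<^sup>2 * Im \<tau> powr k \<le> K * max (Im \<tau>) (1 / Im \<tau>) powr k \<and>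
        (norm (h2 \<tau>))\<^sup>2 * Im \<tau> powr k \<le> K * max (Im \<tau>) (1 / Im \<tau>) powr k"
    and constant_terms: "k = 1/2 \<or> (\<forall>n. s + real n / real w = 0 \<longrightarrow> a n = 0) \<or> (\<forall>n. s + real n / real w = 0 \<longrightarrow> b n = 0)"
    and continuous: "continuous_on upper_half_plane h1" "continuous_on upper_half_plane h2"
begin

definition t :: "nat \<Rightarrow> real" where "t n = s + real n / real w"

lemma t_nonneg: "t n \<ge> 0" using s by (simp add: t_def)

lemmas expansions = summable_a summable_b h1 h2 constant_terms
lemmas expansions_t = expansions[folded t_def]

definition A :: "real \<Rightarrow> real" where "A y = (\<Sum>n. norm (a n) * exp (- (2 * pi * t n * y)))"
definition B :: "real \<Rightarrow> real" where "B y = (\<Sum>n. norm (b n) * exp (- (2 * pi * t n * y)))"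

lemma A_nonneg: "y > 0 \<Longrightarrow> A y \<ge> 0" and B_nonneg: "y > 0 \<Longrightarrow> B y \<ge> 0"
  unfolding A_def B_def by (intro suminf_nonneg expansions_t; simp)+

lemma norm_h1: "Im \<tau> > 0 \<Longrightarrow> norm (h1 \<tau>) \<le> A (Im \<tau>)"
  using summable_norm[of "\<lambda>n. a n * q_term (t n) \<tau>"] expansions_t(1)[of "Im \<tau>"] expansions_t(3)[of \<tau>]
  by (simp add: A_def sums_iff norm_mult norm_q_term)

lemma norm_h2: "Im \<tau> > 0 \<Longrightarrow> norm (h2 \<tau>) \<le> B (Im \<tau>)"
  using summable_norm[of "\<lambda>n. b n * q_term (t n) \<tau>"] expansions_t(2)[of "Im \<tau>"] expansions_t(4)[of \<tau>]
  by (simp add: B_def sums_iff norm_mult norm_q_term)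

lemma product_decay:
  obtains K where "K > 0" "\<And>y. y \<ge> 1 \<Longrightarrow> A y * B y * y powr k \<le> K * y powr (1/2)"
proof -
  \<comment> \<open>A positive lower bound for all nonzero exponents.\<close>
  define \<delta> where "\<delta> = (if s > 0 then s else 1 / real w)"
  have \<delta>: "\<delta> > 0" "t n \<noteq> 0 \<Longrightarrow> \<delta> \<le> t n" for n
  proof -
    show "\<delta> > 0" using w by (simp add: \<delta>_def)
    assume "t n \<noteq> 0"
    then show "\<delta> \<le> t n" using s w by (cases n) (auto simp: \<delta>_def t_def divide_right_mono)
  qed
  \<comment> \<open>The decay rate of the series: it is 0 only if a nonzero constant term is
    present.\<close>
  define \<delta>a where "\<delta>a = (if \<forall>n. t n = 0 \<longrightarrow> a n = 0 then \<delta> else 0)"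
  define \<delta>b where "\<delta>b = (if \<forall>n. t n = 0 \<longrightarrow> b n = 0 then \<delta> else 0)"
  have A: "A y \<le> exp (- (2 * pi * \<delta>a * (y - 1))) * A 1" if "y \<ge> 1" for y
    unfolding A_def
    by (rule q_series_decay) (use that expansions_t(1)[of 1] expansions_t(1)[of y] \<delta>(2) t_nonneg in \<open>auto simp: \<delta>a_def split: if_splits\<close>)
  have B: "B y \<le> exp (- (2 * pi * \<delta>b * (y - 1))) * B 1" if "y \<ge> 1" for y
    unfolding B_def
    by (rule q_series_decay) (use that expansions_t(2)[of 1] expansions_t(2)[of y] \<delta>(2) t_nonneg in \<open>auto simp: \<delta>b_def split: if_splits\<close>)
  \<comment> \<open>If both rates are 0, then both constant terms occur,
    \<open>constant_terms\<close> forces \<open>k = 1/2\<close>, and the power of \<open>y\<close>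
    is trivial.\<close>
  have "\<exists>K>0. \<forall>y\<ge>1. y powr (k - 1/2) * exp (- (2 * pi * (\<delta>a + \<delta>b) * y)) \<le> K"
  proof (cases "\<delta>a + \<delta>b > 0")
    case True
    then show ?thesis using powr_exp_bounded[of "2 * pi * (\<delta>a + \<delta>b)" "k - 1/2"] by (metis mult_pos_pos pi_gt_zero zero_less_numeral)
  next
    case False
    then have "k - 1/2 = 0" "\<delta>a + \<delta>b = 0" using expansions_t(5) \<delta>(1) by (auto simp: \<delta>a_def \<delta>b_def split: if_splits)
    then show ?thesis by (intro exI[of _ 1]) (simp only:, auto)
  qed
  then obtain K where K: "K > 0" "\<And>y. y \<ge> 1 \<Longrightarrow> y powr (k - 1/2) * exp (- (2 * pi * (\<delta>a + \<delta>b) * y)) \<le> K" by blast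
  define c where "c = exp (2 * pi * (\<delta>a + \<delta>b)) * (A 1 * B 1)"
  have c: "c \<ge> 0" using A_nonneg[of 1] B_nonneg[of 1] by (simp add: c_def)
  show thesis
  proof (rule that[of "c * K + 1"])
    show "c * K + 1 > 0" using c K by (simp add: add_nonneg_pos)
    fix y :: real assume y: "y \<ge> 1"
    have "A y * B y \<le> (exp (- (2 * pi * \<delta>a * (y - 1))) * A 1) * (exp (- (2 * pi * \<delta>b * (y - 1))) * B 1)"
      using A[OF y] B[OF y] A_nonneg[of 1] B_nonneg[of y] y by (intro mult_mono) auto
    also have "\<dots> = (exp (- (2 * pi * \<delta>a * (y - 1))) * exp (- (2 * pi * \<delta>b * (y - 1)))) * (A 1 * B 1)" by (simp only: mult_ac)
    also have "exp (- (2 * pi * \<delta>a * (y - 1))) * exp (- (2 * pi * \<delta>b * (y - 1))) = exp (2 * pi * (\<delta>a + \<delta>b)) * exp (- (2 * pi * (\<delta>a + \<delta>b) * y))"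
      by (simp only: exp_add[symmetric]) (simp add: algebra_simps)
    finally have "A y * B y * y powr k \<le> (exp (2 * pi * (\<delta>a + \<delta>b)) * exp (- (2 * pi * (\<delta>a + \<delta>b) * y)) * (A 1 * B 1)) * y powr k"
      by (intro mult_right_mono) auto
    also have "exp (2 * pi * (\<delta>a + \<delta>b)) * exp (- (2 * pi * (\<delta>a + \<delta>b) * y)) * (A 1 * B 1) * y powr k
      = c * (y powr (k - 1/2) * exp (- (2 * pi * (\<delta>a + \<delta>b) * y))) * y powr (1/2)"
    proof -
      have yk: "y powr k = y powr (k - 1/2) * y powr (1/2)" by (simp only: powr_add[symmetric]) simp
      show ?thesis unfolding yk c_def by (simp only: mult_ac)
    qed
    also have "\<dots> \<le> c * K * y powr (1/2)" by (intro mult_right_mono mult_left_mono K y c) auto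
    also have "\<dots> \<le> (c * K + 1) * y powr (1/2)" by (intro mult_right_mono) auto
    finally show "A y * B y * y powr k \<le> (c * K + 1) * y powr (1/2)" .
  qed
qed

text \<open>Parseval applied to \<open>h\<close> and itself identifies the full sum with the mean of
  |h|^2 over one period; all its terms are nonnegative, so partial sums are smaller.\<close>

lemma coefficient_square_bound:
  assumes y: "y > 0" and sc: "summable (\<lambda>n. norm (c n) * exp (- (2 * pi * t n * y)))"
    and h: "\<And>\<tau>. Im \<tau> > 0 \<Longrightarrow> (\<lambda>n. c n * q_term (t n) \<tau>) sums h \<tau>"
    and M: "\<And>\<tau>. Im \<tau> = y \<Longrightarrow> (norm (h \<tau>))\<^sup>2 \<le> M"
  shows "(\<Sum>n<L. (norm (c n))\<^sup>2 * exp (- (4 * pi * t n * y))) \<le> M"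
proof -
  have M0: "M \<ge> 0" using M[of "Complex 0 y"] by (simp add: order_trans[OF zero_le_power2])
  obtain I where I: "((\<lambda>x. h (Complex x y) * cnj (h (Complex x y))) has_integral of_nat w * I) {0..real w}"
      "(\<lambda>n. c n * cnj (c n) * of_real (exp (- (4 * pi * t n * y)))) sums I"
    using q_series_parseval[OF w, of c s y c h h] sc h y unfolding t_def by auto
  have "norm (of_nat w * I) \<le> M * measure lborel {0..real w}"
    by (rule has_integral_bound_real[OF M0 finite.emptyI I(1)]) (use M in \<open>auto simp: norm_mult power2_eq_square\<close>)
  then have "norm I \<le> M" using w by (simp add: norm_mult mult.commute)
  have "(\<lambda>n. (norm (c n))\<^sup>2 * exp (- (4 * pi * t n * y))) sums Re I" (is "?f sums _")
    using sums_Re[OF I(2)] unfolding complex_norm_square[symmetric] of_real_mult[symmetric] by (simp del: of_real_mult of_real_power)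
  then have "summable ?f" "suminf ?f = Re I" by (simp_all add: sums_iff)
  from sum_le_suminf[OF this(1), of "{..<L}"] this(2) have "sum ?f {..<L} \<le> Re I" by simp
  also have "\<dots> \<le> norm I" by (rule complex_Re_le_cmod)
  finally show ?thesis using \<open>norm I \<le> M\<close> by simp
qed

text \<open>The bound on partial sums is the domination needed to integrate termwise in
  \<open>y\<close>. Near the real line it cannot come from the size of \<open>h1\<close> and
  \<open>h2\<close> through absolute coefficient sums; it comes from 2 |a b| \<le> |a|^2 + |b|^2 and
  \<open>coefficient_square_bound\<close>.\<close>

lemma product_bounds:
  obtains K where "K > 0"
    and "\<And>\<tau>. Im \<tau> > 0 \<Longrightarrow> norm (h1 \<tau>) * norm (h2 \<tau>) * Im \<tau> powr k \<le> K * cusp_majorant k (Im \<tau>)"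
    and "\<And>y L. y > 0 \<Longrightarrow> (\<Sum>n<L. norm (a n) * norm (b n) * exp (- (4 * pi * t n * y))) * y powr k \<le> K * cusp_majorant k y"
proof -
  obtain K1 where K1: "K1 > 0" "\<And>y. y \<ge> 1 \<Longrightarrow> A y * B y * y powr k \<le> K1 * y powr (1/2)"
    using product_decay by metis
  obtain K2 where K2: "K2 > 0" "\<And>\<tau>. Im \<tau> > 0 \<Longrightarrow> (norm (h1 \<tau>))\<^sup>2 * Im \<tau> powr k \<le> K2 * max (Im \<tau>) (1 / Im \<tau>) powr k"
      "\<And>\<tau>. Im \<tau> > 0 \<Longrightarrow> (norm (h2 \<tau>))\<^sup>2 * Im \<tau> powr k \<le> K2 * max (Im \<tau>) (1 / Im \<tau>) powr k"
    using moderate_growth by auto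
  have maxp: "max y (1 / y) powr k = y powr (- k)" if "0 < y" "y \<le> 1" for y :: real
  proof -
    have "y \<le> 1 / y" using that by (simp add: field_simps mult_le_one)
    then have "max y (1 / y) = inverse y" by (simp add: max_def divide_inverse)
    then show ?thesis using that by (simp add: powr_minus powr_divide inverse_eq_divide)
  qed
  have amgm: "u * v \<le> (u\<^sup>2 + v\<^sup>2) / 2" for u v :: real
    using sum_squares_bound[of u v] by simp
  show thesis
  proof (rule that[of "max K1 K2"])
    show "max K1 K2 > 0" using K1 by simp
    fix \<tau> :: complex assume \<tau>: "Im \<tau> > 0"
    let ?y = "Im \<tau>"
    show "norm (h1 \<tau>) * norm (h2 \<tau>) * ?y powr k \<le> max K1 K2 * cusp_majorant k ?y"
    proof (cases "?y \<le> 1")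
      case True
      have "norm (h1 \<tau>) * norm (h2 \<tau>) * ?y powr k \<le> ((norm (h1 \<tau>))\<^sup>2 + (norm (h2 \<tau>))\<^sup>2) / 2 * ?y powr k"
        by (intro mult_right_mono amgm) auto
      also have "\<dots> \<le> K2 * ?y powr (- k)"
        using K2(2,3)[OF \<tau>] unfolding maxp[OF \<tau> True] by (simp add: distrib_right)
      also have "\<dots> \<le> max K1 K2 * ?y powr (- k)" by (intro mult_right_mono) auto
      finally show ?thesis using True by (simp add: cusp_majorant_def)
    next
      case False
      have "norm (h1 \<tau>) * norm (h2 \<tau>) * ?y powr k \<le> A ?y * B ?y * ?y powr k"
        using norm_h1[OF \<tau>] norm_h2[OF \<tau>] A_nonneg[OF \<tau>] by (intro mult_right_mono mult_mono) auto
      also have "\<dots> \<le> K1 * ?y powr (1/2)" using False by (intro K1) auto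
      also have "\<dots> \<le> max K1 K2 * ?y powr (1/2)" by (intro mult_right_mono) auto
      finally show ?thesis using False by (simp add: cusp_majorant_def)
    qed
  next
    fix y :: real and L :: nat assume y: "y > 0"
    let ?S = "\<Sum>n<L. norm (a n) * norm (b n) * exp (- (4 * pi * t n * y))"
    show "?S * y powr k \<le> max K1 K2 * cusp_majorant k y"
    proof (cases "y \<le> 1")
      case True
      define SA where "SA = (\<Sum>n<L. (norm (a n))\<^sup>2 * exp (- (4 * pi * t n * y)))"
      define SB where "SB = (\<Sum>n<L. (norm (b n))\<^sup>2 * exp (- (4 * pi * t n * y)))"
      define M where "M = K2 * y powr (- k) / y powr k"
      have "SA \<le> M" unfolding SA_def
      proof (rule coefficient_square_bound[OF y expansions_t(1)[OF y] expansions_t(3)])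
        show "(norm (h1 \<tau>))\<^sup>2 \<le> M" if "Im \<tau> = y" for \<tau>
          using K2(2)[of \<tau>] that maxp[OF y True] y by (simp add: M_def pos_le_divide_eq)
      qed
      moreover have "SB \<le> M" unfolding SB_def
      proof (rule coefficient_square_bound[OF y expansions_t(2)[OF y] expansions_t(4)])
        show "(norm (h2 \<tau>))\<^sup>2 \<le> M" if "Im \<tau> = y" for \<tau>
          using K2(3)[of \<tau>] that maxp[OF y True] y by (simp add: M_def pos_le_divide_eq)
      qed
      ultimately have "SA + SB \<le> M + M" by (rule add_mono)
      then have SM: "(SA + SB) / 2 \<le> M" by simp
      have "?S \<le> (\<Sum>n<L. ((norm (a n))\<^sup>2 + (norm (b n))\<^sup>2) / 2 * exp (- (4 * pi * t n * y)))"
        by (intro sum_mono mult_right_mono amgm) auto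
      also have "\<dots> = (SA + SB) / 2"
        unfolding SA_def SB_def by (simp add: sum.distrib[symmetric] sum_divide_distrib distrib_right add_divide_distrib)
      also note SM
      finally have "?S \<le> M" .
      then have "?S * y powr k \<le> M * y powr k" by (intro mult_right_mono) auto
      also have "\<dots> = K2 * y powr (- k)" using y by (simp add: M_def)
      also have "\<dots> \<le> max K1 K2 * y powr (- k)" by (intro mult_right_mono) auto
      finally show ?thesis using True by (simp add: cusp_majorant_def)
    next
      case False
      have "?S = (\<Sum>n<L. (norm (a n) * exp (- (2 * pi * t n * y))) * (norm (b n) * exp (- (2 * pi * t n * y))))"
      proof (intro sum.cong refl)
        fix n
        have "exp (- (4 * pi * t n * y)) = exp (- (2 * pi * t n * y)) * exp (- (2 * pi * t n * y))"
          by (simp only: exp_add[symmetric]) (simp add: algebra_simps)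
        then show "norm (a n) * norm (b n) * exp (- (4 * pi * t n * y)) = (norm (a n) * exp (- (2 * pi * t n * y))) * (norm (b n) * exp (- (2 * pi * t n * y)))"
          by (simp only: mult_ac)
      qed
      also have "\<dots> \<le> (\<Sum>n<L. (norm (a n) * exp (- (2 * pi * t n * y))) * B y)"
      proof (intro sum_mono mult_left_mono)
        show "norm (b n) * exp (- (2 * pi * t n * y)) \<le> B y" for n
          using sum_le_suminf[OF expansions_t(2)[OF y], of "{n}"] by (simp add: B_def)
      qed simp
      also have "\<dots> = (\<Sum>n<L. norm (a n) * exp (- (2 * pi * t n * y))) * B y" by (simp only: sum_distrib_right)
      also have "\<dots> \<le> A y * B y"
        unfolding A_def by (intro mult_right_mono sum_le_suminf expansions_t(1) y B_nonneg) auto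
      finally have "?S * y powr k \<le> A y * B y * y powr k" by (intro mult_right_mono) auto
      also have "\<dots> \<le> K1 * y powr (1/2)" using False by (intro K1) auto
      also have "\<dots> \<le> max K1 K2 * y powr (1/2)" by (intro mult_right_mono) auto
      finally show ?thesis using False by (simp add: cusp_majorant_def)
    qed
  qed
qed

definition strip_function :: "complex \<Rightarrow> complex" where
  "strip_function \<tau> = indicator upper_half_plane \<tau> *\<^sub>R (h1 \<tau> * cnj (h2 \<tau>) * of_real (Im \<tau> powr k))"

lemma strip_function_measurable [measurable]: "strip_function \<in> borel_measurable borel"
  unfolding strip_function_def[abs_def]
proof (rule borel_measurable_continuous_on_indicator[OF borel_upper_half_plane])
  show "continuous_on upper_half_plane (\<lambda>\<tau>. h1 \<tau> * cnj (h2 \<tau>) * of_real (Im \<tau> powr k))"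
    by (intro continuous_intros continuous) (auto simp: upper_half_plane_def)
qed

text \<open>After integration over \<open>x\<close> each height carries a series whose terms are
  Laplace integrands of \<open>kap\<close>. The partial sum bound of \<open>product_bounds\<close>,
  combined with the decay of \<open>kap\<close>, permits termwise integration over
  \<open>y\<close>.\<close>

lemma strip_integral:
  defines "S \<equiv> \<lambda>\<tau>. strip_function \<tau> * of_real (indicator {0..<real w} (Re \<tau>) * kap (Im \<tau>))"
  shows "integrable hyperbolic_measure S"
    and "(\<lambda>n. of_nat w * (a n * cnj (b n) * of_real (4 * (8 * pi) powr (- (k - 1)) * W_factor k (t n)))) sums
      (LINT \<tau>|hyperbolic_measure. S \<tau>)"
proof -
  obtain K where K: "K > 0"
      "\<And>\<tau>. Im \<tau> > 0 \<Longrightarrow> norm (h1 \<tau>) * norm (h2 \<tau>) * Im \<tau> powr k \<le> K * cusp_majorant k (Im \<tau>)"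
      "\<And>y L. y > 0 \<Longrightarrow> (\<Sum>n<L. norm (a n) * norm (b n) * exp (- (4 * pi * t n * y))) * y powr k \<le> K * cusp_majorant k y"
    by (rule product_bounds) blast
  obtain K' where K': "K' > 0" "\<And>y. y > 0 \<Longrightarrow> \<bar>kap y\<bar> \<le> K' * exp (- (1 / y))"
    using kap_bound by metis
  define m where "m y = (K * K') * (cusp_majorant k y * (y powr (-2) * exp (- (1 / y))))" for y
  have m: "set_integrable lborel {0<..} m"
    unfolding m_def[abs_def] by (rule set_integrable_mult_right) (rule set_integrable_cusp_majorant)
  have maj: "u * y powr k * (\<bar>kap y\<bar> / y\<^sup>2) \<le> m y" if "y > 0" "u * y powr k \<le> K * cusp_majorant k y" for u y
  proof -
    have pos: "K * cusp_majorant k y \<ge> 0" using K by (simp add: cusp_majorant_def)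
    have "u * y powr k * (\<bar>kap y\<bar> / y\<^sup>2) \<le> (K * cusp_majorant k y) * (K' * exp (- (1 / y)) / y\<^sup>2)"
      by (intro mult_mono divide_right_mono that K' pos) auto
    also have "K' * exp (- (1 / y)) / y\<^sup>2 = K' * exp (- (1 / y)) * y powr (-2)"
      using that by (simp add: powr_minus powr_numeral divide_inverse)
    finally show ?thesis by (simp only: m_def mult_ac)
  qed
  define G where "G \<tau> = strip_function \<tau> * of_real (kap (Im \<tau>) / (Im \<tau>)\<^sup>2)" for \<tau>
  have [measurable]: "G \<in> borel_measurable borel" unfolding G_def[abs_def] by measurable
  have G_bound: "norm (G \<tau>) \<le> m (Im \<tau>)" if "Im \<tau> > 0" for \<tau>
    using maj[OF that K(2)[OF that]] that
    by (simp add: G_def strip_function_def norm_mult norm_divide norm_power upper_half_plane_def)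
  define d where "d n = of_nat w * (a n * cnj (b n))" for n
  define term_n where "term_n n y = d n * of_real (y powr (k - 2) * exp (- (4 * pi * t n * y)) * kap y)" for n y
  have "\<exists>I. \<forall>y>0. ((\<lambda>x. G (Complex x y)) has_integral I y) {0..real w} \<and> (\<lambda>n. term_n n y) sums I y"
  proof -
    have "\<exists>J. ((\<lambda>x. G (Complex x y)) has_integral J) {0..real w} \<and> (\<lambda>n. term_n n y) sums J" if y: "y > 0" for y
    proof -
      obtain I where I: "((\<lambda>x. h1 (Complex x y) * cnj (h2 (Complex x y))) has_integral of_nat w * I) {0..real w}"
        "(\<lambda>n. a n * cnj (b n) * of_real (exp (- (4 * pi * t n * y)))) sums I"
        using q_series_parseval[OF w, of a s y b h1 h2] summable_a[OF y] summable_b[OF y] h1 h2 y unfolding t_def by auto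
      define e where "e = complex_of_real (y powr k * (kap y / y\<^sup>2))"
      have e: "y powr (k - 2) * kap y = y powr k * (kap y / y\<^sup>2)"
        using y by (simp add: powr_diff powr_numeral)
      have "((\<lambda>x. h1 (Complex x y) * cnj (h2 (Complex x y)) * e) has_integral of_nat w * I * e) {0..real w}"
        by (rule has_integral_mult_left[OF I(1)])
      also have "(\<lambda>x. h1 (Complex x y) * cnj (h2 (Complex x y)) * e) = (\<lambda>x. G (Complex x y))"
        using y by (auto simp: G_def strip_function_def e_def upper_half_plane_def)
      finally have 1: "((\<lambda>x. G (Complex x y)) has_integral of_nat w * I * e) {0..real w}" .
      have "(\<lambda>n. of_nat w * e * (a n * cnj (b n) * of_real (exp (- (4 * pi * t n * y))))) sums (of_nat w * e * I)"
        by (rule sums_mult[OF I(2)])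
      also have "(\<lambda>n. of_nat w * e * (a n * cnj (b n) * of_real (exp (- (4 * pi * t n * y))))) = (\<lambda>n. term_n n y)"
      proof
        fix n
        have "term_n n y = d n * of_real (exp (- (4 * pi * t n * y)) * (y powr (k - 2) * kap y))"
          unfolding term_n_def by (simp only: mult_ac)
        then show "of_nat w * e * (a n * cnj (b n) * of_real (exp (- (4 * pi * t n * y)))) = term_n n y"
          unfolding e d_def e_def of_real_mult by (simp only: mult_ac)
      qed
      finally show ?thesis using 1 by (auto simp: mult_ac)
    qed
    then show ?thesis by metis
  qed
  then obtain I where I: "\<And>y. y > 0 \<Longrightarrow> ((\<lambda>x. G (Complex x y)) has_integral I y) {0..real w}"
      "\<And>y. y > 0 \<Longrightarrow> (\<lambda>n. term_n n y) sums I y" by metis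
  note fub = strip_fubini[OF \<open>G \<in> borel_measurable borel\<close> of_nat_0_le_iff m G_bound I(1)]
  have S_eq: "(indicator upper_half_plane \<tau> / (Im \<tau>)\<^sup>2) *\<^sub>R S \<tau> = (indicator {0..<real w} (Re \<tau>) * indicator {0<..} (Im \<tau>)) *\<^sub>R G \<tau>" for \<tau>
    by (auto simp: S_def G_def strip_function_def upper_half_plane_def indicator_def scaleR_conv_of_real)
  have [measurable]: "S \<in> borel_measurable borel" unfolding S_def by measurable
  show "integrable hyperbolic_measure S"
    unfolding hyperbolic_measure_def by (subst integrable_density) (use fub(1) in \<open>auto simp: S_eq\<close>)
  have "(LINT \<tau>|hyperbolic_measure. S \<tau>) = (LINT \<tau>|lborel. (indicator upper_half_plane \<tau> / (Im \<tau>)\<^sup>2) *\<^sub>R S \<tau>)"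
    unfolding hyperbolic_measure_def by (rule integral_density) auto
  also have "\<dots> = (LINT y:{0<..}|lborel. I y)" unfolding S_eq by (rule fub(2))
  finally have LS: "(LINT \<tau>|hyperbolic_measure. S \<tau>) = (LINT y:{0<..}|lborel. I y)" .
  have term_int: "set_integrable lborel {0<..} (term_n n)"
      "(LINT y:{0<..}|lborel. term_n n y) = d n * of_real (4 * (8 * pi) powr (- (k - 1)) * W_factor k (t n))" for n
  proof -
    have "set_integrable lborel {0<..} (term_n n) \<and>
      (LINT y:{0<..}|lborel. term_n n y) = d n * of_real (4 * (8 * pi) powr (- (k - 1)) * W_factor k (t n))"
    proof (cases "t n > 0 \<or> k = 1/2")
      case True
      note kw = kap_W_factor[OF k t_nonneg True]
      have "set_integrable lborel {0<..} (\<lambda>y. complex_of_real (y powr (k - 2) * exp (- (4 * pi * t n * y)) * kap y))"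
        using integrable_of_real[OF kw(1)[unfolded set_integrable_def], where 'a = complex]
        unfolding set_integrable_def by (simp add: scaleR_conv_of_real)
      moreover have "(LINT y:{0<..}|lborel. complex_of_real (y powr (k - 2) * exp (- (4 * pi * t n * y)) * kap y))
        = of_real (4 * (8 * pi) powr (- (k - 1)) * W_factor k (t n))"
        unfolding set_integral_complex_of_real kw(2) ..
      ultimately show ?thesis unfolding term_n_def[abs_def] by simp
    next
      \<comment> \<open>Exponent 0 in a weight other than 1/2: one of the two constant coefficients
        vanishes, so the term is identically 0, in accordance with the omitted term of the
        formula.\<close>
      case False
      then have "d n = 0" using expansions_t(5) t_nonneg[of n] by (auto simp: d_def)
      then show ?thesis by (simp add: term_n_def[abs_def] set_integrable_def set_lebesgue_integral_def)
    qed
    then show "set_integrable lborel {0<..} (term_n n)"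
      "(LINT y:{0<..}|lborel. term_n n y) = d n * of_real (4 * (8 * pi) powr (- (k - 1)) * W_factor k (t n))" by auto
  qed
  have partial_int: "set_integrable lborel {0<..} (\<lambda>y. \<Sum>n<L. term_n n y)" for L
    unfolding set_integrable_def scaleR_sum_right
    by (intro Bochner_Integration.integrable_sum) (use term_int(1) in \<open>simp add: set_integrable_def\<close>)
  have partial: "(LINT y:{0<..}|lborel. (\<Sum>n<L. term_n n y)) = (\<Sum>n<L. d n * of_real (4 * (8 * pi) powr (- (k - 1)) * W_factor k (t n)))" for L
    unfolding term_int(2)[symmetric] set_lebesgue_integral_def scaleR_sum_right
    by (intro Bochner_Integration.integral_sum) (use term_int(1) in \<open>simp add: set_integrable_def\<close>)
  have "(\<lambda>L. LINT y|lborel. indicator {0<..} y *\<^sub>R (\<Sum>n<L. term_n n y)) \<longlonglongrightarrow> (LINT y|lborel. indicator {0<..} y *\<^sub>R I y)"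
  proof (rule integral_dominated_convergence)
    show "integrable lborel (\<lambda>y. indicator {0<..} y *\<^sub>R (real w * m y))"
      using set_integrable_mult_right[of "real w", OF m] by (simp add: set_integrable_def)
    show "(\<lambda>y. indicator {0<..} y *\<^sub>R (\<Sum>n<L. term_n n y)) \<in> borel_measurable lborel" for L
      using partial_int[of L] unfolding set_integrable_def by (rule borel_measurable_integrable)
    have lim: "(\<lambda>L. indicator {0<..} y *\<^sub>R (\<Sum>n<L. term_n n y)) \<longlonglongrightarrow> indicator {0<..} y *\<^sub>R I y" for y :: real
    proof (cases "y > 0")
      case True
      then show ?thesis using I(2)[OF True] by (simp add: sums_def)
    qed simp
    then show "AE y in lborel. (\<lambda>L. indicator {0<..} y *\<^sub>R (\<Sum>n<L. term_n n y)) \<longlonglongrightarrow> indicator {0<..} y *\<^sub>R I y" by simp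
    show "(\<lambda>y. indicator {0<..} y *\<^sub>R I y) \<in> borel_measurable lborel"
      by (rule borel_measurable_LIMSEQ_metric[OF _ lim])
        (use partial_int in \<open>auto simp: set_integrable_def intro: borel_measurable_integrable\<close>)
    show "AE y in lborel. norm (indicator {0<..} y *\<^sub>R (\<Sum>n<L. term_n n y)) \<le> indicator {0<..} y *\<^sub>R (real w * m y)" for L
    proof (rule AE_I2)
      fix y :: real
      show "norm (indicator {0<..} y *\<^sub>R (\<Sum>n<L. term_n n y)) \<le> indicator {0<..} y *\<^sub>R (real w * m y)"
      proof (cases "y > 0")
        case True
        let ?S = "\<Sum>n<L. norm (a n) * norm (b n) * exp (- (4 * pi * t n * y))"
        have "y powr (k - 2) = y powr k / y\<^sup>2" using True by (simp add: powr_diff powr_numeral)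
        then have tn: "norm (term_n n y) = real w * ((norm (a n) * norm (b n) * exp (- (4 * pi * t n * y))) * (y powr k * (\<bar>kap y\<bar> / y\<^sup>2)))" for n
          by (simp add: term_n_def d_def norm_mult norm_divide norm_power abs_mult)
        have "norm (\<Sum>n<L. term_n n y) \<le> (\<Sum>n<L. norm (term_n n y))" by (rule norm_sum)
        also have "\<dots> = real w * (?S * y powr k * (\<bar>kap y\<bar> / y\<^sup>2))"
          unfolding tn sum_distrib_left[symmetric] sum_distrib_right[symmetric] by (simp only: mult.assoc)
        also have "\<dots> \<le> real w * m y" by (intro mult_left_mono maj[OF True K(3)[OF True]]) simp
        finally show ?thesis using True by simp
      qed simp
    qed
  qed
  then have "(\<lambda>L. \<Sum>n<L. d n * of_real (4 * (8 * pi) powr (- (k - 1)) * W_factor k (t n))) \<longlonglongrightarrow> (LINT \<tau>|hyperbolic_measure. S \<tau>)"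
    unfolding LS partial[symmetric] set_lebesgue_integral_def .
  then show "(\<lambda>n. of_nat w * (a n * cnj (b n) * of_real (4 * (8 * pi) powr (- (k - 1)) * W_factor k (t n)))) sums
      (LINT \<tau>|hyperbolic_measure. S \<tau>)"
    unfolding sums_def d_def by (simp only: mult.assoc)
qed

end

subsection \<open>The Petersson product\<close>

text \<open>The automorphy factor is constant if the lower left entry is 0; otherwise its imaginary
  part never vanishes on the half-plane, so it stays away from the branch cut.\<close>

lemma continuous_on_slash:
  assumes f: "f holomorphic_on upper_half_plane" and A: "A \<in> SL2"
  shows "continuous_on upper_half_plane (slash f k A)"
proof -
  have "continuous_on upper_half_plane (\<lambda>\<tau>. automorphy A \<tau> powr (- of_real k))"
  proof (cases "A$2$1 = 0")
    case True
    then show ?thesis by (simp add: automorphy_def)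
  next
    case False
    then show ?thesis
      by (intro continuous_on_powr_complex) (auto simp: automorphy_def complex_eq_iff intro!: continuous_intros)
  qed
  moreover have "continuous_on upper_half_plane (\<lambda>\<tau>. f (moebius A \<tau>))"
    using continuous_on_moebius[OF A] Im_moebius_pos[OF A]
    by (intro continuous_on_compose2[OF holomorphic_on_imp_continuous_on[OF f]]) (auto simp: upper_half_plane_def)
  ultimately show ?thesis unfolding slash_def[abs_def] by (rule continuous_on_mult)
qed

lemma sum_indicator_unit_intervals:
  "(\<Sum>i\<in>{0..<int n}. indicator {of_int i..<of_int i + 1} x) = (indicator {0..<real n} x :: real)"
proof -
  have "(\<Sum>i\<in>{0..<int n}. indicator {of_int i..<of_int i + 1} x) = (\<Sum>i\<in>{0..<int n}. if i = \<lfloor>x\<rfloor> then 1 else 0 :: real)"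
  proof (intro sum.cong refl)
    fix i :: int
    have "x \<in> {of_int i..<of_int i + 1} \<longleftrightarrow> i = \<lfloor>x\<rfloor>" unfolding eq_commute[of i] floor_eq_iff by simp
    then show "indicator {of_int i..<of_int i + 1} x = (if i = \<lfloor>x\<rfloor> then 1 else 0 :: real)" by (simp add: indicator_def)
  qed
  also have "\<dots> = (if \<lfloor>x\<rfloor> \<in> {0..<int n} then 1 else 0)" by simp
  also have "\<dots> = indicator {0..<real n} x" by (simp add: indicator_def floor_less_iff)
  finally show ?thesis .
qed

text \<open>The coset representatives at one cusp differ by translations, which preserve the
  measure; the corresponding unit strips add up to a single strip as wide as the cusp.\<close>

lemma strip_sum:
  fixes F :: "complex \<Rightarrow> complex"
  assumes [measurable]: "F \<in> borel_measurable borel" and A: "A \<in> SL2"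
    and int: "integrable hyperbolic_measure (\<lambda>\<tau>. F (moebius A \<tau>) * of_real (indicator {0..<real n} (Re \<tau>) * kap (Im \<tau>)))"
  shows "i \<in> {0..<int n} \<Longrightarrow> integrable hyperbolic_measure (\<lambda>\<tau>. F (moebius (A ** Tmat i) \<tau>) * of_real (strip_kernel \<tau>))"
    and "(\<Sum>i\<in>{0..<int n}. LINT \<tau>|hyperbolic_measure. F (moebius (A ** Tmat i) \<tau>) * of_real (strip_kernel \<tau>))
      = (LINT \<tau>|hyperbolic_measure. F (moebius A \<tau>) * of_real (indicator {0..<real n} (Re \<tau>) * kap (Im \<tau>)))"
proof -
  let ?S = "\<lambda>\<tau>. F (moebius A \<tau>) * of_real (indicator {0..<real n} (Re \<tau>) * kap (Im \<tau>))"
  define P where "P i \<tau> = F (moebius A \<tau>) * of_real (indicator {of_int i..<of_int i + 1} (Re \<tau>) * kap (Im \<tau>))" for i :: int and \<tau>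
  have [measurable]: "P i \<in> borel_measurable borel" for i unfolding P_def[abs_def] by measurable
  have P_int: "integrable hyperbolic_measure (P i)" if "i \<in> {0..<int n}" for i
  proof (rule Bochner_Integration.integrable_bound[OF int])
    have "indicator {of_int i..<of_int i + 1} x \<le> (indicator {0..<real n} x :: real)" for x :: real
      using that by (auto simp: indicator_def)
    then have "norm (P i \<tau>) \<le> norm (?S \<tau>)" for \<tau>
      unfolding P_def norm_mult norm_of_real abs_mult by (intro mult_left_mono mult_right_mono) auto
    then show "AE \<tau> in hyperbolic_measure. norm (P i \<tau>) \<le> norm (?S \<tau>)" by simp
  qed simp
  have eq: "AE \<tau> in hyperbolic_measure. F (moebius (A ** Tmat i) \<tau>) * of_real (strip_kernel \<tau>) = P i (moebius (Tmat i) \<tau>)" for i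
    using AE_hyperbolic_upper
  proof eventually_elim
    case (elim \<tau>)
    have "indicator {of_int i..<of_int i + 1} (Re \<tau> + of_int i) = (indicator {0..<1} (Re \<tau>) :: real)"
      by (simp add: indicator_def)
    then show ?case
      unfolding P_def moebius_mult[OF A SL2_Tmat elim] by (simp add: strip_kernel_def)
  qed
  have m: "moebius (Tmat i) \<in> hyperbolic_measure \<rightarrow>\<^sub>M borel" for i by simp
  have "LINT \<tau>|hyperbolic_measure. F (moebius (A ** Tmat i) \<tau>) * of_real (strip_kernel \<tau>) = (LINT \<tau>|hyperbolic_measure. P i \<tau>)" for i
  proof -
    have "(LINT \<tau>|hyperbolic_measure. P i \<tau>) = (LINT \<tau>|distr hyperbolic_measure borel (moebius (Tmat i)). P i \<tau>)"
      by (simp add: distr_hyperbolic_moebius SL2_Tmat)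
    also have "\<dots> = (LINT \<tau>|hyperbolic_measure. P i (moebius (Tmat i) \<tau>))" by (rule integral_distr[OF m]) simp
    also have "\<dots> = (LINT \<tau>|hyperbolic_measure. F (moebius (A ** Tmat i) \<tau>) * of_real (strip_kernel \<tau>))"
      by (rule integral_cong_AE[OF _ _ AE_symmetric[OF eq]]) (simp_all del: moebius_Tmat)
    finally show ?thesis ..
  qed
  then have "(\<Sum>i\<in>{0..<int n}. LINT \<tau>|hyperbolic_measure. F (moebius (A ** Tmat i) \<tau>) * of_real (strip_kernel \<tau>))
      = (\<Sum>i\<in>{0..<int n}. LINT \<tau>|hyperbolic_measure. P i \<tau>)" by simp
  also have "\<dots> = (LINT \<tau>|hyperbolic_measure. (\<Sum>i\<in>{0..<int n}. P i \<tau>))"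
    by (rule Bochner_Integration.integral_sum[symmetric]) (rule P_int)
  also have "(\<lambda>\<tau>. \<Sum>i\<in>{0..<int n}. P i \<tau>) = ?S"
    unfolding P_def sum_distrib_left[symmetric] of_real_sum[symmetric] sum_distrib_right[symmetric] sum_indicator_unit_intervals ..
  finally show "(\<Sum>i\<in>{0..<int n}. LINT \<tau>|hyperbolic_measure. F (moebius (A ** Tmat i) \<tau>) * of_real (strip_kernel \<tau>))
      = (LINT \<tau>|hyperbolic_measure. ?S \<tau>)" .
  assume i: "i \<in> {0..<int n}"
  have "integrable (distr hyperbolic_measure borel (moebius (Tmat i))) (P i)"
    using P_int[OF i] by (simp add: distr_hyperbolic_moebius SL2_Tmat)
  then have "integrable hyperbolic_measure (\<lambda>\<tau>. P i (moebius (Tmat i) \<tau>))" by (rule integrable_distr[OF m])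
  then show "integrable hyperbolic_measure (\<lambda>\<tau>. F (moebius (A ** Tmat i) \<tau>) * of_real (strip_kernel \<tau>))"
    by (rule integrable_cong_AE[THEN iffD2, rotated 3]) (use eq in \<open>simp_all del: moebius_Tmat\<close>)
qed

lemma (in coset_representatives) cusp_expansion_pair:
  assumes k: "k > 0" "k \<in> \<int> \<or> k - 1/2 \<in> \<int>" and chi: "dirichlet_character N chi"
    and f: "f \<in> modular_forms k N chi" and g: "g \<in> modular_forms k N chi"
    and prod: "product_vanishes_at_cusps k f g \<or> k = 1/2"
    and c: "c \<in> C" and \<alpha>: "0 \<le> \<alpha>"
    and a: "has_q_expansion (slash f k (\<gamma> c)) \<alpha> (cusp_width N c) a"
    and b: "has_q_expansion (slash g k (\<gamma> c)) \<alpha> (cusp_width N c) b"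
  shows "expansion_pair k (of_rat \<alpha>) (cusp_width N c) a b (slash f k (\<gamma> c)) (slash g k (\<gamma> c))"
proof
  have S: "\<gamma> c \<in> SL2" using \<gamma>[OF c] by simp
  show "0 < k" by (rule k)
  show w: "0 < cusp_width N c" by (rule width_pos)
  show "0 \<le> (of_rat \<alpha> :: real)" using \<alpha> by simp
  show "summable (\<lambda>n. norm (a n) * exp (- (2 * pi * (of_rat \<alpha> + real n / real (cusp_width N c)) * y)))"
    "summable (\<lambda>n. norm (b n) * exp (- (2 * pi * (of_rat \<alpha> + real n / real (cusp_width N c)) * y)))" if "y > 0" for y
    using has_q_expansion_sums(1)[OF a w, of "Complex 0 y"] has_q_expansion_sums(1)[OF b w, of "Complex 0 y"] that
    by (simp_all add: cusp_exponent_def)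
  show "(\<lambda>n. a n * q_term (of_rat \<alpha> + real n / real (cusp_width N c)) \<tau>) sums slash f k (\<gamma> c) \<tau>"
    "(\<lambda>n. b n * q_term (of_rat \<alpha> + real n / real (cusp_width N c)) \<tau>) sums slash g k (\<gamma> c) \<tau>" if "Im \<tau> > 0" for \<tau>
    using has_q_expansion_sums(2)[OF a w that] has_q_expansion_sums(2)[OF b w that] by (simp_all add: cusp_exponent_def)
  show "k = 1/2 \<or> (\<forall>n. of_rat \<alpha> + real n / real (cusp_width N c) = 0 \<longrightarrow> a n = 0)
      \<or> (\<forall>n. of_rat \<alpha> + real n / real (cusp_width N c) = 0 \<longrightarrow> b n = 0)"
    using prod S q_expansion_vanishing[OF a w \<alpha>] q_expansion_vanishing[OF b w \<alpha>]
    unfolding product_vanishes_at_cusps_def cusp_exponent_def by blast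
  show "continuous_on upper_half_plane (slash f k (\<gamma> c))" "continuous_on upper_half_plane (slash g k (\<gamma> c))"
    using f g by (auto intro!: continuous_on_slash S simp: modular_forms_def)
  obtain K1 where K1: "K1 > 0" "\<And>M \<tau>. M \<in> SL2 \<Longrightarrow> Im \<tau> > 0 \<Longrightarrow> norm (invariant_product k f f (moebius M \<tau>)) \<le> K1 * max (Im \<tau>) (1 / Im \<tau>) powr k"
    using growth[OF k chi f] by metis
  obtain K2 where K2: "K2 > 0" "\<And>M \<tau>. M \<in> SL2 \<Longrightarrow> Im \<tau> > 0 \<Longrightarrow> norm (invariant_product k g g (moebius M \<tau>)) \<le> K2 * max (Im \<tau>) (1 / Im \<tau>) powr k"
    using growth[OF k chi g] by metis
  have "K1 * x powr k \<le> max K1 K2 * x powr k" "K2 * x powr k \<le> max K1 K2 * x powr k" for x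
    by (auto intro: mult_right_mono)
  note le = order_trans[OF _ this(1)] order_trans[OF _ this(2)]
  have "\<forall>\<tau>. Im \<tau> > 0 \<longrightarrow>
      (norm (slash f k (\<gamma> c) \<tau>))\<^sup>2 * Im \<tau> powr k \<le> max K1 K2 * max (Im \<tau>) (1 / Im \<tau>) powr k \<and>
      (norm (slash g k (\<gamma> c) \<tau>))\<^sup>2 * Im \<tau> powr k \<le> max K1 K2 * max (Im \<tau>) (1 / Im \<tau>) powr k"
    using K1(2)[OF S] K2(2)[OF S] by (auto simp: norm_slash_square[OF S] intro: le)
  then show "\<exists>K>0. \<forall>\<tau>. Im \<tau> > 0 \<longrightarrow>
      (norm (slash f k (\<gamma> c) \<tau>))\<^sup>2 * Im \<tau> powr k \<le> K * max (Im \<tau>) (1 / Im \<tau>) powr k \<and>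
      (norm (slash g k (\<gamma> c) \<tau>))\<^sup>2 * Im \<tau> powr k \<le> K * max (Im \<tau>) (1 / Im \<tau>) powr k"
    using K1(1) by (intro exI[of _ "max K1 K2"]) auto
qed

text \<open>Integrability over \<open>D\<close> and convergence of the series at the cusps are
  asserted together with the formula, because the integral and \<open>suminf\<close> are total
  functions whose values would otherwise carry no information.\<close>

theorem theorem4p4:
  fixes k :: real and N :: nat and chi :: "int \<Rightarrow> complex"
    and f g :: "complex \<Rightarrow> complex"
    and D :: "complex set" and C :: "cusp set"
    and \<gamma> :: "cusp \<Rightarrow> int^2^2" and \<alpha> :: "cusp \<Rightarrow> rat"
    and a b :: "cusp \<Rightarrow> nat \<Rightarrow> complex"
  assumes "k > 0" and "k \<in> \<int> \<or> k - 1/2 \<in> \<int>"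
    and "N \<ge> 1" and "dirichlet_character N chi"
    and "f \<in> modular_forms k N chi" and "g \<in> modular_forms k N chi"
    and "product_vanishes_at_cusps k f g \<or> k = 1/2"
    and "fundamental_domain (Gamma0 N) D"
    and "cusp_representatives N C"
    and "\<And>c. c \<in> C \<Longrightarrow> \<gamma> c \<in> carrier SL2Z \<and> act_cusp (\<gamma> c) Cusp_Infinity = c"
    and "\<And>c. c \<in> C \<Longrightarrow> 0 \<le> \<alpha> c \<and> \<alpha> c < 1"
    and "\<And>c. c \<in> C \<Longrightarrow> has_q_expansion (slash f k (\<gamma> c)) (\<alpha> c) (cusp_width N c) (a c)"
    and "\<And>c. c \<in> C \<Longrightarrow> has_q_expansion (slash g k (\<gamma> c)) (\<alpha> c) (cusp_width N c) (b c)"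
  shows "set_integrable lborel D (petersson_integrand k f g)
    \<and> (\<forall>c\<in>C. summable (\<lambda>n. a c n * cnj (b c n) *
          of_real (W_factor k (of_rat (\<alpha> c) + real n / real (cusp_width N c)))))
    \<and> petersson N D k f g =
        of_real (4 * (8 * pi) powr (- (k - 1)) / real (index_Gamma0 N)) *
        (\<Sum>c\<in>C. of_nat (cusp_width N c) *
          (\<Sum>n. a c n * cnj (b c n) *
            of_real (W_factor k (of_rat (\<alpha> c) + real n / real (cusp_width N c)))))"
proof -
  interpret unfolding_setup N C \<gamma> D
    by (intro unfolding_setup.intro unfolding_setup_axioms.intro coset_representatives.intro assms)
  \<comment> \<open>Cut off outside the half-plane so that \<open>F\<close> is Borel measurable on
    all of the complex numbers, as \<open>unfolding_integral\<close> demands.\<close>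
  define F where "F \<tau> = indicator upper_half_plane \<tau> *\<^sub>R invariant_product k f g \<tau>" for \<tau>
  have F_meas [measurable]: "F \<in> borel_measurable borel"
    unfolding F_def[abs_def]
  proof (rule borel_measurable_continuous_on_indicator[OF borel_upper_half_plane])
    have "f holomorphic_on upper_half_plane" "g holomorphic_on upper_half_plane"
      using assms(5,6) by (auto simp: modular_forms_def)
    then show "continuous_on upper_half_plane (invariant_product k f g)"
      unfolding invariant_product_def[abs_def]
      by (intro continuous_intros holomorphic_on_imp_continuous_on) auto
  qed
  have F_inv: "F (moebius A \<tau>) = F \<tau>" if "A \<in> Gamma0 N" "Im \<tau> > 0" for A \<tau>
    using invariant_product_Gamma0[OF assms(1-6) that] Im_moebius_pos[OF Gamma0_SL2[OF that(1)] that(2)] that(2)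
    by (simp add: F_def)
  define S where "S c \<tau> = F (moebius (\<gamma> c) \<tau>) * of_real (indicator {0..<real (cusp_width N c)} (Re \<tau>) * kap (Im \<tau>))" for c \<tau>
  define u where "u c n = a c n * cnj (b c n) * of_real (W_factor k (of_rat (\<alpha> c) + real n / real (cusp_width N c)))" for c n
  define q where "q = 4 * (8 * pi) powr (- (k - 1))"
  have q: "q \<noteq> 0" by (simp add: q_def)
  have S: "integrable hyperbolic_measure (S c)"
      "(\<lambda>n. of_nat (cusp_width N c) * of_real q * u c n) sums (LINT \<tau>|hyperbolic_measure. S c \<tau>)" if c: "c \<in> C" for c
  proof -
    interpret ep: expansion_pair k "of_rat (\<alpha> c)" "cusp_width N c" "a c" "b c" "slash f k (\<gamma> c)" "slash g k (\<gamma> c)"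
      by (rule cusp_expansion_pair[OF assms(1,2,4-7) c conjunct1[OF assms(11)[OF c]] assms(12)[OF c] assms(13)[OF c]])
    let ?E = "\<lambda>\<tau>. ep.strip_function \<tau> * of_real (indicator {0..<real (cusp_width N c)} (Re \<tau>) * kap (Im \<tau>))"
    have SL: "\<gamma> c \<in> SL2" using \<gamma>[OF c] by simp
    have eq: "AE \<tau> in hyperbolic_measure. ?E \<tau> = S c \<tau>"
      using AE_hyperbolic_upper
      by eventually_elim (simp add: S_def F_def ep.strip_function_def Im_moebius_pos[OF SL] slash_mult_cnj_slash[OF SL])
    have [measurable]: "S c \<in> borel_measurable borel" unfolding S_def[abs_def] by measurable
    show "integrable hyperbolic_measure (S c)"
      by (rule integrable_cong_AE[THEN iffD1, OF _ _ eq ep.strip_integral(1)]) auto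
    have "(LINT \<tau>|hyperbolic_measure. ?E \<tau>) = (LINT \<tau>|hyperbolic_measure. S c \<tau>)"
      by (rule integral_cong_AE[OF _ _ eq]) auto
    with ep.strip_integral(2) show "(\<lambda>n. of_nat (cusp_width N c) * of_real q * u c n) sums (LINT \<tau>|hyperbolic_measure. S c \<tau>)"
      by (simp add: u_def q_def ep.t_def mult_ac)
  qed
  have summable: "summable (u c)" and sum_u: "of_nat (cusp_width N c) * of_real q * (\<Sum>n. u c n) = (LINT \<tau>|hyperbolic_measure. S c \<tau>)"
    if c: "c \<in> C" for c
  proof -
    have "of_nat (cusp_width N c) * complex_of_real q \<noteq> 0" using q width_pos[of c] by simp
    then show "summable (u c)"
      using sums_summable[OF S(2)[OF c]] unfolding summable_cmult_iff by blast
    then show "of_nat (cusp_width N c) * of_real q * (\<Sum>n. u c n) = (LINT \<tau>|hyperbolic_measure. S c \<tau>)"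
      using S(2)[OF c] by (simp add: sums_iff suminf_mult)
  qed
  have pieces: "integrable hyperbolic_measure (\<lambda>\<sigma>. F (moebius (\<beta> j) \<sigma>) * of_real (strip_kernel \<sigma>))" if jJ: "j \<in> J" for j
  proof -
    obtain c i where j: "j = (c, i)" "c \<in> C" "i \<in> {0..<int (cusp_width N c)}" using jJ by (auto simp: J_def)
    show ?thesis
      using strip_sum(1)[OF F_meas, of "\<gamma> c" "cusp_width N c" i] S(1)[OF j(2)] \<gamma>[OF j(2)] j
      by (simp add: \<beta>_def S_def[abs_def])
  qed
  have unfolded: "integrable domain_measure F"
      "(LINT \<tau>|domain_measure. F \<tau>) = (\<Sum>j\<in>J. LINT \<sigma>|hyperbolic_measure. F (moebius (\<beta> j) \<sigma>) * of_real (strip_kernel \<sigma>))"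
    by (rule unfolding_integral; fact F_meas F_inv pieces)+
  have "(LINT \<tau>|domain_measure. F \<tau>) = (\<Sum>c\<in>C. \<Sum>i\<in>{0..<int (cusp_width N c)}. LINT \<sigma>|hyperbolic_measure. F (moebius (\<beta> (c, i)) \<sigma>) * of_real (strip_kernel \<sigma>))"
    using unfolded(2) unfolding J_def by (simp add: sum.Sigma finite_C case_prod_beta')
  also have "\<dots> = (\<Sum>c\<in>C. LINT \<tau>|hyperbolic_measure. S c \<tau>)"
  proof (rule sum.cong[OF refl])
    fix c assume c: "c \<in> C"
    then show "(\<Sum>i\<in>{0..<int (cusp_width N c)}. LINT \<sigma>|hyperbolic_measure. F (moebius (\<beta> (c, i)) \<sigma>) * of_real (strip_kernel \<sigma>))
        = (LINT \<tau>|hyperbolic_measure. S c \<tau>)"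
      using strip_sum(2)[OF F_meas, of "\<gamma> c" "cusp_width N c"] S(1)[OF c] \<gamma>[OF c]
      by (simp add: \<beta>_def S_def[abs_def])
  qed
  also have "\<dots> = (\<Sum>c\<in>C. of_nat (cusp_width N c) * of_real q * (\<Sum>n. u c n))"
    by (intro sum.cong refl sum_u[symmetric])
  also have "\<dots> = of_real q * (\<Sum>c\<in>C. of_nat (cusp_width N c) * (\<Sum>n. u c n))"
    by (simp add: sum_distrib_left mult_ac)
  finally have total: "(LINT \<tau>|domain_measure. F \<tau>) = of_real q * (\<Sum>c\<in>C. of_nat (cusp_width N c) * (\<Sum>n. u c n))" .
  \<comment> \<open>The factor y^(-2) of the invariant measure is already contained in
    \<open>petersson_integrand\<close>, so the density of \<open>domain_measure\<close> must be
    absorbed into the integrand.\<close>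
  have dens: "(indicator D \<tau> / (Im \<tau>)\<^sup>2) *\<^sub>R F \<tau> = indicator D \<tau> *\<^sub>R petersson_integrand k f g \<tau>" for \<tau>
    using D_upper by (auto simp: indicator_def F_def invariant_product_def petersson_integrand_def scaleR_conv_of_real)
  have int: "set_integrable lborel D (petersson_integrand k f g)"
    using unfolded(1) unfolding domain_measure_def set_integrable_def
    by (subst (asm) integrable_density) (auto simp: dens)
  have "(LINT \<tau>|domain_measure. F \<tau>) = (LINT \<tau>|lborel. (indicator D \<tau> / (Im \<tau>)\<^sup>2) *\<^sub>R F \<tau>)"
    unfolding domain_measure_def by (rule integral_density) auto
  also have "\<dots> = (LINT \<tau>:D|lborel. petersson_integrand k f g \<tau>)"
    unfolding dens set_lebesgue_integral_def ..
  finally have "petersson N D k f g = of_real (q / real (index_Gamma0 N)) * (\<Sum>c\<in>C. of_nat (cusp_width N c) * (\<Sum>n. u c n))"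
    unfolding petersson_def total[symmetric] by (simp add: total)
  then show ?thesis using int summable unfolding u_def q_def by blast
qed

end
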